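(* Let $a,b,c>0$ with $c>b$, let $X$ be the continuous-time Markov chain on $\mathbb Z_{\ge0}$ with transition rates $q(n,n+1)=a+bn$ and $q(n,n-1)=cn$, with law $\mathbb P_n$ when started at $n$, and let $A_T=\int_0^TX_s\,\mathrm ds$. For $0<\theta<a/(c-b)$ define $r_\theta=\sqrt{\frac{c\theta}{a+b\theta}}$, $\beta_\theta=br_\theta+\frac c{r_\theta}-b-c$, and $$v_\theta=\frac{2ac\,r_\theta^3}{(c-br_\theta^2)^3},\qquad I_{\mathrm{BDI}}(\theta)=\bigl(\sqrt{a+b\theta}-\sqrt{c\theta}\bigr)^2.$$ Then, for every fixed $n\in\mathbb Z_{\ge0}$ and $z\in\mathbb R$, as $T\to\infty$, $$\mathbb P_n(A_T\le\theta T+z)\sim\frac{\psi_{\beta_\theta}(n)\,\langle\psi_{\beta_\theta},\mathbf 1\rangle_{\ell^2(\pi)}}{\beta_\theta\sqrt{2\pi v_\theta T}}\exp\bigl(-I_{\mathrm{BDI}}(\theta)T+\beta_\theta z\bigr).$$ On every fixed time interval $[0,S]$, the law of $(X_t)_{0\le t\le S}$ conditioned on $A_T\le\theta T$ converges in total variation, as $T\to\infty$, to the law of the birth-death process (started at the same state) with rates $$q^{(\theta)}(n,n+1)=r_\theta(a+bn),\qquad q^{(\theta)}(n,n-1)=\frac c{r_\theta}\,n.$$ Its invariant law is negative binomial with shape parameter $a/b$ and mean $\theta$.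
   Context: The chain is reversible with respect to the negative-binomial probability measure $\pi(n)=\bigl(1-\frac bc\bigr)^{a/b}\frac{\Gamma(n+a/b)}{\Gamma(a/b)\,n!}\bigl(\frac bc\bigr)^n$, $n\in\mathbb Z_{\ge0}$. With $L$ its generator on $\ell^2(\pi)$, $Lf(n)=(a+bn)(f(n+1)-f(n))+cn(f(n-1)-f(n))$, the function $\psi_\beta$ ($\beta>0$) is the strictly positive ground state of $H_\beta=-L+\beta n$ normalized in $\ell^2(\pi)$. It has the form $\psi_\beta(n)=C_\beta r_\beta^n$, where $C_\beta>0$ is the normalizing constant and $r_\beta\in(0,1)$ is the smaller solution of $br_\beta+c/r_\beta=b+c+\beta$; for $\beta=\beta_\theta$ one has $r_{\beta_\theta}=r_\theta$. *)

theory Defs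
  imports "HOL-Probability.Probability"
begin

section \<open>Continuous-time Markov chains on the nonnegative integers\<close>

definition transition_semigroup :: "(real \<Rightarrow> nat \<Rightarrow> nat pmf) \<Rightarrow> bool" where
  "transition_semigroup K \<longleftrightarrow>
     (\<forall>i. K 0 i = return_pmf i) \<and>
     (\<forall>s t i. 0 \<le> s \<and> 0 \<le> t \<longrightarrow> K (s + t) i = bind_pmf (K s i) (K t))"

text \<open>Only the off-diagonal values of a rate function \<open>q\<close> matter. The total exit rate of \<open>i\<close> is
  the sum of the off-diagonal rates, so the Q-matrix is conservative; the semigroup is
  stochastic, so there is no explosion.\<close>

definition has_transition_rates ::
  "(real \<Rightarrow> nat \<Rightarrow> nat pmf) \<Rightarrow> (nat \<Rightarrow> nat \<Rightarrow> real) \<Rightarrow> bool" where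
  "has_transition_rates K q \<longleftrightarrow>
     (\<forall>i j. ((\<lambda>t. pmf (K t i) j) has_real_derivative
              (if i = j then - (\<Sum>\<^sub>\<infinity>k\<in>UNIV - {i}. q i k) else q i j)) (at 0 within {0..}))"

definition cadlag_path :: "(real \<Rightarrow> nat) \<Rightarrow> bool" where
  "cadlag_path x \<longleftrightarrow>
     (\<forall>t\<ge>0. (x \<longlongrightarrow> x t) (at_right t)) \<and> (\<forall>t>0. \<exists>l. (x \<longlongrightarrow> l) (at_left t))"

text \<open>\<open>X\<close> is a Markov chain with transition rates \<open>q\<close> started at \<open>n\<close>. The last conjunct is the
  Markov property, multiplied out so that no conditioning on null events occurs.\<close>

definition markov_chain_from ::
  "'w measure \<Rightarrow> (real \<Rightarrow> 'w \<Rightarrow> nat) \<Rightarrow> (nat \<Rightarrow> nat \<Rightarrow> real) \<Rightarrow> nat \<Rightarrow> bool" where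
  "markov_chain_from M X q n \<longleftrightarrow>
     prob_space M \<and>
     (\<forall>t\<ge>0. X t \<in> measurable M (count_space UNIV)) \<and>
     (\<forall>\<omega>\<in>space M. cadlag_path (\<lambda>t. X t \<omega>)) \<and>
     (AE \<omega> in M. X 0 \<omega> = n) \<and>
     (\<exists>K. transition_semigroup K \<and> has_transition_rates K q \<and>
       (\<forall>m (t :: nat \<Rightarrow> real) (x :: nat \<Rightarrow> nat).
          0 \<le> t 0 \<and> (\<forall>k\<le>m. t k \<le> t (Suc k)) \<longrightarrow>
          measure M {\<omega>\<in>space M. \<forall>k\<le>Suc m. X (t k) \<omega> = x k} =
          measure M {\<omega>\<in>space M. \<forall>k\<le>m. X (t k) \<omega> = x k}
            * pmf (K (t (Suc m) - t m) (x m)) (x (Suc m))))"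

definition birth_death_rates :: "(nat \<Rightarrow> real) \<Rightarrow> (nat \<Rightarrow> real) \<Rightarrow> nat \<Rightarrow> nat \<Rightarrow> real" where
  "birth_death_rates birth death i j =
     (if j = Suc i then birth i else if i = Suc j then death i else 0)"

definition invariant_law :: "(real \<Rightarrow> nat \<Rightarrow> nat pmf) \<Rightarrow> nat pmf \<Rightarrow> bool" where
  "invariant_law K \<mu> \<longleftrightarrow> (\<forall>t\<ge>0. bind_pmf \<mu> (K t) = \<mu>)"

definition time_integral :: "(real \<Rightarrow> 'w \<Rightarrow> nat) \<Rightarrow> real \<Rightarrow> 'w \<Rightarrow> real" where
  "time_integral X T \<omega> = integral {0..T} (\<lambda>s. real (X s \<omega>))"

text \<open>Laws of paths live on the product sigma-algebra, generated by the coordinates. On cadlag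
  paths its trace is the Borel sigma-algebra of the Skorokhod topology.\<close>

definition path_law :: "real \<Rightarrow> 'w measure \<Rightarrow> (real \<Rightarrow> 'w \<Rightarrow> nat) \<Rightarrow> (real \<Rightarrow> nat) measure" where
  "path_law S M X =
     distr M (Pi\<^sub>M {0..S} (\<lambda>_. count_space UNIV)) (\<lambda>\<omega>. restrict (\<lambda>t. X t \<omega>) {0..S})"

definition tv_dist :: "'a measure \<Rightarrow> 'a measure \<Rightarrow> real" where
  "tv_dist M N = (SUP A\<in>sets M. \<bar>measure M A - measure N A\<bar>)"


section \<open>The birth-death chain with immigration\<close>

text \<open>Probability mass function of the negative binomial law with real shape \<open>s\<close>.\<close>

definition neg_binomial_mass :: "real \<Rightarrow> real \<Rightarrow> nat \<Rightarrow> real" where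
  "neg_binomial_mass s p n =
     (1 - p) powr s * (Gamma (real n + s) / (Gamma s * fact n)) * p ^ n"

definition neg_binomial_law :: "real \<Rightarrow> real \<Rightarrow> nat pmf \<Rightarrow> bool" where
  "neg_binomial_law s m \<mu> \<longleftrightarrow>
     (\<exists>p. 0 < p \<and> p < 1 \<and> (\<forall>n. pmf \<mu> n = neg_binomial_mass s p n)) \<and>
     integrable (measure_pmf \<mu>) real \<and> measure_pmf.expectation \<mu> real = m"

definition bdi_rates :: "real \<Rightarrow> real \<Rightarrow> real \<Rightarrow> nat \<Rightarrow> nat \<Rightarrow> real" where
  "bdi_rates a b c = birth_death_rates (\<lambda>n. a + b * real n) (\<lambda>n. c * real n)"

definition bdi_pi :: "real \<Rightarrow> real \<Rightarrow> real \<Rightarrow> nat \<Rightarrow> real" where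
  "bdi_pi a b c = neg_binomial_mass (a / b) (b / c)"

definition bdi_ell2 :: "real \<Rightarrow> real \<Rightarrow> real \<Rightarrow> (nat \<Rightarrow> real) set" where
  "bdi_ell2 a b c = {f. summable (\<lambda>n. bdi_pi a b c n * (f n)\<^sup>2)}"

definition bdi_inner :: "real \<Rightarrow> real \<Rightarrow> real \<Rightarrow> (nat \<Rightarrow> real) \<Rightarrow> (nat \<Rightarrow> real) \<Rightarrow> real" where
  "bdi_inner a b c f g = (\<Sum>n. bdi_pi a b c n * f n * g n)"

text \<open>At \<open>n = 0\<close> the truncated \<open>n - 1\<close> is harmless, since the death rate vanishes there.\<close>

definition bdi_gen :: "real \<Rightarrow> real \<Rightarrow> real \<Rightarrow> (nat \<Rightarrow> real) \<Rightarrow> nat \<Rightarrow> real" where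
  "bdi_gen a b c f n =
     (a + b * real n) * (f (Suc n) - f n) + c * real n * (f (n - 1) - f n)"

definition bdi_ham :: "real \<Rightarrow> real \<Rightarrow> real \<Rightarrow> real \<Rightarrow> (nat \<Rightarrow> real) \<Rightarrow> nat \<Rightarrow> real" where
  "bdi_ham a b c \<beta> f n = - bdi_gen a b c f n + \<beta> * real n * f n"

text \<open>The operator \<open>-L + \<beta> n\<close> is essentially self-adjoint on finitely supported functions, so its
  domain is the set of all square-summable \<open>f\<close> whose image is square-summable. For an eigenvector
  the second condition is automatic.\<close>

definition bdi_eigen :: "real \<Rightarrow> real \<Rightarrow> real \<Rightarrow> real \<Rightarrow> real \<Rightarrow> (nat \<Rightarrow> real) \<Rightarrow> bool" where
  "bdi_eigen a b c \<beta> E f \<longleftrightarrow>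
     f \<in> bdi_ell2 a b c \<and> (\<exists>n. f n \<noteq> 0) \<and> (\<forall>n. bdi_ham a b c \<beta> f n = E * f n)"

definition bdi_ground_state :: "real \<Rightarrow> real \<Rightarrow> real \<Rightarrow> real \<Rightarrow> (nat \<Rightarrow> real) \<Rightarrow> bool" where
  "bdi_ground_state a b c \<beta> f \<longleftrightarrow>
     (\<exists>E. bdi_eigen a b c \<beta> E f \<and> (\<forall>E' g. bdi_eigen a b c \<beta> E' g \<longrightarrow> E \<le> E'))"

definition bdi_psi :: "real \<Rightarrow> real \<Rightarrow> real \<Rightarrow> real \<Rightarrow> nat \<Rightarrow> real" where
  "bdi_psi a b c \<beta> =
     (THE f. bdi_ground_state a b c \<beta> f \<and> (\<forall>n. 0 < f n) \<and> bdi_inner a b c f f = 1)"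

definition bdi_r :: "real \<Rightarrow> real \<Rightarrow> real \<Rightarrow> real \<Rightarrow> real" where
  "bdi_r a b c \<theta> = sqrt (c * \<theta> / (a + b * \<theta>))"

definition bdi_beta :: "real \<Rightarrow> real \<Rightarrow> real \<Rightarrow> real \<Rightarrow> real" where
  "bdi_beta a b c \<theta> = b * bdi_r a b c \<theta> + c / bdi_r a b c \<theta> - b - c"

definition bdi_v :: "real \<Rightarrow> real \<Rightarrow> real \<Rightarrow> real \<Rightarrow> real" where
  "bdi_v a b c \<theta> = 2 * a * c * bdi_r a b c \<theta> ^ 3 / (c - b * (bdi_r a b c \<theta>)\<^sup>2) ^ 3"

definition bdi_I :: "real \<Rightarrow> real \<Rightarrow> real \<Rightarrow> real \<Rightarrow> real" where
  "bdi_I a b c \<theta> = (sqrt (a + b * \<theta>) - sqrt (c * \<theta>))\<^sup>2"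

definition bdi_tilted_rates :: "real \<Rightarrow> real \<Rightarrow> real \<Rightarrow> real \<Rightarrow> nat \<Rightarrow> nat \<Rightarrow> real" where
  "bdi_tilted_rates a b c \<theta> =
     birth_death_rates (\<lambda>n. bdi_r a b c \<theta> * (a + b * real n)) (\<lambda>n. c / bdi_r a b c \<theta> * real n)"

end

theory Submission
  imports Defs
begin

text \<open>The rates are affine in the state, so generating functions of the chain together with its area
\<open>A\<^sub>T\<close> are exponentially affine in the starting point: for \<open>|s| \<le> 1\<close> and \<open>Re \<kappa> \<ge> 0\<close>,
\<open>E\<^sub>n[exp (- \<kappa> A\<^sub>T) s ^ X\<^sub>T] = \<alpha>(T) \<rho>(T) ^ n\<close>, where \<open>(\<rho>, \<alpha>)\<close> solves the Riccati system
\<open>\<rho>' = b \<rho>\<^sup>2 - (b + c + \<kappa>) \<rho> + c\<close>, \<open>\<alpha>' = a \<alpha> (\<rho> - 1)\<close> with \<open>\<rho>(0) = s\<close>, \<open>\<alpha>(0) = 1\<close>. In terms of a fixed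
point \<open>r\<close> of the first equation, that is \<open>b r + c / r = b + c + \<kappa>\<close>, the solution is explicit. For
\<open>\<kappa> = 0\<close> the formula (\<open>bdi_pgf\<close>) follows from the backward equation and uniqueness of its bounded
solutions. It shows that the rates determine the semigroup and that the negative binomial law is
the only invariant law. For general \<open>\<kappa>\<close> the area is a limit of Riemann sums; by the Markov property
their generating functions come from alternating the killing \<open>s \<mapsto> exp (- \<kappa> h) s\<close> with the explicit
flow for \<open>\<kappa> = 0\<close>, and this splitting scheme converges to the Riccati flow
(\<open>feynman_kac_generating_function\<close>).

The lower tail is a saddle point computation on the line \<open>\<kappa> = \<beta> + \<i> u\<close> with \<open>\<beta> = \<beta>\<^sub>\<theta>\<close>. The fixed point
\<open>r(u)\<close> satisfies \<open>|r(u)| \<le> r\<^sub>\<theta> - \<delta> min 1 u\<^sup>2\<close>, and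
\<open>a (r(u) - r\<^sub>\<theta>) + \<i> u \<theta> = - v\<^sub>\<theta> u\<^sup>2 / 2 + o(u\<^sup>2)\<close>, so after the substitution \<open>u = w / sqrt T\<close> dominated
convergence applies. The Laplace transform \<open>1 / \<kappa>\<close> of a half-line indicator is not absolutely integrable
along the line; therefore the inversion is carried out for \<open>E\<^sub>n[max 0 (y - A\<^sub>T)]\<close>, whose kernel
\<open>1 / \<kappa>\<^sup>2\<close> is integrable. This expectation is convex in \<open>y\<close> with \<open>P\<^sub>n(A\<^sub>T \<le> y)\<close> as a subgradient, and
convexity lets the asymptotics pass to the derivative (\<open>lower_tail_limit\<close>). The limiting constant
is \<open>\<psi>(n) \<langle>\<psi>, 1\<rangle>\<close> because the ground state is the normalised geometric sequence \<open>r\<^sub>\<theta> ^ n\<close>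
(\<open>bdi_psi_formula\<close>): it is a positive eigenvector, and an eigenvector for a smaller eigenvalue
grows too fast, relative to it, to be square-summable.

By the Markov property at time \<open>S\<close>, conditioning on \<open>A\<^sub>T \<le> \<theta> T\<close> changes the law on \<open>[0, S]\<close> by the density
\<open>P\<^bsub>X(S)\<^esub>(A\<^bsub>T - S\<^esub> \<le> \<theta> T - A\<^sub>S) / P\<^sub>n(A\<^sub>T \<le> \<theta> T)\<close>. The lower tail asymptotics, applied to the numerator from the state
\<open>X\<^sub>S\<close>, give the pointwise limit \<open>exp (a (1 - r\<^sub>\<theta>) S - \<beta>\<^sub>\<theta> A\<^sub>S) r\<^sub>\<theta> ^ (X\<^sub>S - n)\<close>
(\<open>tail_ratio_limit\<close>). This is the Doob transform by the ground state: by the generating function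
formula its one-time laws are those of the chain with the tilted rates, and the Markov property extends this to the
law of the whole path (\<open>tilted_path_law\<close>). Densities that converge pointwise to a probability density
converge in total variation.\<close>

section \<open>The Riccati flow\<close>

text \<open>The equation \<open>\<rho>' = b \<rho>\<^sup>2 - (b r + c / r) \<rho> + c\<close> has the fixed points \<open>r\<close> and \<open>c / (b r)\<close>. The Moebius
coordinate \<open>w = (\<rho> - r) / (\<rho> - c / (b r))\<close>, which sends them to \<open>0\<close> and \<open>\<infinity>\<close>, decays exponentially
along the flow; \<open>ric_q\<close> is its value at the starting point \<open>s\<close>.\<close>

definition ric_q :: "real \<Rightarrow> real \<Rightarrow> complex \<Rightarrow> complex \<Rightarrow> complex" where
  "ric_q b c r s = b * r * (s - r) / (b * r * s - c)"

definition ric_w :: "real \<Rightarrow> real \<Rightarrow> complex \<Rightarrow> complex \<Rightarrow> real \<Rightarrow> complex" where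
  "ric_w b c r s t = ric_q b c r s * exp (- (c / r - b * r) * t)"

definition ric_rho :: "real \<Rightarrow> real \<Rightarrow> complex \<Rightarrow> complex \<Rightarrow> real \<Rightarrow> complex" where
  "ric_rho b c r s t = (r - ric_w b c r s t * (c / (b * r))) / (1 - ric_w b c r s t)"

definition ric_alpha :: "real \<Rightarrow> real \<Rightarrow> real \<Rightarrow> complex \<Rightarrow> complex \<Rightarrow> real \<Rightarrow> complex" where
  "ric_alpha a b c r s t =
     exp (- a * (1 - r) * t - (a / b) * (Ln (1 - ric_w b c r s t) - Ln (1 - ric_q b c r s)))"

text \<open>Under these conditions \<open>|w| < 1\<close> at all times \<open>t \<ge> 0\<close>. So the flow does not reach the pole at \<open>w = 1\<close>,
and \<open>1 - w\<close> stays in the right half-plane, where \<open>Ln\<close> is the holomorphic branch.\<close>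

definition ric_data :: "real \<Rightarrow> real \<Rightarrow> complex \<Rightarrow> complex \<Rightarrow> bool" where
  "ric_data b c r s \<longleftrightarrow> 0 < b \<and> 0 < c \<and> r \<noteq> 0 \<and> b * r * s \<noteq> c \<and> norm (ric_q b c r s) < 1 \<and>
     0 \<le> Re (c / r - b * r)"

lemma ric_w_le:
  assumes "ric_data b c r s" "0 \<le> t"
  shows "norm (ric_w b c r s t) \<le> norm (ric_q b c r s)" "norm (ric_w b c r s t) < 1"
proof -
  have "Re (- (c / r - b * r) * t) = - (Re (c / r - b * r) * t)"
    by (simp only: Re_complex_of_real Im_complex_of_real times_complex.sel uminus_complex.sel)
  hence "norm (exp (- (c / r - b * r) * t)) = exp (- (Re (c / r - b * r) * t))"
    by (simp only: norm_exp_eq_Re)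
  also have "\<dots> \<le> 1"
    using assms by (auto simp: ric_data_def intro!: mult_nonneg_nonneg)
  finally show "norm (ric_w b c r s t) \<le> norm (ric_q b c r s)"
    unfolding ric_w_def norm_mult by (intro mult_left_le) auto
  also have "\<dots> < 1" using assms by (auto simp: ric_data_def)
  finally show "norm (ric_w b c r s t) < 1" .
qed

lemma one_minus_notin_nonpos:
  fixes w :: complex
  assumes "norm w < 1"
  shows "1 - w \<notin> \<real>\<^sub>\<le>\<^sub>0" "1 - w \<noteq> 0" "0 < Re (1 - w)"
proof -
  have "Re w < 1" using assms complex_Re_le_cmod[of w] by linarith
  thus "0 < Re (1 - w)" by simp
  thus "1 - w \<notin> \<real>\<^sub>\<le>\<^sub>0" "1 - w \<noteq> 0"
    by (auto simp: complex_nonpos_Reals_iff)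
qed

lemma ric_w_deriv:
  "(ric_w b c r s has_vector_derivative (- (c / r - b * r) * ric_w b c r s t)) (at t within S)"
proof -
  have "((\<lambda>t. ric_q b c r s * exp (- (c / r - b * r) * of_real t)) has_vector_derivative
      (ric_q b c r s * (- (c / r - b * r) * exp (- (c / r - b * r) * of_real t)))) (at t within S)"
    by (rule has_vector_derivative_real_field) (auto intro!: derivative_eq_intros)
  thus ?thesis by (simp add: ric_w_def[abs_def] algebra_simps)
qed

lemma ric_rho_deriv:
  assumes "ric_data b c r s" "0 \<le> t"
  shows "(ric_rho b c r s has_vector_derivative
     (b * (ric_rho b c r s t)\<^sup>2 - (b * r + c / r) * ric_rho b c r s t + c)) (at t within S)"
proof -
  define w where "w = ric_w b c r s t"
  have w1: "1 - w \<noteq> 0" using ric_w_le[OF assms] one_minus_notin_nonpos(2) by (auto simp: w_def)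
  have nz: "r \<noteq> 0" "complex_of_real b \<noteq> 0" using assms by (auto simp: ric_data_def)
  have *: "((\<lambda>w. (r - w * (c / (b * r))) / (1 - w)) has_field_derivative
     ((r - c / (b * r)) / (1 - w)\<^sup>2)) (at w)"
    using w1 nz by (auto intro!: derivative_eq_intros simp: divide_simps power2_eq_square)
      (simp add: algebra_simps)
  have "(((\<lambda>w. (r - w * (c / (b * r))) / (1 - w)) \<circ> ric_w b c r s) has_vector_derivative
     ((- (c / r - b * r) * w) * ((r - c / (b * r)) / (1 - w)\<^sup>2))) (at t within S)"
    unfolding w_def
    by (rule field_vector_diff_chain_within[OF ric_w_deriv]) (use * in \<open>auto simp: w_def intro: has_field_derivative_at_within\<close>)
  moreover have "(- (c / r - b * r) * w) * ((r - c / (b * r)) / (1 - w)\<^sup>2)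
     = b * ((r - w * (c / (b * r))) / (1 - w))\<^sup>2 - (b * r + c / r) * ((r - w * (c / (b * r))) / (1 - w)) + c"
    using w1 nz by (simp add: divide_simps power2_eq_square) (simp add: algebra_simps power2_eq_square)?
  ultimately show ?thesis
    by (simp add: ric_rho_def[abs_def] o_def w_def)
qed

lemma ric_rho_0: assumes "ric_data b c r s" shows "ric_rho b c r s 0 = s"
proof -
  have nz: "r \<noteq> 0" "complex_of_real b \<noteq> 0" "b * r * s - c \<noteq> 0" "1 - ric_q b c r s \<noteq> 0"
    using assms one_minus_notin_nonpos(2) by (auto simp: ric_data_def)
  have 1: "1 - ric_q b c r s = (b * r\<^sup>2 - c) / (b * r * s - c)"
    using nz(1-3) by (simp add: ric_q_def field_simps power2_eq_square)
  have 2: "r - ric_q b c r s * (c / (b * r)) = s * (b * r\<^sup>2 - c) / (b * r * s - c)"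
    using nz(1-3) by (simp add: ric_q_def divide_simps power2_eq_square) (simp add: algebra_simps)?
  have "b * r\<^sup>2 - c \<noteq> 0" using nz(4) 1 by auto
  thus ?thesis using nz unfolding ric_rho_def ric_w_def by (simp only: mult_zero_right of_real_0 exp_zero mult_1_right 1 2) (simp add: divide_simps)
qed

lemma ric_alpha_0: assumes "ric_data b c r s" shows "ric_alpha a b c r s 0 = 1"
  by (simp add: ric_alpha_def ric_w_def)

lemma ric_alpha_deriv:
  assumes "ric_data b c r s" "0 \<le> t"
  shows "(ric_alpha a b c r s has_vector_derivative
     (a * ric_alpha a b c r s t * (ric_rho b c r s t - 1))) (at t within S)"
proof -
  define w where "w = ric_w b c r s t"
  have wn: "1 - w \<notin> \<real>\<^sub>\<le>\<^sub>0" "1 - w \<noteq> 0"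
    using ric_w_le[OF assms] one_minus_notin_nonpos by (auto simp: w_def)
  have nz: "r \<noteq> 0" "complex_of_real b \<noteq> 0" using assms by (auto simp: ric_data_def)
  have "((\<lambda>w. Ln (1 - w)) has_field_derivative (- 1 / (1 - w))) (at w)"
    using wn by (auto intro!: derivative_eq_intros simp: divide_simps)
  hence "((\<lambda>w. Ln (1 - w)) has_field_derivative (- 1 / (1 - w))) (at w within ric_w b c r s ` S)"
    by (rule has_field_derivative_at_within)
  from field_vector_diff_chain_within[OF ric_w_deriv[of b c r s t S] this[unfolded w_def]]
  have 1: "((\<lambda>t. Ln (1 - ric_w b c r s t)) has_vector_derivative
     ((- (c / r - b * r) * w) * (- 1 / (1 - w)))) (at t within S)" by (simp add: o_def w_def)
  have 2: "((\<lambda>t. - a * (1 - r) * t) has_vector_derivative (- a * (1 - r))) (at t within S)"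
    using has_vector_derivative_real_field[of "\<lambda>t. - a * (1 - r) * t" "- a * (1 - r)" t S]
    by (auto intro!: derivative_eq_intros)
  define e where "e = (\<lambda>t. - a * (1 - r) * t - (a / b) * (Ln (1 - ric_w b c r s t) - Ln (1 - ric_q b c r s)))"
  have 3: "(e has_vector_derivative (- a * (1 - r) - (a / b) * ((- (c / r - b * r) * w) * (- 1 / (1 - w)))))
     (at t within S)"
    unfolding e_def
    by (intro has_vector_derivative_diff[OF 2] ) (auto intro!: derivative_eq_intros 1 )
  have "((exp \<circ> e) has_vector_derivative
     ((- a * (1 - r) - (a / b) * ((- (c / r - b * r) * w) * (- 1 / (1 - w)))) * exp (e t))) (at t within S)"
    by (rule field_vector_diff_chain_within[OF 3]) (auto intro!: derivative_eq_intros)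
  moreover have "- a * (1 - r) - (a / b) * ((- (c / r - b * r) * w) * (- 1 / (1 - w)))
      = a * ((r - w * (c / (b * r))) / (1 - w) - 1)"
    using wn nz by (simp add: divide_simps) (simp add: algebra_simps)?
  moreover have "exp \<circ> e = ric_alpha a b c r s" by (auto simp: ric_alpha_def e_def)
  moreover have "exp (e t) = ric_alpha a b c r s t" by (auto simp: ric_alpha_def e_def)
  moreover have "(r - w * (c / (b * r))) / (1 - w) = ric_rho b c r s t" by (simp add: ric_rho_def w_def)
  ultimately show ?thesis
    by (simp add: mult.assoc mult.commute[of "ric_rho b c r s t - 1"])
qed

section \<open>The backward equation\<close>

lemma norm_expectation_pmf_le:
  fixes f :: "'a \<Rightarrow> complex"
  assumes "\<And>x. norm (f x) \<le> M"
  shows "norm (measure_pmf.expectation q f) \<le> M" "integrable (measure_pmf q) f"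
proof -
  show I: "integrable (measure_pmf q) f"
    by (rule measure_pmf.integrable_const_bound[where B=M]) (use assms in auto)
  show "norm (measure_pmf.expectation q f) \<le> M"
    by (rule order.trans[OF integral_norm_bound] , rule measure_pmf.integral_le_const) (use assms I in auto)
qed

lemma expectation_bind_pmf_complex:
  fixes f :: "'a \<Rightarrow> complex"
  assumes "\<And>x. norm (f x) \<le> M"
  shows "measure_pmf.expectation (bind_pmf p K) f = measure_pmf.expectation p (\<lambda>x. measure_pmf.expectation (K x) f)"
proof -
  have R: "measure_pmf.expectation (bind_pmf p K) g = measure_pmf.expectation p (\<lambda>x. measure_pmf.expectation (K x) g)"
    if "\<And>x. \<bar>g x\<bar> \<le> M" for g :: "'a \<Rightarrow> real"
    unfolding measure_pmf_bind
    by (rule integral_bind[where K="count_space UNIV" and B=M and B'=1])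
       (use that in \<open>auto simp: measurable_measure_pmf measure_pmf.emeasure_space_1 intro!: measure_pmf.finite_measure measure_pmf_in_subprob_space\<close>)
  have I: "integrable (measure_pmf q) f" for q by (rule norm_expectation_pmf_le(2)[OF assms])
  have M: "norm (measure_pmf.expectation q f) \<le> M" for q by (rule norm_expectation_pmf_le(1)[OF assms])
  have I2: "integrable (measure_pmf p) (\<lambda>x. measure_pmf.expectation (K x) f)"
    by (rule measure_pmf.integrable_const_bound[where B=M]) (use M in auto)
  have "Re (measure_pmf.expectation (bind_pmf p K) f) = Re (measure_pmf.expectation p (\<lambda>x. measure_pmf.expectation (K x) f))"
    using R[of "\<lambda>x. Re (f x)"] abs_Re_le_cmod order.trans[OF abs_Re_le_cmod assms]
    by (simp add: integral_Re I I2 flip: integral_Re)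
  moreover have "Im (measure_pmf.expectation (bind_pmf p K) f) = Im (measure_pmf.expectation p (\<lambda>x. measure_pmf.expectation (K x) f))"
    using R[of "\<lambda>x. Im (f x)"] order.trans[OF abs_Im_le_cmod assms]
    by (simp add: I I2 flip: integral_Im)
  ultimately show ?thesis by (rule complex_eqI)
qed

text \<open>The generator \<open>bdi_gen\<close> acting on complex-valued functions.\<close>

definition bdi_cgen :: "real \<Rightarrow> real \<Rightarrow> real \<Rightarrow> (nat \<Rightarrow> complex) \<Rightarrow> nat \<Rightarrow> complex" where
  "bdi_cgen a b c f i =
     complex_of_real (a + b * real i) * (f (Suc i) - f i) + complex_of_real (c * real i) * (f (i - 1) - f i)"

definition bdi_nbh :: "nat \<Rightarrow> nat set" where "bdi_nbh i = {i - 1, i, Suc i}"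

definition bdi_q :: "real \<Rightarrow> real \<Rightarrow> real \<Rightarrow> nat \<Rightarrow> nat \<Rightarrow> real" where
  "bdi_q a b c i j = (if i = j then - (a + b * real i + c * real i) else bdi_rates a b c i j)"

lemma bdi_exit_rate: "(\<Sum>\<^sub>\<infinity>k\<in>UNIV - {i}. bdi_rates a b c i k) = a + b * real i + c * real i"
proof -
  have "(\<Sum>\<^sub>\<infinity>k\<in>UNIV - {i}. bdi_rates a b c i k) = (\<Sum>\<^sub>\<infinity>k\<in>bdi_nbh i - {i}. bdi_rates a b c i k)"
    by (rule infsum_cong_neutral) (auto simp: bdi_nbh_def bdi_rates_def birth_death_rates_def)
  also have "\<dots> = (\<Sum>k\<in>bdi_nbh i - {i}. bdi_rates a b c i k)" by (rule infsum_finite) (auto simp: bdi_nbh_def)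
  also have "\<dots> = a + b * real i + c * real i"
  proof (cases i)
    case 0
    hence "bdi_nbh i - {i} = {Suc 0}" by (auto simp: bdi_nbh_def)
    thus ?thesis using 0 by (simp add: bdi_rates_def birth_death_rates_def)
  next
    case (Suc k)
    hence "bdi_nbh i - {i} = {k, Suc (Suc k)}" by (auto simp: bdi_nbh_def)
    thus ?thesis using Suc by (simp add: bdi_rates_def birth_death_rates_def)
  qed
  finally show ?thesis .
qed

lemma bdi_cgen_sum: "bdi_cgen a b c f i = (\<Sum>j\<in>bdi_nbh i. complex_of_real (bdi_q a b c i j) * f j)"
  and bdi_q_sum: "(\<Sum>j\<in>bdi_nbh i. bdi_q a b c i j) = 0"
proof -
  show "bdi_cgen a b c f i = (\<Sum>j\<in>bdi_nbh i. complex_of_real (bdi_q a b c i j) * f j)" 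
  proof (cases i)
    case 0
    hence "bdi_nbh i = {0, Suc 0}" by (auto simp: bdi_nbh_def)
    thus ?thesis using 0 by (simp add: bdi_cgen_def bdi_q_def bdi_rates_def birth_death_rates_def algebra_simps)
  next
    case (Suc k)
    hence "bdi_nbh i = {k, Suc k, Suc (Suc k)}" by (auto simp: bdi_nbh_def)
    thus ?thesis using Suc by (simp add: bdi_cgen_def bdi_q_def bdi_rates_def birth_death_rates_def algebra_simps)
  qed
  show "(\<Sum>j\<in>bdi_nbh i. bdi_q a b c i j) = 0"
  proof (cases i)
    case 0
    hence "bdi_nbh i = {0, Suc 0}" by (auto simp: bdi_nbh_def)
    thus ?thesis using 0 by (simp add: bdi_q_def bdi_rates_def birth_death_rates_def algebra_simps)
  next
    case (Suc k)
    hence "bdi_nbh i = {k, Suc k, Suc (Suc k)}" by (auto simp: bdi_nbh_def)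
    thus ?thesis using Suc by (simp add: bdi_q_def bdi_rates_def birth_death_rates_def algebra_simps)
  qed
qed

text \<open>The derivatives at \<open>0\<close> of \<open>pmf (K h i) j\<close> for \<open>|i - j| \<le> 1\<close> suffice: the
corresponding row of the Q-matrix sums to \<open>0\<close>, so the mass that \<open>K h i\<close> puts elsewhere is \<open>o(h)\<close>. The error
bound depends on \<open>f\<close> only through its sup norm; this uniformity is needed to apply it to
functions that vary with time.\<close>

lemma infinitesimal_description:
  assumes K: "transition_semigroup K" "has_transition_rates K (bdi_rates a b c)"
  obtains e where "(e \<longlongrightarrow> 0) (at_right (0::real))"
    "\<And>f M h. 0 < h \<Longrightarrow> (\<And>j. norm (f j) \<le> M) \<Longrightarrow>
       norm (measure_pmf.expectation (K h i) f - f i - h *\<^sub>R bdi_cgen a b c f i) \<le> M * h * e h"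
proof
  define \<delta> :: "nat \<Rightarrow> real" where "\<delta> j = (if i = j then 1 else 0)" for j
  define d where "d j h = (pmf (K h i) j - \<delta> j) / h - bdi_q a b c i j" for j h
  define e where "e = (\<lambda>h. 2 * (\<Sum>j\<in>bdi_nbh i. \<bar>d j h\<bar>))"
  have tail_const: "pmf (K 0 i) j = \<delta> j" for j
    using K(1) by (auto simp: transition_semigroup_def \<delta>_def)
  have "((\<lambda>h. d j h) \<longlongrightarrow> 0) (at_right 0)" for j
  proof -
    have "((\<lambda>t. pmf (K t i) j) has_real_derivative bdi_q a b c i j) (at 0 within {0..})"
      using K(2)[unfolded has_transition_rates_def, rule_format, of i j]
      by (simp only: bdi_exit_rate bdi_q_def)
    hence "((\<lambda>h. (pmf (K h i) j - \<delta> j) / h) \<longlongrightarrow> bdi_q a b c i j) (at_right 0)"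
      by (simp add: has_field_derivative_iff at_within_Ici_at_right tail_const)
    from tendsto_diff[OF this tendsto_const[of "bdi_q a b c i j"]] show ?thesis by (simp add: d_def)
  qed
  hence "(e \<longlongrightarrow> 2 * (\<Sum>j\<in>bdi_nbh i. \<bar>0\<bar>)) (at_right 0)"
    unfolding e_def by (intro tendsto_intros)
  thus "(e \<longlongrightarrow> 0) (at_right 0)" by simp
  show "norm (measure_pmf.expectation (K h i) f - f i - h *\<^sub>R bdi_cgen a b c f i) \<le> M * h * e h"
    if h: "0 < h" and f: "\<And>j. norm (f j) \<le> M" for f M h
  proof -
    let ?J = "bdi_nbh i" let ?p = "\<lambda>j. pmf (K h i) j"
    have fin: "finite ?J" and iJ: "i \<in> ?J" by (auto simp: bdi_nbh_def)
    have M0: "0 \<le> M" using f[of 0] norm_ge_zero order.trans by blast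
    have I: "integrable (measure_pmf (K h i)) g" if "\<And>j. norm (g j) \<le> M" for g :: "nat \<Rightarrow> complex"
      using norm_expectation_pmf_le(2) that by blast
    define f1 f2 where "f1 j = (if j \<in> ?J then f j else 0)" and "f2 j = (if j \<in> ?J then 0 else f j)" for j
    have b1: "norm (f1 j) \<le> M" and b2: "norm (f2 j) \<le> M" for j using f M0 by (auto simp: f1_def f2_def)
    have "f = (\<lambda>j. f1 j + f2 j)" by (auto simp: f1_def f2_def)
    hence "measure_pmf.expectation (K h i) f = measure_pmf.expectation (K h i) f1 + measure_pmf.expectation (K h i) f2"
      using Bochner_Integration.integral_add[OF I[of f1] I[of f2]] b1 b2 by simp
    also have "measure_pmf.expectation (K h i) f1 = (\<Sum>j\<in>?J. complex_of_real (?p j) * f j)"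
      by (subst integral_measure_pmf[OF fin]) (auto simp: f1_def scaleR_conv_of_real intro!: sum.cong split: if_splits)
    finally have 1: "measure_pmf.expectation (K h i) f = (\<Sum>j\<in>?J. complex_of_real (?p j) * f j) + measure_pmf.expectation (K h i) f2" .
    have pd: "?p j = \<delta> j + h * bdi_q a b c i j + h * d j h" for j
      using h by (simp add: d_def field_simps)
    have \<delta>1: "(\<Sum>j\<in>?J. \<delta> j) = 1" using fin iJ by (simp add: \<delta>_def)
    have sp: "(\<Sum>j\<in>?J. ?p j) = 1 + h * (\<Sum>j\<in>?J. d j h)"
      unfolding pd sum.distrib \<delta>1 sum_distrib_left[symmetric] bdi_q_sum by simp
    have "norm (measure_pmf.expectation (K h i) f2) \<le> measure_pmf.expectation (K h i) (\<lambda>j. M * indicator (- ?J) j)"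
    proof (rule order.trans[OF integral_norm_bound], rule integral_mono)
      show "integrable (measure_pmf (K h i)) (\<lambda>j. norm (f2 j))" using I[of f2] b2 by auto
      show "integrable (measure_pmf (K h i)) (\<lambda>j. M * indicat_real (- ?J) j)"
        by (rule measure_pmf.integrable_const_bound[where B=M]) (use M0 in \<open>auto simp: indicator_def\<close>)
    qed (use f M0 in \<open>auto simp: f2_def\<close>)
    also have "\<dots> = M * measure (K h i) (- ?J)" by simp
    also have "measure (K h i) (- ?J) = 1 - (\<Sum>j\<in>?J. ?p j)"
      using measure_pmf.prob_compl[of ?J "K h i"] by (simp add: measure_measure_pmf_finite[OF fin] Compl_eq_Diff_UNIV)
    also have "\<dots> = h * (- (\<Sum>j\<in>?J. d j h))" unfolding sp by simp
    also have "M * (h * (- (\<Sum>j\<in>?J. d j h))) \<le> M * (h * (\<Sum>j\<in>?J. \<bar>d j h\<bar>))"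
      using M0 h by (intro mult_left_mono) (auto simp flip: sum_negf intro!: sum_mono)
    finally have 2: "norm (measure_pmf.expectation (K h i) f2) \<le> M * (h * (\<Sum>j\<in>?J. \<bar>d j h\<bar>))" .
    have "(\<Sum>j\<in>?J. complex_of_real (?p j) * f j) = (\<Sum>j\<in>?J. of_real (\<delta> j) * f j) + h *\<^sub>R bdi_cgen a b c f i + (\<Sum>j\<in>?J. complex_of_real (h * d j h) * f j)"
      unfolding pd bdi_cgen_sum scaleR_conv_of_real
      by (simp add: sum_distrib_left algebra_simps flip: sum.distrib)
    also have "(\<Sum>j\<in>?J. of_real (\<delta> j) * f j) = f i"
      using fin iJ by (simp add: \<delta>_def if_distrib[of of_real] if_distrib[of "\<lambda>x. x * _"] cong: if_cong)
    finally have "measure_pmf.expectation (K h i) f - f i - h *\<^sub>R bdi_cgen a b c f i =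
       (\<Sum>j\<in>?J. complex_of_real (h * d j h) * f j) + measure_pmf.expectation (K h i) f2"
      unfolding 1 by simp
    also have "norm \<dots> \<le> (\<Sum>j\<in>?J. h * \<bar>d j h\<bar> * M) + M * (h * (\<Sum>j\<in>?J. \<bar>d j h\<bar>))"
      by (intro norm_triangle_mono 2 sum_norm_le)
         (use h f in \<open>auto simp: norm_mult abs_mult intro!: mult_left_mono\<close>)
    also have "\<dots> = M * h * e h" by (simp add: e_def sum_distrib_left algebra_simps)
    finally show ?thesis .
  qed
qed

lemma norm_bdi_cgen_le:
  assumes "0 \<le> a" "0 \<le> b" "0 \<le> c" "\<And>j. norm (f j) \<le> M j"
  shows "norm (bdi_cgen a b c f i) \<le> (a + b * i) * (M (Suc i) + M i) + c * i * (M (i - 1) + M i)"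
proof -
  have d: "norm (f j - f k) \<le> M j + M k" for j k
    using norm_triangle_ineq4[of "f j" "f k"] assms(4)[of j] assms(4)[of k] by linarith
  have "norm (complex_of_real (a + b * real i) * (f (Suc i) - f i)) \<le> (a + b * i) * (M (Suc i) + M i)"
    unfolding norm_mult norm_of_real using assms d by (intro mult_mono) auto
  moreover have "norm (complex_of_real (c * real i) * (f (i - 1) - f i)) \<le> c * i * (M (i - 1) + M i)"
    unfolding norm_mult norm_of_real using assms d by (intro mult_mono) auto
  ultimately show ?thesis unfolding bdi_cgen_def by (intro norm_triangle_mono)
qed

lemma bdi_cgen_diff: "bdi_cgen a b c (\<lambda>j. f j - g j) i = bdi_cgen a b c f i - bdi_cgen a b c g i"
  by (simp add: bdi_cgen_def algebra_simps)

text \<open>The right derivative is the infinitesimal description applied to \<open>u t\<close>, since \<open>u (t + h) = K h (u t)\<close>.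
For the left derivative that description is used at the earlier time \<open>y = t - h\<close>, and the generator
at \<open>y\<close> is compared with the one at \<open>t\<close>: it involves only three states, at each of which
\<open>u\<close> is continuous in time.\<close>

lemma kolmogorov_backward:
  assumes K: "transition_semigroup K" "has_transition_rates K (bdi_rates a b c)"
    and abc: "0 \<le> a" "0 \<le> b" "0 \<le> c"
    and f: "\<And>j. norm (f j) \<le> M" and t: "0 \<le> t"
  defines "u \<equiv> \<lambda>t i. measure_pmf.expectation (K t i) f"
  shows "((\<lambda>t. u t i) has_vector_derivative bdi_cgen a b c (u t) i) (at t within {0..})"
proof -
  have M0: "0 \<le> M" using f[of 0] norm_ge_zero order.trans by blast
  have uM: "norm (u t j) \<le> M" for t j unfolding u_def by (rule norm_expectation_pmf_le) (rule f)
  have semi: "u (s + h) i = measure_pmf.expectation (K h i) (u s)" if "0 \<le> s" "0 \<le> h" for s h i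
  proof -
    have "K (h + s) i = bind_pmf (K h i) (K s)" using K(1) that by (auto simp: transition_semigroup_def)
    thus ?thesis unfolding u_def
      by (simp add: add.commute[of s] expectation_bind_pmf_complex[OF f])
  qed
  have "\<forall>i. \<exists>e. (e \<longlongrightarrow> 0) (at_right (0::real)) \<and> (\<forall>f M h. 0 < h \<longrightarrow> (\<forall>j. norm (f j) \<le> M) \<longrightarrow>
       norm (measure_pmf.expectation (K h i) f - f i - h *\<^sub>R bdi_cgen a b c f i) \<le> M * h * e h)"
  proof
    fix i
    obtain e where "(e \<longlongrightarrow> 0) (at_right (0::real))"
      "\<And>f M h. 0 < h \<Longrightarrow> (\<And>j. norm (f j) \<le> M) \<Longrightarrow>
       norm (measure_pmf.expectation (K h i) f - f i - h *\<^sub>R bdi_cgen a b c f i) \<le> M * h * e h"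
      using infinitesimal_description[OF K, where i=i] by blast
    thus "\<exists>e. (e \<longlongrightarrow> 0) (at_right (0::real)) \<and> (\<forall>f M h. 0 < h \<longrightarrow> (\<forall>j. norm (f j) \<le> M) \<longrightarrow>
       norm (measure_pmf.expectation (K h i) f - f i - h *\<^sub>R bdi_cgen a b c f i) \<le> M * h * e h)"
      by (intro exI[of _ e]) blast
  qed
  then obtain e where e: "\<And>i. (e i \<longlongrightarrow> 0) (at_right (0::real))"
    "\<And>i f M h. 0 < h \<Longrightarrow> (\<And>j. norm (f j) \<le> M) \<Longrightarrow>
       norm (measure_pmf.expectation (K h i) f - f i - h *\<^sub>R bdi_cgen a b c f i) \<le> M * h * e i h"
    by metis
  define g where "g i = (a + b * real i) * (M + M) + c * real i * (M + M)" for i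
  \<comment> \<open>\<open>d j h\<close> bounds the increment of \<open>u\<close> at \<open>j\<close> over a time \<open>h\<close>; \<open>Bd\<close> bounds the error of the difference quotient on both sides.\<close>
  define d where "d i h = M * h * e i h + h * g i" for i h
  define Bd where "Bd h = M * e i h + ((a + b * i) * (d (Suc i) h + d i h) + c * i * (d (i - 1) h + d i h))" for h
  have step: "norm (u (s + h) j - u s j - h *\<^sub>R bdi_cgen a b c (u s) j) \<le> M * h * e j h"
    if "0 \<le> s" "0 < h" for s h j
    using e(2)[of h "u s" M j] that uM semi[of s h j] by auto
  have lip: "norm (u (s + h) j - u s j) \<le> d j h" if "0 \<le> s" "0 < h" for s h j
  proof -
    have "norm (u (s + h) j - u s j) \<le> M * h * e j h + norm (h *\<^sub>R bdi_cgen a b c (u s) j)"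
      using step[OF that, of j] norm_triangle_sub[of "u (s + h) j - u s j" "h *\<^sub>R bdi_cgen a b c (u s) j"] by simp
    also have "norm (h *\<^sub>R bdi_cgen a b c (u s) j) \<le> h * g j"
      using norm_bdi_cgen_le[OF abc, of "u s" "\<lambda>_. M" j] uM that by (auto simp: g_def intro!: mult_left_mono)
    finally show ?thesis by (simp add: d_def)
  qed
  have main: "norm (u y i - u t i - (y - t) *\<^sub>R bdi_cgen a b c (u t) i) / norm (y - t) \<le> Bd \<bar>y - t\<bar>"
    if "0 \<le> y" "y \<noteq> t" for y
  proof (cases "t < y")
    case True
    have "0 \<le> d j (y - t)" for j
      using lip[of t "y - t" j] t True norm_ge_zero order.trans by (smt (verit))
    hence "0 \<le> ((a + b * i) * (d (Suc i) (y - t) + d i (y - t)) + c * i * (d (i - 1) (y - t) + d i (y - t)))"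
      using abc by (intro add_nonneg_nonneg mult_nonneg_nonneg) auto
    moreover have "norm (u y i - u t i - (y - t) *\<^sub>R bdi_cgen a b c (u t) i) / norm (y - t) \<le> M * e i (y - t)"
      using step[of t "y - t" i] t True by (simp add: divide_le_eq mult_ac)
    ultimately show ?thesis using True by (simp add: Bd_def)
  next
    case False
    define h where "h = t - y"
    have h: "0 < h" "t = y + h" using False that by (auto simp: h_def)
    have "norm (bdi_cgen a b c (u t) i - bdi_cgen a b c (u y) i)
       \<le> (a + b * i) * (d (Suc i) h + d i h) + c * i * (d (i - 1) h + d i h)"
      unfolding bdi_cgen_diff[symmetric] using lip[OF that(1) h(1)] h(2)
      by (intro norm_bdi_cgen_le[OF abc]) auto
    hence 1: "norm (h *\<^sub>R (bdi_cgen a b c (u t) i - bdi_cgen a b c (u y) i))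
       \<le> h * ((a + b * i) * (d (Suc i) h + d i h) + c * i * (d (i - 1) h + d i h))"
      using h(1) by (auto intro!: mult_left_mono)
    have "u y i - u t i - (y - t) *\<^sub>R bdi_cgen a b c (u t) i =
       h *\<^sub>R (bdi_cgen a b c (u t) i - bdi_cgen a b c (u y) i) - (u (y + h) i - u y i - h *\<^sub>R bdi_cgen a b c (u y) i)"
      using h(2) by (simp add: algebra_simps)
    also have "norm \<dots> \<le> h * ((a + b * i) * (d (Suc i) h + d i h) + c * i * (d (i - 1) h + d i h)) + M * h * e i h"
      by (rule order.trans[OF norm_triangle_ineq4]) (intro add_mono 1 step that h)
    also have "\<dots> = Bd h * h" by (simp add: Bd_def algebra_simps)
    finally have "norm (u y i - u t i - (y - t) *\<^sub>R bdi_cgen a b c (u t) i) / h \<le> Bd h"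
      using h(1) by (simp add: divide_le_eq)
    moreover have "\<bar>y - t\<bar> = h" using h by simp
    ultimately show ?thesis by simp
  qed
  have id0: "((\<lambda>h::real. h) \<longlongrightarrow> 0) (at_right 0)" by (rule tendsto_ident_at)
  have d0: "(d j \<longlongrightarrow> M * 0 * 0 + 0 * g j) (at_right 0)" for j
    unfolding d_def[abs_def] by (intro tendsto_intros e id0)
  have "(Bd \<longlongrightarrow> M * 0 + ((a + b * i) * (0 + 0) + c * i * (0 + 0))) (at_right 0)"
    unfolding Bd_def[abs_def] using d0 by (intro tendsto_intros e) simp_all
  hence Bd0: "(Bd \<longlongrightarrow> 0) (at_right 0)" by simp
  have "filterlim (\<lambda>y. \<bar>y - t\<bar>) (at_right 0) (at t within {0..})"
    unfolding filterlim_at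
  proof
    have "((\<lambda>y. \<bar>y - t\<bar>) \<longlongrightarrow> \<bar>t - t\<bar>) (at t within {0..})" by (intro tendsto_intros)
    thus "((\<lambda>y. \<bar>y - t\<bar>) \<longlongrightarrow> 0) (at t within {0..})" by simp
  qed (auto simp: eventually_at_filter)
  from filterlim_compose[OF Bd0 this] have lim: "((\<lambda>y. Bd \<bar>y - t\<bar>) \<longlongrightarrow> 0) (at t within {0..})" .
  have "((\<lambda>y. norm (u y i - u t i - (y - t) *\<^sub>R bdi_cgen a b c (u t) i) / norm (y - t)) \<longlongrightarrow> 0) (at t within {0..})"
    by (rule tendsto_sandwich[OF _ _ tendsto_const lim]) (auto simp: eventually_at_filter intro!: always_eventually main[unfolded real_norm_def])
  thus ?thesis
    unfolding has_vector_derivative_def has_derivative_iff_norm by (auto intro: bounded_linear_scaleR_left)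
qed

text \<open>A maximum principle with the Lyapunov function \<open>V i t = \<epsilon> (i + 1 + (a + 1) t)\<close>. Since \<open>b \<le> c\<close>, the generator
maps \<open>V\<close> to at most \<open>a \<epsilon>\<close>, which is below its time derivative \<open>(a + 1) \<epsilon>\<close>. If \<open>|w| - V\<close> were positive
somewhere it would have a positive maximum, because \<open>w\<close> is bounded and \<open>V\<close> grows in \<open>i\<close>. After
multiplication of \<open>w\<close> by a phase the backward equation at the maximum point contradicts this.\<close>

lemma bounded_backward_solution_unique:
  fixes w :: "real \<Rightarrow> nat \<Rightarrow> complex"
  assumes abc: "0 \<le> a" "0 \<le> b" "b \<le> c" and T: "0 \<le> T"
    and bdd: "\<And>t i. 0 \<le> t \<Longrightarrow> t \<le> T \<Longrightarrow> norm (w t i) \<le> M"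
    and w0: "\<And>i. w 0 i = 0"
    and deriv: "\<And>t i. 0 \<le> t \<Longrightarrow> t \<le> T \<Longrightarrow>
       ((\<lambda>t. w t i) has_vector_derivative bdi_cgen a b c (w t) i) (at t within {0..T})"
  shows "w T n = 0"
proof -
  have small: "norm (w T n) \<le> \<epsilon> * (real n + 1 + (a + 1) * T)" if \<epsilon>: "0 < \<epsilon>" for \<epsilon>
  proof (rule ccontr)
    assume neg: "\<not> ?thesis"
    define V where "V i t = \<epsilon> * (real i + 1 + (a + 1) * t)" for i t
    define z where "z i t = norm (w t i) - V i t" for i t
    define I where "I = nat \<lceil>\<bar>M\<bar> / \<epsilon>\<rceil> + n"
    have contw: "continuous_on {0..T} (\<lambda>t. w t i)" for i
      by (rule continuous_on_vector_derivative[OF deriv]) auto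
    have cont: "continuous_on {0..T} (z i)" for i
      unfolding z_def[abs_def] V_def by (intro continuous_intros contw)
    have "\<exists>t\<in>{0..T}. \<forall>s\<in>{0..T}. z i s \<le> z i t" for i
      by (rule continuous_attains_sup) (use cont T in auto)
    then obtain \<tau> where \<tau>: "\<And>i. \<tau> i \<in> {0..T}" "\<And>i s. s \<in> {0..T} \<Longrightarrow> z i s \<le> z i (\<tau> i)"
      by metis
    have "\<exists>k\<in>{..I}. \<forall>i\<in>{..I}. z i (\<tau> i) \<le> z k (\<tau> k)"
    proof -
      define m where "m = Max ((\<lambda>i. z i (\<tau> i)) ` {..I})"
      have "m \<in> (\<lambda>i. z i (\<tau> i)) ` {..I}" unfolding m_def by (rule Max_in) auto
      then obtain k where k: "m = z k (\<tau> k)" "k \<in> {..I}" by (rule imageE)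
      have "z i (\<tau> i) \<le> m" if "i \<in> {..I}" for i
        unfolding m_def by (rule Max_ge) (use that in auto)
      thus ?thesis using k by blast
    qed
    then obtain k where k: "k \<le> I" "\<And>i. i \<le> I \<Longrightarrow> z i (\<tau> i) \<le> z k (\<tau> k)" by auto
    define s where "s = \<tau> k"
    have s: "0 \<le> s" "s \<le> T" using \<tau>(1)[of k] by (auto simp: s_def)
    have "0 < z n T" using neg by (simp add: z_def V_def)
    also have "z n T \<le> z n (\<tau> n)" using \<tau>(2)[of T n] T by auto
    also have "\<dots> \<le> z k s" unfolding s_def by (rule k) (simp add: I_def)
    finally have pos: "0 < z k s" .
    have far: "z i t < 0" if "I < i" "0 \<le> t" "t \<le> T" for i t
    proof -
      have "\<bar>M\<bar> / \<epsilon> \<le> real I" unfolding I_def by linarith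
      also have "real I < real i + 1 + (a + 1) * t" 
      proof -
        have "0 \<le> (a + 1) * t" using abc that by simp
        thus ?thesis using that by linarith
      qed
      finally have "\<bar>M\<bar> < V i t" using \<epsilon> by (simp add: V_def divide_less_eq mult.commute)
      thus ?thesis using bdd[of t i] that by (simp add: z_def)
    qed
    have glob: "z i t \<le> z k s" if "0 \<le> t" "t \<le> T" for i t
    proof (cases "i \<le> I")
      case True
      have "z i t \<le> z i (\<tau> i)" using \<tau>(2)[of t i] that by auto
      also have "\<dots> \<le> z k s" unfolding s_def by (rule k) fact
      finally show ?thesis .
    next
      case False thus ?thesis using far[of i t] that pos by simp
    qed
    have s0: "0 < s"
    proof (rule ccontr)
      assume "\<not> 0 < s"
      hence "s = 0" using s by simp
      hence "z k s \<le> 0" using w0 \<epsilon> by (simp add: z_def V_def)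
      thus False using pos by simp
    qed
    \<comment> \<open>The phase that makes \<open>w s k\<close> a positive real number.\<close>
    define p where "p = cnj (sgn (w s k))"
    have wk: "w s k \<noteq> 0"
    proof
      assume "w s k = 0"
      hence "z k s \<le> 0" using \<epsilon> s abc by (simp add: z_def V_def)
      thus False using pos by simp
    qed
    have p1: "norm p = 1" using wk by (simp add: p_def norm_sgn)
    have pw: "p * w s k = norm (w s k)"
    proof -
      have "p * w s k = (w s k * cnj (w s k)) / norm (w s k)"
        by (simp add: p_def sgn_eq mult.commute)
      also have "w s k * cnj (w s k) = of_real (norm (w s k) * norm (w s k))"
        by (simp only: complex_norm_square[symmetric] power2_eq_square)
      also have "of_real (norm (w s k) * norm (w s k)) / complex_of_real (norm (w s k)) = of_real (norm (w s k))"
        using wk by simp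
      finally show ?thesis .
    qed
    define g where "g t = Re (p * w t k) - V k t" for t
    define D where "D = Re (p * bdi_cgen a b c (w s) k) - \<epsilon> * (a + 1)"
    have Rd: "((\<lambda>t. Re (p * w t k)) has_real_derivative Re (p * bdi_cgen a b c (w s) k)) (at s within {0..T})"
      unfolding has_real_derivative_iff_has_vector_derivative
      by (rule bounded_linear.has_vector_derivative[OF bounded_linear_Re])
         (rule bounded_linear.has_vector_derivative[OF bounded_linear_mult_right deriv[OF s]])
    have "((\<lambda>t. V k t) has_real_derivative \<epsilon> * (a + 1)) (at s within {0..T})"
      unfolding V_def by (auto intro!: derivative_eq_intros)
    from DERIV_diff[OF Rd this] have gd: "(g has_real_derivative D) (at s within {0..T})"
      by (simp only: g_def[abs_def] D_def)
    have gle: "g t \<le> g s" if "0 \<le> t" "t \<le> T" for t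
    proof -
      have "Re (p * w t k) \<le> norm (w t k)"
        using complex_Re_le_cmod[of "p * w t k"] p1 by (simp add: norm_mult)
      hence "g t \<le> z k t" by (simp add: g_def z_def)
      also have "\<dots> \<le> z k s" by (rule glob[OF that])
      also have "\<dots> = g s" by (simp add: g_def z_def pw)
      finally show ?thesis .
    qed
    \<comment> \<open>At a maximum over \<open>[0, T]\<close> attained at \<open>s > 0\<close>, the derivative within the interval is nonnegative, also if \<open>s = T\<close>.\<close>
    have "0 \<le> D"
    proof (rule ccontr)
      assume "\<not> 0 \<le> D"
      then obtain d where d: "0 < d" "\<And>h. 0 < h \<Longrightarrow> s - h \<in> {0..T} \<Longrightarrow> h < d \<Longrightarrow> g s < g (s - h)"
        using has_real_derivative_neg_dec_left[OF gd] by auto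
      define h where "h = min (d / 2) (s / 2)"
      have "g s < g (s - h)" by (rule d) (use d(1) s0 s in \<open>auto simp: h_def min_def\<close>)
      moreover have "g (s - h) \<le> g s" by (rule gle) (use d(1) s0 s in \<open>auto simp: h_def min_def\<close>)
      ultimately show False by simp
    qed
    have nb: "Re (p * (w s j - w s k)) \<le> \<epsilon> * (real j - real k)" for j
    proof -
      have "Re (p * w s j) \<le> norm (w s j)"
        using complex_Re_le_cmod[of "p * w s j"] p1 by (simp add: norm_mult)
      moreover have "norm (w s j) \<le> V j s + z k s" using glob[OF s, of j] by (simp add: z_def)
      moreover have "norm (w s k) = V k s + z k s" by (simp add: z_def)
      moreover have "V j s - V k s = \<epsilon> * (real j - real k)" by (simp add: V_def algebra_simps)
      ultimately show ?thesis using pw by (simp add: right_diff_distrib)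
    qed
    have Re_gen: "Re (p * bdi_cgen a b c (w s) k) = (a + b * k) * Re (p * (w s (Suc k) - w s k))
        + c * k * Re (p * (w s (k - 1) - w s k))"
      by (simp add: bdi_cgen_def algebra_simps)
    have "Re (p * bdi_cgen a b c (w s) k) \<le> (a + b * k) * (\<epsilon> * (real (Suc k) - real k)) + c * k * (\<epsilon> * (real (k - 1) - real k))"
      unfolding Re_gen by (intro add_mono mult_left_mono nb) (use abc in auto)
    also have "\<dots> \<le> (a + b * k) * \<epsilon> - c * k * \<epsilon>"
      by (cases k) (auto simp: algebra_simps)
    also have "\<dots> \<le> a * \<epsilon>"
    proof -
      have "(a + b * k) * \<epsilon> - c * k * \<epsilon> = a * \<epsilon> - (c - b) * (real k * \<epsilon>)" by (simp add: algebra_simps)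
      moreover have "0 \<le> (c - b) * (real k * \<epsilon>)" using abc \<epsilon> by simp
      ultimately show ?thesis by linarith
    qed
    finally have "D < 0" using \<epsilon> by (simp add: D_def algebra_simps)
    thus False using \<open>0 \<le> D\<close> by simp
  qed
  have "norm (w T n) \<le> 0"
  proof (rule field_le_epsilon)
    fix e :: real assume e: "0 < e"
    define B where "B = real n + 1 + (a + 1) * T"
    have "0 \<le> (a + 1) * T" using abc T by simp
    hence B: "0 < B" unfolding B_def by linarith
    have "norm (w T n) \<le> (e / B) * B" using e B by (intro small[folded B_def]) simp
    thus "norm (w T n) \<le> 0 + e" using B by simp
  qed
  thus ?thesis by simp
qed

section \<open>Generating functions of the chain\<close>

lemma ric_data_pgf:
  assumes "0 < b" "b < c" "norm s \<le> 1"
  shows "ric_data b c 1 s"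
proof -
  have bs: "norm (of_real b * s) \<le> b" using assms by (simp add: norm_mult mult_left_le)
  have ne: "of_real b * s \<noteq> of_real c"
  proof
    assume "of_real b * s = of_real c"
    hence "norm (complex_of_real c) \<le> b" using bs by simp
    thus False using assms by simp
  qed
  have Re: "Re s \<le> 1" using assms(3) complex_Re_le_cmod[of s] by linarith
  have "(cmod (of_real b * (s - 1)))\<^sup>2 < (cmod (of_real b * s - of_real c))\<^sup>2"
  proof -
    have "(b * Re s - c)\<^sup>2 - (b * (Re s - 1))\<^sup>2 = (c - b) * ((c - b * Re s) + b * (1 - Re s))"
      by (simp add: algebra_simps power2_eq_square)
    also have "\<dots> > 0"
    proof (intro mult_pos_pos add_pos_nonneg mult_nonneg_nonneg)
      have "b * Re s \<le> b" using assms Re by (simp add: mult_left_le)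
      thus "0 < c - b * Re s" using assms by linarith
    qed (use assms Re in auto)
    finally show ?thesis by (simp add: cmod_power2)
  qed
  hence "cmod (of_real b * (s - 1)) < cmod (of_real b * s - of_real c)"
    by (rule power2_less_imp_less) simp
  hence "norm (ric_q b c 1 s) < 1"
    using ne by (simp add: ric_q_def norm_divide divide_less_eq)
  thus ?thesis using assms ne by (auto simp: ric_data_def)
qed

text \<open>The generating function itself is clearly bounded by \<open>1\<close>; here the bound is needed for the explicit
formula, before the two are identified. With \<open>R = c / b\<close>, \<open>|\<rho>| \<le> 1\<close> means \<open>|1 - R w| \<le> |1 - w|\<close>, which is
\<open>(R + 1) |w|\<^sup>2 \<le> 2 Re w\<close>: a disc with \<open>0\<close> on its boundary. The flow for \<open>r = 1\<close> multiplies \<open>w\<close> by a real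
factor in \<open>(0, 1]\<close> and so preserves the disc. On it \<open>|1 - w|\<close> grows as \<open>w\<close> shrinks, which bounds \<open>\<alpha>\<close>.\<close>

lemma pgf_bounds:
  assumes b: "0 < b" "b < c" and s: "norm s \<le> 1" and t: "0 \<le> t" and a: "0 \<le> a"
  shows "norm (ric_rho b c 1 s t) \<le> 1" "norm (ric_alpha a b c 1 s t) \<le> 1"
proof -
  have D: "ric_data b c 1 s" using b s by (rule ric_data_pgf)
  define R q e w where "R = c / b" and "q = ric_q b c 1 s" and "e = exp (- (c - b) * t)" and "w = ric_w b c 1 s t"
  have R: "1 < R" using b by (simp add: R_def)
  have wq: "w = of_real e * q"
    by (simp add: w_def ric_w_def q_def e_def mult.commute exp_of_real flip: of_real_mult of_real_diff of_real_minus)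
       (simp add: exp_of_real[symmetric] algebra_simps)?
  have e: "0 < e" "e \<le> 1" using b t by (auto simp: e_def intro!: mult_nonpos_nonneg)
  have q1: "norm q < 1" using D by (auto simp: ric_data_def q_def)
  have w1: "norm w < 1" using ric_w_le[OF D t] by (simp add: w_def)
  have sq: "(cmod (1 - of_real R * z))\<^sup>2 = 1 - 2 * R * Re z + R\<^sup>2 * (norm z)\<^sup>2" for R z
    by (simp only: cmod_power2) (simp add: power2_eq_square algebra_simps)
  have iff: "cmod (1 - of_real R * z) \<le> cmod (1 - z) \<longleftrightarrow> (R + 1) * (norm z)\<^sup>2 \<le> 2 * Re z" for z
  proof -
    have "cmod (1 - of_real R * z) \<le> cmod (1 - z) \<longleftrightarrow> (cmod (1 - of_real R * z))\<^sup>2 \<le> (cmod (1 - z))\<^sup>2"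
      by (simp add: power2_le_iff_abs_le)
    also have "(cmod (1 - z))\<^sup>2 = (cmod (1 - of_real R * z))\<^sup>2 + (R - 1) * (2 * Re z - (R + 1) * (norm z)\<^sup>2)"
    proof -
      have "(cmod (1 - z))\<^sup>2 = 1 - 2 * Re z + (norm z)\<^sup>2" using sq[of 1 z] by simp
      thus ?thesis unfolding sq by (simp add: algebra_simps power2_eq_square)
    qed
    also have "(cmod (1 - of_real R * z))\<^sup>2 \<le> (cmod (1 - of_real R * z))\<^sup>2 + (R - 1) * (2 * Re z - (R + 1) * (norm z)\<^sup>2)
       \<longleftrightarrow> 0 \<le> (R - 1) * (2 * Re z - (R + 1) * (norm z)\<^sup>2)" by simp
    also have "\<dots> \<longleftrightarrow> (R + 1) * (norm z)\<^sup>2 \<le> 2 * Re z" using R by (simp add: zero_le_mult_iff)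
    finally show ?thesis .
  qed
  have "ric_rho b c 1 s 0 = (1 - of_real R * q) / (1 - q)"
    by (simp add: ric_rho_def ric_w_def q_def R_def mult.commute)
  hence "1 - of_real R * q = s * (1 - q)"
    using ric_rho_0[OF D] one_minus_notin_nonpos(2)[OF q1] by (simp add: divide_eq_eq)
  hence "cmod (1 - of_real R * q) \<le> cmod (1 - q)"
    using s by (simp add: norm_mult mult_left_le_one_le)
  hence qq: "(R + 1) * (norm q)\<^sup>2 \<le> 2 * Re q" by (simp only: iff)
  have q0: "(norm q)\<^sup>2 \<le> Re q" "0 \<le> Re q"
  proof -
    have "2 * (norm q)\<^sup>2 \<le> (R + 1) * (norm q)\<^sup>2" using R by (intro mult_right_mono) auto
    thus "(norm q)\<^sup>2 \<le> Re q" using qq by linarith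
    thus "0 \<le> Re q" using zero_le_power2[of "norm q"] by linarith
  qed
  have "(R + 1) * (norm w)\<^sup>2 = e\<^sup>2 * ((R + 1) * (norm q)\<^sup>2)"
    unfolding wq using e by (simp add: norm_mult power_mult_distrib)
  also have "\<dots> \<le> e\<^sup>2 * (2 * Re q)" using qq by (intro mult_left_mono) auto
  also have "\<dots> \<le> e * (2 * Re q)" using e q0 by (intro mult_right_mono) (auto simp: power2_eq_square mult_left_le)
  also have "\<dots> = 2 * Re w" by (simp add: wq)
  finally have "cmod (1 - of_real R * w) \<le> cmod (1 - w)" by (simp only: iff)
  moreover have "ric_rho b c 1 s t = (1 - of_real R * w) / (1 - w)"
    by (simp add: ric_rho_def w_def R_def mult.commute)
  ultimately show "norm (ric_rho b c 1 s t) \<le> 1"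
    using one_minus_notin_nonpos(2)[OF w1] by (simp add: norm_divide divide_le_eq)
  have "(cmod (1 - q))\<^sup>2 \<le> (cmod (1 - w))\<^sup>2"
  proof -
    have "0 \<le> (1 - e) * (2 * Re q - (1 + e) * (norm q)\<^sup>2)"
    proof (intro mult_nonneg_nonneg)
      have "(1 + e) * (norm q)\<^sup>2 \<le> 2 * (norm q)\<^sup>2" using e by (intro mult_right_mono) auto
      thus "0 \<le> 2 * Re q - (1 + e) * (norm q)\<^sup>2" using q0 by linarith
    qed (use e in auto)
    thus ?thesis using sq[of 1 q] sq[of e q] by (simp add: wq algebra_simps power2_eq_square)
  qed
  hence *: "cmod (1 - q) \<le> cmod (1 - w)" by (rule power2_le_imp_le) simp
  have "Re (Ln (1 - w)) = ln (cmod (1 - w))" "Re (Ln (1 - q)) = ln (cmod (1 - q))"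
    using one_minus_notin_nonpos(2) q1 w1 by auto
  moreover have "ln (cmod (1 - q)) \<le> ln (cmod (1 - w))"
    using * one_minus_notin_nonpos(2)[OF q1] one_minus_notin_nonpos(2)[OF w1] by (subst ln_le_cancel_iff) auto
  ultimately have "0 \<le> (a / b) * (Re (Ln (1 - w)) - Re (Ln (1 - q)))" using a b by (intro mult_nonneg_nonneg) auto
  moreover have "Re (- a * (1 - 1) * t - (a / b) * (Ln (1 - w) - Ln (1 - q))) = - ((a / b) * (Re (Ln (1 - w)) - Re (Ln (1 - q))))"
    by (simp flip: of_real_divide)
  ultimately show "norm (ric_alpha a b c 1 s t) \<le> 1"
    by (simp add: ric_alpha_def norm_exp_eq_Re w_def q_def)
qed

text \<open>For \<open>\<kappa> = 0\<close> the fixed point is \<open>r = 1\<close>. The Riccati system says precisely that \<open>\<alpha>(t) \<rho>(t) ^ i\<close> solves the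
backward equation with initial value \<open>s ^ i\<close>.\<close>

theorem bdi_pgf:
  assumes K: "transition_semigroup K" "has_transition_rates K (bdi_rates a b c)"
    and abc: "0 \<le> a" "0 < b" "b < c" and s: "norm s \<le> 1" and T: "0 \<le> T"
  shows "measure_pmf.expectation (K T i) (\<lambda>j. s ^ j) = ric_alpha a b c 1 s T * ric_rho b c 1 s T ^ i"
proof -
  have D: "ric_data b c 1 s" using abc s by (intro ric_data_pgf)
  define u where "u t i = measure_pmf.expectation (K t i) (\<lambda>j. s ^ j)" for t i
  define v where "v t i = ric_alpha a b c 1 s t * ric_rho b c 1 s t ^ i" for t i
  have s1: "norm (s ^ j) \<le> 1" for j using s by (simp add: norm_power power_le_one)
  have "u T i - v T i = 0"
  proof (rule bounded_backward_solution_unique[where a=a and b=b and c=c and M=2 and w="\<lambda>t i. u t i - v t i"])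
    fix t i assume t: "0 \<le> t" "t \<le> T"
    have "norm (u t i) \<le> 1" unfolding u_def by (rule norm_expectation_pmf_le[OF s1])
    moreover have "norm (v t i) \<le> 1"
      using pgf_bounds[OF abc(2,3) s t(1) abc(1)]
      by (auto simp: v_def norm_mult norm_power intro!: mult_le_one power_le_one)
    ultimately show "norm (u t i - v t i) \<le> 2"
      using norm_triangle_ineq4[of "u t i" "v t i"] by linarith
    have "((\<lambda>t. u t i) has_vector_derivative bdi_cgen a b c (u t) i) (at t within {0..})"
      unfolding u_def using abc by (intro kolmogorov_backward[OF K _ _ _ s1 t(1)]) auto
    hence 1: "((\<lambda>t. u t i) has_vector_derivative bdi_cgen a b c (u t) i) (at t within {0..T})"
      by (rule has_vector_derivative_within_subset) auto
    define \<alpha> \<rho> where "\<alpha> = ric_alpha a b c 1 s t" and "\<rho> = ric_rho b c 1 s t"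
    have "((\<lambda>x. x ^ i) has_field_derivative (of_nat i * \<rho> ^ (i - 1))) (at \<rho> within ric_rho b c 1 s ` {0..T})"
      by (auto intro!: derivative_eq_intros)
    from field_vector_diff_chain_within[OF ric_rho_deriv[OF D t(1)] this[unfolded \<rho>_def]]
    have "((\<lambda>t. ric_rho b c 1 s t ^ i) has_vector_derivative
      ((b * \<rho>\<^sup>2 - (b + c) * \<rho> + c) * (of_nat i * \<rho> ^ (i - 1)))) (at t within {0..T})"
      by (simp add: o_def \<rho>_def)
    from has_vector_derivative_mult[OF ric_alpha_deriv[OF D t(1), of a] this]
    have "((\<lambda>t. v t i) has_vector_derivative
      (\<alpha> * ((b * \<rho>\<^sup>2 - (b + c) * \<rho> + c) * (of_nat i * \<rho> ^ (i - 1))) + (a * \<alpha> * (\<rho> - 1)) * \<rho> ^ i)) (at t within {0..T})"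
      by (simp add: v_def[abs_def] \<alpha>_def \<rho>_def)
    also have "\<alpha> * ((b * \<rho>\<^sup>2 - (b + c) * \<rho> + c) * (of_nat i * \<rho> ^ (i - 1))) + (a * \<alpha> * (\<rho> - 1)) * \<rho> ^ i
        = bdi_cgen a b c (v t) i"
      by (cases i) (auto simp: bdi_cgen_def v_def \<alpha>_def[symmetric] \<rho>_def[symmetric] algebra_simps power2_eq_square)
    finally have 2: "((\<lambda>t. v t i) has_vector_derivative bdi_cgen a b c (v t) i) (at t within {0..T})" .
    show "((\<lambda>t. u t i - v t i) has_vector_derivative bdi_cgen a b c (\<lambda>i. u t i - v t i) i) (at t within {0..T})"
      unfolding bdi_cgen_diff by (rule has_vector_derivative_diff[OF 1 2])
  next
    fix i show "u 0 i - v 0 i = 0"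
      using K(1) by (simp add: u_def v_def transition_semigroup_def ric_rho_0[OF D] ric_alpha_0[OF D])
  qed (use abc T in auto)
  thus ?thesis by (simp add: u_def v_def)
qed

section \<open>Negative binomial laws and the invariant law\<close>

lemma pmf_expectation_sums:
  fixes f :: "nat \<Rightarrow> 'a::{banach,second_countable_topology}"
  assumes "summable (\<lambda>n. pmf p n * norm (f n))"
  shows "integrable (measure_pmf p) f" "(\<lambda>n. pmf p n *\<^sub>R f n) sums measure_pmf.expectation p f"
proof -
  have I: "integrable (count_space UNIV) (\<lambda>n. pmf p n *\<^sub>R f n)"
    using assms by (simp add: integrable_count_space_nat_iff)
  show "integrable (measure_pmf p) f"
    using I unfolding measure_pmf_eq_density by (subst integrable_density) auto
  have "measure_pmf.expectation p f = integral\<^sup>L (count_space UNIV) (\<lambda>n. pmf p n *\<^sub>R f n)"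
    unfolding measure_pmf_eq_density by (subst integral_density) auto
  thus "(\<lambda>n. pmf p n *\<^sub>R f n) sums measure_pmf.expectation p f"
    using sums_integral_count_space_nat[OF I] by simp
qed

lemma summable_pmf_nat: "summable (\<lambda>n. pmf p (n::nat))"
proof -
  have "integrable (count_space UNIV) (pmf p)" by (rule integrable_pmf)
  thus ?thesis by (simp add: integrable_count_space_nat_iff)
qed

lemma pmf_expectation_sums_bounded:
  fixes f :: "nat \<Rightarrow> 'a::{banach,second_countable_topology}"
  assumes "\<And>n. norm (f n) \<le> M"
  shows "(\<lambda>n. pmf p n *\<^sub>R f n) sums measure_pmf.expectation p f"
proof (rule pmf_expectation_sums(2), rule summable_comparison_test'[where N=0])
  show "summable (\<lambda>n. M * pmf p n)" by (intro summable_mult summable_pmf_nat)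
  show "norm (pmf p n * norm (f n)) \<le> M * pmf p n" for n
    using mult_right_mono[OF assms[of n] pmf_nonneg[of p n]] by (simp add: mult.commute)
qed

text \<open>Divide by \<open>x ^ n\<close>, once the coefficients below \<open>n\<close> are known to vanish, and let \<open>x\<close> tend to \<open>0\<close> from the right.\<close>

lemma power_series_zero_coeffs:
  fixes d :: "nat \<Rightarrow> real"
  assumes bdd: "\<And>n. \<bar>d n\<bar> \<le> 1" and zero: "\<And>x. 0 < x \<Longrightarrow> x < \<delta> \<Longrightarrow> (\<lambda>n. d n * x ^ n) sums 0"
    and \<delta>: "0 < \<delta>"
  shows "d n = 0"
proof (induction n rule: less_induct)
  case (less n)
  define e where "e k = d (k + n)" for k
  have "((\<lambda>x. \<Sum>k. e k * x ^ k) \<longlongrightarrow> e 0) (at 0)"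
  proof (rule powser_limit_0[where s=1])
    fix x :: real assume x: "norm x < 1"
    have "summable (\<lambda>k. e k * x ^ k)"
    proof (rule summable_comparison_test'[where N=0])
      show "summable (\<lambda>k. \<bar>x\<bar> ^ k)" using x by (intro summable_geometric) auto
      show "norm (e k * x ^ k) \<le> \<bar>x\<bar> ^ k" for k
        using bdd[of "k + n"] by (simp add: e_def abs_mult power_abs mult_left_le_one_le)
    qed
    thus "(\<lambda>k. e k * x ^ k) sums (\<Sum>k. e k * x ^ k)" by (rule summable_sums)
  qed simp
  hence "((\<lambda>x. \<Sum>k. e k * x ^ k) \<longlongrightarrow> e 0) (at_right 0)" by (rule filterlim_mono) (auto simp: at_within_le_nhds at_le)
  moreover have "\<forall>\<^sub>F x in at_right 0. 0 = (\<Sum>k. e k * x ^ k)"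
  proof -
    have "(\<Sum>k. e k * x ^ k) = 0" if "0 < x" "x < \<delta>" for x
    proof -
      have "(\<lambda>k. d (k + n) * x ^ (k + n)) sums (0 - (\<Sum>i<n. d i * x ^ i))"
        by (rule sums_split_initial_segment[OF zero[OF that]])
      hence "(\<lambda>k. x ^ n * (e k * x ^ k)) sums 0" using less by (simp add: e_def power_add mult_ac)
      hence "(\<lambda>k. inverse (x ^ n) * (x ^ n * (e k * x ^ k))) sums (inverse (x ^ n) * 0)" by (rule sums_mult)
      hence "(\<lambda>k. e k * x ^ k) sums 0" using that by (simp add: mult.assoc[symmetric])
      thus ?thesis by (simp add: sums_iff)
    qed
    thus ?thesis unfolding eventually_at_right_field using \<delta> by metis
  qed
  ultimately have "((\<lambda>_. 0) \<longlongrightarrow> e 0) (at_right (0::real))"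
    by (rule Lim_transform_eventually[OF _ eventually_mono]) simp
  hence "e 0 = 0" using tendsto_unique[OF _ tendsto_const] by (metis trivial_limit_at_right_real)
  thus ?case by (simp add: e_def)
qed

lemma pmf_eqI_pgf:
  assumes "\<And>x::real. 0 < x \<Longrightarrow> x < 1 \<Longrightarrow>
     measure_pmf.expectation p (\<lambda>n. complex_of_real x ^ n) = measure_pmf.expectation q (\<lambda>n. complex_of_real x ^ n)"
  shows "p = q"
proof (rule pmf_eqI)
  fix n
  have "pmf p n - pmf q n = 0"
  proof (rule power_series_zero_coeffs[where \<delta>=1 and d="\<lambda>n. pmf p n - pmf q n"])
    show "\<bar>pmf p n - pmf q n\<bar> \<le> 1" for n
      using pmf_le_1[of p n] pmf_le_1[of q n] pmf_nonneg[of p n] pmf_nonneg[of q n] by linarith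
    fix x :: real assume x: "0 < x" "x < 1"
    have "norm (complex_of_real x ^ n) \<le> 1" for n using x by (simp add: norm_power power_le_one)
    hence S: "(\<lambda>n. pmf p n *\<^sub>R complex_of_real x ^ n) sums measure_pmf.expectation p (\<lambda>n. complex_of_real x ^ n)" for p
      by (rule pmf_expectation_sums_bounded)
    have "(\<lambda>n. complex_of_real ((pmf p n - pmf q n) * x ^ n)) sums of_real 0"
      using sums_diff[OF S[of p] S[of q]] by (simp add: assms[OF x] scaleR_conv_of_real algebra_simps)
    thus "(\<lambda>n. (pmf p n - pmf q n) * x ^ n) sums 0" by (simp only: sums_of_real_iff)
  qed simp
  thus "pmf p n = pmf q n" by simp
qed

lemma neg_binomial_mass_pochhammer:
  assumes "0 < s"
  shows "neg_binomial_mass s p n = (1 - p) powr s * (pochhammer s n / fact n * p ^ n)"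
proof -
  have "s \<notin> \<int>\<^sub>\<le>\<^sub>0" using assms by (auto elim!: nonpos_Ints_cases)
  thus ?thesis by (simp add: neg_binomial_mass_def pochhammer_Gamma add.commute)
qed

lemma neg_binomial_series_complex:
  fixes y :: complex
  assumes "norm y < 1"
  shows "(\<lambda>n. of_real (pochhammer s n / fact n) * y ^ n) sums ((1 - y) powr (- of_real s))"
proof -
  have "(\<lambda>n. ((- of_real s) gchoose n) * (- y) ^ n) sums (1 + (- y)) powr (- of_real s)"
    by (rule gen_binomial_complex) (use assms in simp)
  moreover have "((- complex_of_real s) gchoose n) * (- y) ^ n = of_real (pochhammer s n / fact n) * y ^ n" for n
  proof -
    have "((- complex_of_real s) gchoose n) * (- y) ^ n = ((- 1) ^ n * (- y) ^ n) * (pochhammer (of_real s) n / fact n)"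
      by (simp add: gbinomial_pochhammer)
    also have "(- 1) ^ n * (- y) ^ n = y ^ n" by (simp flip: power_mult_distrib)
    finally show ?thesis by (simp add: pochhammer_of_real)
  qed
  ultimately show ?thesis by simp
qed

lemma neg_binomial_series:
  fixes x :: real
  assumes "\<bar>x\<bar> < 1"
  shows "(\<lambda>n. pochhammer s n / fact n * x ^ n) sums ((1 - x) powr (- s))"
proof -
  have "(\<lambda>n. ((- s) gchoose n) * (- x) ^ n) sums (1 + (- x)) powr (- s)"
    by (rule gen_binomial_real) (use assms in simp)
  moreover have "((- s) gchoose n) * (- x) ^ n = (pochhammer s n / fact n) * x ^ n" for n
  proof -
    have "((- s) gchoose n) * (- x) ^ n = ((- 1) ^ n * (- x) ^ n) * (pochhammer s n / fact n)"
      by (simp add: gbinomial_pochhammer)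
    also have "(- 1) ^ n * (- x) ^ n = x ^ n" by (simp flip: power_mult_distrib)
    finally show ?thesis by simp
  qed
  ultimately show ?thesis by simp
qed

lemma neg_binomial_mass_pgf:
  assumes "0 < s" "0 < p" "p < 1" "\<bar>p * x\<bar> < 1"
  shows "(\<lambda>n. neg_binomial_mass s p n * x ^ n) sums (((1 - p) / (1 - p * x)) powr s)"
proof -
  have "(\<lambda>n. (1 - p) powr s * (pochhammer s n / fact n * (p * x) ^ n)) sums ((1 - p) powr s * (1 - p * x) powr (- s))"
    by (intro sums_mult neg_binomial_series assms)
  moreover have "(1 - p) powr s * (1 - p * x) powr (- s) = ((1 - p) / (1 - p * x)) powr s"
  proof -
    have "0 < 1 - p * x" using assms by linarith
    thus ?thesis using assms by (subst powr_divide) (auto simp: powr_minus divide_inverse)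
  qed
  ultimately show ?thesis by (simp add: neg_binomial_mass_pochhammer[OF assms(1)] power_mult_distrib mult.assoc)
qed

lemma neg_binomial_mass_nonneg: "0 < s \<Longrightarrow> 0 \<le> p \<Longrightarrow> 0 \<le> neg_binomial_mass s p n"
  by (simp add: neg_binomial_mass_pochhammer pochhammer_nonneg)

lemma neg_binomial_mass_pos: "0 < s \<Longrightarrow> 0 < p \<Longrightarrow> p < 1 \<Longrightarrow> 0 < neg_binomial_mass s p n"
  by (simp add: neg_binomial_mass_pochhammer pochhammer_pos)

definition neg_binomial_pmf :: "real \<Rightarrow> real \<Rightarrow> nat pmf" where
  "neg_binomial_pmf s p = embed_pmf (neg_binomial_mass s p)"

lemma pmf_neg_binomial:
  assumes "0 < s" "0 < p" "p < 1"
  shows "pmf (neg_binomial_pmf s p) n = neg_binomial_mass s p n"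
  unfolding neg_binomial_pmf_def
proof (rule pmf_embed_pmf)
  show "0 \<le> neg_binomial_mass s p x" for x using assms neg_binomial_mass_nonneg by auto
  have "neg_binomial_mass s p sums 1" using neg_binomial_mass_pgf[OF assms, of 1] assms by simp
  hence "(\<Sum>n. ennreal (neg_binomial_mass s p n)) = ennreal 1"
    using assms neg_binomial_mass_nonneg by (intro suminf_ennreal_eq) auto
  thus "(\<integral>\<^sup>+ x. ennreal (neg_binomial_mass s p x) \<partial>count_space UNIV) = 1"
    by (simp add: nn_integral_count_space_nat)
qed

lemma neg_binomial_pmf_law:
  assumes "0 < s" "0 < p" "p < 1"
  shows "neg_binomial_law s (s * p / (1 - p)) (neg_binomial_pmf s p)"
proof -
  let ?m = "neg_binomial_mass s p"
  have "(\<lambda>n. ((1 - p) powr s * s * p) * (pochhammer (s + 1) n / fact n * p ^ n)) sums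
     (((1 - p) powr s * s * p) * (1 - p) powr (- (s + 1)))"
    using assms by (intro sums_mult neg_binomial_series) auto
  moreover have "((1 - p) powr s * s * p) * (1 - p) powr (- (s + 1)) = s * p / (1 - p)"
  proof -
    have "(1 - p) powr s * (1 - p) powr (- (s + 1)) = (1 - p) powr (- 1)"
      by (simp flip: powr_add)
    also have "\<dots> = 1 / (1 - p)" using assms by (simp add: powr_minus divide_inverse)
    finally have "(1 - p) powr s * (1 - p) powr (- (s + 1)) * (s * p) = 1 / (1 - p) * (s * p)" by simp
    thus ?thesis by (simp add: mult_ac)
  qed
  moreover have "((1 - p) powr s * s * p) * (pochhammer (s + 1) n / fact n * p ^ n) = ?m (Suc n) * real (Suc n)" for n
    using assms by (simp add: neg_binomial_mass_pochhammer pochhammer_rec field_simps del: of_nat_Suc)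
  ultimately have "(\<lambda>n. ?m (Suc n) * real (Suc n)) sums (s * p / (1 - p))" by simp
  hence S: "(\<lambda>n. ?m n * real n) sums (s * p / (1 - p))"
    using sums_Suc_iff[of "\<lambda>n. ?m n * real n"] by simp
  hence "summable (\<lambda>n. pmf (neg_binomial_pmf s p) n * norm (real n))"
    by (simp add: pmf_neg_binomial assms sums_iff)
  from pmf_expectation_sums[OF this] S have
    "integrable (measure_pmf (neg_binomial_pmf s p)) real"
    "measure_pmf.expectation (neg_binomial_pmf s p) real = s * p / (1 - p)"
    by (auto simp: pmf_neg_binomial assms dest: sums_unique2)
  thus ?thesis using assms pmf_neg_binomial unfolding neg_binomial_law_def by blast
qed

text \<open>The negative binomial generating function \<open>((1 - p) / (1 - p y)) powr s\<close> on the complex unit disc.\<close>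

definition nb_gf :: "real \<Rightarrow> real \<Rightarrow> complex \<Rightarrow> complex" where
  "nb_gf s p y = exp (complex_of_real s * Ln (complex_of_real (1 - p) / (1 - complex_of_real p * y)))"

lemma neg_binomial_pgf_complex:
  assumes "0 < s" "0 < p" "p < 1" "norm y \<le> 1"
  shows "measure_pmf.expectation (neg_binomial_pmf s p) (\<lambda>n. y ^ n) = nb_gf s p y"
proof -
  have py: "norm (of_real p * y) < 1" using assms by (auto simp: norm_mult intro: le_less_trans[OF mult_left_le])
  have nz: "1 - of_real p * y \<noteq> 0" using one_minus_notin_nonpos(2)[OF py] by simp
  have "(\<lambda>n. of_real ((1 - p) powr s) * (of_real (pochhammer s n / fact n) * (of_real p * y) ^ n))
     sums (of_real ((1 - p) powr s) * (1 - of_real p * y) powr (- of_real s))"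
    by (intro sums_mult neg_binomial_series_complex py)
  hence "(\<lambda>n. pmf (neg_binomial_pmf s p) n *\<^sub>R y ^ n) sums (of_real ((1 - p) powr s) * (1 - of_real p * y) powr (- of_real s))"
    using assms by (simp add: pmf_neg_binomial neg_binomial_mass_pochhammer scaleR_conv_of_real power_mult_distrib mult_ac)
  moreover have "(\<lambda>n. pmf (neg_binomial_pmf s p) n *\<^sub>R y ^ n) sums measure_pmf.expectation (neg_binomial_pmf s p) (\<lambda>n. y ^ n)"
    using assms by (intro pmf_expectation_sums_bounded[where M=1]) (auto simp: norm_power power_le_one)
  ultimately have 1: "measure_pmf.expectation (neg_binomial_pmf s p) (\<lambda>n. y ^ n)
     = of_real ((1 - p) powr s) * (1 - of_real p * y) powr (- of_real s)" by (metis sums_unique2)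
  have L1: "Ln (complex_of_real (1 - p)) = of_real (ln (1 - p))" using assms by (subst Ln_of_real) auto
  have "Ln (of_real (1 - p) / (1 - of_real p * y)) = Ln (of_real (1 - p) * inverse (1 - of_real p * y))"
    by (simp add: divide_inverse)
  also have "\<dots> = of_real (ln (1 - p)) + Ln (inverse (1 - of_real p * y))"
  proof -
    have "Ln (of_real (1 - p) * inverse (1 - of_real p * y)) = Ln (of_real (1 - p)) + Ln (inverse (1 - of_real p * y))"
      using Ln_times_of_real[of "1 - p" "inverse (1 - of_real p * y)"] assms nz L1 by (simp del: of_real_diff)
    thus ?thesis by (simp only: L1)
  qed
  also have "Ln (inverse (1 - of_real p * y)) = - Ln (1 - of_real p * y)"
    using one_minus_notin_nonpos(1)[OF py] by (rule Ln_inverse)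
  finally have "exp (of_real s * Ln (of_real (1 - p) / (1 - of_real p * y)))
     = exp (of_real s * of_real (ln (1 - p))) * exp (- of_real s * Ln (1 - of_real p * y))"
    by (simp add: right_diff_distrib exp_diff exp_minus divide_inverse del: of_real_diff)
  also have "exp (of_real s * of_real (ln (1 - p))) = complex_of_real ((1 - p) powr s)"
    using assms by (simp add: powr_def exp_of_real flip: of_real_mult)
  also have "exp (- of_real s * Ln (1 - of_real p * y)) = (1 - of_real p * y) powr (- of_real s)"
    using nz by (simp add: powr_def)
  finally show ?thesis using 1 by (simp only: nb_gf_def)
qed

text \<open>As \<open>t\<close> tends to infinity the Moebius coordinate tends to \<open>0\<close>, so the law of the chain forgets its starting
point, and \<open>\<alpha>\<close> tends to \<open>(1 - q) powr (a / b)\<close>.\<close>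

lemma pgf_limits:
  assumes b: "0 < b" "b < c" and s: "norm s \<le> 1" and a: "0 < a"
  shows "((\<lambda>t. ric_rho b c 1 s t) \<longlongrightarrow> 1) at_top"
    "((\<lambda>t. ric_alpha a b c 1 s t) \<longlongrightarrow> nb_gf (a / b) (b / c) s) at_top"
proof -
  have D: "ric_data b c 1 s" using b s by (rule ric_data_pgf)
  have "((\<lambda>t. exp (- (c - b) * t)) \<longlongrightarrow> 0) at_top"
    using b by real_asymp
  hence "((\<lambda>t. ric_q b c 1 s * of_real (exp (- (c - b) * t))) \<longlongrightarrow> ric_q b c 1 s * of_real 0) at_top"
    by (intro tendsto_intros)
  hence w: "(ric_w b c 1 s \<longlongrightarrow> 0) at_top"
    by (simp add: ric_w_def[abs_def] exp_of_real[symmetric])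
  have "((\<lambda>t. ric_rho b c 1 s t) \<longlongrightarrow> (1 - 0 * (complex_of_real c / (complex_of_real b * 1))) / (1 - 0)) at_top"
    unfolding ric_rho_def by (intro tendsto_intros w) auto
  thus "((\<lambda>t. ric_rho b c 1 s t) \<longlongrightarrow> 1) at_top" by simp
  have "((\<lambda>t. exp (- a * (1 - 1) * 0 - (a / b) * (Ln (1 - ric_w b c 1 s t) - Ln (1 - ric_q b c 1 s))))
      \<longlongrightarrow> exp (- a * (1 - 1) * 0 - (a / b) * (Ln (1 - 0) - Ln (1 - ric_q b c 1 s)))) at_top"
    by (intro tendsto_intros w) auto
  moreover have "1 - ric_q b c 1 s = complex_of_real (1 - b / c) / (1 - complex_of_real (b / c) * s)"
  proof -
    have "of_real b * s - of_real c \<noteq> 0" "complex_of_real c \<noteq> 0" using D by (auto simp: ric_data_def)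
    thus ?thesis by (auto simp: ric_q_def field_simps)
  qed
  ultimately show "((\<lambda>t. ric_alpha a b c 1 s t) \<longlongrightarrow> nb_gf (a / b) (b / c) s) at_top"
    by (simp add: ric_alpha_def nb_gf_def)
qed

lemma bdi_semigroup_unique:
  assumes "transition_semigroup K" "has_transition_rates K (bdi_rates a b c)"
    and "transition_semigroup K'" "has_transition_rates K' (bdi_rates a b c)"
    and abc: "0 \<le> a" "0 < b" "b < c" and T: "0 \<le> T"
  shows "K T i = K' T i"
  by (rule pmf_eqI_pgf) (use assms in \<open>auto simp: bdi_pgf\<close>)

text \<open>The one-time laws converge to \<open>\<pi>\<close> from every starting point. Hence an invariant law \<open>\<nu>\<close>, being the law at
all times when started from \<open>\<nu>\<close>, equals \<open>\<pi>\<close> by dominated convergence. Conversely \<open>\<pi>\<close> is invariant because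
\<open>K (t + h)\<close> has the same limit as \<open>K t\<close>, while applying \<open>K h\<close> to a law replaces its generating function
\<open>G\<close> by \<open>\<alpha>(h) G(\<rho>(h))\<close>, which is continuous under convergence of \<open>G\<close>.\<close>

theorem bdi_invariant_law_iff:
  assumes K: "transition_semigroup K" "has_transition_rates K (bdi_rates a b c)"
    and abc: "0 < a" "0 < b" "b < c"
  shows "invariant_law K \<nu> \<longleftrightarrow> \<nu> = neg_binomial_pmf (a / b) (b / c)"
proof -
  let ?\<pi> = "neg_binomial_pmf (a / b) (b / c)"
  let ?E = "\<lambda>p s. measure_pmf.expectation p (\<lambda>n. s ^ n :: complex)"
  have p: "0 < a / b" "0 < b / c" "b / c < 1" using abc by auto
  have pgf: "?E (K t i) s = ric_alpha a b c 1 s t * ric_rho b c 1 s t ^ i" if "norm s \<le> 1" "0 \<le> t" for s t i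
    using abc that by (intro bdi_pgf[OF K]) auto
  have lim: "((\<lambda>t. ?E (K t i) s) \<longlongrightarrow> ?E ?\<pi> s) at_top" if s: "norm s \<le> 1" for s i
  proof -
    have "((\<lambda>t. ric_alpha a b c 1 s t * ric_rho b c 1 s t ^ i) \<longlongrightarrow> ?E ?\<pi> s * 1 ^ i) at_top"
      unfolding neg_binomial_pgf_complex[OF p s]
      using pgf_limits[OF abc(2,3) s abc(1)] by (intro tendsto_intros) auto
    moreover have "\<forall>\<^sub>F t in at_top. ric_alpha a b c 1 s t * ric_rho b c 1 s t ^ i = ?E (K t i) s"
      using eventually_ge_at_top[of 0] by eventually_elim (simp add: pgf s)
    ultimately show ?thesis by (simp add: Lim_transform_eventually)
  qed
  have bnd: "norm (s ^ n) \<le> 1" if "norm s \<le> 1" for s :: complex and n using that by (simp add: norm_power power_le_one)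
  have bind: "?E (bind_pmf \<nu> (K t)) s = measure_pmf.expectation \<nu> (\<lambda>i. ?E (K t i) s)" if "norm s \<le> 1" for \<nu> s t
    using bnd[OF that] by (rule expectation_bind_pmf_complex)
  have inv: "bind_pmf ?\<pi> (K h) = ?\<pi>" if h: "0 \<le> h" for h
  proof (rule pmf_eqI_pgf)
    fix x :: real assume x: "0 < x" "x < 1"
    define s where "s = complex_of_real x"
    have s: "norm s \<le> 1" using x by (simp add: s_def)
    define y where "y = ric_rho b c 1 s h"
    have y: "norm y \<le> 1" using pgf_bounds(1)[OF abc(2,3) s h, of a] abc by (simp add: y_def)
    have 1: "((\<lambda>t. ric_alpha a b c 1 s h * ?E (K t 0) y) \<longlongrightarrow> ric_alpha a b c 1 s h * ?E ?\<pi> y) at_top"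
      by (intro tendsto_intros lim y)
    have "ric_alpha a b c 1 s h * ?E (K t 0) y = ?E (K (t + h) 0) s" if "0 \<le> t" for t
    proof -
      have "K (t + h) 0 = bind_pmf (K t 0) (K h)" using K(1) that h by (auto simp: transition_semigroup_def)
      thus ?thesis by (simp add: bind[OF s] pgf[OF s h] y_def)
    qed
    hence "\<forall>\<^sub>F t in at_top. ric_alpha a b c 1 s h * ?E (K t 0) y = ?E (K (t + h) 0) s"
      by (intro eventually_mono[OF eventually_ge_at_top[of 0]]) auto
    from Lim_transform_eventually[OF 1 this]
    have "((\<lambda>t. ?E (K (t + h) 0) s) \<longlongrightarrow> ric_alpha a b c 1 s h * ?E ?\<pi> y) at_top" .
    moreover have "((\<lambda>t. ?E (K (t + h) 0) s) \<longlongrightarrow> ?E ?\<pi> s) at_top"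
      by (rule filterlim_compose[OF lim[OF s]]) real_asymp
    ultimately have "ric_alpha a b c 1 s h * ?E ?\<pi> y = ?E ?\<pi> s"
      by (rule tendsto_unique[OF trivial_limit_at_top_linorder])
    moreover have "?E (bind_pmf ?\<pi> (K h)) s = ric_alpha a b c 1 s h * ?E ?\<pi> y"
      using bind[OF s, of ?\<pi> h] pgf[OF s h] by (simp add: y_def)
    ultimately show "?E (bind_pmf ?\<pi> (K h)) (of_real x) = ?E ?\<pi> (of_real x)"
      by (simp add: s_def)
  qed
  have uniq: "\<nu> = ?\<pi>" if \<nu>: "invariant_law K \<nu>" for \<nu>
  proof (rule pmf_eqI_pgf)
    fix x :: real assume x: "0 < x" "x < 1"
    define s where "s = complex_of_real x"
    have s: "norm s \<le> 1" using x by (simp add: s_def)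
    have "((\<lambda>t. measure_pmf.expectation \<nu> (\<lambda>i. ?E (K t i) s)) \<longlongrightarrow> measure_pmf.expectation \<nu> (\<lambda>i. ?E ?\<pi> s)) at_top"
      by (rule integral_dominated_convergence_at_top[where w="\<lambda>_. 1"])
         (use lim[OF s] norm_expectation_pmf_le(1)[where f="\<lambda>n. s ^ n", OF bnd[OF s]] in \<open>auto intro!: always_eventually\<close>)
    moreover have "\<forall>\<^sub>F t in at_top. measure_pmf.expectation \<nu> (\<lambda>i. ?E (K t i) s) = ?E \<nu> s"
      using eventually_ge_at_top[of 0]
    proof eventually_elim
      case (elim t)
      thus ?case using \<nu> bind[OF s, of \<nu> t] by (simp add: invariant_law_def)
    qed
    ultimately have "((\<lambda>t::real. ?E \<nu> s) \<longlongrightarrow> ?E ?\<pi> s) at_top" by (simp add: Lim_transform_eventually)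
    thus "?E \<nu> (of_real x) = ?E ?\<pi> (of_real x)"
      unfolding s_def by (rule tendsto_unique[OF trivial_limit_at_top_linorder tendsto_const])
  qed
  show ?thesis using inv uniq by (auto simp: invariant_law_def)
qed

section \<open>The Markov property on path space\<close>

abbreviation paths :: "real set \<Rightarrow> (real \<Rightarrow> nat) measure" where
  "paths I \<equiv> Pi\<^sub>M I (\<lambda>_. count_space (UNIV :: nat set))"

text \<open>The state space is countable, so cylinders that prescribe single values generate the product
sigma-algebra, and together with the empty set they are closed under intersection.\<close>

definition cyl :: "real set \<Rightarrow> real set \<Rightarrow> (real \<Rightarrow> nat) \<Rightarrow> (real \<Rightarrow> nat) set" where
  "cyl I J p = {x \<in> space (paths I). \<forall>j\<in>J. x j = p j}"

lemma paths_coord [measurable]: "j \<in> I \<Longrightarrow> (\<lambda>x. x j) \<in> measurable (paths I) (count_space UNIV)"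
  by (rule measurable_component_singleton)

lemma cyl_sets: "finite J \<Longrightarrow> J \<subseteq> I \<Longrightarrow> cyl I J p \<in> sets (paths I)"
  unfolding cyl_def by (intro sets.sets_Collect_finite_All) (auto intro!: measurable_sets_Collect[OF paths_coord, of _ I "\<lambda>x. x = _"])

lemma sets_paths_cyl: "sets (paths I) = sigma_sets (space (paths I)) ({cyl I J p | J p. finite J \<and> J \<subseteq> I} \<union> {{}})"
  (is "_ = sigma_sets ?\<Omega> ?E")
proof
  show "sigma_sets ?\<Omega> ?E \<subseteq> sets (paths I)"
    by (rule sets.sigma_sets_subset) (auto simp: cyl_sets)
  have \<Omega>: "(\<Pi>\<^sub>E i\<in>I. space (count_space (UNIV::nat set))) = ?\<Omega>" by (simp add: space_PiM)
  have "{f \<in> ?\<Omega>. f i \<in> A} \<in> sigma_sets ?\<Omega> ?E" if "i \<in> I" for i and A :: "nat set"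
  proof -
    have "{f \<in> ?\<Omega>. f i \<in> A} = \<Union> ((\<lambda>a. cyl I {i} (\<lambda>_. a)) ` A)" by (auto simp: cyl_def)
    also have "\<dots> \<in> sigma_sets ?\<Omega> ?E"
    proof (rule sigma_sets_UNION)
      show "countable ((\<lambda>a. cyl I {i} (\<lambda>_. a)) ` A)" by auto
      fix b assume "b \<in> (\<lambda>a. cyl I {i} (\<lambda>_. a)) ` A"
      then obtain a where "b = cyl I {i} (\<lambda>_. a)" by auto
      thus "b \<in> sigma_sets ?\<Omega> ?E" using that by (intro sigma_sets.Basic) blast
    qed
    finally show ?thesis .
  qed
  thus "sets (paths I) \<subseteq> sigma_sets ?\<Omega> ?E"
    unfolding sets_PiM_single \<Omega> by (intro sigma_sets_mono) auto
qed

lemma paths_measure_eqI: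
  assumes sets: "sets P = sets (paths I)" "sets Q = sets (paths I)" and fin: "finite_measure P"
    and eq: "\<And>J p. finite J \<Longrightarrow> J \<subseteq> I \<Longrightarrow> emeasure P (cyl I J p) = emeasure Q (cyl I J p)"
  shows "P = Q"
proof (rule measure_eqI_generator_eq[where E="{cyl I J p | J p. finite J \<and> J \<subseteq> I} \<union> {{}}" and \<Omega>="space (paths I)"
      and A="\<lambda>_. cyl I {} (\<lambda>_. 0)"])
  show "Int_stable ({cyl I J p | J p. finite J \<and> J \<subseteq> I} \<union> {{}})"
  proof (rule Int_stableI)
    fix a b assume a: "a \<in> {cyl I J p | J p. finite J \<and> J \<subseteq> I} \<union> {{}}" and b: "b \<in> {cyl I J p | J p. finite J \<and> J \<subseteq> I} \<union> {{}}"
    show "a \<inter> b \<in> {cyl I J p | J p. finite J \<and> J \<subseteq> I} \<union> {{}}"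
    proof (cases "a \<inter> b = {}")
      case False
      then obtain z where z: "z \<in> a" "z \<in> b" by auto
      then obtain J p J' p' where J: "a = cyl I J p" "finite J" "J \<subseteq> I" and J': "b = cyl I J' p'" "finite J'" "J' \<subseteq> I"
        using a b by blast
      have "\<forall>j\<in>J. p j = z j" "\<forall>j\<in>J'. p' j = z j" using z J(1) J'(1) by (auto simp: cyl_def)
      hence "a \<inter> b = cyl I (J \<union> J') z" unfolding J(1) J'(1) by (auto simp: cyl_def)
      moreover have "finite (J \<union> J')" "J \<union> J' \<subseteq> I" using J J' by auto
      ultimately show ?thesis by blast
    qed auto
  qed
  show "emeasure P (cyl I {} (\<lambda>_. 0)) \<noteq> \<infinity>" for i :: nat
    using fin by (simp add: finite_measure.emeasure_finite)
qed (use sets sets_paths_cyl eq in \<open>auto simp: cyl_def\<close>)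

definition visits :: "'w measure \<Rightarrow> (real \<Rightarrow> 'w \<Rightarrow> nat) \<Rightarrow> (real \<times> nat) list \<Rightarrow> 'w set" where
  "visits M X L = {\<omega> \<in> space M. \<forall>(t, x) \<in> set L. X t \<omega> = x}"

text \<open>Probability that the chain visits the states in the list of (time, state) pairs, when it is in
state \<open>i\<close> at time \<open>s\<close>.\<close>

fun chain_weight :: "(real \<Rightarrow> nat \<Rightarrow> nat pmf) \<Rightarrow> nat \<Rightarrow> real \<Rightarrow> (real \<times> nat) list \<Rightarrow> real" where
  "chain_weight K i s [] = 1"
| "chain_weight K i s ((t, x) # L) = pmf (K (t - s) i) x * chain_weight K x t L"

lemma chain_weight_snoc:
  "chain_weight K i s (L @ [(t', x')]) = chain_weight K i s L *
     pmf (K (t' - (if L = [] then s else fst (last L))) (if L = [] then i else snd (last L))) x'"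
proof (induction L arbitrary: i s)
  case (Cons a L) thus ?case by (cases a) (auto simp: mult.assoc)
qed simp

text \<open>The predicate \<open>markov_chain_from\<close> with its existentially quantified semigroup made explicit, so that chains with different
starting points can be required to share one semigroup.\<close>

definition markov_with :: "'w measure \<Rightarrow> (real \<Rightarrow> 'w \<Rightarrow> nat) \<Rightarrow> (real \<Rightarrow> nat \<Rightarrow> nat pmf) \<Rightarrow> nat \<Rightarrow> bool" where
  "markov_with M X K n \<longleftrightarrow>
     prob_space M \<and>
     (\<forall>t\<ge>0. X t \<in> measurable M (count_space UNIV)) \<and>
     (\<forall>\<omega>\<in>space M. cadlag_path (\<lambda>t. X t \<omega>)) \<and>
     (AE \<omega> in M. X 0 \<omega> = n) \<and>
       (\<forall>m (t :: nat \<Rightarrow> real) (x :: nat \<Rightarrow> nat).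
          0 \<le> t 0 \<and> (\<forall>k\<le>m. t k \<le> t (Suc k)) \<longrightarrow>
          measure M {\<omega>\<in>space M. \<forall>k\<le>Suc m. X (t k) \<omega> = x k} =
          measure M {\<omega>\<in>space M. \<forall>k\<le>m. X (t k) \<omega> = x k}
            * pmf (K (t (Suc m) - t m) (x m)) (x (Suc m)))"

lemma measurable_markov: "markov_with M X K n \<Longrightarrow> 0 \<le> t \<Longrightarrow> X t \<in> measurable M (count_space UNIV)"
  by (auto simp: markov_with_def)

lemma markov_ev_snoc:
  assumes M: "markov_with M X K n" and L: "L \<noteq> []" "sorted (map fst L @ [t'])" "\<And>t x. (t, x) \<in> set L \<Longrightarrow> 0 \<le> t"
  shows "measure M (visits M X (L @ [(t', x')])) = measure M (visits M X L) * pmf (K (t' - fst (last L)) (snd (last L))) x'"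
proof -
  define m where "m = length L - 1"
  define L' where "L' = L @ [(t', x')]"
  have len: "length L = Suc m" "length L' = Suc (Suc m)" using L(1) by (auto simp: m_def L'_def)
  \<comment> \<open>The Markov property quantifies over sequences of times, so the list is continued by its last entry.\<close>
  define t x where "t k = fst (L' ! min k (Suc m))" and "x k = snd (L' ! min k (Suc m))" for k
  have srt: "sorted (map fst L')" using L(2) by (simp add: L'_def)
  have mono: "t k \<le> t (Suc k)" if "k \<le> m" for k
    using sorted_nth_mono[OF srt, of k "Suc k"] that len by (simp add: t_def)
  have "0 \<le> t 0" using L(3)[of "fst (L ! 0)" "snd (L ! 0)"] len
    by (simp add: t_def L'_def nth_append)
  hence "measure M {\<omega>\<in>space M. \<forall>k\<le>Suc m. X (t k) \<omega> = x k} =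
          measure M {\<omega>\<in>space M. \<forall>k\<le>m. X (t k) \<omega> = x k}
            * pmf (K (t (Suc m) - t m) (x m)) (x (Suc m))"
    using M mono unfolding markov_with_def by blast
  moreover have "{\<omega>\<in>space M. \<forall>k\<le>Suc m. X (t k) \<omega> = x k} = visits M X L'"
  proof -
    have "(\<forall>(s, y)\<in>set L'. X s \<omega> = y) \<longleftrightarrow> (\<forall>k\<le>Suc m. X (t k) \<omega> = x k)" for \<omega>
      unfolding all_set_conv_all_nth len by (auto simp: t_def x_def case_prod_beta less_Suc_eq_le)
    thus ?thesis by (auto simp: visits_def)
  qed
  moreover have "{\<omega>\<in>space M. \<forall>k\<le>m. X (t k) \<omega> = x k} = visits M X L"
  proof -
    have "(\<forall>(s, y)\<in>set L. X s \<omega> = y) \<longleftrightarrow> (\<forall>k\<le>m. X (t k) \<omega> = x k)" for \<omega>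
      unfolding all_set_conv_all_nth len by (auto simp: t_def x_def case_prod_beta less_Suc_eq_le L'_def nth_append len)
    thus ?thesis by (auto simp: visits_def)
  qed
  moreover have "t (Suc m) = t'" "x (Suc m) = x'" "t m = fst (last L)" "x m = snd (last L)"
    using L(1) len by (auto simp: t_def x_def L'_def nth_append last_conv_nth)
  ultimately show ?thesis by (simp add: L'_def)
qed

lemma markov_ev_append:
  assumes M: "markov_with M X K n" and L: "sorted (map fst (L @ [(S, m)]))" "\<And>t x. (t, x) \<in> set L \<Longrightarrow> 0 \<le> t" "0 \<le> S"
    and L1: "sorted (map fst L1)" "\<And>t x. (t, x) \<in> set L1 \<Longrightarrow> 0 \<le> t"
  shows "measure M (visits M X (L @ [(S, m)] @ map (\<lambda>(t, x). (S + t, x)) L1)) = measure M (visits M X (L @ [(S, m)])) * chain_weight K m 0 L1"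
  using L1
proof (induction L1 rule: rev_induct)
  case (snoc a L1)
  obtain t x where a: "a = (t, x)" by (cases a)
  define L2 where "L2 = L @ [(S, m)] @ map (\<lambda>(t, x). (S + t, x)) L1"
  have nn: "0 \<le> u" if "(u, v) \<in> set L1" for u v using snoc.prems(2)[of u v] that by (simp add: a)
  have LS: "u \<le> S + u'" if "(u, v) \<in> set L" "(u', v') \<in> set L1" for u v u' v'
  proof -
    have "u \<le> S" using L(1) that(1) by (force simp: sorted_append)
    thus ?thesis using nn[OF that(2)] by simp
  qed
  have LS': "u \<le> S + t" if "(u, v) \<in> set L" for u v
  proof -
    have "u \<le> S" using L(1) that(1) by (force simp: sorted_append)
    thus ?thesis using snoc.prems(2)[of t x] a by simp
  qed
  have srt: "sorted (map fst L2 @ [S + t])"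
    using L(1) snoc.prems unfolding L2_def a
    by (auto simp: sorted_append comp_def case_prod_beta sorted_map intro: nn LS LS')
  have "measure M (visits M X (L2 @ [(S + t, x)])) = measure M (visits M X L2) * pmf (K (S + t - fst (last L2)) (snd (last L2))) x"
    by (rule markov_ev_snoc[OF M _ srt])
       (use L snoc.prems in \<open>auto simp: L2_def intro!: add_nonneg_nonneg\<close>)
  also have "measure M (visits M X L2) = measure M (visits M X (L @ [(S, m)])) * chain_weight K m 0 L1"
    unfolding L2_def using snoc.prems by (intro snoc.IH) (auto simp: sorted_append)
  also have "pmf (K (S + t - fst (last L2)) (snd (last L2))) x =
      pmf (K (t - (if L1 = [] then 0 else fst (last L1))) (if L1 = [] then m else snd (last L1))) x"
    by (auto simp: L2_def last_map case_prod_beta)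
  finally show ?case by (simp add: a L2_def chain_weight_snoc mult.assoc)
qed simp

definition graph_list :: "real set \<Rightarrow> (real \<Rightarrow> nat) \<Rightarrow> (real \<times> nat) list" where
  "graph_list J p = map (\<lambda>t. (t, p t)) (sorted_list_of_set J)"

lemma graph_list: "finite J \<Longrightarrow> set (graph_list J p) = (\<lambda>t. (t, p t)) ` J" "sorted (map fst (graph_list J p))" "map fst (graph_list J p) = sorted_list_of_set J"
  by (auto simp: graph_list_def o_def)

lemma markov_past_future:
  assumes M: "markov_with M X K n" and S: "0 \<le> S"
    and J: "finite J" "J \<subseteq> {0..S}" and J1: "finite J1" "J1 \<subseteq> {0..}"
  shows "measure M {\<omega> \<in> space M. (\<forall>j\<in>J. X j \<omega> = p j) \<and> X S \<omega> = m \<and> (\<forall>j\<in>J1. X (S + j) \<omega> = p1 j)} =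
     measure M {\<omega> \<in> space M. (\<forall>j\<in>J. X j \<omega> = p j) \<and> X S \<omega> = m} * chain_weight K m 0 (graph_list J1 p1)"
proof -
  have "measure M (visits M X (graph_list J p @ [(S, m)] @ map (\<lambda>(t, x). (S + t, x)) (graph_list J1 p1))) =
     measure M (visits M X (graph_list J p @ [(S, m)])) * chain_weight K m 0 (graph_list J1 p1)"
    by (rule markov_ev_append[OF M _ _ S]) (use J J1 in \<open>auto simp: graph_list sorted_append\<close>)
  moreover have "visits M X (graph_list J p @ [(S, m)] @ map (\<lambda>(t, x). (S + t, x)) (graph_list J1 p1)) =
    {\<omega> \<in> space M. (\<forall>j\<in>J. X j \<omega> = p j) \<and> X S \<omega> = m \<and> (\<forall>j\<in>J1. X (S + j) \<omega> = p1 j)}"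
    using J J1 unfolding visits_def by (auto simp: graph_list image_Un ball_Un image_image)
  moreover have "visits M X (graph_list J p @ [(S, m)]) = {\<omega> \<in> space M. (\<forall>j\<in>J. X j \<omega> = p j) \<and> X S \<omega> = m}"
    using J by (auto simp: visits_def graph_list)
  ultimately show ?thesis by simp
qed

lemma markov_start:
  assumes M: "markov_with M X K n" and J: "finite J" "J \<subseteq> {0..}"
  shows "measure M {\<omega> \<in> space M. \<forall>j\<in>J. X j \<omega> = p j} = chain_weight K n 0 (graph_list J p)"
proof -
  interpret prob_space M using M by (simp add: markov_with_def)
  have [measurable]: "X t \<in> measurable M (count_space UNIV)" if "0 \<le> t" for t using measurable_markov[OF M that] .
  have AE: "AE \<omega> in M. X 0 \<omega> = n" using M by (simp add: markov_with_def)
  have fin: "{\<omega> \<in> space M. \<forall>j\<in>J. X j \<omega> = p j} \<in> sets M"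
    using J by (intro sets.sets_Collect_finite_All) auto
  have "measure M {\<omega> \<in> space M. (\<forall>j\<in>{}. X j \<omega> = p j) \<and> X 0 \<omega> = n \<and> (\<forall>j\<in>J. X (0 + j) \<omega> = p j)} =
     measure M {\<omega> \<in> space M. (\<forall>j\<in>{}. X j \<omega> = p j) \<and> X 0 \<omega> = n} * chain_weight K n 0 (graph_list J p)"
    by (rule markov_past_future[OF M]) (use J in auto)
  moreover have "measure M {\<omega> \<in> space M. (\<forall>j\<in>{}. X j \<omega> = p j) \<and> X 0 \<omega> = n} = 1"
    using AE by (simp add: prob_Collect_eq_1)
  moreover have "measure M {\<omega> \<in> space M. (\<forall>j\<in>{}. X j \<omega> = p j) \<and> X 0 \<omega> = n \<and> (\<forall>j\<in>J. X (0 + j) \<omega> = p j)}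
     = measure M {\<omega> \<in> space M. \<forall>j\<in>J. X j \<omega> = p j}"
  proof (rule measure_eq_AE)
    show "{\<omega> \<in> space M. (\<forall>j\<in>{}. X j \<omega> = p j) \<and> X 0 \<omega> = n \<and> (\<forall>j\<in>J. X (0 + j) \<omega> = p j)} \<in> sets M"
    proof -
      have "{\<omega> \<in> space M. (\<forall>j\<in>{}. X j \<omega> = p j) \<and> X 0 \<omega> = n \<and> (\<forall>j\<in>J. X (0 + j) \<omega> = p j)} =
         {\<omega> \<in> space M. X 0 \<omega> = n} \<inter> {\<omega> \<in> space M. \<forall>j\<in>J. X j \<omega> = p j}" by auto
      thus ?thesis using fin by simp
    qed
  qed (use AE fin in auto)
  ultimately show ?thesis by simp
qed

definition pth :: "real set \<Rightarrow> (real \<Rightarrow> 'w \<Rightarrow> nat) \<Rightarrow> 'w \<Rightarrow> (real \<Rightarrow> nat)" where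
  "pth I X \<omega> = restrict (\<lambda>t. X t \<omega>) I"

lemma pth_measurable:
  assumes "\<And>t. t \<in> I \<Longrightarrow> X t \<in> measurable M (count_space UNIV)"
  shows "pth I X \<in> measurable M (paths I)"
  unfolding pth_def[abs_def] by (rule measurable_restrict) (use assms in auto)

lemma pth_in_cyl: "J \<subseteq> I \<Longrightarrow> pth I X \<omega> \<in> cyl I J p \<longleftrightarrow> (\<forall>j\<in>J. X j \<omega> = p j)"
  by (auto simp: cyl_def pth_def space_PiM)

abbreviation shiftp :: "real \<Rightarrow> (real \<Rightarrow> 'w \<Rightarrow> nat) \<Rightarrow> real \<Rightarrow> 'w \<Rightarrow> nat" where
  "shiftp S X \<equiv> \<lambda>t. X (S + t)"

text \<open>Two uses of the uniqueness of measures on paths: first in the future event, for a cylinder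
past, then in the past event, for an arbitrary future.\<close>

theorem markov_rectangle:
  assumes M: "markov_with M X K n" and M': "markov_with M' X' K m" and S: "0 \<le> S"
    and A: "A \<in> sets (paths {0..S})" and C: "C \<in> sets (paths {0..})"
  shows "emeasure M {\<omega> \<in> space M. pth {0..S} X \<omega> \<in> A \<and> X S \<omega> = m \<and> pth {0..} (shiftp S X) \<omega> \<in> C} =
     emeasure M {\<omega> \<in> space M. pth {0..S} X \<omega> \<in> A \<and> X S \<omega> = m} * emeasure M' {\<omega> \<in> space M'. pth {0..} X' \<omega> \<in> C}"
proof -
  interpret prob_space M using M by (simp add: markov_with_def)
  interpret M': prob_space M' using M' by (simp add: markov_with_def)
  have mX: "X t \<in> measurable M (count_space UNIV)" if "0 \<le> t" for t using measurable_markov[OF M that] .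
  have mX': "X' t \<in> measurable M' (count_space UNIV)" if "0 \<le> t" for t using measurable_markov[OF M' that] .
  have [measurable]: "pth {0..S} X \<in> measurable M (paths {0..S})" by (rule pth_measurable) (auto intro: mX)
  have [measurable]: "pth {0..} (shiftp S X) \<in> measurable M (paths {0..})" by (rule pth_measurable) (use S in \<open>auto intro: mX\<close>)
  have [measurable]: "pth {0..} X' \<in> measurable M' (paths {0..})" by (rule pth_measurable) (auto intro: mX')
  have [measurable]: "X S \<in> measurable M (count_space UNIV)" by (rule mX[OF S])
  let ?past = "pth {0..S} X" and ?fut = "pth {0..} (shiftp S X)"
  have step1: "emeasure M {\<omega> \<in> space M. ?past \<omega> \<in> cyl {0..S} J p \<and> X S \<omega> = m \<and> ?fut \<omega> \<in> C} =
     emeasure M {\<omega> \<in> space M. ?past \<omega> \<in> cyl {0..S} J p \<and> X S \<omega> = m} * emeasure M' {\<omega> \<in> space M'. pth {0..} X' \<omega> \<in> C}"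
    if J: "finite J" "J \<subseteq> {0..S}" and C: "C \<in> sets (paths {0..})" for J p C
  proof -
    have [measurable]: "cyl {0..S} J p \<in> sets (paths {0..S})" using J by (rule cyl_sets)
    define B where "B = {\<omega> \<in> space M. ?past \<omega> \<in> cyl {0..S} J p \<and> X S \<omega> = m}"
    have [measurable]: "B \<in> sets M" unfolding B_def by measurable
    define P Q where "P = distr (density M (indicator B)) (paths {0..}) ?fut"
      and "Q = scale_measure (emeasure M B) (distr M' (paths {0..}) (pth {0..} X'))"
    have P: "emeasure P D = emeasure M {\<omega> \<in> space M. ?past \<omega> \<in> cyl {0..S} J p \<and> X S \<omega> = m \<and> ?fut \<omega> \<in> D}"
      if "D \<in> sets (paths {0..})" for D
      using that by (simp add: P_def emeasure_distr emeasure_restricted)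
        (auto intro!: arg_cong[where f="emeasure M"] simp: B_def)
    have Q: "emeasure Q D = emeasure M B * emeasure M' {\<omega> \<in> space M'. pth {0..} X' \<omega> \<in> D}"
      if "D \<in> sets (paths {0..})" for D
      using that by (simp add: Q_def emeasure_distr vimage_def Int_def conj_commute)
    have "P = Q"
    proof (rule paths_measure_eqI)
      show "sets P = sets (paths {0..})" "sets Q = sets (paths {0..})" by (auto simp: P_def Q_def)
      show "finite_measure P"
      proof
        have "emeasure P (space P) = emeasure M {\<omega> \<in> space M. ?past \<omega> \<in> cyl {0..S} J p \<and> X S \<omega> = m \<and> ?fut \<omega> \<in> space P}"
          by (rule P) (auto simp: P_def)
        thus "emeasure P (space P) \<noteq> \<infinity>" by simp
      qed
      fix J1 :: "real set" and p1 :: "real \<Rightarrow> nat" assume J1: "finite J1" "J1 \<subseteq> {0..}"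
      have c: "cyl {0..} J1 p1 \<in> sets (paths {0..})" using J1 by (rule cyl_sets)
      have "measure M {\<omega> \<in> space M. ?past \<omega> \<in> cyl {0..S} J p \<and> X S \<omega> = m \<and> ?fut \<omega> \<in> cyl {0..} J1 p1} =
        measure M B * measure M' {\<omega> \<in> space M'. pth {0..} X' \<omega> \<in> cyl {0..} J1 p1}"
        unfolding B_def pth_in_cyl[OF J(2)] pth_in_cyl[OF J1(2)]
        by (simp only: markov_past_future[OF M S J J1] markov_start[OF M' J1])
      thus "emeasure P (cyl {0..} J1 p1) = emeasure Q (cyl {0..} J1 p1)"
        unfolding P[OF c] Q[OF c] by (simp add: emeasure_eq_measure M'.emeasure_eq_measure ennreal_mult)
    qed
    hence "emeasure P C = emeasure Q C" by simp
    thus ?thesis unfolding P[OF C] Q[OF C] by (simp add: B_def)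
  qed
  define B where "B = {\<omega> \<in> space M. X S \<omega> = m \<and> ?fut \<omega> \<in> C}"
  define B' where "B' = {\<omega> \<in> space M. X S \<omega> = m}"
  note C[measurable]
  have [measurable]: "B \<in> sets M" "B' \<in> sets M" unfolding B_def B'_def by measurable
  define P Q where "P = distr (density M (indicator B)) (paths {0..S}) ?past"
    and "Q = scale_measure (emeasure M' {\<omega> \<in> space M'. pth {0..} X' \<omega> \<in> C}) (distr (density M (indicator B')) (paths {0..S}) ?past)"
  have P: "emeasure P D = emeasure M {\<omega> \<in> space M. ?past \<omega> \<in> D \<and> X S \<omega> = m \<and> ?fut \<omega> \<in> C}"
    if "D \<in> sets (paths {0..S})" for D
    using that by (simp add: P_def emeasure_distr emeasure_restricted)
      (auto intro!: arg_cong[where f="emeasure M"] simp: B_def)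
  have "{\<omega> \<in> space M. X S \<omega> = m} \<inter> (?past -` D \<inter> space M) = {\<omega> \<in> space M. ?past \<omega> \<in> D \<and> X S \<omega> = m}" for D by auto
  hence Q: "emeasure Q D = emeasure M' {\<omega> \<in> space M'. pth {0..} X' \<omega> \<in> C} * emeasure M {\<omega> \<in> space M. ?past \<omega> \<in> D \<and> X S \<omega> = m}"
    if "D \<in> sets (paths {0..S})" for D
    using that by (simp add: Q_def emeasure_distr emeasure_restricted B'_def)
  have "P = Q"
  proof (rule paths_measure_eqI)
    show "sets P = sets (paths {0..S})" "sets Q = sets (paths {0..S})" by (auto simp: P_def Q_def)
    show "finite_measure P"
    proof
      have "emeasure P (space P) = emeasure M {\<omega> \<in> space M. ?past \<omega> \<in> space P \<and> X S \<omega> = m \<and> ?fut \<omega> \<in> C}"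
        by (rule P) (auto simp: P_def)
      thus "emeasure P (space P) \<noteq> \<infinity>" by simp
    qed
    fix J :: "real set" and p :: "real \<Rightarrow> nat" assume J: "finite J" "J \<subseteq> {0..S}"
    show "emeasure P (cyl {0..S} J p) = emeasure Q (cyl {0..S} J p)"
      unfolding P[OF cyl_sets[OF J]] Q[OF cyl_sets[OF J]] step1[OF J C] by (rule mult.commute)
  qed
  hence "emeasure P A = emeasure Q A" by simp
  thus ?thesis unfolding P[OF A] Q[OF A] by (simp add: mult.commute)
qed

text \<open>Conditional independence of past and future given \<open>X S = m\<close>, passed from rectangles to the product
sigma-algebra.\<close>

lemma markov_product:
  assumes M: "markov_with M X K n" and M': "markov_with M' X' K m" and S: "0 \<le> S"
  defines "D \<equiv> density M (indicator {\<omega> \<in> space M. X S \<omega> = m})"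
  shows "distr D (paths {0..S} \<Otimes>\<^sub>M paths {0..}) (\<lambda>\<omega>. (pth {0..S} X \<omega>, pth {0..} (shiftp S X) \<omega>)) =
    distr D (paths {0..S}) (pth {0..S} X) \<Otimes>\<^sub>M distr M' (paths {0..}) (pth {0..} X')"
proof (rule pair_measure_eqI[symmetric])
  interpret prob_space M using M by (simp add: markov_with_def)
  interpret M': prob_space M' using M' by (simp add: markov_with_def)
  have mX: "X t \<in> measurable M (count_space UNIV)" if "0 \<le> t" for t using measurable_markov[OF M that] .
  have mX': "X' t \<in> measurable M' (count_space UNIV)" if "0 \<le> t" for t using measurable_markov[OF M' that] .
  have [measurable]: "pth {0..S} X \<in> measurable M (paths {0..S})" by (rule pth_measurable) (auto intro: mX)
  have [measurable]: "pth {0..} (shiftp S X) \<in> measurable M (paths {0..})" by (rule pth_measurable) (use S in \<open>auto intro: mX\<close>)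
  have p': "pth {0..} X' \<in> measurable M' (paths {0..})" by (rule pth_measurable) (auto intro: mX')
  have [measurable]: "X S \<in> measurable M (count_space UNIV)" by (rule mX[OF S])
  define B where "B = {\<omega> \<in> space M. X S \<omega> = m}"
  have B[measurable]: "B \<in> sets M" unfolding B_def by measurable
  have D: "D = density M (indicator B)" by (simp add: D_def B_def)
  have finD: "finite_measure D"
    by (rule finite_measureI) (simp add: D emeasure_restricted)
  show "sigma_finite_measure (distr D (paths {0..S}) (pth {0..S} X))"
    by (rule finite_measure.axioms(1), rule finite_measure.finite_measure_distr[OF finD]) (simp add: D)
  show "sigma_finite_measure (distr M' (paths {0..}) (pth {0..} X'))"
    by (rule finite_measure.axioms(1), rule M'.finite_measure_distr[OF p'])
  show "sets (distr D (paths {0..S}) (pth {0..S} X) \<Otimes>\<^sub>M distr M' (paths {0..}) (pth {0..} X')) =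
     sets (distr D (paths {0..S} \<Otimes>\<^sub>M paths {0..}) (\<lambda>\<omega>. (pth {0..S} X \<omega>, pth {0..} (shiftp S X) \<omega>)))"
    by (simp cong: sets_pair_measure_cong)
  fix A C assume "A \<in> sets (distr D (paths {0..S}) (pth {0..S} X))" "C \<in> sets (distr M' (paths {0..}) (pth {0..} X'))"
  hence A[measurable]: "A \<in> sets (paths {0..S})" and C[measurable]: "C \<in> sets (paths {0..})" by auto
  have "emeasure (distr D (paths {0..S}) (pth {0..S} X)) A = emeasure M {\<omega> \<in> space M. pth {0..S} X \<omega> \<in> A \<and> X S \<omega> = m}"
    by (simp add: D emeasure_distr emeasure_restricted)
      (auto intro!: arg_cong[where f="emeasure M"] simp: B_def)
  moreover have "emeasure (distr M' (paths {0..}) (pth {0..} X')) C = emeasure M' {\<omega> \<in> space M'. pth {0..} X' \<omega> \<in> C}"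
    using p' by (simp add: emeasure_distr vimage_def Int_def conj_commute)
  moreover have "emeasure (distr D (paths {0..S} \<Otimes>\<^sub>M paths {0..}) (\<lambda>\<omega>. (pth {0..S} X \<omega>, pth {0..} (shiftp S X) \<omega>))) (A \<times> C) =
    emeasure M {\<omega> \<in> space M. pth {0..S} X \<omega> \<in> A \<and> X S \<omega> = m \<and> pth {0..} (shiftp S X) \<omega> \<in> C}"
    by (simp add: D emeasure_distr emeasure_restricted)
      (auto intro!: arg_cong[where f="emeasure M"] simp: B_def)
  ultimately show "emeasure (distr D (paths {0..S}) (pth {0..S} X)) A * emeasure (distr M' (paths {0..}) (pth {0..} X')) C =
     emeasure (distr D (paths {0..S} \<Otimes>\<^sub>M paths {0..}) (\<lambda>\<omega>. (pth {0..S} X \<omega>, pth {0..} (shiftp S X) \<omega>))) (A \<times> C)"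
    using markov_rectangle[OF M M' S A C] by simp
qed

text \<open>The form of the Markov property used for functionals that couple past and future: sum the product
formula over the countably many values of \<open>X S\<close>.\<close>

theorem markov_fubini:
  fixes Pr :: "nat \<Rightarrow> 'v measure"
  assumes M: "markov_with M X K n" and M': "\<And>m. markov_with (Pr m) X' K m" and S: "0 \<le> S"
    and H: "case_prod H \<in> borel_measurable (paths {0..S} \<Otimes>\<^sub>M paths {0..})"
  shows "(\<integral>\<^sup>+\<omega>. H (pth {0..S} X \<omega>) (pth {0..} (shiftp S X) \<omega>) \<partial>M) =
     (\<integral>\<^sup>+\<omega>. (\<integral>\<^sup>+\<omega>'. H (pth {0..S} X \<omega>) (pth {0..} X' \<omega>') \<partial>Pr (X S \<omega>)) \<partial>M)"
    and "(\<lambda>\<omega>. \<integral>\<^sup>+\<omega>'. H (pth {0..S} X \<omega>) (pth {0..} X' \<omega>') \<partial>Pr (X S \<omega>)) \<in> borel_measurable M"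
proof -
  interpret prob_space M using M by (simp add: markov_with_def)
  have mX: "X t \<in> measurable M (count_space UNIV)" if "0 \<le> t" for t using measurable_markov[OF M that] .
  have [measurable]: "pth {0..S} X \<in> measurable M (paths {0..S})" by (rule pth_measurable) (auto intro: mX)
  have [measurable]: "pth {0..} (shiftp S X) \<in> measurable M (paths {0..})" by (rule pth_measurable) (use S in \<open>auto intro: mX\<close>)
  have [measurable]: "X S \<in> measurable M (count_space UNIV)" by (rule mX[OF S])
  note H[measurable]
  have p': "pth {0..} X' \<in> measurable (Pr m) (paths {0..})" for m
    by (rule pth_measurable) (auto intro: measurable_markov[OF M'])
  define L where "L m = distr (Pr m) (paths {0..}) (pth {0..} X')" for m
  have sL[measurable_cong]: "sets (L m) = sets (paths {0..})" for m by (simp add: L_def)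
  have sfL: "sigma_finite_measure (L m)" for m
  proof -
    interpret M': prob_space "Pr m" using M'[of m] by (simp add: markov_with_def)
    show ?thesis unfolding L_def by (rule finite_measure.axioms(1), rule M'.finite_measure_distr[OF p'])
  qed
  have inner: "(\<integral>\<^sup>+\<omega>'. H x (pth {0..} X' \<omega>') \<partial>Pr m) = (\<integral>\<^sup>+y. H x y \<partial>L m)" if "x \<in> space (paths {0..S})" for x m
    unfolding L_def using that by (subst nn_integral_distr[OF p']) auto
  have pin: "pth {0..S} X \<omega> \<in> space (paths {0..S})" for \<omega> by (auto simp: pth_def space_PiM)
  define g where "g m x = (\<integral>\<^sup>+y. H x y \<partial>L m)" for m x
  have gm[measurable]: "g m \<in> borel_measurable (paths {0..S})" for m
    unfolding g_def using sfL by (intro sigma_finite_measure.borel_measurable_nn_integral) auto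
  have RHS: "(\<integral>\<^sup>+\<omega>'. H (pth {0..S} X \<omega>) (pth {0..} X' \<omega>') \<partial>Pr (X S \<omega>)) = g (X S \<omega>) (pth {0..S} X \<omega>)" for \<omega>
    unfolding g_def by (rule inner[OF pin])
  have gX[measurable]: "(\<lambda>\<omega>. g (X S \<omega>) (pth {0..S} X \<omega>)) \<in> borel_measurable M"
    by (rule measurable_compose_countable[where f="\<lambda>m \<omega>. g m (pth {0..S} X \<omega>)"]) measurable
  thus "(\<lambda>\<omega>. \<integral>\<^sup>+\<omega>'. H (pth {0..S} X \<omega>) (pth {0..} X' \<omega>') \<partial>Pr (X S \<omega>)) \<in> borel_measurable M"
    by (simp only: RHS)
  let ?I = "\<lambda>m. indicator {\<omega> \<in> space M. X S \<omega> = m} :: _ \<Rightarrow> ennreal"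
  have split: "(\<integral>\<^sup>+\<omega>. f \<omega> \<partial>M) = (\<Sum>m. \<integral>\<^sup>+\<omega>. ?I m \<omega> * f \<omega> \<partial>M)" if [measurable]: "f \<in> borel_measurable M" for f
  proof -
    have "(\<integral>\<^sup>+\<omega>. f \<omega> \<partial>M) = (\<integral>\<^sup>+\<omega>. (\<Sum>m. ?I m \<omega> * f \<omega>) \<partial>M)"
    proof (rule nn_integral_cong)
      fix \<omega> assume "\<omega> \<in> space M"
      hence "(\<lambda>m. ?I m \<omega> * f \<omega>) = (\<lambda>m. if m = X S \<omega> then f \<omega> else 0)" by (auto simp: indicator_def)
      moreover have "(\<lambda>m. if m = X S \<omega> then f \<omega> else 0) sums f \<omega>" by (rule sums_single)
      ultimately show "f \<omega> = (\<Sum>m. ?I m \<omega> * f \<omega>)" by (simp add: sums_iff)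
    qed
    also have "\<dots> = (\<Sum>m. \<integral>\<^sup>+\<omega>. ?I m \<omega> * f \<omega> \<partial>M)" by (rule nn_integral_suminf) measurable
    finally show ?thesis .
  qed
  have "(\<integral>\<^sup>+\<omega>. ?I m \<omega> * H (pth {0..S} X \<omega>) (pth {0..} (shiftp S X) \<omega>) \<partial>M) = (\<integral>\<^sup>+\<omega>. ?I m \<omega> * g (X S \<omega>) (pth {0..S} X \<omega>) \<partial>M)" for m
  proof -
    define D where "D = density M (?I m)"
    have sD[measurable_cong]: "sets D = sets M" by (simp add: D_def)
    have "(\<integral>\<^sup>+\<omega>. ?I m \<omega> * H (pth {0..S} X \<omega>) (pth {0..} (shiftp S X) \<omega>) \<partial>M) = (\<integral>\<^sup>+\<omega>. H (pth {0..S} X \<omega>) (pth {0..} (shiftp S X) \<omega>) \<partial>D)"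
      unfolding D_def by (subst nn_integral_density) auto
    also have "\<dots> = (\<integral>\<^sup>+z. case_prod H z \<partial>distr D (paths {0..S} \<Otimes>\<^sub>M paths {0..}) (\<lambda>\<omega>. (pth {0..S} X \<omega>, pth {0..} (shiftp S X) \<omega>)))"
      by (subst nn_integral_distr) auto
    also have "\<dots> = (\<integral>\<^sup>+z. case_prod H z \<partial>(distr D (paths {0..S}) (pth {0..S} X) \<Otimes>\<^sub>M L m))"
      unfolding L_def D_def by (simp only: markov_product[OF M M' S])
    also have "\<dots> = (\<integral>\<^sup>+x. g m x \<partial>distr D (paths {0..S}) (pth {0..S} X))"
      unfolding g_def by (subst sigma_finite_measure.nn_integral_fst[OF sfL, symmetric]) auto
    also have "\<dots> = (\<integral>\<^sup>+\<omega>. g m (pth {0..S} X \<omega>) \<partial>D)" by (rule nn_integral_distr) auto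
    also have "\<dots> = (\<integral>\<^sup>+\<omega>. ?I m \<omega> * g m (pth {0..S} X \<omega>) \<partial>M)"
      unfolding D_def by (subst nn_integral_density) auto
    also have "\<dots> = (\<integral>\<^sup>+\<omega>. ?I m \<omega> * g (X S \<omega>) (pth {0..S} X \<omega>) \<partial>M)"
      by (rule nn_integral_cong) (auto simp: indicator_def)
    finally show ?thesis .
  qed
  thus "(\<integral>\<^sup>+\<omega>. H (pth {0..S} X \<omega>) (pth {0..} (shiftp S X) \<omega>) \<partial>M) =
     (\<integral>\<^sup>+\<omega>. (\<integral>\<^sup>+\<omega>'. H (pth {0..S} X \<omega>) (pth {0..} X' \<omega>') \<partial>Pr (X S \<omega>)) \<partial>M)"
    unfolding RHS by (subst (1 2) split) auto
qed

lemma markov_distr: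
  assumes M: "markov_with M X K n" and t: "0 \<le> t"
  shows "distr M (count_space UNIV) (X t) = measure_pmf (K t n)"
proof (rule measure_eqI_countable[where A=UNIV])
  interpret prob_space M using M by (simp add: markov_with_def)
  note mX = measurable_markov[OF M t]
  fix x :: nat
  have "emeasure (distr M (count_space UNIV) (X t)) {x} = emeasure M {\<omega> \<in> space M. \<forall>j\<in>{t}. X j \<omega> = x}"
    using mX by (simp add: emeasure_distr vimage_def Int_def conj_commute)
  also have "\<dots> = ennreal (chain_weight K n 0 (graph_list {t} (\<lambda>_. x)))"
    unfolding emeasure_eq_measure using t by (subst markov_start[OF M]) auto
  also have "\<dots> = emeasure (measure_pmf (K t n)) {x}" by (simp add: graph_list_def emeasure_pmf_single)
  finally show "emeasure (distr M (count_space UNIV) (X t)) {x} = emeasure (measure_pmf (K t n)) {x}" .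
qed auto

lemma markov_shift_law:
  assumes M: "markov_with M X K n" and M': "\<And>m. markov_with (Pr m) X' K m" and S: "0 \<le> S"
  shows "distr M (paths {0..}) (pth {0..} (shiftp S X)) =
     measure_pmf (K S n) \<bind> (\<lambda>m. distr (Pr m) (paths {0..}) (pth {0..} X'))"
    and "(\<lambda>m. distr (Pr m) (paths {0..}) (pth {0..} X')) \<in> measurable (measure_pmf (K S n)) (subprob_algebra (paths {0..}))"
proof -
  have p: "pth {0..} (shiftp S X) \<in> measurable M (paths {0..})"
    by (rule pth_measurable) (use S in \<open>auto intro: measurable_markov[OF M]\<close>)
  have p': "pth {0..} X' \<in> measurable (Pr m) (paths {0..})" for m
    by (rule pth_measurable) (auto intro: measurable_markov[OF M'])
  let ?L = "\<lambda>m. distr (Pr m) (paths {0..}) (pth {0..} X')"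
  show k: "?L \<in> measurable (measure_pmf (K S n)) (subprob_algebra (paths {0..}))"
  proof -
    have "?L m \<in> space (subprob_algebra (paths {0..}))" for m
    proof -
      interpret M': prob_space "Pr m" using M'[of m] by (simp add: markov_with_def)
      show ?thesis using M'.prob_space_distr[OF p'] by (auto simp: space_subprob_algebra intro: prob_space_imp_subprob_space)
    qed
    thus ?thesis by auto
  qed
  show "distr M (paths {0..}) (pth {0..} (shiftp S X)) = measure_pmf (K S n) \<bind> ?L"
  proof (rule measure_eqI)
    show "sets (distr M (paths {0..}) (pth {0..} (shiftp S X))) = sets (measure_pmf (K S n) \<bind> ?L)"
      by (subst sets_bind[where N="paths {0..}"]) auto
    fix C assume "C \<in> sets (distr M (paths {0..}) (pth {0..} (shiftp S X)))"
    hence C[measurable]: "C \<in> sets (paths {0..})" by simp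
    have "emeasure (distr M (paths {0..}) (pth {0..} (shiftp S X))) C = (\<integral>\<^sup>+\<omega>. indicator C (pth {0..} (shiftp S X) \<omega>) \<partial>M)"
      by (simp only: nn_integral_indicator[symmetric] nn_integral_distr[OF p] C sets_distr borel_measurable_indicator)
    also have "\<dots> = (\<integral>\<^sup>+\<omega>. (\<integral>\<^sup>+\<omega>'. indicator C (pth {0..} X' \<omega>') \<partial>Pr (X S \<omega>)) \<partial>M)"
      by (rule markov_fubini(1)[OF M M' S]) measurable
    also have "\<dots> = (\<integral>\<^sup>+\<omega>. emeasure (?L (X S \<omega>)) C \<partial>M)"
    proof -
      have "(\<integral>\<^sup>+\<omega>'. indicator C (pth {0..} X' \<omega>') \<partial>Pr m) = emeasure (?L m) C" for m
        by (simp only: nn_integral_indicator[symmetric] nn_integral_distr[OF p'] C sets_distr borel_measurable_indicator)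
      thus ?thesis by simp
    qed
    also have "\<dots> = (\<integral>\<^sup>+m. emeasure (?L m) C \<partial>distr M (count_space UNIV) (X S))"
      by (subst nn_integral_distr[OF measurable_markov[OF M S]]) auto
    also have "\<dots> = emeasure (measure_pmf (K S n) \<bind> ?L) C"
      unfolding markov_distr[OF M S] by (subst emeasure_bind[OF _ k]) auto
    finally show "emeasure (distr M (paths {0..}) (pth {0..} (shiftp S X))) C = emeasure (measure_pmf (K S n) \<bind> ?L) C" .
  qed
qed

lemma markov_shift_expectation:
  fixes \<Phi> :: "(real \<Rightarrow> nat) \<Rightarrow> complex"
  assumes M: "markov_with M X K n" and M': "\<And>m. markov_with (Pr m) X' K m" and S: "0 \<le> S"
    and \<Phi>: "\<Phi> \<in> borel_measurable (paths {0..})" and bdd: "\<And>x. norm (\<Phi> x) \<le> B"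
  shows "(\<integral>\<omega>. \<Phi> (pth {0..} (shiftp S X) \<omega>) \<partial>M) =
    measure_pmf.expectation (K S n) (\<lambda>m. \<integral>\<omega>. \<Phi> (pth {0..} X' \<omega>) \<partial>Pr m)"
proof -
  interpret prob_space M using M by (simp add: markov_with_def)
  have p: "pth {0..} (shiftp S X) \<in> measurable M (paths {0..})"
    by (rule pth_measurable) (use S in \<open>auto intro: measurable_markov[OF M]\<close>)
  have p': "pth {0..} X' \<in> measurable (Pr m) (paths {0..})" for m
    by (rule pth_measurable) (auto intro: measurable_markov[OF M'])
  have pM': "prob_space (Pr m)" for m using M' by (simp add: markov_with_def)
  let ?L = "\<lambda>m. distr (Pr m) (paths {0..}) (pth {0..} X')"
  have real: "(\<integral>\<omega>. g (pth {0..} (shiftp S X) \<omega>) \<partial>M) = measure_pmf.expectation (K S n) (\<lambda>m. \<integral>\<omega>. g (pth {0..} X' \<omega>) \<partial>Pr m)"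
    if g: "g \<in> borel_measurable (paths {0..})" "\<And>x. \<bar>g x\<bar> \<le> B" for g :: "(real \<Rightarrow> nat) \<Rightarrow> real"
  proof -
    have "(\<integral>\<omega>. g (pth {0..} (shiftp S X) \<omega>) \<partial>M) = integral\<^sup>L (distr M (paths {0..}) (pth {0..} (shiftp S X))) g"
      by (rule integral_distr[OF p g(1), symmetric])
    also have "\<dots> = integral\<^sup>L (measure_pmf (K S n) \<bind> ?L) g" by (simp only: markov_shift_law(1)[OF M M' S])
    also have "\<dots> = measure_pmf.expectation (K S n) (\<lambda>m. integral\<^sup>L (?L m) g)"
    proof (rule integral_bind[OF g(1) g(2) markov_shift_law(2)[OF M M' S], where B'=1])
      show "finite_measure (measure_pmf (K S n))" by (rule measure_pmf.finite_measure)
      show "AE m in measure_pmf (K S n). emeasure (?L m) (space (?L m)) \<le> ennreal 1"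
        using prob_space.prob_space_distr[OF pM' p'] by (simp add: prob_space.emeasure_space_1 del: space_distr)
    qed
    also have "\<dots> = measure_pmf.expectation (K S n) (\<lambda>m. \<integral>\<omega>. g (pth {0..} X' \<omega>) \<partial>Pr m)"
      by (simp add: integral_distr[OF p' g(1)])
    finally show ?thesis .
  qed
  have I: "integrable M (\<lambda>\<omega>. \<Phi> (pth {0..} (shiftp S X) \<omega>))"
    by (rule integrable_const_bound[where B=B]) (use bdd p \<Phi> in auto)
  have I': "integrable (Pr m) (\<lambda>\<omega>. \<Phi> (pth {0..} X' \<omega>))" for m
  proof -
    interpret M': prob_space "Pr m" by (rule pM')
    show ?thesis by (rule M'.integrable_const_bound[where B=B]) (use bdd p'[of m] \<Phi> in auto)
  qed
  have nb: "norm (\<integral>\<omega>. \<Phi> (pth {0..} X' \<omega>) \<partial>Pr m) \<le> B" for m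
  proof -
    interpret M': prob_space "Pr m" by (rule pM')
    show ?thesis by (rule order.trans[OF integral_norm_bound], rule M'.integral_le_const) (use I' bdd in auto)
  qed
  have I2: "integrable (measure_pmf (K S n)) (\<lambda>m. \<integral>\<omega>. \<Phi> (pth {0..} X' \<omega>) \<partial>Pr m)"
    by (rule norm_expectation_pmf_le(2)[OF nb])
  show ?thesis
  proof (rule complex_eqI)
    show "Re (\<integral>\<omega>. \<Phi> (pth {0..} (shiftp S X) \<omega>) \<partial>M) = Re (measure_pmf.expectation (K S n) (\<lambda>m. \<integral>\<omega>. \<Phi> (pth {0..} X' \<omega>) \<partial>Pr m))"
      using real[of "\<lambda>x. Re (\<Phi> x)"] \<Phi> order.trans[OF abs_Re_le_cmod bdd]
      by (simp add: I I' I2 flip: integral_Re)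
    show "Im (\<integral>\<omega>. \<Phi> (pth {0..} (shiftp S X) \<omega>) \<partial>M) = Im (measure_pmf.expectation (K S n) (\<lambda>m. \<integral>\<omega>. \<Phi> (pth {0..} X' \<omega>) \<partial>Pr m))"
      using real[of "\<lambda>x. Im (\<Phi> x)"] \<Phi> order.trans[OF abs_Im_le_cmod bdd]
      by (simp add: I I' I2 flip: integral_Im)
  qed
qed

section \<open>The area of a path\<close>

definition rsum :: "real \<Rightarrow> nat \<Rightarrow> (real \<Rightarrow> nat) \<Rightarrow> real" where
  "rsum T N x = (T / real N) * (\<Sum>k=1..N. real (x (real k * (T / real N))))"

text \<open>Not every element of the product space is integrable, and the integral depends on uncountably many
coordinates; as a limit of Riemann sums the area is measurable on path space. On cadlag paths it agrees
with the integral.\<close>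

definition area :: "real \<Rightarrow> (real \<Rightarrow> nat) \<Rightarrow> real" where
  "area T x = lim (\<lambda>N. rsum T (Suc N) x)"

text \<open>A path with values in the natural numbers is constant on a one-sided neighbourhood on either side
of each time, so it takes only finitely many values near it, and compactness applies.\<close>

lemma cadlag_bounded:
  assumes x: "cadlag_path x" and T: "0 \<le> T"
  obtains B where "\<And>s. 0 \<le> s \<Longrightarrow> s \<le> T \<Longrightarrow> x s \<le> B"
proof -
  have "\<exists>B. \<forall>s\<in>{0..T}. 0 \<le> s \<and> s \<le> T \<longrightarrow> x s \<le> B"
  proof (rule Bolzano[OF T, where P="\<lambda>a b. \<exists>B. \<forall>s\<in>{a..b}. 0 \<le> s \<and> s \<le> T \<longrightarrow> x s \<le> B"])
    fix a b c assume "\<exists>B. \<forall>s\<in>{a..b}. 0 \<le> s \<and> s \<le> T \<longrightarrow> x s \<le> B" "\<exists>B. \<forall>s\<in>{b..c}. 0 \<le> s \<and> s \<le> T \<longrightarrow> x s \<le> B"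
    then obtain B1 B2 where "\<forall>s\<in>{a..b}. 0 \<le> s \<and> s \<le> T \<longrightarrow> x s \<le> B1" "\<forall>s\<in>{b..c}. 0 \<le> s \<and> s \<le> T \<longrightarrow> x s \<le> B2" by blast
    thus "\<exists>B. \<forall>s\<in>{a..c}. 0 \<le> s \<and> s \<le> T \<longrightarrow> x s \<le> B"
      by (intro exI[of _ "max B1 B2"]) (metis atLeastAtMost_iff le_max_iff_disj linorder_linear)
  next
    fix t assume t: "0 \<le> t" "t \<le> T"
    have "\<forall>\<^sub>F s in at_right t. x s = x t" using x t by (simp add: cadlag_path_def tendsto_discrete)
    then obtain d1 where d1: "t < d1" "\<And>s. t < s \<Longrightarrow> s < d1 \<Longrightarrow> x s = x t"
      unfolding eventually_at_right_field by blast
    obtain l d2 where d2: "d2 < t" "\<And>s. d2 < s \<Longrightarrow> s < t \<Longrightarrow> 0 \<le> s \<Longrightarrow> x s = l"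
    proof (cases "t = 0")
      case True thus ?thesis using that[of "-1" 0] by auto
    next
      case False
      hence "0 < t" using t by simp
      hence "\<exists>l. \<forall>\<^sub>F s in at_left t. x s = l" using x by (simp add: cadlag_path_def tendsto_discrete)
      then obtain l where "\<forall>\<^sub>F s in at_left t. x s = l" by blast
      then obtain d where "d < t" "\<And>s. d < s \<Longrightarrow> s < t \<Longrightarrow> x s = l" unfolding eventually_at_left_field by blast
      thus ?thesis using that by blast
    qed
    show "\<exists>d>0. \<forall>a b. a \<le> t \<and> t \<le> b \<and> b - a < d \<longrightarrow> (\<exists>B. \<forall>s\<in>{a..b}. 0 \<le> s \<and> s \<le> T \<longrightarrow> x s \<le> B)"
    proof (intro exI[of _ "min (d1 - t) (t - d2)"] conjI allI impI)
      show "0 < min (d1 - t) (t - d2)" using d1 d2 by auto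
      fix a b assume ab: "a \<le> t \<and> t \<le> b \<and> b - a < min (d1 - t) (t - d2)"
      show "\<exists>B. \<forall>s\<in>{a..b}. 0 \<le> s \<and> s \<le> T \<longrightarrow> x s \<le> B"
      proof (intro exI[of _ "max (x t) l"] ballI impI)
        fix s assume s: "s \<in> {a..b}" "0 \<le> s \<and> s \<le> T"
        consider "s = t" | "t < s" "s < d1" | "d2 < s" "s < t" using s ab by fastforce
        thus "x s \<le> max (x t) l" using d1(2)[of s] d2(2)[of s] s by cases auto
      qed
    qed
  qed
  then obtain B where "\<forall>s\<in>{0..T}. 0 \<le> s \<and> s \<le> T \<longrightarrow> x s \<le> B" by blast
  thus ?thesis by (intro that[of B]) auto
qed

lemma rsum_step_integral:
  fixes h :: real
  assumes "0 < h"
  shows "((\<lambda>s. real (x (of_int \<lceil>s / h\<rceil> * h))) has_integral (h * (\<Sum>k=1..N. real (x (real k * h))))) {0..real N * h}"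
proof (induction N)
  case 0 thus ?case using has_integral_refl(2)[of _ 0] by simp
next
  case (Suc N)
  have "((\<lambda>s. real (x (real (Suc N) * h))) has_integral (h * real (x (real (Suc N) * h)))) {real N * h..real (Suc N) * h}"
    using has_integral_const_real[of "real (x (real (Suc N) * h))" "real N * h" "real (Suc N) * h"] assms
    by (simp add: algebra_simps)
  hence "((\<lambda>s. real (x (of_int \<lceil>s / h\<rceil> * h))) has_integral (h * real (x (real (Suc N) * h)))) {real N * h..real (Suc N) * h}"
  proof (rule has_integral_spike_finite[of "{real N * h}", rotated 2])
    fix s assume s: "s \<in> {real N * h..real (Suc N) * h} - {real N * h}"
    have "\<lceil>s / h\<rceil> = int (Suc N)"
      by (rule ceiling_unique) (use s assms in \<open>auto simp: field_simps\<close>)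
    thus "real (x (of_int \<lceil>s / h\<rceil> * h)) = real (x (real (Suc N) * h))" by simp
  qed simp
  from has_integral_combine[OF _ _ Suc.IH this] assms show ?case
    by (simp add: distrib_left algebra_simps)
qed

text \<open>Rounding the time up to the next grid point approaches it from the right, so right continuity gives
pointwise convergence of the step functions, and dominated convergence yields integrability and the
limit together.\<close>

lemma rsum_tendsto_aux:
  assumes x: "cadlag_path x" and T: "0 \<le> T"
  shows "(\<lambda>s. real (x s)) integrable_on {0..T} \<and> (\<lambda>N. rsum T (Suc N) x) \<longlonglongrightarrow> integral {0..T} (\<lambda>s. real (x s))"
proof (cases "T = 0")
  case True thus ?thesis using integrable_on_refl[of "\<lambda>s. real (x s)" 0] by (simp add: rsum_def)
next
  case False
  hence T0: "0 < T" using T by simp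
  define h where "h N = T / real (Suc N)" for N
  have h: "0 < h N" for N using T0 by (simp add: h_def)
  define f where "f N s = real (x (of_int \<lceil>s / h N\<rceil> * h N))" for N s
  obtain B where B: "\<And>s. 0 \<le> s \<Longrightarrow> s \<le> T \<Longrightarrow> x s \<le> B" using cadlag_bounded[OF x T] by blast
  have int: "(f N has_integral rsum T (Suc N) x) {0..T}" for N
    using rsum_step_integral[OF h[of N], of x "Suc N"] by (simp add: f_def[abs_def] rsum_def h_def)
  have fint: "f N integrable_on {0..T}" for N using int by blast
  have Bint: "(\<lambda>_. real B) integrable_on {0..T}" by (rule integrable_const_ivl)
  have cs: "s \<le> of_int \<lceil>s / h N\<rceil> * h N" "of_int \<lceil>s / h N\<rceil> * h N < s + h N" for s N
  proof -
    have "s / h N \<le> of_int \<lceil>s / h N\<rceil>" "of_int \<lceil>s / h N\<rceil> < s / h N + 1" by linarith+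
    thus "s \<le> of_int \<lceil>s / h N\<rceil> * h N" "of_int \<lceil>s / h N\<rceil> * h N < s + h N"
      using h[of N] mult_right_mono[of "s / h N" "of_int \<lceil>s / h N\<rceil>" "h N"] mult_strict_right_mono[of "of_int \<lceil>s / h N\<rceil>" "s / h N + 1" "h N"]
      by (auto simp: distrib_right)
  qed
  have fbound: "norm (f N s) \<le> real B" if "s \<in> {0..T}" for N s
  proof -
    have "s / h N \<le> T / h N" using that h[of N] by (intro divide_right_mono) auto
    also have "T / h N = real (Suc N)" using T0 by (simp add: h_def)
    finally have "s / h N \<le> real (Suc N)" .
    hence "\<lceil>s / h N\<rceil> \<le> int (Suc N)" by (simp add: ceiling_le_iff)
    hence "of_int \<lceil>s / h N\<rceil> * h N \<le> of_int (int (Suc N)) * h N"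
      using h[of N] by (intro mult_right_mono) auto
    also have "\<dots> = T" by (simp add: h_def)
    finally have "of_int \<lceil>s / h N\<rceil> * h N \<le> T" .
    thus ?thesis using B cs(1)[of s N] that by (simp add: f_def)
  qed
  have flim: "(\<lambda>N. f N s) \<longlonglongrightarrow> real (x s)" if "s \<in> {0..T}" for s
  proof -
    have "\<forall>\<^sub>F u in at_right s. x u = x s" using x that by (simp add: cadlag_path_def tendsto_discrete)
    then obtain d where d: "s < d" "\<And>u. s < u \<Longrightarrow> u < d \<Longrightarrow> x u = x s"
      unfolding eventually_at_right_field by blast
    have "h \<longlonglongrightarrow> 0" unfolding h_def by (rule LIMSEQ_Suc[OF lim_const_over_n])
    hence "\<forall>\<^sub>F N in sequentially. h N < d - s" by (rule order_tendstoD) (use d in simp)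
    hence "\<forall>\<^sub>F N in sequentially. f N s = real (x s)"
    proof eventually_elim
      case (elim N)
      thus ?case using cs[of s N] d(2)[of "of_int \<lceil>s / h N\<rceil> * h N"] by (cases "of_int \<lceil>s / h N\<rceil> * h N = s") (auto simp: f_def)
    qed
    thus ?thesis by (rule tendsto_eventually)
  qed
  have "(\<lambda>s. real (x s)) integrable_on {0..T}"
    by (rule dominated_convergence(1)[OF fint Bint fbound flim])
  moreover have "(\<lambda>N. integral {0..T} (f N)) \<longlonglongrightarrow> integral {0..T} (\<lambda>s. real (x s))"
    by (rule dominated_convergence(2)[OF fint Bint fbound flim])
  ultimately show ?thesis by (simp only: integral_unique[OF int] simp_thms)
qed

lemmas cadlag_integrable = rsum_tendsto_aux[THEN conjunct1]
lemmas rsum_tendsto = rsum_tendsto_aux[THEN conjunct2]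

lemma area_eq: "cadlag_path x \<Longrightarrow> 0 \<le> T \<Longrightarrow> area T x = integral {0..T} (\<lambda>s. real (x s))"
  unfolding area_def by (rule limI, rule rsum_tendsto)

lemma rsum_measurable: "0 \<le> T \<Longrightarrow> {0..T} \<subseteq> I \<Longrightarrow> rsum T N \<in> borel_measurable (paths I)"
proof -
  assume T: "0 \<le> T" "{0..T} \<subseteq> I"
  have "(\<lambda>x. real (x (real k * (T / real N)))) \<in> borel_measurable (paths I)" if "k \<in> {1..N}" for k
  proof -
    have "real k * (T / real N) \<le> T" using that T by (auto simp: field_simps mult_left_mono)
    hence "real k * (T / real N) \<in> I" using T by (auto intro!: subsetD[OF T(2)])
    from measurable_compose[OF paths_coord[OF this] borel_measurable_count_space] show ?thesis .
  qed
  thus ?thesis unfolding rsum_def[abs_def] by (intro borel_measurable_times borel_measurable_sum) auto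
qed

lemma area_measurable: "0 \<le> T \<Longrightarrow> {0..T} \<subseteq> I \<Longrightarrow> area T \<in> borel_measurable (paths I)"
  unfolding area_def[abs_def] by (intro borel_measurable_lim_metric rsum_measurable)

lemma rsum_pth: "0 \<le> T \<Longrightarrow> {0..T} \<subseteq> I \<Longrightarrow> rsum T N (pth I X \<omega>) = rsum T N (\<lambda>t. X t \<omega>)"
proof -
  assume T: "0 \<le> T" "{0..T} \<subseteq> I"
  have "real k * (T / real N) \<in> I" if "k \<in> {1..N}" for k
  proof -
    have "real k * (T / real N) \<le> T" using that T by (auto simp: field_simps mult_left_mono)
    thus ?thesis using T by (auto intro!: subsetD[OF T(2)])
  qed
  thus ?thesis by (auto simp: rsum_def pth_def intro!: sum.cong)
qed

lemma area_pth:
  assumes "cadlag_path (\<lambda>t. X t \<omega>)" "0 \<le> T" "{0..T} \<subseteq> I"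
  shows "area T (pth I X \<omega>) = time_integral X T \<omega>" "(\<lambda>N. rsum T (Suc N) (pth I X \<omega>)) \<longlonglongrightarrow> time_integral X T \<omega>"
  using area_eq[OF assms(1,2)] rsum_tendsto[OF assms(1,2)]
  by (simp_all add: area_def time_integral_def rsum_pth[OF assms(2,3)])

section \<open>The generating function of the chain and its area\<close>

text \<open>Right-hand side of the Riccati system for the pair \<open>(\<rho>, \<alpha>)\<close>.\<close>

definition ric_field :: "real \<Rightarrow> real \<Rightarrow> real \<Rightarrow> complex \<Rightarrow> complex \<times> complex \<Rightarrow> complex \<times> complex" where
  "ric_field a b c \<kappa> z = (of_real b * (fst z)\<^sup>2 - (of_real b + of_real c + \<kappa>) * fst z + of_real c, of_real a * snd z * (fst z - 1))"

definition bidisk :: "real \<Rightarrow> (complex \<times> complex) set" where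
  "bidisk M = {z. norm (fst z) \<le> M \<and> norm (snd z) \<le> M}"

lemma norm_fst_snd_le: "norm (fst z) \<le> norm z" "norm (snd z) \<le> norm z" "norm z \<le> norm (fst z) + norm (snd z)"
  for z :: "complex \<times> complex"
  using norm_Pair_le[of "fst z" "snd z"] norm_fst_le[of "fst z" "snd z"] norm_snd_le[of "snd z" "fst z"]
  by simp_all

lemma ric_field_lipschitz:
  assumes M: "0 \<le> M"
  obtains L where "0 \<le> L"
    "\<And>p q. p \<in> bidisk M \<Longrightarrow> q \<in> bidisk M \<Longrightarrow> norm (ric_field a b c \<kappa> p - ric_field a b c \<kappa> q) \<le> L * norm (p - q)"
proof
  define g where "g = complex_of_real b + of_real c + \<kappa>"
  define L where "L = (\<bar>b\<bar> * (2 * M) + norm g) + \<bar>a\<bar> * ((M + 1) + M)"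
  show "0 \<le> L" using M by (simp add: L_def)
  fix p q :: "complex \<times> complex" assume p: "p \<in> bidisk M" and q: "q \<in> bidisk M"
  define x y x' y' where "x = fst p" and "y = snd p" and "x' = fst q" and "y' = snd q"
  have B: "norm x \<le> M" "norm y \<le> M" "norm x' \<le> M" "norm y' \<le> M" using p q by (auto simp: bidisk_def x_def y_def x'_def y'_def)
  have d: "norm (x - x') \<le> norm (p - q)" "norm (y - y') \<le> norm (p - q)"
    using norm_fst_snd_le(1,2)[of "p - q"] by (auto simp: x_def y_def x'_def y'_def)
  have "fst (ric_field a b c \<kappa> p - ric_field a b c \<kappa> q) = of_real b * (x + x') * (x - x') - g * (x - x')"
    by (simp add: ric_field_def g_def x_def x'_def algebra_simps power2_eq_square)
  also have "norm \<dots> \<le> \<bar>b\<bar> * (2 * M) * norm (p - q) + norm g * norm (p - q)"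
    using B(1,3) d M unfolding norm_mult
    by (intro order.trans[OF norm_triangle_ineq4] add_mono)
       (auto simp: norm_mult intro!: mult_mono order.trans[OF norm_triangle_ineq])
  finally have 1: "norm (fst (ric_field a b c \<kappa> p - ric_field a b c \<kappa> q)) \<le> (\<bar>b\<bar> * (2 * M) + norm g) * norm (p - q)"
    by (simp add: algebra_simps)
  have "snd (ric_field a b c \<kappa> p - ric_field a b c \<kappa> q) = of_real a * ((x - 1) * (y - y') + y' * (x - x'))"
    by (simp add: ric_field_def x_def x'_def y_def y'_def algebra_simps)
  also have "norm \<dots> \<le> \<bar>a\<bar> * ((M + 1) * norm (p - q) + M * norm (p - q))"
  proof -
    have "norm (x - 1) \<le> M + 1" using B(1) norm_triangle_ineq4[of x 1] by simp
    hence "norm ((x - 1) * (y - y') + y' * (x - x')) \<le> (M + 1) * norm (p - q) + M * norm (p - q)"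
      using B d M by (intro order.trans[OF norm_triangle_ineq] add_mono) (auto simp: norm_mult intro!: mult_mono)
    thus ?thesis by (simp add: norm_mult mult_left_mono)
  qed
  finally have 2: "norm (snd (ric_field a b c \<kappa> p - ric_field a b c \<kappa> q)) \<le> \<bar>a\<bar> * ((M + 1) + M) * norm (p - q)"
    by (simp add: algebra_simps)
  show "norm (ric_field a b c \<kappa> p - ric_field a b c \<kappa> q) \<le> L * norm (p - q)"
    using norm_fst_snd_le(3)[of "ric_field a b c \<kappa> p - ric_field a b c \<kappa> q"] 1 2
    by (simp add: L_def algebra_simps)
qed

lemma ric_field_bounded:
  assumes M: "0 \<le> M"
  obtains B where "0 \<le> B" "\<And>p. p \<in> bidisk M \<Longrightarrow> norm (ric_field a b c \<kappa> p) \<le> B"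
proof -
  obtain L where L: "0 \<le> L" "\<And>p q. p \<in> bidisk M \<Longrightarrow> q \<in> bidisk M \<Longrightarrow> norm (ric_field a b c \<kappa> p - ric_field a b c \<kappa> q) \<le> L * norm (p - q)"
    using ric_field_lipschitz[OF M] by blast
  have 0: "0 \<in> bidisk M" using M by (simp add: bidisk_def)
  show ?thesis
  proof
    show "0 \<le> L * (2 * M) + norm (ric_field a b c \<kappa> 0)" using L M by simp
    fix p :: "complex \<times> complex" assume p: "p \<in> bidisk M"
    have "norm (p - 0) \<le> 2 * M" using p norm_fst_snd_le(3)[of p] by (simp add: bidisk_def)
    hence "L * norm (p - 0) \<le> L * (2 * M)" using L by (intro mult_left_mono)
    thus "norm (ric_field a b c \<kappa> p) \<le> L * (2 * M) + norm (ric_field a b c \<kappa> 0)"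
      using L(2)[OF p 0] norm_triangle_sub[of "ric_field a b c \<kappa> p" "ric_field a b c \<kappa> 0"] by linarith
  qed
qed

lemma euler_step_error:
  fixes f :: "real \<Rightarrow> 'a::real_normed_vector"
  assumes h: "0 \<le> h" and L: "0 \<le> L"
    and der: "\<And>t. u \<le> t \<Longrightarrow> t \<le> u + h \<Longrightarrow> (f has_vector_derivative v (f t)) (at t within {u..u+h})"
    and D: "\<And>t. u \<le> t \<Longrightarrow> t \<le> u + h \<Longrightarrow> f t \<in> D"
    and lip: "\<And>p q. p \<in> D \<Longrightarrow> q \<in> D \<Longrightarrow> norm (v p - v q) \<le> L * norm (p - q)"
    and bnd: "\<And>p. p \<in> D \<Longrightarrow> norm (v p) \<le> B"
  shows "norm (f (u + h) - f u - h *\<^sub>R v (f u)) \<le> L * B * h\<^sup>2"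
proof (cases "h = 0")
  case False
  hence h0: "0 < h" using h by simp
  have cont: "continuous_on {u..u+h} f" by (rule continuous_on_vector_derivative[OF der]) auto
  have der': "(f has_vector_derivative v (f t)) (at t)" if "u < t" "t < u + h" for t
    using der[of t] that at_within_Icc_at[of u t "u + h"] by simp
  have B0: "0 \<le> B" using bnd[OF D[of u]] h norm_ge_zero order.trans by (metis le_add_same_cancel1 order_refl)
  have 1: "norm (f t - f u) \<le> B * h" if t: "u \<le> t" "t \<le> u + h" for t
  proof (cases "u = t")
    case False
    hence ut: "u < t" using t by simp
    have "norm (f t - f u) \<le> (\<lambda>x. B * x) t - (\<lambda>x. B * x) u"
    proof (rule differentiable_bound_general[OF ut, where \<phi>'="\<lambda>_. B" and f'="\<lambda>t. v (f t)"])
      show "continuous_on {u..t} f" by (rule continuous_on_subset[OF cont]) (use t in auto)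
      show "((\<lambda>x. B * x) has_vector_derivative B) (at x)" for x
        unfolding has_real_derivative_iff_has_vector_derivative[symmetric] by (auto intro!: derivative_eq_intros)
    qed (use t der' bnd D in \<open>auto intro!: continuous_intros\<close>)
    also have "\<dots> \<le> B * h" using t B0 by (simp add: right_diff_distrib[symmetric] mult_left_mono)
    finally show ?thesis .
  qed (use B0 h in auto)
  define F where "F t = f t - (t - u) *\<^sub>R v (f u)" for t
  have "norm (F (u + h) - F u) \<le> (\<lambda>x. (L * (B * h)) * x) (u + h) - (\<lambda>x. (L * (B * h)) * x) u"
  proof (rule differentiable_bound_general[where \<phi>'="\<lambda>_. L * (B * h)" and f'="\<lambda>t. v (f t) - v (f u)"])
    show "u < u + h" using h0 by simp
    show "continuous_on {u..u+h} F" unfolding F_def by (intro continuous_intros cont)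
    show "((\<lambda>x. (L * (B * h)) * x) has_vector_derivative L * (B * h)) (at x)" for x
      unfolding has_real_derivative_iff_has_vector_derivative[symmetric] by (auto intro!: derivative_eq_intros)
    show "(F has_vector_derivative v (f x) - v (f u)) (at x)" if "u < x" "x < u + h" for x
      unfolding F_def[abs_def] by (rule has_vector_derivative_diff[OF der'[OF that]]) (auto intro!: derivative_eq_intros)
    show "norm (v (f x) - v (f u)) \<le> L * (B * h)" if "u < x" "x < u + h" for x
      using lip[OF D D, of x u] 1[of x] that h L by (meson le_add_same_cancel1 less_imp_le mult_left_mono order.trans order_refl)
  qed (auto intro!: continuous_intros)
  also have "\<dots> = L * B * h\<^sup>2" by (simp add: algebra_simps power2_eq_square)
  finally show ?thesis by (simp add: F_def algebra_simps)
qed auto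

text \<open>Two sequences that both follow the Euler step of a Lipschitz field up to an error \<open>C h\<^sup>2\<close> per step stay
within \<open>O(N h\<^sup>2)\<close> of each other, by the discrete Gronwall inequality. It is applied to the
exact flow and the splitting scheme.\<close>

lemma euler_two_schemes:
  fixes x y :: "nat \<Rightarrow> 'a::real_normed_vector"
  assumes "x 0 = y 0" "0 \<le> h" "0 \<le> L" "0 \<le> C"
    and D: "\<And>k. k \<le> N \<Longrightarrow> x k \<in> D" "\<And>k. k \<le> N \<Longrightarrow> y k \<in> D"
    and lip: "\<And>p q. p \<in> D \<Longrightarrow> q \<in> D \<Longrightarrow> norm (v p - v q) \<le> L * norm (p - q)"
    and x: "\<And>k. k < N \<Longrightarrow> norm (x (Suc k) - x k - h *\<^sub>R v (x k)) \<le> C * h\<^sup>2"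
    and y: "\<And>k. k < N \<Longrightarrow> norm (y (Suc k) - y k - h *\<^sub>R v (y k)) \<le> C * h\<^sup>2"
  shows "norm (x N - y N) \<le> N * (2 * C * h\<^sup>2) * exp (L * (N * h))"
proof -
  have "norm (x k - y k) \<le> k * (2 * C * h\<^sup>2) * exp (L * (k * h))" if "k \<le> N" for k
    using that
  proof (induction k)
    case 0 thus ?case using assms(1) by simp
  next
    case (Suc k)
    define E where "E = exp (L * (real k * h))"
    have E: "1 \<le> E" "1 + L * h \<le> exp (L * h)" using assms(2,3) by (auto simp: E_def)
    have IH: "norm (x k - y k) \<le> k * (2 * C * h\<^sup>2) * E" using Suc by (simp add: E_def)
    have "x (Suc k) - y (Suc k) = (x k - y k) + h *\<^sub>R (v (x k) - v (y k))
       + (x (Suc k) - x k - h *\<^sub>R v (x k)) - (y (Suc k) - y k - h *\<^sub>R v (y k))"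
      by (simp add: algebra_simps)
    hence "norm (x (Suc k) - y (Suc k)) \<le> norm (x k - y k) + norm (h *\<^sub>R (v (x k) - v (y k)))
       + norm (x (Suc k) - x k - h *\<^sub>R v (x k)) + norm (y (Suc k) - y k - h *\<^sub>R v (y k))"
      by (smt (verit) norm_triangle_ineq norm_triangle_ineq4)
    also have "norm (h *\<^sub>R (v (x k) - v (y k))) \<le> h * (L * norm (x k - y k))"
      using lip[OF D(1) D(2), of k k] Suc.prems assms(2) by (auto intro!: mult_left_mono)
    also have "norm (x k - y k) + h * (L * norm (x k - y k)) = (1 + L * h) * norm (x k - y k)"
      by (simp add: algebra_simps)
    also have "\<dots> \<le> exp (L * h) * (k * (2 * C * h\<^sup>2) * E)"
      using E IH assms by (intro mult_mono) auto
    also have "\<dots> = k * (2 * C * h\<^sup>2) * exp (L * (real (Suc k) * h))"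
      by (simp add: E_def algebra_simps flip: exp_add)
    finally have "norm (x (Suc k) - y (Suc k)) \<le> k * (2 * C * h\<^sup>2) * exp (L * (real (Suc k) * h))
       + 2 * (C * h\<^sup>2)" using x[of k] y[of k] Suc.prems by simp
    also have "2 * (C * h\<^sup>2) \<le> 2 * (C * h\<^sup>2) * exp (L * (real (Suc k) * h))"
      using mult_left_mono[of 1 "exp (L * (real (Suc k) * h))" "2 * (C * h\<^sup>2)"] assms(2-4) by auto
    finally show ?case by (simp add: algebra_simps)
  qed
  from this[of N] show ?thesis by simp
qed

lemma ric_pair_deriv:
  assumes D: "ric_data b c r s" and lam: "of_real b * r + of_real c / r = of_real b + of_real c + \<kappa>" and t: "0 \<le> t"
  shows "((\<lambda>t. (ric_rho b c r s t, A * ric_alpha a b c r s t)) has_vector_derivative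
     ric_field a b c \<kappa> (ric_rho b c r s t, A * ric_alpha a b c r s t)) (at t within S)"
proof -
  have "((\<lambda>t. A * ric_alpha a b c r s t) has_vector_derivative A * (of_real a * ric_alpha a b c r s t * (ric_rho b c r s t - 1))) (at t within S)"
    by (rule bounded_linear.has_vector_derivative[OF bounded_linear_mult_right ric_alpha_deriv[OF D t]])
  from has_vector_derivative_Pair[OF ric_rho_deriv[OF D t] this] show ?thesis
    unfolding lam by (simp add: ric_field_def mult_ac)
qed

text \<open>Lie splitting of the Riccati flow: killing over a time \<open>h\<close>, which is \<open>s \<mapsto> exp (- \<kappa> h) s\<close>, followed by the exact
flow for \<open>\<kappa> = 0\<close>. The second component accumulates the factors \<open>\<alpha>\<close>.\<close>

fun split_step :: "real \<Rightarrow> real \<Rightarrow> real \<Rightarrow> complex \<Rightarrow> real \<Rightarrow> complex \<Rightarrow> nat \<Rightarrow> complex \<times> complex" where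
  "split_step a b c \<kappa> h s 0 = (s, 1)"
| "split_step a b c \<kappa> h s (Suc k) =
     (ric_rho b c 1 (exp (- \<kappa> * h) * fst (split_step a b c \<kappa> h s k)) h,
      snd (split_step a b c \<kappa> h s k) * ric_alpha a b c 1 (exp (- \<kappa> * h) * fst (split_step a b c \<kappa> h s k)) h)"

lemma norm_exp_killing_le: "0 \<le> Re \<kappa> \<Longrightarrow> 0 \<le> h \<Longrightarrow> norm (exp (- \<kappa> * complex_of_real h)) \<le> 1"
  by (simp add: norm_exp_eq_Re)

lemma split_step_bidisk:
  assumes abc: "0 \<le> a" "0 < b" "b < c" and lam: "0 \<le> Re \<kappa>" and s: "norm s \<le> 1" and h: "0 \<le> h"
  shows "split_step a b c \<kappa> h s k \<in> bidisk 1"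
proof (induction k)
  case (Suc k)
  define z where "z = exp (- \<kappa> * h) * fst (split_step a b c \<kappa> h s k)"
  have z: "norm z \<le> 1" using Suc norm_exp_killing_le[OF lam h] by (auto simp: z_def norm_mult bidisk_def intro!: mult_le_one)
  show ?case using pgf_bounds[OF abc(2,3) z h abc(1)] Suc by (auto simp: bidisk_def norm_mult z_def intro!: mult_le_one)
qed (use s in \<open>auto simp: bidisk_def\<close>)

text \<open>One step of the splitting scheme differs from an Euler step by \<open>O(h\<^sup>2)\<close>: the flow for \<open>\<kappa> = 0\<close> does,
\<open>exp (- \<kappa> h) = 1 - \<kappa> h + O(h\<^sup>2)\<close>, and moving the base point of the field by \<open>O(h)\<close> costs another
\<open>O(h\<^sup>2)\<close>. The constant is uniform because every step stays in the unit bidisk.\<close>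

lemma split_step_error:
  assumes abc: "0 \<le> a" "0 < b" "b < c" and lam: "0 \<le> Re \<kappa>" and s: "norm s \<le> 1"
  obtains C where "0 \<le> C" "\<And>h k. 0 \<le> h \<Longrightarrow> h \<le> 1 \<Longrightarrow>
     norm (split_step a b c \<kappa> h s (Suc k) - split_step a b c \<kappa> h s k - h *\<^sub>R ric_field a b c \<kappa> (split_step a b c \<kappa> h s k)) \<le> C * h\<^sup>2"
proof -
  obtain L where L: "0 \<le> L" "\<And>p q. p \<in> bidisk 1 \<Longrightarrow> q \<in> bidisk 1 \<Longrightarrow> norm (ric_field a b c 0 p - ric_field a b c 0 q) \<le> L * norm (p - q)"
    using ric_field_lipschitz[of 1 a b c 0] zero_le_one by blast
  obtain B where B: "0 \<le> B" "\<And>p. p \<in> bidisk 1 \<Longrightarrow> norm (ric_field a b c 0 p) \<le> B"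
    using ric_field_bounded[of 1 a b c 0] zero_le_one by blast
  define E where "E = exp \<bar>Re \<kappa>\<bar> * (norm \<kappa>)\<^sup>2"
  have E0: "0 \<le> E" by (simp add: E_def)
  show ?thesis
  proof
    show "0 \<le> L * B + E + L * (norm \<kappa> + E)" using L B E0 by simp
    fix h :: real and k assume h: "0 \<le> h" "h \<le> 1"
    define x where "x = split_step a b c \<kappa> h s k"
    define R A where "R = fst x" and "A = snd x"
    define z where "z = exp (- \<kappa> * h) * R"
    have x: "x \<in> bidisk 1" unfolding x_def by (rule split_step_bidisk) (use assms h in auto)
    have RA: "norm R \<le> 1" "norm A \<le> 1" "x = (R, A)" using x by (auto simp: bidisk_def R_def A_def)
    have z: "norm z \<le> 1" using RA norm_exp_killing_le[OF lam h(1)] by (auto simp: z_def norm_mult intro!: mult_le_one)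
    have zA: "(z, A) \<in> bidisk 1" using z RA by (auto simp: bidisk_def)
    have D: "ric_data b c 1 z" using abc(2,3) z by (rule ric_data_pgf)
    define f where "f t = (ric_rho b c 1 z t, A * ric_alpha a b c 1 z t)" for t
    have f0: "f 0 = (z, A)" by (simp add: f_def ric_rho_0[OF D] ric_alpha_0[OF D])
    have fh: "split_step a b c \<kappa> h s (Suc k) = f h" by (simp add: f_def z_def R_def A_def x_def)
    have "norm (f (0 + h) - f 0 - h *\<^sub>R ric_field a b c 0 (f 0)) \<le> L * B * h\<^sup>2"
    proof (rule euler_step_error[where D="bidisk 1"])
      fix t assume t: "0 \<le> t" "t \<le> 0 + h"
      show "(f has_vector_derivative ric_field a b c 0 (f t)) (at t within {0..0 + h})"
        unfolding f_def[abs_def] by (rule ric_pair_deriv[OF D _ t(1)]) simp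
      show "f t \<in> bidisk 1" using pgf_bounds[OF abc(2,3) z t(1) abc(1)] RA by (auto simp: f_def bidisk_def norm_mult intro!: mult_le_one)
    qed (use L B h in auto)
    hence 1: "norm (f h - (z, A) - h *\<^sub>R ric_field a b c 0 (z, A)) \<le> L * B * h\<^sup>2" by (simp add: f0)
    have 2: "norm (z - R + h *\<^sub>R (\<kappa> * R)) \<le> E * h\<^sup>2"
    proof -
      have "norm (exp (- \<kappa> * h) - (\<Sum>i\<le>1. (- \<kappa> * h) ^ i / fact i)) \<le> exp \<bar>Re (- \<kappa> * h)\<bar> * (norm (- \<kappa> * h)) ^ Suc 1 / fact 1"
        by (rule Taylor_exp)
      also have "\<dots> \<le> exp \<bar>Re \<kappa>\<bar> * (norm (- \<kappa> * h)) ^ Suc 1 / fact 1"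
        using h by (intro divide_right_mono mult_right_mono) (auto simp: abs_mult mult_left_le)
      also have "\<dots> = E * h\<^sup>2" by (simp add: E_def norm_mult power_mult_distrib power2_eq_square)
      finally have *: "norm (exp (- \<kappa> * h) - 1 + \<kappa> * h) \<le> E * h\<^sup>2" by (simp add: algebra_simps)
      have "z - R + h *\<^sub>R (\<kappa> * R) = (exp (- \<kappa> * h) - 1 + \<kappa> * h) * R"
        by (simp add: z_def algebra_simps scaleR_conv_of_real)
      thus ?thesis using * RA(1) E0 by (auto simp: norm_mult intro: order.trans[OF mult_left_le])
    qed
    have 3: "norm (z - R) \<le> (norm \<kappa> + E) * h"
    proof -
      have "norm (z - R) \<le> norm (z - R + h *\<^sub>R (\<kappa> * R)) + norm (h *\<^sub>R (\<kappa> * R))"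
        using norm_triangle_ineq4[of "z - R + h *\<^sub>R (\<kappa> * R)" "h *\<^sub>R (\<kappa> * R)"] by simp
      also have "norm (h *\<^sub>R (\<kappa> * R)) \<le> h * norm \<kappa>"
        using h RA(1) by (auto simp: norm_mult intro!: mult_left_mono mult_left_le)
      finally have "norm (z - R) \<le> norm (z - R + h *\<^sub>R (\<kappa> * R)) + h * norm \<kappa>" by simp
      moreover have "E * h\<^sup>2 \<le> E * h" using h E0 by (intro mult_left_mono) (auto simp: power2_eq_square mult_left_le)
      ultimately show ?thesis using 2 by (simp add: algebra_simps)
    qed
    have "f h - x - h *\<^sub>R ric_field a b c \<kappa> x = (f h - (z, A) - h *\<^sub>R ric_field a b c 0 (z, A))
       + (z - R + h *\<^sub>R (\<kappa> * R), 0) + h *\<^sub>R (ric_field a b c 0 (z, A) - ric_field a b c 0 x)"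
      by (simp add: RA(3) ric_field_def algebra_simps prod_eq_iff)
    also have "norm \<dots> \<le> L * B * h\<^sup>2 + E * h\<^sup>2 + h * (L * ((norm \<kappa> + E) * h))"
    proof (intro norm_triangle_mono 1)
      show "norm (z - R + h *\<^sub>R (\<kappa> * R), 0::complex) \<le> E * h\<^sup>2" using 2 by (simp add: norm_Pair)
      have "norm (ric_field a b c 0 (z, A) - ric_field a b c 0 x) \<le> L * norm ((z, A) - x)" by (rule L(2)[OF zA x])
      also have "norm ((z, A) - x) = norm (z - R)" by (simp add: RA(3) norm_Pair)
      also have "L * norm (z - R) \<le> L * ((norm \<kappa> + E) * h)" using L 3 by (intro mult_left_mono)
      finally show "norm (h *\<^sub>R (ric_field a b c 0 (z, A) - ric_field a b c 0 x)) \<le> h * (L * ((norm \<kappa> + E) * h))"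
        using h by (simp add: mult_left_mono)
    qed
    also have "\<dots> = (L * B + E + L * (norm \<kappa> + E)) * h\<^sup>2" by (simp add: algebra_simps power2_eq_square)
    finally show "norm (split_step a b c \<kappa> h s (Suc k) - split_step a b c \<kappa> h s k - h *\<^sub>R ric_field a b c \<kappa> (split_step a b c \<kappa> h s k))
       \<le> (L * B + E + L * (norm \<kappa> + E)) * h\<^sup>2" by (simp only: fh x_def)
  qed
qed

lemma split_step_tendsto:
  assumes abc: "0 \<le> a" "0 < b" "b < c" and lam: "0 \<le> Re \<kappa>" and s: "norm s \<le> 1" and T: "0 \<le> T"
    and D: "ric_data b c r s" and r: "of_real b * r + of_real c / r = of_real b + of_real c + \<kappa>"
  shows "(\<lambda>N. split_step a b c \<kappa> (T / real (Suc N)) s (Suc N)) \<longlonglongrightarrow> (ric_rho b c r s T, ric_alpha a b c r s T)"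
proof -
  define y where "y t = (ric_rho b c r s t, ric_alpha a b c r s t)" for t
  have yd: "(y has_vector_derivative ric_field a b c \<kappa> (y t)) (at t within S)" if "0 \<le> t" for t S
    using ric_pair_deriv[OF D r that, of 1 a S] by (simp add: y_def[abs_def])
  have "continuous_on {0..T} y" by (rule continuous_on_vector_derivative[OF yd]) auto
  hence "bounded (y ` {0..T})" by (intro compact_imp_bounded compact_continuous_image) auto
  then obtain M0 where "\<forall>x\<in>y ` {0..T}. norm x \<le> M0" unfolding bounded_iff by blast
  hence M0: "norm (y t) \<le> M0" if "t \<in> {0..T}" for t using that by blast
  define M where "M = max 1 M0"
  have M: "1 \<le> M" "0 \<le> M" by (auto simp: M_def)
  have yM: "y t \<in> bidisk M" if "t \<in> {0..T}" for t
    using M0[OF that] norm_fst_snd_le(1,2)[of "y t"] by (auto simp: bidisk_def M_def)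
  obtain L where L: "0 \<le> L" "\<And>p q. p \<in> bidisk M \<Longrightarrow> q \<in> bidisk M \<Longrightarrow> norm (ric_field a b c \<kappa> p - ric_field a b c \<kappa> q) \<le> L * norm (p - q)"
    using ric_field_lipschitz[OF M(2)] by blast
  obtain B where B: "0 \<le> B" "\<And>p. p \<in> bidisk M \<Longrightarrow> norm (ric_field a b c \<kappa> p) \<le> B"
    using ric_field_bounded[OF M(2)] by blast
  obtain C0 where C0: "0 \<le> C0" "\<And>h k. 0 \<le> h \<Longrightarrow> h \<le> 1 \<Longrightarrow>
     norm (split_step a b c \<kappa> h s (Suc k) - split_step a b c \<kappa> h s k - h *\<^sub>R ric_field a b c \<kappa> (split_step a b c \<kappa> h s k)) \<le> C0 * h\<^sup>2"
    using split_step_error[OF abc lam s] by blast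
  define C where "C = max C0 (L * B)"
  have C: "0 \<le> C" "C0 \<le> C" "L * B \<le> C" using C0(1) by (auto simp: C_def)
  define x where "x h k = split_step a b c \<kappa> h s k" for h k
  have main: "norm (x (T / real (Suc N)) (Suc N) - y T) \<le> 2 * C * T\<^sup>2 * exp (L * T) / real (Suc N)" if N: "T \<le> real (Suc N)" for N
  proof -
    define h where "h = T / real (Suc N)"
    have h: "0 \<le> h" "h \<le> 1" "real (Suc N) * h = T" using T N by (auto simp: h_def)
    have kh: "real k * h \<in> {0..T}" if "k \<le> Suc N" for k
    proof -
      have "real k * h \<le> real (Suc N) * h" using that h(1) by (intro mult_right_mono) auto
      thus ?thesis using h by simp
    qed
    have "norm (x h (Suc N) - y (real (Suc N) * h)) \<le> real (Suc N) * (2 * C * h\<^sup>2) * exp (L * (real (Suc N) * h))"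
    proof (rule euler_two_schemes[where D="bidisk M" and v="ric_field a b c \<kappa>" and y="\<lambda>k. y (real k * h)"])
      show "x h 0 = y (real 0 * h)" by (simp add: x_def y_def ric_rho_0[OF D] ric_alpha_0[OF D])
      show "x h k \<in> bidisk M" for k
        using split_step_bidisk[OF abc lam s h(1), of k] M by (auto simp: x_def bidisk_def)
      show "y (real k * h) \<in> bidisk M" if "k \<le> Suc N" for k by (rule yM[OF kh[OF that]])
      show "norm (x h (Suc k) - x h k - h *\<^sub>R ric_field a b c \<kappa> (x h k)) \<le> C * h\<^sup>2" for k
        using C0(2)[OF h(1,2), of k] C(2) mult_right_mono[OF C(2), of "h\<^sup>2"] by (simp add: x_def)
      show "norm (y (real (Suc k) * h) - y (real k * h) - h *\<^sub>R ric_field a b c \<kappa> (y (real k * h))) \<le> C * h\<^sup>2" if "k < Suc N" for k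
      proof -
        have sub: "t \<in> {0..T}" if "real k * h \<le> t" "t \<le> real k * h + h" for t
        proof -
          have "0 \<le> t" using that(1) h(1) by (meson mult_nonneg_nonneg of_nat_0_le_iff order.trans)
          moreover have "t \<le> real (Suc k) * h" using that(2) by (simp add: algebra_simps)
          ultimately show ?thesis using kh[of "Suc k"] \<open>k < Suc N\<close> by auto
        qed
        have "norm (y (real k * h + h) - y (real k * h) - h *\<^sub>R ric_field a b c \<kappa> (y (real k * h))) \<le> L * B * h\<^sup>2"
          by (rule euler_step_error[where D="bidisk M"]) (use h L B sub yM yd in auto)
        also have "\<dots> \<le> C * h\<^sup>2" using C(3) by (intro mult_right_mono) auto
        finally show ?thesis by (simp add: algebra_simps)
      qed
    qed (use h L C in auto)
    also have "real (Suc N) * (2 * C * h\<^sup>2) * exp (L * (real (Suc N) * h)) = 2 * C * T\<^sup>2 * exp (L * T) / real (Suc N)"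
      by (simp only: h(3)) (simp add: h_def power2_eq_square)
    finally show ?thesis by (simp only: h(3)) (simp add: h_def)
  qed
  have "(\<lambda>N. 2 * C * T\<^sup>2 * exp (L * T) / real (Suc N)) \<longlonglongrightarrow> 0" by (rule LIMSEQ_Suc[OF lim_const_over_n])
  moreover have "\<forall>\<^sub>F N in sequentially. norm (x (T / real (Suc N)) (Suc N) - y T) \<le> 2 * C * T\<^sup>2 * exp (L * T) / real (Suc N)"
  proof -
    have "\<forall>\<^sub>F N in sequentially. T \<le> real N" by (rule eventually_sequentiallyI[of "nat \<lceil>T\<rceil>"]) linarith
    thus ?thesis by eventually_elim (rule main, simp)
  qed
  ultimately have "(\<lambda>N. x (T / real (Suc N)) (Suc N) - y T) \<longlonglongrightarrow> 0" by (rule Lim_null_comparison[rotated])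
  hence "(\<lambda>N. x (T / real (Suc N)) (Suc N)) \<longlonglongrightarrow> y T" by (simp add: LIM_zero_iff)
  thus ?thesis by (simp add: x_def y_def)
qed

text \<open>The functional \<open>exp (- \<kappa> A) s ^ X\<close> at time \<open>N h\<close>, with the area replaced by its right-endpoint Riemann sum
of mesh \<open>h\<close>.\<close>

definition disc_fk :: "complex \<Rightarrow> complex \<Rightarrow> real \<Rightarrow> nat \<Rightarrow> (real \<Rightarrow> nat) \<Rightarrow> complex" where
  "disc_fk \<kappa> s h N x = (\<Prod>k=1..N. exp (- \<kappa> * h) ^ x (real k * h)) * s ^ x (real N * h)"

lemma disc_fk_measurable: "0 \<le> h \<Longrightarrow> disc_fk \<kappa> s h N \<in> borel_measurable (paths {0..})"
proof -
  assume h: "0 \<le> h"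
  have "(\<lambda>x. g (x (real k * h))) \<in> borel_measurable (paths {0..})" for g :: "nat \<Rightarrow> complex" and k
    using h by (intro measurable_compose[OF paths_coord borel_measurable_count_space]) auto
  thus ?thesis unfolding disc_fk_def[abs_def] by (intro borel_measurable_times borel_measurable_prod)
qed

lemma disc_fk_bound:
  assumes "0 \<le> Re \<kappa>" "0 \<le> h" "norm s \<le> 1" shows "norm (disc_fk \<kappa> s h N x) \<le> 1"
proof -
  have "norm (exp (- \<kappa> * h) ^ k) \<le> 1" for k using norm_exp_killing_le[OF assms(1,2)] by (simp add: norm_power power_le_one)
  hence "(\<Prod>k=1..N. norm (exp (- \<kappa> * h) ^ x (real k * h))) \<le> 1" by (intro prod_le_1) auto
  moreover have "norm (s ^ x (real N * h)) \<le> 1" using assms by (simp add: norm_power power_le_one)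
  ultimately show ?thesis by (auto simp: disc_fk_def norm_mult prod_norm intro!: mult_le_one)
qed

lemma disc_fk_Suc: "disc_fk \<kappa> s h (Suc N) x = exp (- \<kappa> * h) ^ x h * disc_fk \<kappa> s h N (\<lambda>t. x (h + t))"
proof -
  have "(\<Prod>k=1..Suc N. exp (- \<kappa> * h) ^ x (real k * h)) = exp (- \<kappa> * h) ^ x h * (\<Prod>k=2..Suc N. exp (- \<kappa> * h) ^ x (real k * h))"
    by (subst prod.atLeast_Suc_atMost) (auto simp: numeral_2_eq_2)
  also have "(\<Prod>k=2..Suc N. exp (- \<kappa> * h) ^ x (real k * h)) = (\<Prod>k=1..N. exp (- \<kappa> * h) ^ x (real (Suc k) * h))"
    using prod.shift_bounds_cl_Suc_ivl[of "\<lambda>k. exp (- \<kappa> * h) ^ x (real k * h)" 1 N] by (simp add: numeral_2_eq_2)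
  finally show ?thesis by (simp add: disc_fk_def algebra_simps)
qed

lemma disc_fk_cong: "(\<And>t. 0 \<le> t \<Longrightarrow> x t = y t) \<Longrightarrow> 0 \<le> h \<Longrightarrow> disc_fk \<kappa> s h N x = disc_fk \<kappa> s h N y"
  by (simp add: disc_fk_def)

text \<open>Induction on the number of steps, by conditioning on the state at the first grid point: the remaining expectation is
again of the form \<open>A R ^ m\<close>, to which \<open>bdi_pgf\<close> applies.\<close>

lemma disc_fk_expectation:
  fixes Pr :: "nat \<Rightarrow> 'w measure"
  assumes K: "transition_semigroup K" "has_transition_rates K (bdi_rates a b c)"
    and M: "\<And>m. markov_with (Pr m) X K m"
    and abc: "0 \<le> a" "0 < b" "b < c" and lam: "0 \<le> Re \<kappa>" and s: "norm s \<le> 1" and h: "0 \<le> h"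
  shows "(\<integral>\<omega>. disc_fk \<kappa> s h N (\<lambda>t. X t \<omega>) \<partial>Pr n) = snd (split_step a b c \<kappa> h s N) * fst (split_step a b c \<kappa> h s N) ^ n"
proof (induction N arbitrary: n)
  case 0
  interpret prob_space "Pr n" using M[of n] by (simp add: markov_with_def)
  have "AE \<omega> in Pr n. X 0 \<omega> = n" using M[of n] by (simp add: markov_with_def)
  moreover have "(\<lambda>\<omega>. s ^ X 0 \<omega>) \<in> borel_measurable (Pr n)"
    by (rule measurable_compose[OF measurable_markov[OF M] borel_measurable_count_space]) simp
  ultimately have "(\<integral>\<omega>. s ^ X 0 \<omega> \<partial>Pr n) = (\<integral>\<omega>. s ^ n \<partial>Pr n)" by (intro integral_cong_AE) auto
  thus ?case by (simp add: disc_fk_def prob_space)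
next
  case (Suc N)
  define e where "e = exp (- \<kappa> * h)"
  define \<Phi> where "\<Phi> x = e ^ x 0 * disc_fk \<kappa> s h N x" for x :: "real \<Rightarrow> nat"
  define R A where "R = fst (split_step a b c \<kappa> h s N)" and "A = snd (split_step a b c \<kappa> h s N)"
  have e: "norm e \<le> 1" unfolding e_def by (rule norm_exp_killing_le[OF lam h])
  have RA: "norm R \<le> 1" using split_step_bidisk[OF abc lam s h, of N] by (auto simp: bidisk_def R_def)
  have \<Phi>m: "\<Phi> \<in> borel_measurable (paths {0..})"
  proof -
    have "(\<lambda>x. e ^ x 0) \<in> borel_measurable (paths {0..})"
      by (rule measurable_compose[OF paths_coord borel_measurable_count_space]) simp
    thus ?thesis unfolding \<Phi>_def[abs_def] by (intro borel_measurable_times disc_fk_measurable h)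
  qed
  have \<Phi>b: "norm (\<Phi> x) \<le> 1" for x
    using disc_fk_bound[OF lam h s, of N x] e by (auto simp: \<Phi>_def norm_mult norm_power intro!: mult_le_one power_le_one)
  have inner: "(\<integral>\<omega>. \<Phi> (pth {0..} X \<omega>) \<partial>Pr m) = A * (e * R) ^ m" for m
  proof -
    interpret Pm: prob_space "Pr m" using M[of m] by (simp add: markov_with_def)
    have p: "pth {0..} X \<in> measurable (Pr m) (paths {0..})" by (rule pth_measurable) (auto intro: measurable_markov[OF M])
    have eq: "\<Phi> (pth {0..} X \<omega>) = e ^ X 0 \<omega> * disc_fk \<kappa> s h N (\<lambda>t. X t \<omega>)" for \<omega>
    proof -
      have "disc_fk \<kappa> s h N (pth {0..} X \<omega>) = disc_fk \<kappa> s h N (\<lambda>t. X t \<omega>)"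
        by (rule disc_fk_cong[OF _ h]) (simp add: pth_def)
      thus ?thesis by (simp add: \<Phi>_def pth_def)
    qed
    have meas: "(\<lambda>\<omega>. disc_fk \<kappa> s h N (\<lambda>t. X t \<omega>)) \<in> borel_measurable (Pr m)"
    proof -
      have "disc_fk \<kappa> s h N (pth {0..} X \<omega>) = disc_fk \<kappa> s h N (\<lambda>t. X t \<omega>)" for \<omega>
        by (rule disc_fk_cong[OF _ h]) (simp add: pth_def)
      thus ?thesis using measurable_compose[OF p disc_fk_measurable[OF h, of \<kappa> s N]] by simp
    qed
    have "(\<integral>\<omega>. \<Phi> (pth {0..} X \<omega>) \<partial>Pr m) = (\<integral>\<omega>. e ^ m * disc_fk \<kappa> s h N (\<lambda>t. X t \<omega>) \<partial>Pr m)"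
    proof (rule integral_cong_AE)
      show "(\<lambda>\<omega>. \<Phi> (pth {0..} X \<omega>)) \<in> borel_measurable (Pr m)" using p \<Phi>m by (rule measurable_compose)
      have "AE \<omega> in Pr m. X 0 \<omega> = m" using M[of m] by (simp add: markov_with_def)
      thus "AE \<omega> in Pr m. \<Phi> (pth {0..} X \<omega>) = e ^ m * disc_fk \<kappa> s h N (\<lambda>t. X t \<omega>)" by eventually_elim (simp add: eq)
    qed (use meas in auto)
    also have "\<dots> = e ^ m * (A * R ^ m)" by (simp add: Suc.IH A_def R_def)
    finally show ?thesis by (simp add: power_mult_distrib)
  qed
  have "(\<integral>\<omega>. disc_fk \<kappa> s h (Suc N) (\<lambda>t. X t \<omega>) \<partial>Pr n) = (\<integral>\<omega>. \<Phi> (pth {0..} (shiftp h X) \<omega>) \<partial>Pr n)"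
  proof (rule Bochner_Integration.integral_cong)
    fix \<omega>
    have "disc_fk \<kappa> s h N (pth {0..} (shiftp h X) \<omega>) = disc_fk \<kappa> s h N (\<lambda>t. X (h + t) \<omega>)"
      by (rule disc_fk_cong[OF _ h]) (simp add: pth_def)
    moreover have "pth {0..} (shiftp h X) \<omega> 0 = X h \<omega>" by (simp add: pth_def)
    ultimately show "disc_fk \<kappa> s h (Suc N) (\<lambda>t. X t \<omega>) = \<Phi> (pth {0..} (shiftp h X) \<omega>)"
      by (simp only: disc_fk_Suc \<Phi>_def e_def)
  qed simp
  also have "\<dots> = measure_pmf.expectation (K h n) (\<lambda>m. \<integral>\<omega>. \<Phi> (pth {0..} X \<omega>) \<partial>Pr m)"
    by (rule markov_shift_expectation[OF M M h \<Phi>m \<Phi>b])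
  also have "\<dots> = measure_pmf.expectation (K h n) (\<lambda>m. A * (e * R) ^ m)" by (simp only: inner)
  also have "measure_pmf.expectation (K h n) (\<lambda>m. A * (e * R) ^ m) = A * measure_pmf.expectation (K h n) (\<lambda>m. (e * R) ^ m)" by simp
  also have "measure_pmf.expectation (K h n) (\<lambda>m. (e * R) ^ m) = ric_alpha a b c 1 (e * R) h * ric_rho b c 1 (e * R) h ^ n"
    by (rule bdi_pgf[OF K abc _ h]) (use e RA in \<open>auto simp: norm_mult intro!: mult_le_one\<close>)
  finally show ?case by (simp add: e_def A_def R_def)
qed

theorem feynman_kac_generating_function:
  fixes Pr :: "nat \<Rightarrow> 'w measure"
  assumes K: "transition_semigroup K" "has_transition_rates K (bdi_rates a b c)"
    and M: "\<And>m. markov_with (Pr m) X K m"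
    and abc: "0 \<le> a" "0 < b" "b < c" and lam: "0 \<le> Re \<kappa>" and s: "norm s \<le> 1" and T: "0 \<le> T"
    and D: "ric_data b c r s" and r: "of_real b * r + of_real c / r = of_real b + of_real c + \<kappa>"
  shows "(\<integral>\<omega>. exp (- \<kappa> * time_integral X T \<omega>) * s ^ X T \<omega> \<partial>Pr n) = ric_alpha a b c r s T * ric_rho b c r s T ^ n"
proof -
  interpret prob_space "Pr n" using M[of n] by (simp add: markov_with_def)
  define h where "h N = T / real (Suc N)" for N
  have h: "0 \<le> h N" for N using T by (simp add: h_def)
  have p: "pth {0..} X \<in> measurable (Pr n) (paths {0..})" by (rule pth_measurable) (auto intro: measurable_markov[OF M])
  have eq: "disc_fk \<kappa> s (h N) (Suc N) (\<lambda>t. X t \<omega>) = exp (- \<kappa> * rsum T (Suc N) (\<lambda>t. X t \<omega>)) * s ^ X T \<omega>" for N \<omega>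
  proof -
    have "(\<Prod>k=1..Suc N. exp (- \<kappa> * h N) ^ X (real k * h N) \<omega>) = exp (\<Sum>k=1..Suc N. of_nat (X (real k * h N) \<omega>) * (- \<kappa> * h N))"
      by (simp only: exp_of_nat_mult[symmetric] exp_sum[OF finite_atLeastAtMost])
    also have "(\<Sum>k=1..Suc N. of_nat (X (real k * h N) \<omega>) * (- \<kappa> * h N)) = - \<kappa> * rsum T (Suc N) (\<lambda>t. X t \<omega>)"
      unfolding rsum_def h_def[symmetric] of_real_mult of_real_sum by (simp add: sum_distrib_left mult_ac flip: sum_negf del: sum.cl_ivl_Suc)
    finally have "(\<Prod>k=1..Suc N. exp (- \<kappa> * h N) ^ X (real k * h N) \<omega>) = exp (- \<kappa> * rsum T (Suc N) (\<lambda>t. X t \<omega>))" .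
    moreover have "real (Suc N) * h N = T" by (simp add: h_def)
    ultimately show ?thesis by (simp only: disc_fk_def)
  qed
  have meas: "(\<lambda>\<omega>. disc_fk \<kappa> s (h N) (Suc N) (\<lambda>t. X t \<omega>)) \<in> borel_measurable (Pr n)" for N
  proof -
    have "disc_fk \<kappa> s (h N) (Suc N) (pth {0..} X \<omega>) = disc_fk \<kappa> s (h N) (Suc N) (\<lambda>t. X t \<omega>)" for \<omega>
      by (rule disc_fk_cong[OF _ h]) (simp add: pth_def)
    thus ?thesis using measurable_compose[OF p disc_fk_measurable[OF h, of \<kappa> s N "Suc N"]] by simp
  qed
  have lim: "(\<lambda>N. disc_fk \<kappa> s (h N) (Suc N) (\<lambda>t. X t \<omega>)) \<longlonglongrightarrow> exp (- \<kappa> * time_integral X T \<omega>) * s ^ X T \<omega>"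
    if "\<omega> \<in> space (Pr n)" for \<omega>
  proof -
    have "cadlag_path (\<lambda>t. X t \<omega>)" using M[of n] that by (simp add: markov_with_def)
    hence "(\<lambda>N. rsum T (Suc N) (\<lambda>t. X t \<omega>)) \<longlonglongrightarrow> time_integral X T \<omega>"
      unfolding time_integral_def by (rule rsum_tendsto[OF _ T])
    thus ?thesis unfolding eq by (intro tendsto_intros)
  qed
  have "(\<lambda>N. \<integral>\<omega>. disc_fk \<kappa> s (h N) (Suc N) (\<lambda>t. X t \<omega>) \<partial>Pr n) \<longlonglongrightarrow> (\<integral>\<omega>. exp (- \<kappa> * time_integral X T \<omega>) * s ^ X T \<omega> \<partial>Pr n)"
  proof (rule integral_dominated_convergence[where w="\<lambda>_. 1"])
    show "(\<lambda>\<omega>. exp (- \<kappa> * time_integral X T \<omega>) * s ^ X T \<omega>) \<in> borel_measurable (Pr n)"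
      by (rule borel_measurable_LIMSEQ_metric[OF meas lim])
  qed (use meas lim disc_fk_bound[OF lam h s] in auto)
  moreover have "(\<lambda>N. \<integral>\<omega>. disc_fk \<kappa> s (h N) (Suc N) (\<lambda>t. X t \<omega>) \<partial>Pr n) \<longlonglongrightarrow> ric_alpha a b c r s T * ric_rho b c r s T ^ n"
  proof -
    have "(\<lambda>N. split_step a b c \<kappa> (h N) s (Suc N)) \<longlonglongrightarrow> (ric_rho b c r s T, ric_alpha a b c r s T)"
      unfolding h_def by (rule split_step_tendsto) fact+
    from tendsto_mult[OF tendsto_snd[OF this] tendsto_power[OF tendsto_fst[OF this], of n]] show ?thesis
      by (simp add: disc_fk_expectation[OF K M abc lam s h] del: split_step.simps)
  qed
  ultimately show ?thesis by (rule LIMSEQ_unique)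
qed

section \<open>The fixed points on a vertical line\<close>

text \<open>The root of \<open>b r + c / r = b r\<^sub>0 + c / r\<^sub>0 + \<i> u\<close> in the disc of radius \<open>r\<^sub>0\<close>. The two roots have product
\<open>c / b\<close>, whose modulus exceeds \<open>r\<^sub>0\<^sup>2\<close>, so at most one of them lies there.\<close>

definition ric_root :: "real \<Rightarrow> real \<Rightarrow> real \<Rightarrow> real \<Rightarrow> complex" where
  "ric_root b c r\<^sub>0 u = (SOME r. r \<noteq> 0 \<and>
     of_real b * r + of_real c / r = of_real (b * r\<^sub>0 + c / r\<^sub>0) + \<i> * of_real u \<and> norm r \<le> r\<^sub>0)"

text \<open>The real and imaginary part of the equation, after multiplication by \<open>|r|\<^sup>2\<close>. They make the argument of \<open>r\<close>
explicit as a function of its modulus.\<close>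

lemma ric_root_polar:
  fixes r :: complex
  assumes "r \<noteq> 0" and eq: "of_real b * r + of_real c / r = of_real s + \<i> * of_real u"
  shows "(b * (norm r)\<^sup>2 + c) * Re r = s * (norm r)\<^sup>2" "(b * (norm r)\<^sup>2 - c) * Im r = u * (norm r)\<^sup>2"
proof -
  define m where "m = (norm r)\<^sup>2"
  have m: "m \<noteq> 0" using assms(1) by (simp add: m_def)
  have "of_real c / r = of_real c * cnj r / of_real m"
    by (simp only: m_def complex_div_cnj[of "of_real c" r] of_real_power)
  hence c: "of_real c / r = of_real (c / m) * cnj r" by simp
  have "Re (of_real b * r + of_real c / r) = s" "Im (of_real b * r + of_real c / r) = u" unfolding eq by auto
  hence "b * Re r + c / m * Re r = s" "b * Im r - c / m * Im r = u" unfolding c by auto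
  thus "(b * (norm r)\<^sup>2 + c) * Re r = s * (norm r)\<^sup>2" "(b * (norm r)\<^sup>2 - c) * Im r = u * (norm r)\<^sup>2"
    using m unfolding m_def[symmetric] by (auto simp: field_simps)
qed

context
  fixes b c r\<^sub>0 :: real
  assumes b: "0 < b" and r\<^sub>0: "0 < r\<^sub>0" and cr: "b * r\<^sub>0\<^sup>2 < c"
begin

lemma c_pos: "0 < c" using b r\<^sub>0 cr by (smt (verit) mult_nonneg_nonneg zero_le_power2)

text \<open>Take the root of smaller modulus \<open>m\<close>, so \<open>m\<^sup>2 \<le> c / b\<close>. The real part of the equation and \<open>Re r \<le> m\<close> give
\<open>b m + c / m \<ge> b r\<^sub>0 + c / r\<^sub>0\<close>. As \<open>x \<mapsto> b x + c / x\<close> decreases up to \<open>sqrt (c / b)\<close>, this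
means \<open>m \<le> r\<^sub>0\<close>.\<close>

lemma ric_root_exists:
  "\<exists>r. r \<noteq> 0 \<and> of_real b * r + of_real c / r = of_real (b * r\<^sub>0 + c / r\<^sub>0) + \<i> * of_real u \<and> norm r \<le> r\<^sub>0"
proof -
  define s where "s = b * r\<^sub>0 + c / r\<^sub>0"
  define w where "w = complex_of_real s + \<i> * of_real u"
  define d where "d = csqrt (w\<^sup>2 - 4 * of_real b * of_real c)"
  have d2: "d\<^sup>2 = w\<^sup>2 - 4 * of_real b * of_real c" by (simp add: d_def)
  define p q where "p = (w + d) / (2 * of_real b)" and "q = (w - d) / (2 * of_real b)"
  have bz: "complex_of_real b \<noteq> 0" using b by simp
  have pq: "p * q = of_real (c / b)"
  proof -
    have "p * q = (w\<^sup>2 - d\<^sup>2) / (4 * (of_real b)\<^sup>2)" using bz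
      by (simp add: p_def q_def field_simps power2_eq_square)
    thus ?thesis unfolding d2 using bz by (simp add: field_simps power2_eq_square)
  qed
  have sum: "of_real b * (p + q) = w" using bz by (simp add: p_def q_def field_simps)
  have nz: "p \<noteq> 0" "q \<noteq> 0" using pq b c_pos by auto
  have "norm p * norm q = \<bar>c / b\<bar>" using arg_cong[OF pq, of norm] by (simp only: norm_mult norm_of_real)
  hence "norm p * norm q = c / b" using b c_pos by simp
  hence "\<exists>r\<in>{p, q}. (norm r)\<^sup>2 \<le> c / b"
    by (metis insertCI linorder_linear mult_left_mono mult_right_mono norm_ge_zero power2_eq_square)
  then obtain r where r: "r \<in> {p, q}" "(norm r)\<^sup>2 \<le> c / b" by blast
  have eq: "of_real b * r + of_real c / r = w"
  proof -
    have "of_real c / p = of_real b * q" "of_real c / q = of_real b * p"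
      using pq nz bz by (auto simp: field_simps)
    thus ?thesis using r(1) sum by (auto simp: distrib_left add.commute)
  qed
  have r0: "r \<noteq> 0" using r nz by auto
  define m where "m = norm r"
  have m: "0 < m" using r0 by (simp add: m_def)
  have "s * m\<^sup>2 = (b * m\<^sup>2 + c) * Re r"
    using ric_root_polar(1)[OF r0 eq[unfolded w_def]] by (simp add: m_def)
  also have "\<dots> \<le> (b * m\<^sup>2 + c) * m"
    using b c_pos complex_Re_le_cmod[of r] by (intro mult_left_mono) (auto simp: m_def)
  finally have "m * (s * m) \<le> m * (b * m\<^sup>2 + c)" by (simp add: power2_eq_square algebra_simps)
  hence "s * m \<le> b * m\<^sup>2 + c" using m by simp
  moreover have "b * m\<^sup>2 + c - s * m = (m - r\<^sub>0) * (b * m - c / r\<^sub>0)"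
    using r\<^sub>0 by (simp add: s_def field_simps power2_eq_square)
  ultimately have "0 \<le> (m - r\<^sub>0) * (b * m - c / r\<^sub>0)" by simp
  moreover have "b * m - c / r\<^sub>0 < 0"
  proof -
    have "(m * r\<^sub>0)\<^sup>2 = m\<^sup>2 * r\<^sub>0\<^sup>2" by (simp add: power_mult_distrib)
    also have "\<dots> < (c / b) * (c / b)"
      by (rule mult_le_less_imp_less) (use r(2) m r\<^sub>0 cr b in \<open>auto simp: m_def[symmetric] field_simps\<close>)
    finally have "(m * r\<^sub>0)\<^sup>2 < (c / b)\<^sup>2" by (simp add: power2_eq_square)
    hence "m * r\<^sub>0 < c / b" by (rule power2_less_imp_less) (use b c_pos in auto)
    thus ?thesis using b r\<^sub>0 by (simp add: field_simps)
  qed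
  ultimately have "m \<le> r\<^sub>0" by (simp add: zero_le_mult_iff)
  thus ?thesis using eq r0 unfolding w_def s_def m_def by blast
qed

lemma ric_root:
  "ric_root b c r\<^sub>0 u \<noteq> 0"
  "of_real b * ric_root b c r\<^sub>0 u + of_real c / ric_root b c r\<^sub>0 u = of_real (b * r\<^sub>0 + c / r\<^sub>0) + \<i> * of_real u"
  "norm (ric_root b c r\<^sub>0 u) \<le> r\<^sub>0"
  using someI_ex[OF ric_root_exists[of u]] unfolding ric_root_def by blast+

lemma ric_root_denom: "of_real c - of_real b * ric_root b c r\<^sub>0 u * of_real r\<^sub>0 \<noteq> 0"
  "c - b * r\<^sub>0\<^sup>2 \<le> norm (of_real c - of_real b * ric_root b c r\<^sub>0 u * of_real r\<^sub>0)"
proof -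
  have "norm (of_real b * ric_root b c r\<^sub>0 u * of_real r\<^sub>0) \<le> b * r\<^sub>0 * r\<^sub>0"
    using b r\<^sub>0 ric_root(3)[of u] by (auto simp: norm_mult intro!: mult_mono)
  thus *: "c - b * r\<^sub>0\<^sup>2 \<le> norm (of_real c - of_real b * ric_root b c r\<^sub>0 u * of_real r\<^sub>0)"
    using norm_triangle_ineq2[of "of_real c" "of_real b * ric_root b c r\<^sub>0 u * of_real r\<^sub>0"] c_pos
    by (simp add: power2_eq_square mult.assoc)
  show "of_real c - of_real b * ric_root b c r\<^sub>0 u * of_real r\<^sub>0 \<noteq> 0" using * cr by auto
qed

text \<open>Subtract the equations for \<open>u\<close> and for \<open>0\<close>; the difference of the left-hand sides factors.\<close>

lemma ric_root_diff:
  "ric_root b c r\<^sub>0 u - of_real r\<^sub>0 = - \<i> * of_real u * ric_root b c r\<^sub>0 u * of_real r\<^sub>0 / (of_real c - of_real b * ric_root b c r\<^sub>0 u * of_real r\<^sub>0)"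
proof -
  define r where "r = ric_root b c r\<^sub>0 u"
  have nz: "r \<noteq> 0" "complex_of_real r\<^sub>0 \<noteq> 0" using ric_root(1) r\<^sub>0 by (auto simp: r_def)
  have "of_real b * r + of_real c / r = of_real b * of_real r\<^sub>0 + of_real c / of_real r\<^sub>0 + \<i> * of_real u"
    using ric_root(2)[of u] by (simp add: r_def)
  hence "(of_real b * r + of_real c / r) * (r * of_real r\<^sub>0) = (of_real b * of_real r\<^sub>0 + of_real c / of_real r\<^sub>0 + \<i> * of_real u) * (r * of_real r\<^sub>0)"
    by simp
  hence "(r - of_real r\<^sub>0) * (of_real c - of_real b * r * of_real r\<^sub>0) = - \<i> * of_real u * r * of_real r\<^sub>0"
    using nz by (simp add: algebra_simps power2_eq_square)
  thus ?thesis using ric_root_denom(1)[of u] by (simp add: r_def field_simps)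
qed

lemma ric_root_lipschitz: "norm (ric_root b c r\<^sub>0 u - of_real r\<^sub>0) \<le> \<bar>u\<bar> * (r\<^sub>0\<^sup>2 / (c - b * r\<^sub>0\<^sup>2))"
proof -
  have "norm (ric_root b c r\<^sub>0 u - of_real r\<^sub>0) = \<bar>u\<bar> * norm (ric_root b c r\<^sub>0 u) * r\<^sub>0 / norm (of_real c - of_real b * ric_root b c r\<^sub>0 u * of_real r\<^sub>0)"
    unfolding ric_root_diff[of u] using r\<^sub>0 by (simp add: norm_mult norm_divide)
  also have "\<dots> \<le> (\<bar>u\<bar> * r\<^sub>0 * r\<^sub>0) / (c - b * r\<^sub>0\<^sup>2)"
    using ric_root_denom(2)[of u] ric_root(3)[of u] r\<^sub>0 cr by (intro frac_le mult_mono) auto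
  finally show ?thesis by (simp add: power2_eq_square)
qed

lemma ric_root_tendsto: "(ric_root b c r\<^sub>0 \<longlongrightarrow> of_real r\<^sub>0) (nhds 0)"
proof -
  have "((\<lambda>u. \<bar>u\<bar> * (r\<^sub>0\<^sup>2 / (c - b * r\<^sub>0\<^sup>2))) \<longlongrightarrow> \<bar>0\<bar> * (r\<^sub>0\<^sup>2 / (c - b * r\<^sub>0\<^sup>2))) (nhds 0)"
    by (intro tendsto_intros) (simp add: filterlim_ident)
  hence "((\<lambda>u. \<bar>u\<bar> * (r\<^sub>0\<^sup>2 / (c - b * r\<^sub>0\<^sup>2))) \<longlongrightarrow> 0) (nhds 0)" by simp
  moreover have "\<forall>\<^sub>F u in nhds 0. norm (ric_root b c r\<^sub>0 u - of_real r\<^sub>0) \<le> \<bar>u\<bar> * (r\<^sub>0\<^sup>2 / (c - b * r\<^sub>0\<^sup>2))"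
    by (intro always_eventually allI ric_root_lipschitz)
  ultimately have "((\<lambda>u. ric_root b c r\<^sub>0 u - of_real r\<^sub>0) \<longlongrightarrow> 0) (nhds 0)"
    by (rule Lim_null_comparison[rotated])
  thus ?thesis by (simp add: LIM_zero_iff)
qed

text \<open>The exact second-order remainder: the first-order term of \<open>r(u) - r\<^sub>0\<close> cancels against the linear term,
and inserting \<open>ric_root_diff\<close> a second time leaves a factor \<open>u\<^sup>2\<close>.\<close>

lemma ric_root_exponent:
  "of_real a * (ric_root b c r\<^sub>0 u - of_real r\<^sub>0) + \<i> * of_real u * of_real (a * r\<^sub>0\<^sup>2 / (c - b * r\<^sub>0\<^sup>2)) =
    - of_real (u\<^sup>2) * of_real (a * c * r\<^sub>0\<^sup>2 / (c - b * r\<^sub>0\<^sup>2)) * ric_root b c r\<^sub>0 u / (of_real c - of_real b * ric_root b c r\<^sub>0 u * of_real r\<^sub>0)\<^sup>2"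
proof -
  define r where "r = ric_root b c r\<^sub>0 u"
  define D where "D = of_real c - of_real b * r * of_real r\<^sub>0"
  define D0 where "D0 = complex_of_real (c - b * r\<^sub>0\<^sup>2)"
  have nz: "D \<noteq> 0" "D0 \<noteq> 0" using ric_root_denom(1)[of u] cr by (auto simp: D_def D0_def r_def simp del: of_real_diff)
  have diff: "(r - of_real r\<^sub>0) = - \<i> * of_real u * r * of_real r\<^sub>0 / D" using ric_root_diff[of u] by (simp add: r_def D_def)
  have "of_real a * (r - of_real r\<^sub>0) + \<i> * of_real u * (of_real (a * r\<^sub>0\<^sup>2) / D0)
     = of_real a * \<i> * of_real u * of_real r\<^sub>0 * ((of_real r\<^sub>0 * D - r * D0) / (D0 * D))"
    unfolding diff using nz by (simp add: field_simps power2_eq_square)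
  also have "of_real r\<^sub>0 * D - r * D0 = - of_real c * (r - of_real r\<^sub>0)"
    by (simp add: D_def D0_def algebra_simps power2_eq_square)
  also have "of_real a * \<i> * of_real u * of_real r\<^sub>0 * ((- of_real c * (r - of_real r\<^sub>0)) / (D0 * D)) =
     - of_real (u\<^sup>2) * (of_real (a * c * r\<^sub>0\<^sup>2) / D0) * r / D\<^sup>2"
    unfolding diff using nz by (simp add: field_simps power2_eq_square)
  finally show ?thesis by (simp add: r_def D_def D0_def)
qed

text \<open>The modulus of \<open>r(u)\<close> drops below \<open>r\<^sub>0\<close> at a quadratic rate near \<open>u = 0\<close> and by a fixed amount far
from it. This is quantitative: the imaginary part of the equation bounds \<open>u\<^sup>2\<close> by
\<open>m\<^sup>2 - (Re r)\<^sup>2\<close>, up to factors, and the real part bounds the latter by \<open>r\<^sub>0 - m\<close>, where \<open>m = |r(u)|\<close>.\<close>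

lemma ric_root_gap:
  obtains \<delta> where "0 < \<delta>" "\<And>u. \<delta> * min 1 (u\<^sup>2) \<le> r\<^sub>0 - norm (ric_root b c r\<^sub>0 u)"
proof
  define \<delta> where "\<delta> = min (r\<^sub>0 / 2) (r\<^sub>0 ^ 3 / (8 * c\<^sup>2))"
  show "0 < \<delta>" using r\<^sub>0 c_pos by (simp add: \<delta>_def)
  fix u
  define s where "s = b * r\<^sub>0 + c / r\<^sub>0"
  define r where "r = ric_root b c r\<^sub>0 u"
  define m where "m = norm r"
  have m: "0 < m" "m \<le> r\<^sub>0" using ric_root[of u] by (auto simp: m_def r_def)
  note pol = ric_root_polar[OF ric_root(1)[of u] ric_root(2)[of u], folded r_def s_def, folded m_def]
  define Q where "Q = b * m\<^sup>2 + c"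
  have Q: "c \<le> Q" "0 < Q" using b c_pos m(1) by (auto simp: Q_def intro!: add_pos_pos)
  have bm: "b * m\<^sup>2 \<le> b * r\<^sub>0\<^sup>2" using m b by (intro mult_left_mono power_mono) auto
  have Qs: "Q - s * m = (r\<^sub>0 - m) * (c / r\<^sub>0 - b * m)"
    using r\<^sub>0 by (simp add: s_def Q_def field_simps power2_eq_square)
  have "0 \<le> c / r\<^sub>0 - b * m"
  proof -
    have "b * m * r\<^sub>0 \<le> b * r\<^sub>0 * r\<^sub>0" using m b r\<^sub>0 by (intro mult_right_mono mult_left_mono) auto
    hence "b * m * r\<^sub>0 \<le> c" using cr by (simp add: power2_eq_square mult.assoc)
    thus ?thesis using r\<^sub>0 by (simp add: field_simps)
  qed
  hence sm: "s * m \<le> Q" using Qs m by (smt (verit) mult_nonneg_nonneg)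
  have s0: "0 \<le> s" using b r\<^sub>0 c_pos by (simp add: s_def)
  have "(u * m\<^sup>2)\<^sup>2 = (b * m\<^sup>2 - c)\<^sup>2 * (Im r)\<^sup>2" using pol(2) by (metis power_mult_distrib)
  also have "\<dots> \<le> c\<^sup>2 * (Im r)\<^sup>2"
  proof (rule mult_right_mono)
    have "0 \<le> b * m\<^sup>2" using b by simp
    hence "\<bar>b * m\<^sup>2 - c\<bar> \<le> \<bar>c\<bar>" using bm cr by linarith
    thus "(b * m\<^sup>2 - c)\<^sup>2 \<le> c\<^sup>2" by (simp only: abs_le_square_iff)
  qed simp
  also have "(Im r)\<^sup>2 = m\<^sup>2 - (Re r)\<^sup>2" by (simp add: m_def cmod_power2)
  finally have 1: "(u * m\<^sup>2)\<^sup>2 \<le> c\<^sup>2 * (m\<^sup>2 - (Re r)\<^sup>2)" .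
  have "Q\<^sup>2 * (m\<^sup>2 - (Re r)\<^sup>2) = Q\<^sup>2 * m\<^sup>2 - (Q * Re r)\<^sup>2" by (simp add: algebra_simps power_mult_distrib)
  also have "Q * Re r = s * m\<^sup>2" using pol(1) by (simp add: Q_def)
  also have "Q\<^sup>2 * m\<^sup>2 - (s * m\<^sup>2)\<^sup>2 = m\<^sup>2 * ((Q - s * m) * (Q + s * m))"
    by (simp add: algebra_simps power2_eq_square)
  also have "\<dots> \<le> m\<^sup>2 * ((Q - s * m) * (2 * Q))" using sm by (intro mult_left_mono) auto
  finally have "Q * (Q * (m\<^sup>2 - (Re r)\<^sup>2)) \<le> Q * (2 * m\<^sup>2 * (Q - s * m))" by (simp add: power2_eq_square algebra_simps)
  hence 2: "Q * (m\<^sup>2 - (Re r)\<^sup>2) \<le> 2 * m\<^sup>2 * (Q - s * m)" using Q(2) by simp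
  have "c * (m\<^sup>2 - (Re r)\<^sup>2) \<le> Q * (m\<^sup>2 - (Re r)\<^sup>2)"
    using Q by (intro mult_right_mono) (auto simp: m_def cmod_power2)
  also note 2
  also have "2 * m\<^sup>2 * (Q - s * m) \<le> 2 * m\<^sup>2 * ((r\<^sub>0 - m) * (c / r\<^sub>0))"
    unfolding Qs using m b by (intro mult_left_mono) auto
  finally have "c * (m\<^sup>2 - (Re r)\<^sup>2) \<le> c * (2 * m\<^sup>2 * (r\<^sub>0 - m) / r\<^sub>0)" by (simp add: field_simps)
  hence "m\<^sup>2 - (Re r)\<^sup>2 \<le> 2 * m\<^sup>2 * (r\<^sub>0 - m) / r\<^sub>0" using c_pos by (rule mult_left_le_imp_le)
  hence le: "c\<^sup>2 * (m\<^sup>2 - (Re r)\<^sup>2) \<le> c\<^sup>2 * (2 * m\<^sup>2 * (r\<^sub>0 - m) / r\<^sub>0)" by (rule mult_left_mono) simp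
  have "m\<^sup>2 * (u\<^sup>2 * m\<^sup>2) = (u * m\<^sup>2)\<^sup>2" by (simp add: power_mult_distrib power2_eq_square)
  also note 1
  also note le
  also have "c\<^sup>2 * (2 * m\<^sup>2 * (r\<^sub>0 - m) / r\<^sub>0) = m\<^sup>2 * (2 * c\<^sup>2 * (r\<^sub>0 - m) / r\<^sub>0)" by simp
  finally have "m\<^sup>2 * (u\<^sup>2 * m\<^sup>2) \<le> m\<^sup>2 * (2 * c\<^sup>2 * (r\<^sub>0 - m) / r\<^sub>0)" .
  hence 3: "u\<^sup>2 * m\<^sup>2 \<le> 2 * c\<^sup>2 * (r\<^sub>0 - m) / r\<^sub>0" by (rule mult_left_le_imp_le) (use m(1) in simp)
  \<comment> \<open>The bound on \<open>u\<^sup>2 m\<^sup>2\<close> is useful only if \<open>m\<close> is not small; if it is small the gap is large anyway.\<close>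
  show "\<delta> * min 1 (u\<^sup>2) \<le> r\<^sub>0 - norm (ric_root b c r\<^sub>0 u)"
  proof (cases "m < r\<^sub>0 / 2")
    case True
    have "\<delta> * min 1 (u\<^sup>2) \<le> \<delta> * 1" using \<open>0 < \<delta>\<close> by (intro mult_left_mono) auto
    also have "\<dots> \<le> r\<^sub>0 / 2" by (simp add: \<delta>_def)
    also have "\<dots> \<le> r\<^sub>0 - m" using True by simp
    finally show ?thesis by (simp add: m_def r_def)
  next
    case False
    hence "(r\<^sub>0 / 2)\<^sup>2 \<le> m\<^sup>2" using r\<^sub>0 by (intro power_mono) auto
    hence "u\<^sup>2 * (r\<^sub>0 / 2)\<^sup>2 \<le> u\<^sup>2 * m\<^sup>2" by (intro mult_left_mono) auto
    with 3 have "u\<^sup>2 * (r\<^sub>0 / 2)\<^sup>2 \<le> 2 * c\<^sup>2 * (r\<^sub>0 - m) / r\<^sub>0" by linarith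
    hence "r\<^sub>0 ^ 3 / (8 * c\<^sup>2) * u\<^sup>2 \<le> r\<^sub>0 - m"
      using r\<^sub>0 c_pos by (simp add: field_simps power2_eq_square power3_eq_cube)
    moreover have "\<delta> * min 1 (u\<^sup>2) \<le> r\<^sub>0 ^ 3 / (8 * c\<^sup>2) * u\<^sup>2"
      using \<open>0 < \<delta>\<close> by (intro mult_mono) (auto simp: \<delta>_def)
    ultimately show ?thesis by (simp add: m_def r_def)
  qed
qed

lemma ric_root_data:
  assumes bc: "b < c" and r1: "r\<^sub>0 < 1"
  shows "ric_data b c (ric_root b c r\<^sub>0 u) 1" "norm (ric_q b c (ric_root b c r\<^sub>0 u) 1) \<le> r\<^sub>0"
proof -
  define r where "r = ric_root b c r\<^sub>0 u"
  have r: "r \<noteq> 0" "norm r \<le> r\<^sub>0" using ric_root[of u] by (auto simp: r_def)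
  have Re1: "Re r < 1" using r(2) r1 complex_Re_le_cmod[of r] by linarith
  have "(cmod (of_real b * (1 - r)))\<^sup>2 < (cmod (of_real b * r - of_real c))\<^sup>2"
  proof -
    have "(b * Re r - c)\<^sup>2 - (b * (1 - Re r))\<^sup>2 = (c - b) * ((c - b) + 2 * b * (1 - Re r))"
      by (simp add: algebra_simps power2_eq_square)
    also have "\<dots> > 0" using bc b Re1 by (intro mult_pos_pos add_pos_pos) auto
    finally show ?thesis by (simp add: cmod_power2)
  qed
  hence lt: "cmod (of_real b * (1 - r)) < cmod (of_real b * r - of_real c)" by (rule power2_less_imp_less) simp
  hence ne: "of_real b * r \<noteq> of_real c" using norm_ge_zero[of "of_real b * (1 - r)"] by force
  have "norm (ric_q b c r 1) = norm r * (cmod (of_real b * (1 - r)) / cmod (of_real b * r - of_real c))"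
    by (simp add: ric_q_def norm_divide norm_mult)
  also have "\<dots> \<le> norm r * 1" using lt ne by (intro mult_left_mono) auto
  finally show qr: "norm (ric_q b c (ric_root b c r\<^sub>0 u) 1) \<le> r\<^sub>0" using r by (simp add: r_def)
  define m where "m = (norm r)\<^sup>2"
  have m: "0 < m" "m \<le> r\<^sub>0\<^sup>2" using r by (auto simp: m_def intro!: power_mono)
  have bm: "b * m < c" using m b cr by (smt (verit) mult_left_mono)
  have "(b * m + c) * Re r = (b * r\<^sub>0 + c / r\<^sub>0) * m"
    using ric_root_polar(1)[OF ric_root(1)[of u] ric_root(2)[of u]] by (simp add: m_def r_def)
  moreover have "0 < (b * r\<^sub>0 + c / r\<^sub>0) * m" using m b r\<^sub>0 c_pos by (simp add: add_pos_pos)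
  ultimately have "0 < (b * m + c) * Re r" by simp
  moreover have "0 < b * m + c" using b m c_pos by (simp add: add_pos_pos)
  ultimately have Re0: "0 < Re r" by (rule zero_less_mult_pos)
  have "of_real c / r = of_real c * cnj r / of_real m" by (simp only: m_def complex_div_cnj[of "of_real c" r] of_real_power)
  hence "Re (of_real c / r - of_real b * r) = (c / m - b) * Re r" by (simp add: algebra_simps)
  moreover have "0 \<le> (c / m - b) * Re r" using Re0 bm m by (intro mult_nonneg_nonneg) (auto simp: field_simps)
  ultimately have "0 \<le> Re (of_real c / r - of_real b * r)" by simp
  moreover have "norm (ric_q b c (ric_root b c r\<^sub>0 u) 1) < 1" using qr r1 by (rule le_less_trans)
  ultimately show "ric_data b c (ric_root b c r\<^sub>0 u) 1"
    using b c_pos r(1) ne by (simp add: ric_data_def r_def)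
qed

end

section \<open>Inverting the Laplace transform of the ramp\<close>

lemma integrable_inverse_quadratic:
  assumes "0 < \<beta>"
  shows "integrable lborel (\<lambda>u::real. 1 / (\<beta>\<^sup>2 + u\<^sup>2))"
proof -
  have "integrable lborel (\<lambda>x::real. inverse (1 + x\<^sup>2))"
    using integrable_inverse_1_plus_square by (simp add: set_integrable_def einterval_eq_UNIV)
  hence "integrable lborel (\<lambda>x. inverse (1 + (0 + (1 / \<beta>) * x)\<^sup>2))"
    by (rule lborel_integrable_real_affine) (use assms in simp)
  hence "integrable lborel (\<lambda>x. (1 / \<beta>\<^sup>2) * inverse (1 + (0 + (1 / \<beta>) * x)\<^sup>2))" by (rule integrable_mult_right)
  moreover have "(1 / \<beta>\<^sup>2) * inverse (1 + (0 + (1 / \<beta>) * x)\<^sup>2) = 1 / (\<beta>\<^sup>2 + x\<^sup>2)" for x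
  proof -
    have "\<beta>\<^sup>2 + x\<^sup>2 \<noteq> 0" "1 + (x / \<beta>)\<^sup>2 \<noteq> 0" using assms by (auto simp: add_nonneg_eq_0_iff sum_power2_eq_zero_iff)
    thus ?thesis using assms by (simp add: field_simps)
  qed
  ultimately show ?thesis by simp
qed

lemma gaussian_fourier:
  assumes \<sigma>: "0 < \<sigma>"
  shows "integrable lborel (\<lambda>u. iexp (u * t) * of_real (exp (- (\<sigma> * u)\<^sup>2 / 2)))" (is ?I)
    and "(\<integral>u. iexp (u * t) * of_real (exp (- (\<sigma> * u)\<^sup>2 / 2)) \<partial>lborel) = of_real (2 * pi * normal_density 0 \<sigma> t)" (is ?V)
proof -
  define g where "g v = iexp (v * (t / \<sigma>)) * of_real (exp (- v\<^sup>2 / 2))" for v :: real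
  have g: "g v = of_real (sqrt (2 * pi)) * (std_normal_density v *\<^sub>R iexp ((t / \<sigma>) * v))" for v
    by (simp add: g_def std_normal_density_def scaleR_conv_of_real mult_ac)
  have I1: "integrable lborel (\<lambda>v. std_normal_density v *\<^sub>R iexp ((t / \<sigma>) * v))"
    by (rule Bochner_Integration.integrable_bound[of _ "std_normal_density"]) auto
  hence Ig: "integrable lborel g" unfolding g by (rule integrable_mult_right)
  have "(\<integral>v. g v \<partial>lborel) = of_real (sqrt (2 * pi)) * (\<integral>v. std_normal_density v *\<^sub>R iexp ((t / \<sigma>) * v) \<partial>lborel)"
    unfolding g by (rule Bochner_Integration.integral_mult_right[OF I1])
  also have "(\<integral>v. std_normal_density v *\<^sub>R iexp ((t / \<sigma>) * v) \<partial>lborel) = char std_normal_distribution (t / \<sigma>)"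
    unfolding char_def by (subst integral_density) auto
  also have "char std_normal_distribution (t / \<sigma>) = of_real (exp (- (t / \<sigma>)\<^sup>2 / 2))"
    by (simp add: char_std_normal_distribution)
  finally have Vg: "(\<integral>v. g v \<partial>lborel) = of_real (sqrt (2 * pi) * exp (- (t / \<sigma>)\<^sup>2 / 2))" by simp
  have gu: "iexp (u * t) * of_real (exp (- (\<sigma> * u)\<^sup>2 / 2)) = g (0 + \<sigma> * u)" for u
    using \<sigma> by (simp add: g_def)
  show ?I unfolding gu by (rule lborel_integrable_real_affine[OF Ig]) (use \<sigma> in simp)
  have "(\<integral>v. g v \<partial>lborel) = \<bar>\<sigma>\<bar> *\<^sub>R (\<integral>u. g (0 + \<sigma> * u) \<partial>lborel)"
    by (rule lborel_integral_real_affine) (use \<sigma> in simp)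
  hence "(\<integral>u. g (0 + \<sigma> * u) \<partial>lborel) = of_real (sqrt (2 * pi) * exp (- (t / \<sigma>)\<^sup>2 / 2)) / of_real \<sigma>"
    unfolding Vg using \<sigma> by (simp add: scaleR_conv_of_real field_simps)
  also have "\<dots> = of_real (sqrt (2 * pi) * exp (- (t / \<sigma>)\<^sup>2 / 2) / \<sigma>)" by simp
  also have "sqrt (2 * pi) * exp (- (t / \<sigma>)\<^sup>2 / 2) / \<sigma> = 2 * pi * normal_density 0 \<sigma> t"
  proof -
    have "2 * pi = sqrt (2 * pi) * sqrt (2 * pi)" by simp
    hence "2 * pi * (1 / (sqrt (2 * pi) * \<sigma>)) = sqrt (2 * pi) / \<sigma>" using \<sigma> by (simp add: field_simps)
    moreover have "normal_density 0 \<sigma> t = 1 / (sqrt (2 * pi) * \<sigma>) * exp (- (t / \<sigma>)\<^sup>2 / 2)"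
      using \<sigma> by (simp add: normal_density_def real_sqrt_mult power_divide)
    ultimately show ?thesis by (metis (no_types, lifting) mult.assoc times_divide_eq_left)
  qed
  finally show ?V unfolding gu .
qed

text \<open>Damping the outer integral by a Gaussian makes Fubini applicable, and the inner integral becomes a Gaussian density:
the damped integral is an average of \<open>h\<close> around \<open>x\<close> on the scale \<open>\<sigma>\<close>. Both sides converge as
\<open>\<sigma>\<close> tends to \<open>0\<close>, by integrability of \<open>H\<close> and by continuity of \<open>h\<close> at \<open>x\<close> respectively.\<close>

lemma fourier_inversion_at_continuity_point:
  fixes h :: "real \<Rightarrow> real"
  assumes I: "integrable lborel h" and bdd: "\<And>y. \<bar>h y\<bar> \<le> B" and cont: "isCont h x"
    and H: "\<And>u. H u = (\<integral>y. iexp (- (u * y)) * of_real (h y) \<partial>lborel)" and IH: "integrable lborel H"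
  shows "(\<integral>u. iexp (u * x) * H u \<partial>lborel) = of_real (2 * pi * h x)"
proof (rule LIMSEQ_unique)
  have hm[measurable]: "h \<in> borel_measurable borel" using I by auto
  have Hm[measurable]: "H \<in> borel_measurable borel" using IH by auto
  define \<sigma> where "\<sigma> k = 1 / real (Suc k)" for k
  have \<sigma>: "0 < \<sigma> k" for k by (simp add: \<sigma>_def)
  have \<sigma>0: "\<sigma> \<longlonglongrightarrow> 0" unfolding \<sigma>_def by (rule LIMSEQ_Suc[OF lim_const_over_n])
  define A where "A k = (\<integral>u. iexp (u * x) * of_real (exp (- (\<sigma> k * u)\<^sup>2 / 2)) * H u \<partial>lborel)" for k
  show "A \<longlonglongrightarrow> (\<integral>u. iexp (u * x) * H u \<partial>lborel)"
    unfolding A_def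
  proof (rule integral_dominated_convergence[where w="\<lambda>u. norm (H u)"])
    show "integrable lborel (\<lambda>u. norm (H u))" using IH by simp
    show "AE u in lborel. norm (iexp (u * x) * of_real (exp (- (\<sigma> k * u)\<^sup>2 / 2)) * H u) \<le> norm (H u)" for k
      by (auto simp: norm_mult intro!: mult_left_le_one_le)
    have "(\<lambda>k. iexp (u * x) * of_real (exp (- (\<sigma> k * u)\<^sup>2 / 2)) * H u) \<longlonglongrightarrow> iexp (u * x) * of_real (exp (- (0 * u)\<^sup>2 / 2)) * H u" for u
      by (intro tendsto_intros \<sigma>0) auto
    thus "AE u in lborel. (\<lambda>k. iexp (u * x) * of_real (exp (- (\<sigma> k * u)\<^sup>2 / 2)) * H u) \<longlonglongrightarrow> iexp (u * x) * H u" by simp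
  qed auto
  have A: "A k = of_real (2 * pi * (\<integral>v. h (x + \<sigma> k * v) * std_normal_density v \<partial>lborel))" for k
  proof -
    define F where "F u y = iexp (u * (x - y)) * of_real (exp (- (\<sigma> k * u)\<^sup>2 / 2)) * of_real (h y)" for u y
    have nF: "norm (F u y) = exp (- (\<sigma> k * u)\<^sup>2 / 2) * \<bar>h y\<bar>" for u y by (simp add: F_def norm_mult)
    have Ig: "integrable lborel (\<lambda>u. exp (- (\<sigma> k * u)\<^sup>2 / 2))"
    proof -
      have "integrable lborel (\<lambda>u. norm (iexp (u * 0) * complex_of_real (exp (- (\<sigma> k * u)\<^sup>2 / 2))))"
        by (intro integrable_norm gaussian_fourier(1) \<sigma>)
      thus ?thesis by (simp add: norm_mult)
    qed
    have int: "integrable (lborel \<Otimes>\<^sub>M lborel) (case_prod F)"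
    proof (rule lborel_pair.Fubini_integrable)
      show "case_prod F \<in> borel_measurable (lborel \<Otimes>\<^sub>M lborel)" unfolding F_def[abs_def] by measurable
      show "integrable lborel (\<lambda>u. \<integral>y. norm (case_prod F (u, y)) \<partial>lborel)"
        using Ig by (simp add: nF)
      have "integrable lborel (\<lambda>y. F u y)" for u
        by (rule Bochner_Integration.integrable_bound[OF I])
          (auto simp: F_def norm_mult intro!: mult_left_le_one_le)
      thus "AE u in lborel. integrable lborel (\<lambda>y. case_prod F (u, y))" by simp
    qed
    have Ih: "integrable lborel (\<lambda>y. iexp (- (u * y)) * complex_of_real (h y))" for u
      by (rule Bochner_Integration.integrable_bound[OF I]) (auto simp: norm_mult)
    have "A k = (\<integral>u. (\<integral>y. F u y \<partial>lborel) \<partial>lborel)"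
      unfolding A_def
    proof (rule Bochner_Integration.integral_cong)
      fix u :: real
      have "iexp (u * x) * of_real (exp (- (\<sigma> k * u)\<^sup>2 / 2)) * H u =
         (\<integral>y. iexp (u * x) * of_real (exp (- (\<sigma> k * u)\<^sup>2 / 2)) * (iexp (- (u * y)) * of_real (h y)) \<partial>lborel)"
        unfolding H by (rule Bochner_Integration.integral_mult_right[OF Ih, symmetric])
      also have "\<dots> = (\<integral>y. F u y \<partial>lborel)"
        by (rule Bochner_Integration.integral_cong) (auto simp: F_def exp_add[symmetric] exp_diff exp_minus field_simps)
      finally show "iexp (u * x) * of_real (exp (- (\<sigma> k * u)\<^sup>2 / 2)) * H u = (\<integral>y. F u y \<partial>lborel)" .
    qed simp
    also have "\<dots> = (\<integral>y. (\<integral>u. F u y \<partial>lborel) \<partial>lborel)"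
      by (rule lborel_pair.Fubini_integral[OF int, symmetric])
    also have "\<dots> = (\<integral>y. of_real (2 * pi * (h y * normal_density 0 (\<sigma> k) (x - y))) \<partial>lborel)"
    proof (rule Bochner_Integration.integral_cong)
      fix y :: real
      have "(\<integral>u. F u y \<partial>lborel) = of_real (2 * pi * normal_density 0 (\<sigma> k) (x - y)) * of_real (h y)"
        unfolding F_def by (subst gaussian_fourier(2)[OF \<sigma>, symmetric], rule Bochner_Integration.integral_mult_left[OF gaussian_fourier(1)[OF \<sigma>]])
      thus "(\<integral>u. F u y \<partial>lborel) = of_real (2 * pi * (h y * normal_density 0 (\<sigma> k) (x - y)))" by (simp add: mult_ac)
    qed simp
    also have "\<dots> = of_real (\<integral>y. 2 * pi * (h y * normal_density 0 (\<sigma> k) (x - y)) \<partial>lborel)" by (rule integral_complex_of_real)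
    also have "(\<integral>y. 2 * pi * (h y * normal_density 0 (\<sigma> k) (x - y)) \<partial>lborel) = 2 * pi * (\<integral>y. h y * normal_density 0 (\<sigma> k) (x - y) \<partial>lborel)"
      by simp
    also have "(\<integral>y. h y * normal_density 0 (\<sigma> k) (x - y) \<partial>lborel) = \<bar>\<sigma> k\<bar> *\<^sub>R (\<integral>v. h (x + \<sigma> k * v) * normal_density 0 (\<sigma> k) (x - (x + \<sigma> k * v)) \<partial>lborel)"
      by (rule lborel_integral_real_affine) (use \<sigma>[of k] in simp)
    also have "\<dots> = (\<integral>v. \<sigma> k * (h (x + \<sigma> k * v) * normal_density 0 (\<sigma> k) (x - (x + \<sigma> k * v))) \<partial>lborel)"
      using \<sigma>[of k] by simp
    also have "\<dots> = (\<integral>v. h (x + \<sigma> k * v) * std_normal_density v \<partial>lborel)"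
    proof (rule Bochner_Integration.integral_cong)
      fix v
      have "\<sigma> k * normal_density 0 (\<sigma> k) (x - (x + \<sigma> k * v)) = std_normal_density v"
        using \<sigma>[of k] by (simp add: normal_density_def real_sqrt_mult power_mult_distrib)
      thus "\<sigma> k * (h (x + \<sigma> k * v) * normal_density 0 (\<sigma> k) (x - (x + \<sigma> k * v))) = h (x + \<sigma> k * v) * std_normal_density v"
        by (metis mult.assoc mult.commute)
    qed simp
    finally show ?thesis .
  qed
  have "(\<lambda>k. \<integral>v. h (x + \<sigma> k * v) * std_normal_density v \<partial>lborel) \<longlonglongrightarrow> (\<integral>v. h x * std_normal_density v \<partial>lborel)"
  proof (rule integral_dominated_convergence[where w="\<lambda>v. B * std_normal_density v"])
    show "AE v in lborel. norm (h (x + \<sigma> k * v) * std_normal_density v) \<le> B * std_normal_density v" for k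
      using bdd by (auto simp: abs_mult intro!: mult_right_mono)
    have "(\<lambda>k. h (x + \<sigma> k * v)) \<longlonglongrightarrow> h x" for v
    proof (rule isCont_tendsto_compose[OF cont])
      have "(\<lambda>k. x + \<sigma> k * v) \<longlonglongrightarrow> x + 0 * v" by (intro tendsto_intros \<sigma>0)
      thus "(\<lambda>k. x + \<sigma> k * v) \<longlonglongrightarrow> x" by simp
    qed
    thus "AE v in lborel. (\<lambda>k. h (x + \<sigma> k * v) * std_normal_density v) \<longlonglongrightarrow> h x * std_normal_density v"
      by (auto intro!: tendsto_mult_right)
  qed auto
  hence "(\<lambda>k. complex_of_real (2 * pi * (\<integral>v. h (x + \<sigma> k * v) * std_normal_density v \<partial>lborel))) \<longlonglongrightarrow> of_real (2 * pi * (\<integral>v. h x * std_normal_density v \<partial>lborel))"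
    by (intro tendsto_intros)
  moreover have "(\<integral>v. h x * std_normal_density v \<partial>lborel) = h x" by simp
  ultimately show "A \<longlonglongrightarrow> of_real (2 * pi * h x)" by (simp only: ext[of A, OF A])
qed

lemma laplace_ramp:
  fixes \<mu> :: complex
  assumes "0 < Re \<mu>"
  shows "integrable lborel (\<lambda>y. of_real (max 0 y) * exp (- \<mu> * of_real y))"
    "(\<integral>y. of_real (max 0 y) * exp (- \<mu> * of_real y) \<partial>lborel) = 1 / \<mu>\<^sup>2"
proof -
  let ?f = "\<lambda>y. of_real (max 0 y) * exp (- \<mu> * of_real y)"
  have \<mu>: "\<mu> \<noteq> 0" using assms by auto
  have "integrable lborel (erlang_density 1 (Re \<mu>))"
    by (rule integrableI_nonneg) (use assms nn_integral_erlang_ith_moment[OF assms, of 1 0] in auto)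
  hence "integrable lborel (\<lambda>y. (1 / (Re \<mu>)\<^sup>2) * erlang_density 1 (Re \<mu>) y)" by (rule integrable_mult_right)
  moreover have n: "norm (?f y) = (1 / (Re \<mu>)\<^sup>2) * erlang_density 1 (Re \<mu>) y" for y
    using assms by (auto simp: erlang_density_def norm_mult norm_exp_eq_Re power2_eq_square max_def)
  ultimately show I: "integrable lborel ?f"
    using assms by (intro Bochner_Integration.integrable_bound[where g="?f" and f="\<lambda>y. (1 / (Re \<mu>)\<^sup>2) * erlang_density 1 (Re \<mu>) y"]) auto
  define F where "F y = - ((of_real y / \<mu> + 1 / \<mu>\<^sup>2) * exp (- \<mu> * of_real y))" for y :: real
  have fin: "(\<integral>y. indicator {..T} y *\<^sub>R ?f y \<partial>lborel) = F T - F 0" if T: "0 \<le> T" for T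
  proof -
    have "(\<integral>y. indicator {..T} y *\<^sub>R ?f y \<partial>lborel) = (\<integral>y. indicator {0..T} y *\<^sub>R (of_real y * exp (- \<mu> * of_real y)) \<partial>lborel)"
      by (rule Bochner_Integration.integral_cong) (auto simp: indicator_def)
    also have "\<dots> = F T - F 0"
    proof (rule integral_FTC_Icc[OF T])
      fix y assume "0 \<le> y" "y \<le> T"
      have "((\<lambda>z. - ((z / \<mu> + 1 / \<mu>\<^sup>2) * exp (- \<mu> * z))) has_field_derivative (of_real y * exp (- \<mu> * of_real y))) (at (of_real y))"
        using \<mu> by (auto intro!: derivative_eq_intros simp: field_simps power2_eq_square)
      from has_vector_derivative_real_field[OF this]
      show "(F has_vector_derivative of_real y * exp (- \<mu> * of_real y)) (at y within {0..T})" by (simp add: F_def[abs_def])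
    qed (auto intro!: continuous_intros)
    finally show ?thesis .
  qed
  have "(F \<longlongrightarrow> 0) at_top"
  proof (rule Lim_null_comparison)
    have "((\<lambda>y. (y / norm \<mu> + 1 / (norm \<mu>)\<^sup>2) * exp (- Re \<mu> * y)) \<longlongrightarrow> 0) at_top" using assms \<mu> by real_asymp
    thus "((\<lambda>y. (\<bar>y\<bar> / norm \<mu> + 1 / (norm \<mu>)\<^sup>2) * exp (- Re \<mu> * y)) \<longlongrightarrow> 0) at_top"
      by (rule Lim_transform_eventually) (use eventually_ge_at_top[of "0::real"] in eventually_elim, simp)
    show "\<forall>\<^sub>F y in at_top. norm (F y) \<le> (\<bar>y\<bar> / norm \<mu> + 1 / (norm \<mu>)\<^sup>2) * exp (- Re \<mu> * y)"
    proof (intro always_eventually allI)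
      fix y :: real
      have "norm (of_real y / \<mu> + 1 / \<mu>\<^sup>2) \<le> \<bar>y\<bar> / norm \<mu> + 1 / (norm \<mu>)\<^sup>2"
        by (rule order.trans[OF norm_triangle_ineq]) (simp add: norm_divide norm_power)
      thus "norm (F y) \<le> (\<bar>y\<bar> / norm \<mu> + 1 / (norm \<mu>)\<^sup>2) * exp (- Re \<mu> * y)"
        by (auto simp: F_def norm_mult norm_exp_eq_Re intro!: mult_right_mono)
    qed
  qed
  hence "((\<lambda>T. F T - F 0) \<longlongrightarrow> 0 - F 0) at_top" by (intro tendsto_intros)
  moreover have "\<forall>\<^sub>F T in at_top. F T - F 0 = (\<integral>y. indicator {..T} y *\<^sub>R ?f y \<partial>lborel)"
    using eventually_ge_at_top[of "0::real"] by eventually_elim (simp only: fin)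
  ultimately have "((\<lambda>T. \<integral>y. indicator {..T} y *\<^sub>R ?f y \<partial>lborel) \<longlongrightarrow> 0 - F 0) at_top" by (rule Lim_transform_eventually)
  moreover have "((\<lambda>T. \<integral>y. indicator {..T} y *\<^sub>R ?f y \<partial>lborel) \<longlongrightarrow> (\<integral>y. ?f y \<partial>lborel)) at_top"
    by (rule tendsto_integral_at_top[OF _ I]) simp
  ultimately have "(\<integral>y. ?f y \<partial>lborel) = 0 - F 0" by (rule tendsto_unique[OF trivial_limit_at_top_linorder, rotated])
  thus "(\<integral>y. ?f y \<partial>lborel) = 1 / \<mu>\<^sup>2" by (simp add: F_def)
qed

lemma norm_beta_iu: "(norm (of_real \<beta> + \<i> * of_real u))\<^sup>2 = \<beta>\<^sup>2 + u\<^sup>2"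
  by (simp add: cmod_power2)

text \<open>Fourier inversion of \<open>max 0 y * exp (- \<beta> y)\<close>, whose transform is \<open>1 / (\<beta> + \<i> u)\<^sup>2\<close>.\<close>

lemma laplace_inversion_ramp:
  assumes \<beta>: "0 < \<beta>"
  shows "integrable lborel (\<lambda>u. exp ((of_real \<beta> + \<i> * of_real u) * of_real x) / (of_real \<beta> + \<i> * of_real u)\<^sup>2)"
    "(\<integral>u. exp ((of_real \<beta> + \<i> * of_real u) * of_real x) / (of_real \<beta> + \<i> * of_real u)\<^sup>2 \<partial>lborel) = of_real (2 * pi * max 0 x)"
proof -
  define H where "H u = 1 / (of_real \<beta> + \<i> * of_real u)\<^sup>2" for u :: real
  define h where "h y = max 0 y * exp (- \<beta> * y)" for y
  have hc: "continuous_on UNIV h" unfolding h_def by (intro continuous_intros)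
  have IH: "integrable lborel H"
  proof (rule Bochner_Integration.integrable_bound[OF integrable_inverse_quadratic[OF \<beta>]])
    show "H \<in> borel_measurable lborel" unfolding H_def by measurable
    show "AE u in lborel. norm (H u) \<le> norm (1 / (\<beta>\<^sup>2 + u\<^sup>2))"
      by (simp add: H_def norm_divide norm_power norm_beta_iu)
  qed
  have "integrable lborel (\<lambda>y. norm (of_real (max 0 y) * exp (- complex_of_real \<beta> * of_real y)))"
    by (intro integrable_norm laplace_ramp(1)) (use \<beta> in simp)
  hence Ih: "integrable lborel h"
    by (simp add: h_def[abs_def] norm_mult norm_exp_eq_Re)
  have H: "H u = (\<integral>y. iexp (- (u * y)) * of_real (h y) \<partial>lborel)" for u
  proof -
    have "(\<integral>y. of_real (max 0 y) * exp (- (of_real \<beta> + \<i> * of_real u) * of_real y) \<partial>lborel) = H u"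
      unfolding H_def by (rule laplace_ramp(2)) (use \<beta> in simp)
    moreover have "of_real (max 0 y) * exp (- (of_real \<beta> + \<i> * of_real u) * of_real y) = iexp (- (u * y)) * of_real (h y)" for y
      by (simp add: h_def exp_of_real[symmetric] exp_add[symmetric] algebra_simps)
    ultimately show ?thesis by simp
  qed
  have hb: "\<bar>h y\<bar> \<le> 1 / \<beta>" for y
  proof (cases "y \<le> 0")
    case False
    have "\<beta> * y \<le> exp (\<beta> * y)" using exp_ge_add_one_self[of "\<beta> * y"] by linarith
    hence "y * exp (- \<beta> * y) * \<beta> \<le> 1" by (simp add: exp_minus field_simps)
    thus ?thesis using False \<beta> by (simp add: h_def pos_le_divide_eq)
  qed (use \<beta> in \<open>simp add: h_def\<close>)
  have eq: "exp ((of_real \<beta> + \<i> * of_real u) * of_real x) / (of_real \<beta> + \<i> * of_real u)\<^sup>2 = of_real (exp (\<beta> * x)) * (iexp (u * x) * H u)" for u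
    by (simp add: H_def exp_of_real[symmetric] exp_add[symmetric] algebra_simps)
  have "integrable lborel (\<lambda>u. iexp (u * x) * H u)"
    by (rule Bochner_Integration.integrable_bound[OF IH]) (use IH in \<open>auto simp: norm_mult\<close>)
  thus "integrable lborel (\<lambda>u. exp ((of_real \<beta> + \<i> * of_real u) * of_real x) / (of_real \<beta> + \<i> * of_real u)\<^sup>2)"
    unfolding eq by (rule integrable_mult_right)
  have "(\<integral>u. iexp (u * x) * H u \<partial>lborel) = of_real (2 * pi * h x)"
    by (rule fourier_inversion_at_continuity_point[OF Ih hb _ H IH]) (use hc in \<open>simp add: continuous_on_eq_continuous_at\<close>)
  hence "(\<integral>u. exp ((of_real \<beta> + \<i> * of_real u) * of_real x) / (of_real \<beta> + \<i> * of_real u)\<^sup>2 \<partial>lborel) = of_real (exp (\<beta> * x)) * of_real (2 * pi * h x)"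
    unfolding eq by simp
  also have "\<dots> = of_real (2 * pi * max 0 x)" by (simp add: h_def exp_minus field_simps)
  finally show "(\<integral>u. exp ((of_real \<beta> + \<i> * of_real u) * of_real x) / (of_real \<beta> + \<i> * of_real u)\<^sup>2 \<partial>lborel) = of_real (2 * pi * max 0 x)" .
qed

section \<open>The Laplace transform of the area near the saddle point\<close>

locale bdi_family =
  fixes a b c \<theta> :: real and Pr :: "nat \<Rightarrow> 'w measure" and X :: "real \<Rightarrow> 'w \<Rightarrow> nat" and K :: "real \<Rightarrow> nat \<Rightarrow> nat pmf"
  assumes a: "0 < a" and b: "0 < b" and c: "0 < c" and bc: "b < c" and \<theta>0: "0 < \<theta>" and \<theta>1: "\<theta> < a / (c - b)"
    and K: "transition_semigroup K" "has_transition_rates K (bdi_rates a b c)"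
    and M: "\<And>m. markov_with (Pr m) X K m"
begin

definition r where "r = bdi_r a b c \<theta>"
definition \<beta> where "\<beta> = bdi_beta a b c \<theta>"
definition E where "E = a * (1 - r)"
definition v where "v = bdi_v a b c \<theta>"

lemma r_sq: "r\<^sup>2 = c * \<theta> / (a + b * \<theta>)" "r\<^sup>2 * (a + b * \<theta>) = c * \<theta>"
proof -
  have "0 < a + b * \<theta>" using a b \<theta>0 by (simp add: add_pos_pos)
  thus "r\<^sup>2 = c * \<theta> / (a + b * \<theta>)" "r\<^sup>2 * (a + b * \<theta>) = c * \<theta>" using c \<theta>0 by (auto simp: r_def bdi_r_def)
qed

lemma r_pos: "0 < r"
  using a b c \<theta>0 by (simp add: r_def bdi_r_def add_pos_pos)

lemma r_lt1: "r < 1"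
proof -
  have "\<theta> * (c - b) < a" using \<theta>1 bc by (simp add: pos_less_divide_eq)
  hence "c * \<theta> < a + b * \<theta>" by (simp add: algebra_simps)
  hence "r\<^sup>2 < 1" using a b \<theta>0 by (simp add: r_sq(1) add_pos_pos)
  hence "r\<^sup>2 < 1\<^sup>2" by simp
  thus ?thesis by (rule power2_less_imp_less) simp
qed

lemma br2: "b * r\<^sup>2 < c"
proof -
  have "b * r\<^sup>2 * (a + b * \<theta>) < c * (a + b * \<theta>)"
  proof -
    have "b * r\<^sup>2 * (a + b * \<theta>) = b * (c * \<theta>)" by (simp only: r_sq(2)[symmetric] mult.assoc)
    also have "\<dots> < c * (a + b * \<theta>)" using a c by (simp add: algebra_simps)
    finally show ?thesis .
  qed
  thus ?thesis using a b \<theta>0 by (simp add: add_pos_pos mult_less_cancel_right)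
qed

lemma br: "b * r < c" using b bc r_lt1 by (smt (verit) mult_left_le r_pos)

lemma theta_eq: "\<theta> = a * r\<^sup>2 / (c - b * r\<^sup>2)"
proof -
  have "\<theta> * (c - b * r\<^sup>2) = a * r\<^sup>2" using r_sq(2) by (simp add: algebra_simps)
  thus ?thesis using br2 by (simp add: field_simps)
qed

lemma beta_root: "b * r + c / r = b + c + \<beta>" by (simp add: \<beta>_def bdi_beta_def r_def)

lemma beta_pos: "0 < \<beta>"
proof -
  have "\<beta> = (1 - r) * (c - b * r) / r" using beta_root r_pos by (simp add: field_simps)
  thus ?thesis using r_lt1 br r_pos by simp
qed

text \<open>The rate function as the Legendre transform of the ground state energy, evaluated at its critical point.\<close>

lemma I_eq: "bdi_I a b c \<theta> = E - \<beta> * \<theta>"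
proof -
  define A where "A = a + b * \<theta>"
  have A: "0 < A" using a b \<theta>0 by (simp add: A_def add_pos_pos)
  have rA: "c * \<theta> = r\<^sup>2 * A" using r_sq(2) by (simp add: A_def)
  have "sqrt (c * \<theta>) = r * sqrt A" using r_pos by (simp add: rA real_sqrt_mult)
  hence "bdi_I a b c \<theta> = (sqrt A - r * sqrt A)\<^sup>2" by (simp add: bdi_I_def A_def)
  also have "sqrt A - r * sqrt A = (1 - r) * sqrt A" by (simp add: algebra_simps)
  also have "((1 - r) * sqrt A)\<^sup>2 = A * (1 - r)\<^sup>2" using A by (simp add: power_mult_distrib)
  also have "\<dots> = A + r\<^sup>2 * A - r * A - (r\<^sup>2 * A) / r" using r_pos by (simp add: field_simps power2_eq_square)
  also have "\<dots> = E - \<beta> * \<theta>"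
    unfolding rA[symmetric] using r_pos by (simp add: \<beta>_def bdi_beta_def r_def[symmetric] E_def A_def field_simps)
  finally show ?thesis .
qed

lemma v_eq: "v = 2 * (a * c * r ^ 3 / (c - b * r\<^sup>2) ^ 3)" by (simp add: v_def bdi_v_def r_def)

lemma v_pos: "0 < v" using a c r_pos br2 by (simp add: v_eq)

abbreviation root where "root \<equiv> ric_root b c r"

lemmas root = ric_root[OF b r_pos br2]
lemmas root_data = ric_root_data[OF b r_pos br2 bc r_lt1]

definition \<phi> :: "real \<Rightarrow> nat \<Rightarrow> real \<Rightarrow> complex" where
  "\<phi> T n u = (\<integral>\<omega>. exp (- (of_real \<beta> + \<i> * of_real u) * of_real (time_integral X T \<omega>)) \<partial>Pr n)"

text \<open>The part of the transform \<open>\<phi>\<close> that remains after the exponential factor \<open>exp (- a (1 - r(u)) T)\<close> is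
removed. It is bounded in \<open>T\<close> and \<open>u\<close>.\<close>

definition bounded_part :: "real \<Rightarrow> nat \<Rightarrow> real \<Rightarrow> complex" where
  "bounded_part T n u = exp (- (of_real a / of_real b) * (Ln (1 - ric_w b c (root u) 1 T) - Ln (1 - ric_q b c (root u) 1)))
      * ric_rho b c (root u) 1 T ^ n"

lemma prob_Pr: "prob_space (Pr n)" using M[of n] by (simp add: markov_with_def)

lemma cadlag: "\<omega> \<in> space (Pr n) \<Longrightarrow> cadlag_path (\<lambda>t. X t \<omega>)" using M[of n] by (simp add: markov_with_def)

lemma X_meas: "0 \<le> t \<Longrightarrow> X t \<in> measurable (Pr n) (count_space UNIV)" by (rule measurable_markov[OF M])

lemma A_meas[measurable]: "time_integral X T \<in> borel_measurable (Pr n)"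
proof (cases "0 \<le> T")
  case True
  have p: "pth {0..} X \<in> measurable (Pr n) (paths {0..})" by (rule pth_measurable) (auto intro: X_meas)
  have "(\<lambda>\<omega>. area T (pth {0..} X \<omega>)) \<in> borel_measurable (Pr n)"
    by (rule measurable_compose[OF p area_measurable]) (use True in auto)
  moreover have "area T (pth {0..} X \<omega>) = time_integral X T \<omega>" if "\<omega> \<in> space (Pr n)" for \<omega>
    by (rule area_pth(1)[where X=X, OF cadlag[OF that] True]) auto
  ultimately show ?thesis by (simp cong: measurable_cong)
next
  case False thus ?thesis by (simp add: time_integral_def[abs_def])
qed

lemma A_nonneg: "0 \<le> time_integral X T \<omega>"
  unfolding time_integral_def
  by (cases "(\<lambda>s. real (X s \<omega>)) integrable_on {0..T}") (auto intro!: integral_nonneg simp: not_integrable_integral)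

lemma root_eq: "of_real b * root u + of_real c / root u = of_real b + of_real c + (of_real \<beta> + \<i> * of_real u)"
  using root(2)[of u] by (simp add: beta_root)

lemma phi_formula:
  assumes T: "0 \<le> T"
  shows "\<phi> T n u = ric_alpha a b c (root u) 1 T * ric_rho b c (root u) 1 T ^ n"
proof -
  have "(\<integral>\<omega>. exp (- (of_real \<beta> + \<i> * of_real u) * time_integral X T \<omega>) * 1 ^ X T \<omega> \<partial>Pr n)
     = ric_alpha a b c (root u) 1 T * ric_rho b c (root u) 1 T ^ n"
    by (rule feynman_kac_generating_function[OF K M]) (use a b bc beta_pos T root_data root_eq in auto)
  thus ?thesis by (simp add: \<phi>_def)
qed

text \<open>For complex \<open>\<kappa>\<close> the Moebius coordinate spirals, so the disc argument for \<open>r = 1\<close> is not available;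
the bound is inherited from the splitting scheme.\<close>

lemma rho_le1: assumes T: "0 \<le> T" shows "norm (ric_rho b c (root u) 1 T) \<le> 1"
proof -
  have "(\<lambda>N. split_step a b c (of_real \<beta> + \<i> * of_real u) (T / real (Suc N)) 1 (Suc N)) \<longlonglongrightarrow> (ric_rho b c (root u) 1 T, ric_alpha a b c (root u) 1 T)"
    by (rule split_step_tendsto) (use a b bc beta_pos T root_data root_eq in auto)
  hence "(\<lambda>N. norm (fst (split_step a b c (of_real \<beta> + \<i> * of_real u) (T / real (Suc N)) 1 (Suc N)))) \<longlonglongrightarrow> norm (ric_rho b c (root u) 1 T)"
    by (auto dest!: tendsto_fst intro!: tendsto_norm simp del: split_step.simps)
  hence "norm (ric_rho b c (root u) 1 T) \<le> norm (1::complex)"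
  proof (rule LIMSEQ_le_const2)
    have "split_step a b c (of_real \<beta> + \<i> * of_real u) (T / real (Suc N)) 1 (Suc N) \<in> bidisk 1" for N
      by (rule split_step_bidisk) (use a b bc beta_pos T in auto)
    thus "\<exists>N. \<forall>n\<ge>N. norm (fst (split_step a b c (of_real \<beta> + \<i> * of_real u) (T / real (Suc n)) 1 (Suc n))) \<le> norm (1::complex)"
      by (auto simp: bidisk_def simp del: split_step.simps)
  qed
  thus ?thesis by simp
qed

lemma bounded_part_bound:
  assumes T: "0 \<le> T" shows "norm (bounded_part T n u) \<le> exp (a / b * ln (2 / (1 - r)))"
proof -
  define q w where "q = ric_q b c (root u) 1" and "w = ric_w b c (root u) 1 T"
  have q: "norm q \<le> r" "norm q < 1" using root_data(2)[of u] r_lt1 by (auto simp: q_def)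
  have w: "norm w \<le> r" "norm w < 1" using ric_w_le[OF root_data(1) T, of u] q(1) r_lt1 by (auto simp: q_def w_def)
  have nz: "1 - q \<noteq> 0" "1 - w \<noteq> 0" using one_minus_notin_nonpos(2) q w by auto
  have "1 - r \<le> norm (1 - w)" using norm_triangle_ineq2[of 1 w] w by simp
  moreover have "norm (1 - q) \<le> 2" using norm_triangle_ineq4[of 1 q] q by simp
  ultimately have "ln (norm (1 - q)) - ln (norm (1 - w)) \<le> ln 2 - ln (1 - r)"
    using nz r_lt1 by (intro diff_mono) auto
  hence "a / b * (ln (norm (1 - q)) - ln (norm (1 - w))) \<le> a / b * ln (2 / (1 - r))"
    using a b r_lt1 by (intro mult_left_mono) (auto simp: ln_div)
  moreover have "Re (- (of_real a / of_real b) * (Ln (1 - w) - Ln (1 - q))) = a / b * (ln (norm (1 - q)) - ln (norm (1 - w)))"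
    using nz by (simp add: algebra_simps flip: of_real_divide)
  ultimately have "norm (exp (- (of_real a / of_real b) * (Ln (1 - w) - Ln (1 - q)))) \<le> exp (a / b * ln (2 / (1 - r)))"
    by (simp only: norm_exp_eq_Re exp_le_cancel_iff)
  moreover have "norm (ric_rho b c (root u) 1 T ^ n) \<le> 1" using rho_le1[OF T] by (simp add: norm_power power_le_one)
  ultimately have "norm (exp (- (of_real a / of_real b) * (Ln (1 - w) - Ln (1 - q)))) * norm (ric_rho b c (root u) 1 T ^ n) \<le> exp (a / b * ln (2 / (1 - r))) * 1"
    by (intro mult_mono) auto
  thus ?thesis by (simp add: bounded_part_def norm_mult q_def w_def)
qed

text \<open>The exponent per unit of time, normalised to vanish at the saddle point \<open>u = 0\<close>.\<close>

definition \<eta> :: "real \<Rightarrow> complex" where "\<eta> u = of_real a * (root u - of_real r) + \<i> * of_real u * of_real \<theta>"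

lemma phi_eq:
  assumes T: "0 \<le> T"
  shows "exp ((of_real E + \<i> * of_real u * of_real \<theta>) * of_real T) * \<phi> T n u = exp (of_real T * \<eta> u) * bounded_part T n u"
proof -
  have "exp ((of_real E + \<i> * of_real u * of_real \<theta>) * of_real T) * ric_alpha a b c (root u) 1 T =
     exp (of_real T * \<eta> u) * exp (- (of_real a / of_real b) * (Ln (1 - ric_w b c (root u) 1 T) - Ln (1 - ric_q b c (root u) 1)))"
    unfolding ric_alpha_def exp_add[symmetric]
    by (rule arg_cong[where f=exp]) (simp add: \<eta>_def E_def algebra_simps)
  thus ?thesis unfolding phi_formula[OF T] bounded_part_def by (simp add: mult.assoc[symmetric])
qed

lemma eta_bound:
  obtains \<delta> where "0 < \<delta>" "\<And>u T. 0 \<le> T \<Longrightarrow> norm (exp (of_real T * \<eta> u)) \<le> exp (- (\<delta> * T * min 1 (u\<^sup>2)))"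
proof -
  obtain \<delta> where \<delta>: "0 < \<delta>" "\<And>u. \<delta> * min 1 (u\<^sup>2) \<le> r - norm (root u)"
    using ric_root_gap[OF b r_pos br2] by blast
  show ?thesis
  proof
    show "0 < a * \<delta>" using a \<delta> by simp
    fix u T :: real assume T: "0 \<le> T"
    have "Re (of_real T * \<eta> u) = - (T * a * (r - Re (root u)))" by (simp add: \<eta>_def algebra_simps)
    moreover have "T * a * (\<delta> * min 1 (u\<^sup>2)) \<le> T * a * (r - Re (root u))"
      using T a \<delta>(2)[of u] complex_Re_le_cmod[of "root u"] by (intro mult_left_mono) auto
    ultimately show "norm (exp (of_real T * \<eta> u)) \<le> exp (- (a * \<delta> * T * min 1 (u\<^sup>2)))"
      by (simp only: norm_exp_eq_Re exp_le_cancel_iff) (simp add: mult_ac)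
  qed
qed

lemma eta_scaled_limit: "((\<lambda>T. of_real T * \<eta> (w / sqrt T)) \<longlongrightarrow> - of_real (v * w\<^sup>2 / 2)) at_top"
proof -
  have u: "((\<lambda>T. w / sqrt T) \<longlongrightarrow> 0) at_top" by real_asymp
  have R: "((\<lambda>T. root (w / sqrt T)) \<longlongrightarrow> of_real r) at_top"
    by (rule filterlim_compose[OF ric_root_tendsto[OF b r_pos br2] u])
  define C where "C = a * c * r\<^sup>2 / (c - b * r\<^sup>2)"
  have D: "complex_of_real c - of_real b * of_real r * of_real r = of_real (c - b * r\<^sup>2)" by (simp add: power2_eq_square)
  have 1: "((\<lambda>T. - of_real (w\<^sup>2) * of_real C * root (w / sqrt T) / (of_real c - of_real b * root (w / sqrt T) * of_real r)\<^sup>2)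
     \<longlongrightarrow> - of_real (w\<^sup>2) * of_real C * of_real r / (of_real c - of_real b * of_real r * of_real r)\<^sup>2) at_top"
    by (intro tendsto_intros R) (use br2 D in \<open>auto simp del: of_real_diff\<close>)
  have 2: "- of_real (w\<^sup>2) * of_real C * of_real r / (of_real c - of_real b * of_real r * of_real r)\<^sup>2 = - complex_of_real (v * w\<^sup>2 / 2)"
  proof -
    have "w\<^sup>2 * C * r / (c - b * r\<^sup>2)\<^sup>2 = v * w\<^sup>2 / 2"
      by (simp add: C_def v_eq power2_eq_square power3_eq_cube)
    thus ?thesis unfolding D by (simp only: of_real_mult[symmetric] of_real_power[symmetric] of_real_divide[symmetric] mult_minus_left minus_divide_left[symmetric])
  qed
  have 3: "\<forall>\<^sub>F T in at_top. - of_real (w\<^sup>2) * of_real C * root (w / sqrt T) / (of_real c - of_real b * root (w / sqrt T) * of_real r)\<^sup>2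
      = of_real T * \<eta> (w / sqrt T)"
    using eventually_gt_at_top[of "0::real"]
  proof eventually_elim
    case (elim T)
    have "\<eta> (w / sqrt T) = - of_real ((w / sqrt T)\<^sup>2) * of_real C * root (w / sqrt T) / (of_real c - of_real b * root (w / sqrt T) * of_real r)\<^sup>2"
      using ric_root_exponent[OF b r_pos br2, of a "w / sqrt T"] by (simp only: \<eta>_def C_def theta_eq[symmetric])
    moreover have "complex_of_real T * of_real ((w / sqrt T)\<^sup>2) = of_real (w\<^sup>2)"
      unfolding of_real_mult[symmetric] using elim by (simp add: power_divide)
    ultimately show ?case by (simp add: mult.assoc[symmetric])
  qed
  show ?thesis using Lim_transform_eventually[OF 1 3] unfolding 2 .
qed

text \<open>The limit of \<open>bounded_part\<close> at the saddle point. It turns out to be \<open>\<psi>(n) \<langle>\<psi>, 1\<rangle>\<close>.\<close>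

definition tail_const :: "nat \<Rightarrow> real" where "tail_const n = ((c - b * r\<^sup>2) / (c - b * r)) powr (a / b) * r ^ n"

lemma tail_const_pos: "0 < tail_const n" using br br2 r_pos by (simp add: tail_const_def)

text \<open>The Moebius coordinate decays exponentially at a rate that stays bounded below for \<open>u\<close> near \<open>0\<close>, so it
vanishes in the limit although \<open>u\<close> varies with \<open>T\<close>; the other terms are continuous at \<open>u = 0\<close>.\<close>

lemma bounded_part_scaled_limit: "((\<lambda>T. bounded_part T n (w / sqrt T)) \<longlongrightarrow> of_real (tail_const n)) at_top"
proof -
  define u where "u T = w / sqrt T" for T
  have u: "(u \<longlongrightarrow> 0) at_top" unfolding u_def by real_asymp
  have R: "((\<lambda>T. root (u T)) \<longlongrightarrow> of_real r) at_top"
    by (rule filterlim_compose[OF ric_root_tendsto[OF b r_pos br2] u])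
  have cbr: "of_real b * of_real r * 1 - complex_of_real c \<noteq> 0"
  proof -
    have "of_real b * of_real r * 1 - complex_of_real c = of_real (b * r - c)" by simp
    thus ?thesis using br by (simp del: of_real_diff of_real_mult)
  qed
  have rz: "complex_of_real r \<noteq> 0" using r_pos by simp
  define q0 where "q0 = ric_q b c (of_real r) 1"
  have Q: "((\<lambda>T. ric_q b c (root (u T)) 1) \<longlongrightarrow> q0) at_top"
    unfolding ric_q_def q0_def by (intro tendsto_intros R cbr)
  define \<kappa> where "\<kappa> T = Re (of_real c / root (u T) - of_real b * root (u T))" for T
  have "(\<kappa> \<longlongrightarrow> Re (of_real c / of_real r - of_real b * of_real r)) at_top"
    unfolding \<kappa>_def by (intro tendsto_intros R rz)
  hence k: "(\<kappa> \<longlongrightarrow> c / r - b * r) at_top" by (simp flip: of_real_divide of_real_mult of_real_diff)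
  have k0: "0 < c / r - b * r" using br2 r_pos by (simp add: field_simps power2_eq_square)
  obtain k1 where k1: "0 < k1" "k1 < c / r - b * r" using dense[OF k0] by blast
  have W: "((\<lambda>T. ric_w b c (root (u T)) 1 T) \<longlongrightarrow> 0) at_top"
  proof (rule Lim_null_comparison)
    show "((\<lambda>T. exp (- k1 * T)) \<longlongrightarrow> 0) at_top" using k1 by real_asymp
    show "\<forall>\<^sub>F T in at_top. norm (ric_w b c (root (u T)) 1 T) \<le> exp (- k1 * T)"
      using order_tendstoD(1)[OF k k1(2)] eventually_ge_at_top[of "0::real"]
    proof eventually_elim
      case (elim T)
      have "Re (- (of_real c / root (u T) - of_real b * root (u T)) * of_real T) = - \<kappa> T * T"
        by (simp only: times_complex.sel uminus_complex.sel Re_complex_of_real Im_complex_of_real \<kappa>_def)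
      hence "norm (ric_w b c (root (u T)) 1 T) = norm (ric_q b c (root (u T)) 1) * exp (- \<kappa> T * T)"
        by (simp only: ric_w_def norm_mult norm_exp_eq_Re)
      also have "\<dots> \<le> 1 * exp (- k1 * T)"
        using root_data(2)[of "u T"] r_lt1 elim by (intro mult_mono) (auto intro: mult_right_mono)
      finally show ?case by simp
    qed
  qed
  have q0: "1 - q0 = of_real ((c - b * r\<^sup>2) / (c - b * r))"
  proof -
    have "q0 = of_real (b * r * (1 - r) / (b * r - c))" by (simp add: q0_def ric_q_def)
    moreover have "1 - b * r * (1 - r) / (b * r - c) = (c - b * r\<^sup>2) / (c - b * r)"
    proof -
      have "b * r - c \<noteq> 0" "c - b * r \<noteq> 0" using br by auto
      thus ?thesis by (simp add: divide_simps power2_eq_square) (simp add: algebra_simps)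
    qed
    ultimately show ?thesis by (metis of_real_1 of_real_diff)
  qed
  have q0p: "0 < (c - b * r\<^sup>2) / (c - b * r)" using br br2 by simp
  have nn: "1 - q0 \<notin> \<real>\<^sub>\<le>\<^sub>0" unfolding q0 using q0p by (simp add: complex_nonpos_Reals_iff del: of_real_divide)
  have L1: "((\<lambda>T. Ln (1 - ric_w b c (root (u T)) 1 T)) \<longlongrightarrow> Ln (1 - 0)) at_top"
    by (intro tendsto_intros W) auto
  have L2: "((\<lambda>T. Ln (1 - ric_q b c (root (u T)) 1)) \<longlongrightarrow> Ln (1 - q0)) at_top"
    by (intro tendsto_intros Q nn)
  have "((\<lambda>T. exp (- (of_real a / of_real b) * (Ln (1 - ric_w b c (root (u T)) 1 T) - Ln (1 - ric_q b c (root (u T)) 1)))) \<longlongrightarrow>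
     exp (- (of_real a / of_real b) * (Ln (1 - 0) - Ln (1 - q0)))) at_top"
    by (intro tendsto_intros L1 L2)
  moreover have "exp (- (of_real a / of_real b) * (Ln (1 - 0) - Ln (1 - q0))) = of_real (((c - b * r\<^sup>2) / (c - b * r)) powr (a / b))"
  proof -
    have "Ln (1 - q0) = of_real (ln ((c - b * r\<^sup>2) / (c - b * r)))" unfolding q0 by (rule Ln_of_real[OF q0p])
    hence "- (of_real a / of_real b) * (Ln (1 - 0) - Ln (1 - q0)) = of_real (a / b * ln ((c - b * r\<^sup>2) / (c - b * r)))" by simp
    moreover have "exp (s * ln y) = y powr s" if "0 < y" for s y :: real using that by (simp add: powr_def)
    ultimately show ?thesis using q0p by (simp only: exp_of_real)
  qed
  moreover have "((\<lambda>T. ric_rho b c (root (u T)) 1 T) \<longlongrightarrow> (of_real r - 0 * (of_real c / (of_real b * of_real r))) / (1 - 0)) at_top"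
    unfolding ric_rho_def by (intro tendsto_intros R W) (use rz b in auto)
  ultimately have "((\<lambda>T. bounded_part T n (u T)) \<longlongrightarrow> of_real (((c - b * r\<^sup>2) / (c - b * r)) powr (a / b)) * ((of_real r - 0 * (of_real c / (of_real b * of_real r))) / (1 - 0)) ^ n) at_top"
    unfolding bounded_part_def by (intro tendsto_mult tendsto_power) simp_all
  thus ?thesis by (simp add: tail_const_def u_def)
qed

end

section \<open>The lower tail of the area\<close>

lemma gaussian_integral:
  assumes "0 < v"
  shows "integrable lborel (\<lambda>w::real. exp (- (v * w\<^sup>2 / 2)))" "(\<integral>w. exp (- (v * w\<^sup>2 / 2)) \<partial>lborel) = sqrt (2 * pi / v)"
proof -
  define \<sigma> where "\<sigma> = 1 / sqrt v"
  have \<sigma>: "0 < \<sigma>" "\<sigma>\<^sup>2 = 1 / v" using assms by (auto simp: \<sigma>_def power_divide)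
  have eq: "exp (- (v * w\<^sup>2 / 2)) = sqrt (2 * pi / v) * normal_density 0 \<sigma> w" for w
  proof -
    have "normal_density 0 \<sigma> w = 1 / sqrt (2 * pi / v) * exp (- (v * w\<^sup>2 / 2))"
      using assms by (simp add: normal_density_def \<sigma>(2))
    moreover have "sqrt (2 * pi / v) * (1 / sqrt (2 * pi / v) * x) = x" for x using assms by simp
    ultimately show ?thesis by (simp only:)
  qed
  show "integrable lborel (\<lambda>w::real. exp (- (v * w\<^sup>2 / 2)))" unfolding eq using \<sigma>(1) by (intro integrable_mult_right integrable_normal_density)
  show "(\<integral>w. exp (- (v * w\<^sup>2 / 2)) \<partial>lborel) = sqrt (2 * pi / v)"
    unfolding eq by (simp only: integral_mult_right_zero integral_normal_density[OF \<sigma>(1)] mult_1_right)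
qed

text \<open>Monotonicity of difference quotients: \<open>p\<close> acts as a subgradient of \<open>j\<close>, so difference quotients of \<open>j\<close> to the
left and to the right enclose it, for every fixed step. Let \<open>T\<close> tend to infinity first and the step to \<open>0\<close>
afterwards.\<close>

lemma convex_sandwich_derivative_limit:
  fixes p j :: "real \<Rightarrow> real \<Rightarrow> real"
  assumes lower: "\<And>T z e. 0 < T \<Longrightarrow> 0 < e \<Longrightarrow> e * p z T \<le> j (z + e) T - j z T"
    and upper: "\<And>T z e. 0 < T \<Longrightarrow> 0 < e \<Longrightarrow> j z T - j (z - e) T \<le> e * p z T"
    and lim: "\<And>z. ((\<lambda>T. j z T) \<longlongrightarrow> L z) at_top"
    and der: "(L has_real_derivative d) (at z)"
  shows "((\<lambda>T. p z T) \<longlongrightarrow> d) at_top"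
proof (rule order_tendstoI)
  have D: "((\<lambda>h. (L (z + h) - L z) / h) \<longlongrightarrow> d) (at 0)" using der by (simp add: DERIV_def)
  fix y assume y: "d < y"
  have "\<forall>\<^sub>F h in at_right 0. (L (z + h) - L z) / h < y"
    using order_tendstoD(2)[OF filterlim_mono[OF D order_refl at_le[of "{0<..}" UNIV 0]] y] by simp
  hence "\<forall>\<^sub>F h in at_right 0. (L (z + h) - L z) / h < y \<and> 0 < h" by (auto intro: eventually_conj eventually_at_right_less)
  then obtain h where h: "(L (z + h) - L z) / h < y" "0 < h" using eventually_happens trivial_limit_at_right_real by blast
  have "((\<lambda>T. (j (z + h) T - j z T) / h) \<longlongrightarrow> (L (z + h) - L z) / h) at_top" using h by (intro tendsto_intros lim) auto
  from order_tendstoD(2)[OF this h(1)] eventually_gt_at_top[of 0]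
  show "\<forall>\<^sub>F T in at_top. p z T < y"
  proof eventually_elim
    case (elim T)
    have "p z T \<le> (j (z + h) T - j z T) / h" using lower[OF elim(2) h(2), of z] h(2) by (simp add: pos_le_divide_eq mult.commute)
    thus ?case using elim by linarith
  qed
next
  have D: "((\<lambda>h. (L (z + h) - L z) / h) \<longlongrightarrow> d) (at 0)" using der by (simp add: DERIV_def)
  fix y assume y: "y < d"
  have "\<forall>\<^sub>F h in at_left 0. y < (L (z + h) - L z) / h"
    using order_tendstoD(1)[OF filterlim_mono[OF D order_refl at_le[of "{..<0}" UNIV 0]] y] by simp
  moreover have "\<forall>\<^sub>F h in at_left (0::real). h < 0" by (simp add: eventually_at_left_field) (use lt_ex in blast)
  ultimately have "\<forall>\<^sub>F h in at_left 0. y < (L (z + h) - L z) / h \<and> h < 0" by (rule eventually_conj)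
  then obtain h' where h': "y < (L (z + h') - L z) / h'" "h' < 0" using eventually_happens trivial_limit_at_left_real by blast
  define h where "h = - h'"
  have "(L (z + h') - L z) / h' = (L z - L (z - h)) / h" using h'(2) by (simp add: h_def field_simps)
  hence h: "y < (L z - L (z - h)) / h" "0 < h" using h' by (auto simp: h_def)
  have "((\<lambda>T. (j z T - j (z - h) T) / h) \<longlongrightarrow> (L z - L (z - h)) / h) at_top" using h by (intro tendsto_intros lim) auto
  from order_tendstoD(1)[OF this h(1)] eventually_gt_at_top[of 0]
  show "\<forall>\<^sub>F T in at_top. y < p z T"
  proof eventually_elim
    case (elim T)
    have "(j z T - j (z - h) T) / h \<le> p z T" using upper[OF elim(2) h(2), of z] h(2) by (simp add: pos_divide_le_eq mult.commute)
    thus ?case using elim by linarith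
  qed
qed

context bdi_family begin

definition ramp :: "nat \<Rightarrow> real \<Rightarrow> real \<Rightarrow> real" where
  "ramp n T y = (\<integral>\<omega>. max 0 (y - time_integral X T \<omega>) \<partial>Pr n)"

lemma ramp_integrable: "integrable (Pr n) (\<lambda>\<omega>. max 0 (y - time_integral X T \<omega>))"
proof -
  interpret prob_space "Pr n" by (rule prob_Pr)
  show ?thesis
    by (rule integrable_const_bound[where B="\<bar>y\<bar>"]) (use A_nonneg[of T] in \<open>auto simp: max_def intro!: order.trans[OF _ abs_ge_self]\<close>)
qed

lemma phi_measurable[measurable]: "\<phi> T n \<in> borel_measurable borel"
proof -
  interpret prob_space "Pr n" by (rule prob_Pr)
  show ?thesis unfolding \<phi>_def[abs_def] by (rule borel_measurable_lebesgue_integral) measurable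
qed

text \<open>Inversion of the ramp at each value of the area, integrated over \<open>\<omega>\<close>. The kernel \<open>1 / (\<beta> + \<i> u)\<^sup>2\<close> makes
Fubini applicable.\<close>

lemma ramp_laplace:
  "of_real (2 * pi * ramp n T y) =
    (\<integral>u. exp ((of_real \<beta> + \<i> * of_real u) * of_real y) / (of_real \<beta> + \<i> * of_real u)\<^sup>2 * \<phi> T n u \<partial>lborel)"
proof -
  interpret prob_space "Pr n" by (rule prob_Pr)
  interpret P: pair_sigma_finite "Pr n" "lborel :: real measure" ..
  define f where "f \<omega> u = exp ((of_real \<beta> + \<i> * of_real u) * of_real (y - time_integral X T \<omega>)) / (of_real \<beta> + \<i> * of_real u)\<^sup>2" for \<omega> u
  have nf: "norm (f \<omega> u) = exp (\<beta> * (y - time_integral X T \<omega>)) * (1 / (\<beta>\<^sup>2 + u\<^sup>2))" for \<omega> u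
    by (simp add: f_def norm_divide norm_power norm_beta_iu norm_exp_eq_Re)
  have int: "integrable (Pr n \<Otimes>\<^sub>M lborel) (case_prod f)"
  proof (rule P.Fubini_integrable)
    show "case_prod f \<in> borel_measurable (Pr n \<Otimes>\<^sub>M lborel)" unfolding f_def[abs_def] by measurable
    have "integrable (Pr n) (\<lambda>\<omega>. exp (\<beta> * (y - time_integral X T \<omega>)))"
      by (rule integrable_const_bound[where B="exp (\<beta> * y)"]) (use A_nonneg[of T] beta_pos in auto)
    thus "integrable (Pr n) (\<lambda>\<omega>. \<integral>u. norm (case_prod f (\<omega>, u)) \<partial>lborel)"
      unfolding case_prod_conv nf by (subst integral_mult_right_zero) (rule integrable_mult_left)
    show "AE \<omega> in Pr n. integrable lborel (\<lambda>u. case_prod f (\<omega>, u))"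
      unfolding case_prod_conv f_def by (intro AE_I2 laplace_inversion_ramp(1) beta_pos)
  qed
  have "(\<integral>u. (\<integral>\<omega>. f \<omega> u \<partial>Pr n) \<partial>lborel) = (\<integral>\<omega>. (\<integral>u. f \<omega> u \<partial>lborel) \<partial>Pr n)"
    by (rule P.Fubini_integral[OF int])
  also have "\<dots> = (\<integral>\<omega>. of_real (2 * pi * max 0 (y - time_integral X T \<omega>)) \<partial>Pr n)"
    unfolding f_def by (simp only: laplace_inversion_ramp(2)[OF beta_pos])
  also have "\<dots> = of_real (2 * pi * ramp n T y)"
    by (simp only: integral_complex_of_real ramp_def integral_mult_right_zero)
  finally have "of_real (2 * pi * ramp n T y) = (\<integral>u. (\<integral>\<omega>. f \<omega> u \<partial>Pr n) \<partial>lborel)" by simp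
  also have "\<dots> = (\<integral>u. exp ((of_real \<beta> + \<i> * of_real u) * of_real y) / (of_real \<beta> + \<i> * of_real u)\<^sup>2 * \<phi> T n u \<partial>lborel)"
  proof (rule Bochner_Integration.integral_cong)
    fix u :: real
    have "f \<omega> u = exp ((of_real \<beta> + \<i> * of_real u) * of_real y) / (of_real \<beta> + \<i> * of_real u)\<^sup>2 *
       exp (- (of_real \<beta> + \<i> * of_real u) * of_real (time_integral X T \<omega>))" for \<omega>
    proof -
      have "exp ((of_real \<beta> + \<i> * of_real u) * of_real (y - time_integral X T \<omega>)) =
         exp ((of_real \<beta> + \<i> * of_real u) * of_real y) * exp (- (of_real \<beta> + \<i> * of_real u) * of_real (time_integral X T \<omega>))"
        unfolding exp_add[symmetric] by (rule arg_cong[where f=exp]) (simp add: algebra_simps)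
      thus ?thesis by (simp add: f_def)
    qed
    thus "(\<integral>\<omega>. f \<omega> u \<partial>Pr n) = exp ((of_real \<beta> + \<i> * of_real u) * of_real y) / (of_real \<beta> + \<i> * of_real u)\<^sup>2 * \<phi> T n u"
      by (simp add: \<phi>_def)
  qed simp
  finally show ?thesis .
qed

definition scaled_integrand :: "nat \<Rightarrow> real \<Rightarrow> real \<Rightarrow> real \<Rightarrow> complex" where
  "scaled_integrand n z T w = (let u = w / sqrt T in
     exp ((of_real (\<beta> * z) + \<i> * of_real (u * z))) / (of_real \<beta> + \<i> * of_real u)\<^sup>2 *
     (exp ((of_real E + \<i> * of_real u * of_real \<theta>) * of_real T) * \<phi> T n u))"

text \<open>The substitution \<open>u = w / sqrt T\<close>, with \<open>exp (I T) = exp ((E - \<beta> \<theta>) T)\<close> moved into the integral.\<close>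

lemma scaled_ramp:
  assumes T: "0 < T"
  shows "of_real (2 * pi * (sqrt T * exp (bdi_I a b c \<theta> * T) * ramp n T (\<theta> * T + z))) = (\<integral>w. scaled_integrand n z T w \<partial>lborel)"
proof -
  define g where "g u = exp ((of_real \<beta> + \<i> * of_real u) * of_real (\<theta> * T + z)) / (of_real \<beta> + \<i> * of_real u)\<^sup>2 * \<phi> T n u" for u
  have "(\<integral>u. g u \<partial>lborel) = \<bar>1 / sqrt T\<bar> *\<^sub>R (\<integral>w. g (0 + 1 / sqrt T * w) \<partial>lborel)"
    by (rule lborel_integral_real_affine) (use T in simp)
  hence "of_real (2 * pi * ramp n T (\<theta> * T + z)) = of_real (1 / sqrt T) * (\<integral>w. g (w / sqrt T) \<partial>lborel)"
    using T ramp_laplace[of n T "\<theta> * T + z"] by (simp add: g_def scaleR_conv_of_real)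
  hence "of_real (sqrt T * exp (bdi_I a b c \<theta> * T)) * of_real (2 * pi * ramp n T (\<theta> * T + z)) =
     of_real (sqrt T * exp (bdi_I a b c \<theta> * T)) * (of_real (1 / sqrt T) * (\<integral>w. g (w / sqrt T) \<partial>lborel))" by simp
  also have "\<dots> = of_real (exp (bdi_I a b c \<theta> * T)) * (\<integral>w. g (w / sqrt T) \<partial>lborel)" using T by simp
  also have "\<dots> = (\<integral>w. of_real (exp (bdi_I a b c \<theta> * T)) * g (w / sqrt T) \<partial>lborel)" by simp
  also have "\<dots> = (\<integral>w. scaled_integrand n z T w \<partial>lborel)"
  proof (rule Bochner_Integration.integral_cong)
    fix w :: real
    define u where "u = w / sqrt T"
    have "of_real (exp (bdi_I a b c \<theta> * T)) * exp ((of_real \<beta> + \<i> * of_real u) * of_real (\<theta> * T + z)) =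
       exp ((of_real (\<beta> * z) + \<i> * of_real (u * z))) * exp ((of_real E + \<i> * of_real u * of_real \<theta>) * of_real T)"
      unfolding exp_of_real[symmetric] exp_add[symmetric] I_eq
      by (rule arg_cong[where f=exp]) (simp add: algebra_simps)
    thus "of_real (exp (bdi_I a b c \<theta> * T)) * g (w / sqrt T) = scaled_integrand n z T w"
      unfolding g_def scaled_integrand_def Let_def u_def[symmetric] by (simp add: mult_ac)
  qed simp
  finally show ?thesis by (simp add: mult_ac)
qed

lemma scaled_integrand_eq:
  "0 \<le> T \<Longrightarrow> scaled_integrand n z T w = exp (of_real (\<beta> * z) + \<i> * of_real (w / sqrt T * z)) / (of_real \<beta> + \<i> * of_real (w / sqrt T))\<^sup>2 *
     (exp (of_real T * \<eta> (w / sqrt T)) * bounded_part T n (w / sqrt T))"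
  unfolding scaled_integrand_def Let_def by (simp only: phi_eq)

lemma scaled_integrand_limit:
  "((\<lambda>T. scaled_integrand n z T w) \<longlongrightarrow> of_real (exp (\<beta> * z) / \<beta>\<^sup>2 * tail_const n * exp (- (v * w\<^sup>2 / 2)))) at_top"
proof -
  have u: "((\<lambda>T. w / sqrt T) \<longlongrightarrow> 0) at_top" by real_asymp
  have 1: "((\<lambda>T. exp (of_real (\<beta> * z) + \<i> * of_real (w / sqrt T * z)) / (of_real \<beta> + \<i> * of_real (w / sqrt T))\<^sup>2 *
     (exp (of_real T * \<eta> (w / sqrt T)) * bounded_part T n (w / sqrt T))) \<longlongrightarrow>
     exp (of_real (\<beta> * z) + \<i> * of_real (0 * z)) / (of_real \<beta> + \<i> * of_real 0)\<^sup>2 * (exp (- of_real (v * w\<^sup>2 / 2)) * of_real (tail_const n))) at_top"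
    by (intro tendsto_intros u eta_scaled_limit bounded_part_scaled_limit) (use beta_pos in auto)
  have 2: "exp (of_real (\<beta> * z) + \<i> * of_real (0 * z)) / (of_real \<beta> + \<i> * of_real 0)\<^sup>2 * (exp (- of_real (v * w\<^sup>2 / 2)) * of_real (tail_const n)) =
      complex_of_real (exp (\<beta> * z) / \<beta>\<^sup>2 * tail_const n * exp (- (v * w\<^sup>2 / 2)))"
    by (simp add: exp_of_real[symmetric])
  have 3: "\<forall>\<^sub>F T in at_top. exp (of_real (\<beta> * z) + \<i> * of_real (w / sqrt T * z)) / (of_real \<beta> + \<i> * of_real (w / sqrt T))\<^sup>2 *
     (exp (of_real T * \<eta> (w / sqrt T)) * bounded_part T n (w / sqrt T)) = scaled_integrand n z T w"
    using eventually_ge_at_top[of "0::real"] by eventually_elim (simp only: scaled_integrand_eq)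
  show ?thesis using Lim_transform_eventually[OF 1 3] unfolding 2 .
qed

text \<open>For \<open>|u| \<le> 1\<close> the quadratic gap gives a Gaussian in \<open>w\<close>. For \<open>|u| > 1\<close> the integrand is at most
\<open>exp (- \<delta> T) / (\<beta>\<^sup>2 + u\<^sup>2)\<close>, up to a constant, and \<open>exp (- \<delta> T) \<le> 1 / (\<delta> T)\<close> absorbs the Jacobian of the substitution.\<close>

lemma scaled_integrand_dominated:
  obtains g where "integrable lborel g" "\<And>T w. 1 \<le> T \<Longrightarrow> norm (scaled_integrand n z T w) \<le> g w"
proof -
  obtain \<delta> where \<delta>: "0 < \<delta>" "\<And>u T. 0 \<le> T \<Longrightarrow> norm (exp (of_real T * \<eta> u)) \<le> exp (- (\<delta> * T * min 1 (u\<^sup>2)))"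
    using eta_bound by blast
  define C where "C = exp (\<beta> * z) * exp (a / b * ln (2 / (1 - r)))"
  have C: "0 < C" by (simp add: C_def)
  define g where "g w = C / \<beta>\<^sup>2 * exp (- ((2 * \<delta>) * w\<^sup>2 / 2)) + C / \<delta> * (1 / (\<beta>\<^sup>2 + w\<^sup>2))" for w
  show ?thesis
  proof
    show "integrable lborel g" unfolding g_def
      by (intro Bochner_Integration.integrable_add integrable_mult_right gaussian_integral integrable_inverse_quadratic beta_pos) (use \<delta> in simp)
    fix T w :: real assume T: "1 \<le> T"
    define u where "u = w / sqrt T"
    have u2: "u\<^sup>2 = w\<^sup>2 / T" using T by (simp add: u_def power_divide)
    have b2: "0 < \<beta>\<^sup>2" using beta_pos by simp
    have "norm (scaled_integrand n z T w) = exp (\<beta> * z) / (\<beta>\<^sup>2 + u\<^sup>2) * (norm (exp (of_real T * \<eta> u)) * norm (bounded_part T n u))"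
      using T by (simp add: scaled_integrand_eq u_def[symmetric] norm_mult norm_divide norm_power norm_beta_iu norm_exp_eq_Re)
    also have "\<dots> \<le> exp (\<beta> * z) / (\<beta>\<^sup>2 + u\<^sup>2) * (exp (- (\<delta> * T * min 1 (u\<^sup>2))) * exp (a / b * ln (2 / (1 - r))))"
      using T \<delta>(2)[of T u] bounded_part_bound[of T n u] by (intro mult_left_mono mult_mono) auto
    also have "\<dots> = C / (\<beta>\<^sup>2 + u\<^sup>2) * exp (- (\<delta> * T * min 1 (u\<^sup>2)))" by (simp add: C_def)
    also have "\<dots> \<le> g w"
    proof (cases "u\<^sup>2 \<le> 1")
      case True
      hence e: "\<delta> * T * min 1 (u\<^sup>2) = (2 * \<delta>) * w\<^sup>2 / 2" using T u2 by simp
      have "C / (\<beta>\<^sup>2 + u\<^sup>2) \<le> C / \<beta>\<^sup>2" using C b2 by (intro divide_left_mono mult_pos_pos add_pos_nonneg) auto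
      hence "C / (\<beta>\<^sup>2 + u\<^sup>2) * exp (- (\<delta> * T * min 1 (u\<^sup>2))) \<le> C / \<beta>\<^sup>2 * exp (- ((2 * \<delta>) * w\<^sup>2 / 2))"
        unfolding e by (rule mult_right_mono) simp
      moreover have "0 \<le> C / \<delta> * (1 / (\<beta>\<^sup>2 + w\<^sup>2))" using C \<delta> b2 by (auto intro!: mult_nonneg_nonneg divide_nonneg_nonneg add_nonneg_nonneg)
      ultimately show ?thesis by (simp add: g_def)
    next
      case False
      hence m: "min 1 (u\<^sup>2) = 1" by simp
      have "\<delta> * T \<le> exp (\<delta> * T)" using exp_ge_add_one_self[of "\<delta> * T"] by linarith
      hence e: "exp (- (\<delta> * T)) \<le> 1 / (\<delta> * T)" using \<delta> T by (simp add: exp_minus field_simps)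
      have p: "0 < \<beta>\<^sup>2 + w\<^sup>2" using b2 by (simp add: add_pos_nonneg)
      have "C / (\<beta>\<^sup>2 + u\<^sup>2) * exp (- (\<delta> * T * 1)) \<le> C / (\<beta>\<^sup>2 + u\<^sup>2) * (1 / (\<delta> * T))"
        using e C b2 by (intro mult_left_mono) (auto intro!: divide_nonneg_nonneg add_nonneg_nonneg)
      also have "\<dots> = C / \<delta> * (1 / (\<beta>\<^sup>2 * T + w\<^sup>2))"
      proof -
        have "(\<beta>\<^sup>2 + u\<^sup>2) * (\<delta> * T) = \<delta> * (\<beta>\<^sup>2 * T + w\<^sup>2)" using T unfolding u2 by (simp add: field_simps)
        thus ?thesis by (simp add: times_divide_times_eq)
      qed
      also have "\<dots> \<le> C / \<delta> * (1 / (\<beta>\<^sup>2 + w\<^sup>2))"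
      proof (intro mult_left_mono divide_left_mono)
        show "\<beta>\<^sup>2 + w\<^sup>2 \<le> \<beta>\<^sup>2 * T + w\<^sup>2" using T b2 by simp
        thus "0 < (\<beta>\<^sup>2 * T + w\<^sup>2) * (\<beta>\<^sup>2 + w\<^sup>2)" using p by (intro mult_pos_pos) auto
      qed (use C \<delta> in auto)
      also have "\<dots> \<le> g w" using C by (simp add: g_def)
      finally show ?thesis by (simp add: m)
    qed
    finally show "norm (scaled_integrand n z T w) \<le> g w" .
  qed
qed

lemma scaled_ramp_limit:
  "((\<lambda>T. sqrt T * exp (bdi_I a b c \<theta> * T) * ramp n T (\<theta> * T + z)) \<longlongrightarrow> tail_const n / (\<beta>\<^sup>2 * sqrt (2 * pi * v)) * exp (\<beta> * z)) at_top"
proof -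
  obtain g where g: "integrable lborel g" "\<And>T w. 1 \<le> T \<Longrightarrow> norm (scaled_integrand n z T w) \<le> g w"
    using scaled_integrand_dominated[of n z] by blast
  define f where "f w = complex_of_real (exp (\<beta> * z) / \<beta>\<^sup>2 * tail_const n * exp (- (v * w\<^sup>2 / 2)))" for w
  have 1: "((\<lambda>T. \<integral>w. scaled_integrand n z T w \<partial>lborel) \<longlongrightarrow> (\<integral>w. f w \<partial>lborel)) at_top"
  proof (rule integral_dominated_convergence_at_top[OF _ _ g(1)])
    show "f \<in> borel_measurable lborel" unfolding f_def by measurable
    show "scaled_integrand n z T \<in> borel_measurable lborel" for T
      unfolding scaled_integrand_def[abs_def] Let_def by measurable
    show "AE w in lborel. ((\<lambda>T. scaled_integrand n z T w) \<longlongrightarrow> f w) at_top" unfolding f_def by (simp only: scaled_integrand_limit) simp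
    show "\<forall>\<^sub>F T in at_top. AE w in lborel. norm (scaled_integrand n z T w) \<le> g w"
      using eventually_ge_at_top[of "1::real"] by eventually_elim (simp add: g(2))
  qed
  have 2: "(\<integral>w. f w \<partial>lborel) = of_real (exp (\<beta> * z) / \<beta>\<^sup>2 * tail_const n * sqrt (2 * pi / v))"
    unfolding f_def integral_complex_of_real by (simp only: integral_mult_right_zero gaussian_integral(2)[OF v_pos])
  have 3: "\<forall>\<^sub>F T in at_top. (\<integral>w. scaled_integrand n z T w \<partial>lborel) = of_real (2 * pi * (sqrt T * exp (bdi_I a b c \<theta> * T) * ramp n T (\<theta> * T + z)))"
    using eventually_gt_at_top[of "0::real"] by eventually_elim (simp only: scaled_ramp)
  have "((\<lambda>T. complex_of_real (2 * pi * (sqrt T * exp (bdi_I a b c \<theta> * T) * ramp n T (\<theta> * T + z)))) \<longlongrightarrow>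
      of_real (exp (\<beta> * z) / \<beta>\<^sup>2 * tail_const n * sqrt (2 * pi / v))) at_top"
    using Lim_transform_eventually[OF 1 3] unfolding 2 .
  hence "((\<lambda>T. 2 * pi * (sqrt T * exp (bdi_I a b c \<theta> * T) * ramp n T (\<theta> * T + z))) \<longlongrightarrow>
      exp (\<beta> * z) / \<beta>\<^sup>2 * tail_const n * sqrt (2 * pi / v)) at_top"
    by (simp only: tendsto_of_real_iff)
  hence "((\<lambda>T. (2 * pi * (sqrt T * exp (bdi_I a b c \<theta> * T) * ramp n T (\<theta> * T + z))) / (2 * pi)) \<longlongrightarrow>
      (exp (\<beta> * z) / \<beta>\<^sup>2 * tail_const n * sqrt (2 * pi / v)) / (2 * pi)) at_top"
    by (intro tendsto_divide tendsto_const) auto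
  moreover have "(exp (\<beta> * z) / \<beta>\<^sup>2 * tail_const n * sqrt (2 * pi / v)) / (2 * pi) = tail_const n / (\<beta>\<^sup>2 * sqrt (2 * pi * v)) * exp (\<beta> * z)"
  proof -
    define p2 where "p2 = 2 * pi"
    have p2: "0 < p2" by (simp add: p2_def)
    have "sqrt (p2 / v) / p2 = 1 / sqrt (p2 * v)"
    proof -
      have "sqrt (p2 / v) * sqrt (p2 * v) = p2" using p2 v_pos by (simp flip: real_sqrt_mult)
      thus ?thesis using p2 v_pos by (simp add: field_simps)
    qed
    hence "exp (\<beta> * z) / \<beta>\<^sup>2 * tail_const n * (sqrt (p2 / v) / p2) = exp (\<beta> * z) / \<beta>\<^sup>2 * tail_const n * (1 / sqrt (p2 * v))" by (simp only:)
    thus ?thesis unfolding p2_def[symmetric] by simp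
  qed
  ultimately show ?thesis by simp
qed

text \<open>The expected ramp is convex in its level and has the lower tail probability as a subgradient, so the tail
inherits the derivative in \<open>z\<close> of the limit of the rescaled ramp.\<close>

theorem lower_tail_limit:
  "((\<lambda>T. sqrt T * exp (bdi_I a b c \<theta> * T) * measure (Pr n) {\<omega> \<in> space (Pr n). time_integral X T \<omega> \<le> \<theta> * T + z})
     \<longlongrightarrow> tail_const n / (\<beta> * sqrt (2 * pi * v)) * exp (\<beta> * z)) at_top"
proof -
  interpret prob_space "Pr n" by (rule prob_Pr)
  define S where "S T = sqrt T * exp (bdi_I a b c \<theta> * T)" for T
  define P where "P y T = prob {\<omega> \<in> space (Pr n). time_integral X T \<omega> \<le> y}" for y T
  have P: "P y T = (\<integral>\<omega>. indicator {\<omega> \<in> space (Pr n). time_integral X T \<omega> \<le> y} \<omega> \<partial>Pr n)" for y T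
    unfolding P_def by simp
  have I: "integrable (Pr n) (\<lambda>\<omega>. indicator {\<omega> \<in> space (Pr n). time_integral X T \<omega> \<le> y} \<omega> :: real)" for y T
    by (rule integrable_const_bound[where B=1]) auto
  have lo: "e * P y T \<le> ramp n T (y + e) - ramp n T y" if "0 < e" for e y T
  proof -
    have "e * P y T = (\<integral>\<omega>. e * indicator {\<omega> \<in> space (Pr n). time_integral X T \<omega> \<le> y} \<omega> \<partial>Pr n)" unfolding P by simp
    also have "\<dots> \<le> (\<integral>\<omega>. max 0 (y + e - time_integral X T \<omega>) - max 0 (y - time_integral X T \<omega>) \<partial>Pr n)"
      by (intro integral_mono Bochner_Integration.integrable_diff ramp_integrable integrable_mult_right I) (use that in \<open>auto simp: indicator_def\<close>)
    also have "\<dots> = ramp n T (y + e) - ramp n T y" unfolding ramp_def by (intro Bochner_Integration.integral_diff ramp_integrable)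
    finally show ?thesis .
  qed
  have up: "ramp n T y - ramp n T (y - e) \<le> e * P y T" if "0 < e" for e y T
  proof -
    have "ramp n T y - ramp n T (y - e) = (\<integral>\<omega>. max 0 (y - time_integral X T \<omega>) - max 0 (y - e - time_integral X T \<omega>) \<partial>Pr n)"
      unfolding ramp_def by (intro Bochner_Integration.integral_diff[symmetric] ramp_integrable)
    also have "\<dots> \<le> (\<integral>\<omega>. e * indicator {\<omega> \<in> space (Pr n). time_integral X T \<omega> \<le> y} \<omega> \<partial>Pr n)"
      by (intro integral_mono Bochner_Integration.integrable_diff ramp_integrable integrable_mult_right I) (use that in \<open>auto simp: indicator_def\<close>)
    also have "\<dots> = e * P y T" unfolding P by simp
    finally show ?thesis .
  qed
  have "((\<lambda>T. S T * P (\<theta> * T + z) T) \<longlongrightarrow> tail_const n / (\<beta> * sqrt (2 * pi * v)) * exp (\<beta> * z)) at_top"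
  proof (rule convex_sandwich_derivative_limit[where p="\<lambda>z T. S T * P (\<theta> * T + z) T" and j="\<lambda>z T. S T * ramp n T (\<theta> * T + z)"
        and L="\<lambda>z. tail_const n / (\<beta>\<^sup>2 * sqrt (2 * pi * v)) * exp (\<beta> * z)"])
    fix T z e :: real assume T: "0 < T" and e: "0 < e"
    have S: "0 \<le> S T" using T by (simp add: S_def)
    show "e * (S T * P (\<theta> * T + z) T) \<le> S T * ramp n T (\<theta> * T + (z + e)) - S T * ramp n T (\<theta> * T + z)"
      using mult_left_mono[OF lo[OF e, of "\<theta> * T + z" T] S] by (simp add: algebra_simps)
    show "S T * ramp n T (\<theta> * T + z) - S T * ramp n T (\<theta> * T + (z - e)) \<le> e * (S T * P (\<theta> * T + z) T)"
      using mult_left_mono[OF up[OF e, of T "\<theta> * T + z"] S] by (simp add: algebra_simps)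
  next
    show "((\<lambda>T. S T * ramp n T (\<theta> * T + z)) \<longlongrightarrow> tail_const n / (\<beta>\<^sup>2 * sqrt (2 * pi * v)) * exp (\<beta> * z)) at_top" for z
      unfolding S_def by (rule scaled_ramp_limit)
    have "((\<lambda>z. tail_const n / (\<beta>\<^sup>2 * sqrt (2 * pi * v)) * exp (\<beta> * z)) has_real_derivative tail_const n / (\<beta>\<^sup>2 * sqrt (2 * pi * v)) * (exp (\<beta> * z) * \<beta>)) (at z)"
      by (rule DERIV_cmult) (auto intro!: derivative_eq_intros)
    moreover have "tail_const n / (\<beta>\<^sup>2 * sqrt (2 * pi * v)) * (exp (\<beta> * z) * \<beta>) = tail_const n / (\<beta> * sqrt (2 * pi * v)) * exp (\<beta> * z)"
    proof -
      have "\<beta> \<noteq> 0" using beta_pos by simp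
      hence "tail_const n / (\<beta>\<^sup>2 * s) * (exp (\<beta> * z) * \<beta>) = tail_const n / (\<beta> * s) * exp (\<beta> * z)" for s
        by (cases "s = 0") (auto simp: power2_eq_square)
      thus ?thesis .
    qed
    ultimately show "((\<lambda>z. tail_const n / (\<beta>\<^sup>2 * sqrt (2 * pi * v)) * exp (\<beta> * z)) has_real_derivative tail_const n / (\<beta> * sqrt (2 * pi * v)) * exp (\<beta> * z)) (at z)"
      by simp
  qed
  thus ?thesis by (simp add: S_def P_def)
qed

end

section \<open>The ground state\<close>

lemma bdi_pi_detailed_balance:
  assumes "0 < a" "0 < b" "0 < c"
  shows "bdi_pi a b c (Suc n) * (c * real (Suc n)) = bdi_pi a b c n * (a + b * real n)"
proof -
  have s: "0 < a / b" using assms by simp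
  have "pochhammer s (Suc n) / fact (Suc n) * p ^ Suc n * (c * real (Suc n)) =
     pochhammer s n / fact n * p ^ n * (((s + real n) * p) * c)" for s p :: real
    unfolding pochhammer_Suc power_Suc fact_Suc by (simp del: of_nat_Suc)
  hence "pochhammer (a / b) (Suc n) / fact (Suc n) * (b / c) ^ Suc n * (c * real (Suc n)) =
     pochhammer (a / b) n / fact n * (b / c) ^ n * (((a / b + real n) * (b / c)) * c)" .
  also have "((a / b + real n) * (b / c)) * c = a + b * real n" using assms by (simp add: field_simps)
  finally have "pochhammer (a / b) (Suc n) / fact (Suc n) * (b / c) ^ Suc n * (c * real (Suc n)) =
     pochhammer (a / b) n / fact n * (b / c) ^ n * (a + b * real n)" .
  from arg_cong[OF this, of "\<lambda>x. (1 - b / c) powr (a / b) * x"] show ?thesis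
    unfolding bdi_pi_def neg_binomial_mass_pochhammer[OF s] by (simp only: mult.assoc)
qed

lemma bdi_pi_pos: "0 < a \<Longrightarrow> 0 < b \<Longrightarrow> b < c \<Longrightarrow> 0 < bdi_pi a b c n"
  unfolding bdi_pi_def by (rule neg_binomial_mass_pos) auto

lemma bdi_pi_geometric_sums:
  assumes "0 < a" "0 < b" "b < c" "0 \<le> x" "x \<le> 1"
  shows "(\<lambda>n. bdi_pi a b c n * x ^ n) sums (((c - b) / (c - b * x)) powr (a / b))"
proof -
  have "\<bar>b / c * x\<bar> < 1"
  proof -
    have "b / c * x \<le> b / c * 1" using assms by (intro mult_left_mono) auto
    also have "\<dots> < 1" using assms by simp
    finally show ?thesis using assms by simp
  qed
  hence "(\<lambda>n. bdi_pi a b c n * x ^ n) sums (((1 - b / c) / (1 - b / c * x)) powr (a / b))"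
    unfolding bdi_pi_def using assms by (intro neg_binomial_mass_pgf) auto
  moreover have "(1 - b / c) / (1 - b / c * x) = (c - b) / (c - b * x)"
  proof -
    have "1 - b / c = (c - b) / c" "1 - b / c * x = (c - b * x) / c" using assms by (auto simp: field_simps)
    thus ?thesis using assms by simp
  qed
  ultimately show ?thesis by simp
qed

text \<open>The upward rates are positive and the downward rate from \<open>0\<close> vanishes, so the eigenvalue equation at \<open>n\<close> yields
the value at \<open>n + 1\<close> from the earlier ones.\<close>

lemma bdi_eigen_unique:
  assumes ab: "0 < a" "0 < b"
    and f: "\<And>n. bdi_ham a b c \<beta> f n = E * f n" and g: "\<And>n. bdi_ham a b c \<beta> g n = E * g n"
    and 0: "f 0 = k * g 0"
  shows "f n = k * g n"
proof (induction n rule: less_induct)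
  case (less n)
  show ?case
  proof (cases n)
    case (Suc m)
    have A: "a + b * real m \<noteq> 0" using ab by (smt (verit) mult_nonneg_nonneg of_nat_0_le_iff)
    have step: "(a + b * real m) * w (Suc m) = (a + b * real m) * w m - E * w m + \<beta> * real m * w m - c * real m * (w (m - 1) - w m)"
      if "bdi_ham a b c \<beta> w m = E * w m" for w :: "nat \<Rightarrow> real"
      using that by (simp add: bdi_ham_def bdi_gen_def algebra_simps)
    have "(a + b * real m) * f (Suc m) = (a + b * real m) * (k * g (Suc m))"
    proof -
      have "f m = k * g m" "f (m - 1) = k * g (m - 1)" using less.IH Suc by auto
      hence "(a + b * real m) * f (Suc m) = k * ((a + b * real m) * g (Suc m))"
        unfolding step[OF f] step[OF g] by (simp add: algebra_simps)
      thus ?thesis by simp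
    qed
    thus ?thesis using A Suc by simp
  qed (use 0 in simp)
qed

context
  fixes a b c r \<beta> :: real
  assumes a: "0 < a" and b: "0 < b" and bc: "b < c" and r0: "0 < r" and r1: "r < 1" and br: "b * r + c / r = b + c + \<beta>"
begin

lemma geometric_eigen: "bdi_ham a b c \<beta> (\<lambda>n. k * r ^ n) n = a * (1 - r) * (k * r ^ n)"
proof (cases n)
  case 0 thus ?thesis by (simp add: bdi_ham_def bdi_gen_def algebra_simps)
next
  case (Suc m)
  have "\<beta> * r = (1 - r) * (c - b * r)" using br r0 by (simp add: field_simps)
  hence "\<beta> * real n * (k * r ^ Suc m) = real n * (k * r ^ m) * ((1 - r) * (c - b * r))"
    by (metis (no_types, lifting) mult.assoc mult.commute power_Suc)
  thus ?thesis unfolding bdi_ham_def bdi_gen_def Suc by (simp add: algebra_simps)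
qed

lemma geometric_ell2: "(\<lambda>n. k * r ^ n) \<in> bdi_ell2 a b c"
proof -
  have "(\<lambda>n. bdi_pi a b c n * (r\<^sup>2) ^ n) sums (((c - b) / (c - b * r\<^sup>2)) powr (a / b))"
    by (rule bdi_pi_geometric_sums) (use a b bc r0 r1 in \<open>auto simp: power_le_one\<close>)
  hence "summable (\<lambda>n. k\<^sup>2 * (bdi_pi a b c n * (r\<^sup>2) ^ n))" by (intro summable_mult) (auto simp: sums_iff)
  thus ?thesis by (simp add: bdi_ell2_def power_mult_distrib power_mult[symmetric] mult_ac)
qed

text \<open>Suppose \<open>E = a (1 - r) - \<delta>\<close> with \<open>\<delta> > 0\<close>. The quotient \<open>h\<close> of the eigenvector by \<open>r ^ n\<close>, normalised to
\<open>h 0 = 1\<close>, is an eigenvector of the generator of the tilted chain with eigenvalue \<open>\<delta>\<close>. The chain is reversible with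
respect to \<open>\<mu>\<close>, so the flux \<open>V n\<close> of \<open>h\<close> from \<open>n\<close> to \<open>n + 1\<close> satisfies
\<open>V (n + 1) = V n + \<delta> \<mu> (n + 1) h (n + 1)\<close>. Inductively \<open>h\<close> increases and \<open>V n \<ge> V 0 > 0\<close>. By detailed balance
\<open>V n \<le> \<mu> (n + 1) (c / r) (n + 1) (h (n + 1))\<^sup>2\<close>, so \<open>\<mu> n (h n)\<^sup>2\<close> is at least a constant over \<open>n\<close> and
not summable.\<close>

lemma eigenvalue_ge:
  assumes "bdi_eigen a b c \<beta> E g"
  shows "a * (1 - r) \<le> E"
proof (rule ccontr)
  assume "\<not> ?thesis"
  define \<delta> where "\<delta> = a * (1 - r) - E"
  have \<delta>: "0 < \<delta>" using \<open>\<not> _\<close> by (simp add: \<delta>_def)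
  have c: "0 < c" using b bc by simp
  have g: "g \<in> bdi_ell2 a b c" "\<exists>n. g n \<noteq> 0" "\<And>n. bdi_ham a b c \<beta> g n = E * g n" using assms by (auto simp: bdi_eigen_def)
  have g0: "g 0 \<noteq> 0"
  proof
    assume "g 0 = 0"
    hence z: "g 0 = 0 * g 0" by simp
    have "g n = 0 * g n" for n by (rule bdi_eigen_unique[OF a b g(3) g(3) z])
    thus False using g(2) by simp
  qed
  define h where "h n = g n / (g 0 * r ^ n)" for n
  have gh: "g n = g 0 * r ^ n * h n" for n using g0 r0 by (simp add: h_def)
  define \<mu> where "\<mu> n = bdi_pi a b c n * (r ^ n)\<^sup>2" for n
  have \<mu>: "0 < \<mu> n" for n using bdi_pi_pos[OF a b bc, of n] r0 by (simp add: \<mu>_def)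
  have bal: "\<mu> (Suc n) * (c / r * real (Suc n)) = \<mu> n * (r * (a + b * real n))" for n
  proof -
    have "\<mu> (Suc n) * (c / r * real (Suc n)) = (bdi_pi a b c (Suc n) * (c * real (Suc n))) * ((r ^ n)\<^sup>2 * r)"
      using r0 by (simp add: \<mu>_def power2_eq_square del: of_nat_Suc)
    also have "\<dots> = \<mu> n * (r * (a + b * real n))"
      unfolding bdi_pi_detailed_balance[OF a b c] by (simp add: \<mu>_def)
    finally show ?thesis .
  qed
  define d where "d n = h (Suc n) - h n" for n
  have \<beta>: "\<beta> = b * r + c / r - b - c" using br by simp
  have rec0: "r * a * d 0 = \<delta> * h 0"
  proof -
    have "- (a * (g 1 - g 0)) = E * g 0" using g(3)[of 0] by (simp add: bdi_ham_def bdi_gen_def)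
    hence "g 0 * (r * a * d 0) = g 0 * (\<delta> * h 0)"
      using gh[of 1] gh[of 0] g0 by (simp add: d_def \<delta>_def algebra_simps)
    thus ?thesis using g0 by simp
  qed
  have rec: "r * (a + b * real (Suc n)) * d (Suc n) = c / r * real (Suc n) * d n + \<delta> * h (Suc n)" for n
  proof -
    have "- ((a + b * real (Suc n)) * (g (Suc (Suc n)) - g (Suc n)) + c * real (Suc n) * (g n - g (Suc n))) + \<beta> * real (Suc n) * g (Suc n) = E * g (Suc n)"
      using g(3)[of "Suc n"] by (simp add: bdi_ham_def bdi_gen_def)
    hence "(g 0 * r ^ Suc n) * (r * (a + b * real (Suc n)) * d (Suc n)) = (g 0 * r ^ Suc n) * (c / r * real (Suc n) * d n + \<delta> * h (Suc n))"
      unfolding gh[of n] gh[of "Suc n"] gh[of "Suc (Suc n)"] d_def \<delta>_def \<beta>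
      using r0 by (simp add: field_simps del: of_nat_Suc)
    thus ?thesis using g0 r0 by simp
  qed
  define V where "V n = \<mu> n * (r * (a + b * real n) * d n)" for n
  have V0: "V 0 = \<delta> * \<mu> 0 * h 0" using rec0 by (simp add: V_def)
  have VS: "V (Suc n) = V n + \<delta> * \<mu> (Suc n) * h (Suc n)" for n
  proof -
    have "V (Suc n) = \<mu> (Suc n) * (c / r * real (Suc n)) * d n + \<delta> * \<mu> (Suc n) * h (Suc n)"
      unfolding V_def rec by (simp add: algebra_simps)
    thus ?thesis unfolding bal by (simp add: V_def mult.assoc)
  qed
  have h0: "h 0 = 1" using g0 by (simp add: h_def)
  have pos: "0 < r * (a + b * real n)" for n using a b r0 by (simp add: add_pos_nonneg)
  have main: "1 \<le> h n \<and> V 0 \<le> V n" for n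
  proof (induction n)
    case (Suc n)
    have "0 < V 0" using V0 h0 \<delta> \<mu> by simp
    hence "0 < V n" using Suc by linarith
    hence "0 < d n" using \<mu>[of n] pos[of n] by (simp add: V_def zero_less_mult_iff)
    hence h: "1 \<le> h (Suc n)" using Suc by (simp add: d_def)
    moreover have "0 \<le> \<delta> * \<mu> (Suc n) * h (Suc n)" using \<delta> \<mu>[of "Suc n"] h by (intro mult_nonneg_nonneg) auto
    ultimately show ?case using Suc VS[of n] by simp
  qed (simp add: h0)
  have V0p: "0 < V 0" using V0 h0 \<delta> \<mu> by simp
  have lower: "V 0 * (r / c) * inverse (real (Suc n)) \<le> \<mu> (Suc n) * (h (Suc n))\<^sup>2" for n
  proof -
    have "V 0 \<le> \<mu> n * (r * (a + b * real n)) * d n" using main[of n] by (simp add: V_def mult.assoc)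
    also have "\<dots> \<le> \<mu> n * (r * (a + b * real n)) * (h (Suc n))\<^sup>2"
    proof (rule mult_left_mono)
      have "d n \<le> h (Suc n) * 1" using main[of n] by (simp add: d_def)
      also have "\<dots> \<le> h (Suc n) * h (Suc n)" using main[of "Suc n"] by (intro mult_left_mono) auto
      finally show "d n \<le> (h (Suc n))\<^sup>2" by (simp add: power2_eq_square)
    qed (use \<mu>[of n] pos[of n] in \<open>auto intro!: mult_nonneg_nonneg less_imp_le\<close>)
    also have "\<mu> n * (r * (a + b * real n)) = \<mu> (Suc n) * (c / r * real (Suc n))" by (rule bal[symmetric])
    finally have "V 0 \<le> (\<mu> (Suc n) * (h (Suc n))\<^sup>2) * (c / r * real (Suc n))" by (simp add: mult_ac)
    hence "V 0 * (r / c * inverse (real (Suc n))) \<le> (\<mu> (Suc n) * (h (Suc n))\<^sup>2) * (c / r * real (Suc n)) * (r / c * inverse (real (Suc n)))"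
      using r0 c by (intro mult_right_mono) auto
    also have "\<dots> = \<mu> (Suc n) * (h (Suc n))\<^sup>2" using r0 c by (simp del: of_nat_Suc)
    finally show ?thesis by (simp add: mult.assoc)
  qed
  have "summable (\<lambda>n. bdi_pi a b c n * (g n)\<^sup>2)" using g(1) by (simp add: bdi_ell2_def)
  hence "summable (\<lambda>n. inverse ((g 0)\<^sup>2) * (bdi_pi a b c n * (g n)\<^sup>2))" by (rule summable_mult)
  moreover have "inverse ((g 0)\<^sup>2) * (bdi_pi a b c n * (g n)\<^sup>2) = \<mu> n * (h n)\<^sup>2" for n
  proof -
    have "(g n)\<^sup>2 = (g 0)\<^sup>2 * ((r ^ n)\<^sup>2 * (h n)\<^sup>2)" by (subst gh) (simp add: power_mult_distrib)
    thus ?thesis using g0 by (simp add: \<mu>_def)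
  qed
  ultimately have "summable (\<lambda>n. \<mu> n * (h n)\<^sup>2)" by simp
  hence "summable (\<lambda>n. \<mu> (Suc n) * (h (Suc n))\<^sup>2)" by (subst summable_Suc_iff)
  hence "summable (\<lambda>n. V 0 * (r / c) * inverse (real (Suc n)))"
    by (rule summable_comparison_test'[where N=0]) (use lower V0p r0 c in auto)
  hence "summable (\<lambda>n. inverse (V 0 * (r / c)) * (V 0 * (r / c) * inverse (real (Suc n))))" by (rule summable_mult)
  hence "summable (\<lambda>n. inverse (real (Suc n)))" using V0p r0 c by (simp add: mult.assoc[symmetric] del: of_nat_Suc)
  hence "summable (\<lambda>n. inverse (real n))" by (subst (asm) summable_Suc_iff)
  thus False using not_summable_harmonic[where 'a=real] by simp
qed

definition "geometric_norm_sq = ((c - b) / (c - b * r\<^sup>2)) powr (a / b)"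
definition "geometric_inner_one = ((c - b) / (c - b * r)) powr (a / b)"

text \<open>All geometric sequences \<open>k r ^ n\<close> are eigenvectors for the least eigenvalue, and there are no others for it;
normalisation and positivity fix \<open>k\<close>.\<close>

lemma bdi_psi_formula: "bdi_psi a b c \<beta> = (\<lambda>n. r ^ n / sqrt geometric_norm_sq)"
proof -
  have c: "0 < c" using b bc by simp
  have r21: "r\<^sup>2 \<le> 1" using r0 r1 by (simp add: power_le_one)
  have "b * r\<^sup>2 \<le> b * 1" using b r21 by (intro mult_left_mono) auto
  hence geometric_norm_sq: "0 < geometric_norm_sq" using bc by (simp add: geometric_norm_sq_def)
  have S2: "(\<lambda>n. bdi_pi a b c n * (r\<^sup>2) ^ n) sums geometric_norm_sq" unfolding geometric_norm_sq_def
    by (rule bdi_pi_geometric_sums) (use a b bc r21 in auto)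
  have inner: "bdi_inner a b c (\<lambda>n. k * r ^ n) (\<lambda>n. k * r ^ n) = k\<^sup>2 * geometric_norm_sq" for k
  proof -
    have "(\<lambda>n. k\<^sup>2 * (bdi_pi a b c n * (r\<^sup>2) ^ n)) sums (k\<^sup>2 * geometric_norm_sq)" by (rule sums_mult[OF S2])
    moreover have "k\<^sup>2 * (bdi_pi a b c n * (r\<^sup>2) ^ n) = bdi_pi a b c n * (k * r ^ n) * (k * r ^ n)" for n
      by (simp add: power2_eq_square power_mult_distrib mult_ac)
    ultimately show ?thesis by (simp add: bdi_inner_def sums_iff)
  qed
  have eig: "bdi_eigen a b c \<beta> (a * (1 - r)) (\<lambda>n. k * r ^ n)" if "k \<noteq> 0" for k
    using geometric_ell2[of k] geometric_eigen[of k] that r0 by (auto simp: bdi_eigen_def)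
  have gs: "bdi_ground_state a b c \<beta> (\<lambda>n. k * r ^ n)" if "k \<noteq> 0" for k
    unfolding bdi_ground_state_def using eig[OF that] eigenvalue_ge by blast
  define k where "k = 1 / sqrt geometric_norm_sq"
  have k: "0 < k" "k\<^sup>2 * geometric_norm_sq = 1" using geometric_norm_sq by (auto simp: k_def power_divide)
  have "bdi_psi a b c \<beta> = (\<lambda>n. k * r ^ n)"
    unfolding bdi_psi_def
  proof (rule the_equality)
    show "bdi_ground_state a b c \<beta> (\<lambda>n. k * r ^ n) \<and> (\<forall>n. 0 < k * r ^ n) \<and> bdi_inner a b c (\<lambda>n. k * r ^ n) (\<lambda>n. k * r ^ n) = 1"
      using gs k r0 inner by simp
    fix f assume f: "bdi_ground_state a b c \<beta> f \<and> (\<forall>n. 0 < f n) \<and> bdi_inner a b c f f = 1"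
    then obtain E where E: "bdi_eigen a b c \<beta> E f" "\<And>E' g. bdi_eigen a b c \<beta> E' g \<Longrightarrow> E \<le> E'"
      by (auto simp: bdi_ground_state_def)
    have "E = a * (1 - r)" using E(2)[OF eig[of 1]] eigenvalue_ge[OF E(1)] by simp
    hence "\<And>n. bdi_ham a b c \<beta> f n = a * (1 - r) * f n" using E(1) by (simp add: bdi_eigen_def)
    hence fn: "f n = f 0 * (1 * r ^ n)" for n
      by (rule bdi_eigen_unique[where g="\<lambda>n. 1 * r ^ n" and k="f 0" and f=f and E="a * (1 - r)", OF a b _ geometric_eigen]) simp
    have ff: "f = (\<lambda>n. f 0 * r ^ n)"
    proof
      fix n show "f n = f 0 * r ^ n" using fn[of n] by (simp only: mult_1_left)
    qed
    have "bdi_inner a b c f f = (f 0)\<^sup>2 * geometric_norm_sq" using inner[of "f 0"] by (simp only: ff[symmetric])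
    hence "(f 0)\<^sup>2 * geometric_norm_sq = k\<^sup>2 * geometric_norm_sq" using f k by simp
    hence "(f 0)\<^sup>2 = k\<^sup>2" using geometric_norm_sq by simp
    moreover have "0 \<le> f 0" using f by (meson less_imp_le)
    ultimately have "f 0 = k" using less_imp_le[OF k(1)] by (rule power2_eq_imp_eq)
    thus "f = (\<lambda>n. k * r ^ n)" by (subst ff) (simp only:)
  qed
  thus ?thesis by (simp add: k_def)
qed

lemma bdi_psi_prefactor:
  "bdi_psi a b c \<beta> n * bdi_inner a b c (bdi_psi a b c \<beta>) (\<lambda>_. 1) = ((c - b * r\<^sup>2) / (c - b * r)) powr (a / b) * r ^ n"
proof -
  have r21: "r\<^sup>2 \<le> 1" using r0 r1 by (simp add: power_le_one)
  have "b * r\<^sup>2 \<le> b * 1" "b * r \<le> b * 1" using b r21 r1 by (intro mult_left_mono; simp)+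
  hence p: "0 < c - b * r\<^sup>2" "0 < c - b * r" "0 < c - b" using bc by auto
  have geometric_norm_sq: "0 < geometric_norm_sq" using p by (simp add: geometric_norm_sq_def)
  have "(\<lambda>n. bdi_pi a b c n * r ^ n) sums geometric_inner_one" unfolding geometric_inner_one_def
    by (rule bdi_pi_geometric_sums) (use a b bc r0 r1 in auto)
  hence "(\<lambda>n. (1 / sqrt geometric_norm_sq) * (bdi_pi a b c n * r ^ n)) sums ((1 / sqrt geometric_norm_sq) * geometric_inner_one)" by (rule sums_mult)
  hence "bdi_inner a b c (bdi_psi a b c \<beta>) (\<lambda>_. 1) = geometric_inner_one / sqrt geometric_norm_sq"
    unfolding bdi_psi_formula bdi_inner_def by (simp add: sums_iff mult_ac)
  hence "bdi_psi a b c \<beta> n * bdi_inner a b c (bdi_psi a b c \<beta>) (\<lambda>_. 1) = r ^ n * (geometric_inner_one / geometric_norm_sq)"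
    using geometric_norm_sq unfolding bdi_psi_formula by simp
  also have "geometric_inner_one / geometric_norm_sq = ((c - b * r\<^sup>2) / (c - b * r)) powr (a / b)"
    unfolding geometric_inner_one_def geometric_norm_sq_def using p by (simp add: powr_divide)
  finally show ?thesis by (simp add: mult.commute)
qed

end

context bdi_family begin

lemma prefactor: "bdi_psi a b c \<beta> n * bdi_inner a b c (bdi_psi a b c \<beta>) (\<lambda>_. 1) = tail_const n"
  using bdi_psi_prefactor[OF a b bc r_pos r_lt1 beta_root] by (simp add: tail_const_def)

text \<open>The limit \<open>lower_tail_limit\<close> rewritten in terms of the ground state.\<close>

theorem lower_tail_asymptotics:
  "(\<lambda>T. measure (Pr n) {\<omega>\<in>space (Pr n). time_integral X T \<omega> \<le> \<theta> * T + z}) \<sim>[at_top]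
    (\<lambda>T. bdi_psi a b c (bdi_beta a b c \<theta>) n * bdi_inner a b c (bdi_psi a b c (bdi_beta a b c \<theta>)) (\<lambda>_. 1)
         / (bdi_beta a b c \<theta> * sqrt (2 * pi * bdi_v a b c \<theta> * T)) * exp (- bdi_I a b c \<theta> * T + bdi_beta a b c \<theta> * z))"
proof (rule asymp_equivI')
  define P where "P T = measure (Pr n) {\<omega>\<in>space (Pr n). time_integral X T \<omega> \<le> \<theta> * T + z}" for T
  define L where "L = tail_const n / (\<beta> * sqrt (2 * pi * v)) * exp (\<beta> * z)"
  have L: "0 < L" using tail_const_pos[of n] beta_pos v_pos by (simp add: L_def)
  have "((\<lambda>T. sqrt T * exp (bdi_I a b c \<theta> * T) * P T / L) \<longlongrightarrow> L / L) at_top"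
    unfolding P_def by (intro tendsto_divide tendsto_const lower_tail_limit[of n z, folded L_def]) (use L in simp)
  moreover have "\<forall>\<^sub>F T in at_top. sqrt T * exp (bdi_I a b c \<theta> * T) * P T / L =
      P T / (tail_const n / (\<beta> * sqrt (2 * pi * v * T)) * exp (- bdi_I a b c \<theta> * T + \<beta> * z))"
    using eventually_gt_at_top[of "0::real"]
  proof eventually_elim
    case (elim T)
    have "tail_const n / (\<beta> * sqrt (2 * pi * v * T)) * exp (- bdi_I a b c \<theta> * T + \<beta> * z) = L / (sqrt T * exp (bdi_I a b c \<theta> * T))"
    proof -
      have "exp (- bdi_I a b c \<theta> * T + \<beta> * z) = exp (\<beta> * z) / exp (bdi_I a b c \<theta> * T)"
        by (simp add: exp_diff)
      moreover have "sqrt (2 * pi * v * T) = sqrt (2 * pi * v) * sqrt T" by (rule real_sqrt_mult)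
      ultimately show ?thesis by (simp only: L_def) simp
    qed
    thus ?case by simp
  qed
  ultimately have "((\<lambda>T. P T / (tail_const n / (\<beta> * sqrt (2 * pi * v * T)) * exp (- bdi_I a b c \<theta> * T + \<beta> * z))) \<longlongrightarrow> L / L) at_top"
    by (rule Lim_transform_eventually)
  thus "((\<lambda>T. measure (Pr n) {\<omega>\<in>space (Pr n). time_integral X T \<omega> \<le> \<theta> * T + z} /
    (bdi_psi a b c (bdi_beta a b c \<theta>) n * bdi_inner a b c (bdi_psi a b c (bdi_beta a b c \<theta>)) (\<lambda>_. 1)
         / (bdi_beta a b c \<theta> * sqrt (2 * pi * bdi_v a b c \<theta> * T)) * exp (- bdi_I a b c \<theta> * T + bdi_beta a b c \<theta> * z))) \<longlongrightarrow> 1) at_top"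
    using L unfolding \<beta>_def[symmetric] v_def[symmetric] prefactor P_def by simp
qed

end

section \<open>The tilted chain and the conditioned paths\<close>

lemma cadlag_shift:
  assumes x: "cadlag_path x" and t: "0 \<le> t"
  shows "cadlag_path (\<lambda>s. x (t + s))"
  unfolding cadlag_path_def tendsto_discrete
proof (intro conjI allI impI)
  fix u :: real assume "0 \<le> u"
  hence "\<forall>\<^sub>F s in at_right (t + u). x s = x (t + u)" using x t by (simp add: cadlag_path_def tendsto_discrete)
  then obtain d where d: "t + u < d" "\<And>s. t + u < s \<Longrightarrow> s < d \<Longrightarrow> x s = x (t + u)" unfolding eventually_at_right_field by blast
  show "\<forall>\<^sub>F s in at_right u. x (t + s) = x (t + u)"
    unfolding eventually_at_right_field by (rule exI[of _ "d - t"]) (use d in auto)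
next
  fix u :: real assume "0 < u"
  hence "0 < t + u" using t by simp
  hence "\<exists>l. \<forall>\<^sub>F s in at_left (t + u). x s = l" using x by (simp add: cadlag_path_def tendsto_discrete)
  then obtain l d where d: "d < t + u" "\<And>s. d < s \<Longrightarrow> s < t + u \<Longrightarrow> x s = l" unfolding eventually_at_left_field by blast
  have "\<forall>\<^sub>F s in at_left u. x (t + s) = l"
    unfolding eventually_at_left_field by (rule exI[of _ "d - t"]) (use d in auto)
  thus "\<exists>l. \<forall>\<^sub>F s in at_left u. x (t + s) = l" by blast
qed

lemma time_integral_add:
  assumes x: "cadlag_path (\<lambda>t. X t \<omega>)" and t: "0 \<le> t" "t \<le> S"
  shows "time_integral X S \<omega> = time_integral X t \<omega> + time_integral (shiftp t X) (S - t) \<omega>"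
proof -
  define f where "f s = real (X s \<omega>)" for s
  have I: "f integrable_on {0..S}" unfolding f_def using cadlag_integrable[OF x, of S] t by simp
  have "integral {0..t} f + integral {t..S} f = integral {0..S} f" by (rule Henstock_Kurzweil_Integration.integral_combine[OF t I])
  moreover have "integral {t..S} f = integral {0..S - t} (\<lambda>s. f (t + s))"
  proof -
    have "f integrable_on {t..S}" by (rule integrable_on_subinterval[OF I]) (use t in auto)
    hence "(f has_integral integral {t..S} f) (cbox t S)" by (simp add: integrable_integral)
    from has_integral_affinity'[OF this, of 1 t]
    have "((\<lambda>s. f (t + s)) has_integral integral {t..S} f) {0..S - t}" by (simp add: add.commute)
    thus ?thesis by (simp add: integral_unique)
  qed
  ultimately show ?thesis unfolding time_integral_def f_def by simp
qed

lemma chain_weight_shift: "chain_weight K i s L = chain_weight K i 0 (map (\<lambda>(u, y). (u - s, y)) L)"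
proof -
  have "chain_weight K i s L = chain_weight K i (s - d) (map (\<lambda>(u, y). (u - d, y)) L)" for d
    by (induction L arbitrary: i s) (auto split: prod.splits)
  from this[of s] show ?thesis by simp
qed

lemma path_law_pth: "path_law S M X = distr M (paths {0..S}) (pth {0..S} X)"
  by (simp add: path_law_def pth_def[abs_def])

context bdi_family begin

text \<open>Density at time \<open>S\<close> of the Doob transform by the ground state \<open>r ^ n\<close>, whose energy is \<open>E = a (1 - r)\<close>.\<close>

definition tilt :: "real \<Rightarrow> nat \<Rightarrow> 'w \<Rightarrow> real" where
  "tilt S n \<omega> = exp (E * S - \<beta> * time_integral X S \<omega>) * r ^ X S \<omega> / r ^ n"

lemma tilt_nonneg: "0 \<le> tilt S n \<omega>" using r_pos by (simp add: tilt_def)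

lemma tilt_bounded: "0 \<le> S \<Longrightarrow> tilt S n \<omega> \<le> exp (E * S) / r ^ n"
proof -
  have "exp (E * S - \<beta> * time_integral X S \<omega>) * r ^ X S \<omega> \<le> exp (E * S) * 1"
    using beta_pos A_nonneg[of S \<omega>] r_pos r_lt1 by (intro mult_mono) (auto simp: power_le_one)
  thus ?thesis using r_pos by (simp add: tilt_def divide_right_mono)
qed

lemma tilt_measurable: "0 \<le> S \<Longrightarrow> tilt S n \<in> borel_measurable (Pr m)"
proof -
  assume "0 \<le> S"
  hence [measurable]: "(\<lambda>\<omega>. r ^ X S \<omega>) \<in> borel_measurable (Pr m)"
    by (intro measurable_compose[OF X_meas borel_measurable_count_space])
  show ?thesis unfolding tilt_def[abs_def] by measurable
qed

lemma tilt_integrable: "0 \<le> S \<Longrightarrow> integrable (Pr m) (tilt S n)"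
proof -
  assume S: "0 \<le> S"
  interpret prob_space "Pr m" by (rule prob_Pr)
  show ?thesis
    by (rule integrable_const_bound[where B="exp (E * S) / r ^ n"]) (use tilt_nonneg tilt_bounded[OF S] tilt_measurable[OF S] in auto)
qed

text \<open>Under \<open>\<rho> \<mapsto> \<rho> / r\<close> the Riccati equation with parameter \<open>\<beta>\<close> and rates \<open>a, b, c\<close> becomes the one with parameter
\<open>0\<close> and rates \<open>r a, r b, c / r\<close>; the fixed point \<open>r\<close> becomes \<open>1\<close>. The Moebius coordinate is the same for
both, and the factors \<open>\<alpha>\<close> differ by \<open>exp (E t)\<close>.\<close>

lemma tilted_generating_function:
  assumes KQ: "transition_semigroup KQ" "has_transition_rates KQ (bdi_rates (r * a) (r * b) (c / r))"
    and s: "0 < s" "s \<le> 1" and t: "0 \<le> t"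
  shows "(\<integral>\<omega>. complex_of_real (tilt t i \<omega>) * complex_of_real s ^ X t \<omega> \<partial>Pr i) =
     measure_pmf.expectation (KQ t i) (\<lambda>j. complex_of_real s ^ j)"
proof -
  define z where "z = complex_of_real s"
  define R where "R = complex_of_real r"
  have R: "R \<noteq> 0" using r_pos by (simp add: R_def)
  have bz: "complex_of_real b \<noteq> 0" using b by simp
  have rb: "0 < r * b" "r * b < c / r" using b r_pos br2 by (auto simp: field_simps power2_eq_square)
  have z1: "norm z \<le> 1" using s by (simp add: z_def)
  have Q: "measure_pmf.expectation (KQ t i) (\<lambda>j. z ^ j) =
     ric_alpha (r * a) (r * b) (c / r) 1 z t * ric_rho (r * b) (c / r) 1 z t ^ i"
    by (rule bdi_pgf[OF KQ _ rb z1 t]) (use a r_pos in simp)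
  have lt: "b * r\<^sup>2 * (1 - s) < c - b * r\<^sup>2 * s" using br2 by (simp add: algebra_simps)
  have pos: "0 < c - b * r\<^sup>2 * s" using lt b s by (smt (verit) mult_nonneg_nonneg zero_le_power2)
  have qr: "ric_q b c R (R * z) = of_real (b * r\<^sup>2 * (1 - s) / (c - b * r\<^sup>2 * s))"
  proof -
    have "ric_q b c R (R * z) = of_real (b * r * (r * s - r) / (b * r * (r * s) - c))"
      by (simp add: ric_q_def R_def z_def)
    also have "b * r * (r * s - r) = - (b * r\<^sup>2 * (1 - s))" by (simp add: algebra_simps power2_eq_square)
    also have "b * r * (r * s) - c = - (c - b * r\<^sup>2 * s)" by (simp add: algebra_simps power2_eq_square)
    finally show ?thesis by (simp only: minus_divide_divide)
  qed
  have "b * r\<^sup>2 * (1 - s) / (c - b * r\<^sup>2 * s) < 1" "0 \<le> b * r\<^sup>2 * (1 - s) / (c - b * r\<^sup>2 * s)"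
    using lt pos b s by (auto intro!: divide_nonneg_pos mult_nonneg_nonneg)
  hence q1: "norm (ric_q b c R (R * z)) < 1" unfolding qr norm_of_real by (simp only: abs_of_nonneg)
  have D: "ric_data b c R (R * z)"
    unfolding ric_data_def
  proof (intro conjI q1 b c R)
    have "of_real b * R * (R * z) = complex_of_real (b * r\<^sup>2 * s)" by (simp add: R_def z_def power2_eq_square)
    thus "of_real b * R * (R * z) \<noteq> of_real c" using pos by (metis less_irrefl of_real_eq_iff right_minus_eq)
    have "Re (of_real c / R - of_real b * R) = c / r - b * r" by (simp add: R_def flip: of_real_divide)
    thus "0 \<le> Re (of_real c / R - of_real b * R)" using rb by (simp add: mult.commute)
  qed
  have fk: "(\<integral>\<omega>. exp (- complex_of_real \<beta> * complex_of_real (time_integral X t \<omega>)) * (R * z) ^ X t \<omega> \<partial>Pr i) = ric_alpha a b c R (R * z) t * ric_rho b c R (R * z) t ^ i"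
  proof (rule feynman_kac_generating_function[OF K M _ b bc _ _ t D])
    show "norm (R * z) \<le> 1" using s r_pos r_lt1 by (simp add: R_def z_def norm_mult mult_le_one)
    show "of_real b * R + of_real c / R = of_real b + of_real c + of_real \<beta>"
      using beta_root by (simp add: R_def flip: of_real_mult of_real_divide of_real_add)
  qed (use a beta_pos in auto)
  have q: "ric_q (r * b) (c / r) 1 z = ric_q b c R (R * z)"
  proof -
    have ne: "of_real b * R * R * z - of_real c \<noteq> 0" using D by (simp add: ric_data_def mult.assoc)
    have "ric_q (r * b) (c / r) 1 z = (R * of_real b * (z - 1)) / ((R * of_real b * R * z - of_real c) / R)"
      using R by (simp add: ric_q_def R_def[symmetric] field_simps)
    also have "\<dots> = ric_q b c R (R * z)" using R ne by (simp add: ric_q_def field_simps)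
    finally show ?thesis .
  qed
  have w: "ric_w (r * b) (c / r) 1 z t = ric_w b c R (R * z) t"
    unfolding ric_w_def q by (simp add: R_def mult.commute)
  have rho: "ric_rho b c R (R * z) t = R * ric_rho (r * b) (c / r) 1 z t"
  proof -
    have "R - ric_w b c R (R * z) t * (of_real c / (of_real b * R)) =
      R * (1 - ric_w b c R (R * z) t * (of_real (c / r) / (of_real (r * b) * 1)))"
      using R bz by (simp add: R_def[symmetric] right_diff_distrib)
    thus ?thesis unfolding ric_rho_def w by (simp only: times_divide_eq_right)
  qed
  have alpha: "exp (of_real (E * t)) * ric_alpha a b c R (R * z) t = ric_alpha (r * a) (r * b) (c / r) 1 z t"
    unfolding ric_alpha_def q w exp_add[symmetric] using R by (intro arg_cong[where f=exp]) (simp add: E_def R_def algebra_simps)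
  have "(\<integral>\<omega>. complex_of_real (tilt t i \<omega>) * z ^ X t \<omega> \<partial>Pr i) =
     (\<integral>\<omega>. (exp (of_real (E * t)) / R ^ i) * (exp (- complex_of_real \<beta> * complex_of_real (time_integral X t \<omega>)) * (R * z) ^ X t \<omega>) \<partial>Pr i)"
  proof (rule Bochner_Integration.integral_cong)
    fix \<omega>
    have "complex_of_real (exp (E * t - \<beta> * time_integral X t \<omega>)) = exp (of_real (E * t)) * exp (- complex_of_real \<beta> * complex_of_real (time_integral X t \<omega>))"
      unfolding exp_of_real[symmetric] exp_add[symmetric] by simp
    thus "complex_of_real (tilt t i \<omega>) * z ^ X t \<omega> = (exp (of_real (E * t)) / R ^ i) * (exp (- complex_of_real \<beta> * complex_of_real (time_integral X t \<omega>)) * (R * z) ^ X t \<omega>)"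
      by (simp add: tilt_def R_def[symmetric] power_mult_distrib)
  qed simp
  also have "\<dots> = (exp (of_real (E * t)) / R ^ i) * (ric_alpha a b c R (R * z) t * ric_rho b c R (R * z) t ^ i)"
    by (simp only: integral_mult_right_zero fk)
  also have "\<dots> = ric_alpha (r * a) (r * b) (c / r) 1 z t * ric_rho (r * b) (c / r) 1 z t ^ i"
    using R unfolding rho alpha[symmetric] by (simp add: power_mult_distrib)
  finally show ?thesis using Q by (simp add: z_def)
qed

text \<open>The tilted law of \<open>X t\<close> is a probability law with the generating function of \<open>KQ t i\<close>.\<close>

lemma tilted_one_time_law:
  assumes KQ: "transition_semigroup KQ" "has_transition_rates KQ (bdi_rates (r * a) (r * b) (c / r))" and t: "0 \<le> t"
  shows "(\<integral>\<^sup>+\<omega>. ennreal (tilt t i \<omega>) * indicator {\<omega> \<in> space (Pr i). X t \<omega> = j} \<omega> \<partial>Pr i) = ennreal (pmf (KQ t i) j)"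
    and "(\<integral>\<^sup>+\<omega>. ennreal (tilt t i \<omega>) \<partial>Pr i) = 1"
proof -
  note tm[measurable] = tilt_measurable[OF t, of i i]
  note Xm[measurable] = X_meas[OF t, of i]
  have "complex_of_real (\<integral>\<omega>. tilt t i \<omega> \<partial>Pr i) = 1"
    using tilted_generating_function[OF KQ, of 1 t i] t by simp
  hence one: "(\<integral>\<omega>. tilt t i \<omega> \<partial>Pr i) = 1" by (simp only: of_real_eq_1_iff)
  show nn1: "(\<integral>\<^sup>+\<omega>. ennreal (tilt t i \<omega>) \<partial>Pr i) = 1"
    by (subst nn_integral_eq_integral) (use tilt_integrable[OF t] tilt_nonneg one in auto)
  define D where "D = density (Pr i) (\<lambda>\<omega>. ennreal (tilt t i \<omega>))"
  interpret D: prob_space D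
    by (rule prob_spaceI) (simp add: D_def emeasure_density nn1 cong: nn_integral_cong)
  define q' where "q' = distr D (count_space UNIV) (X t)"
  have XD: "X t \<in> measurable D (count_space UNIV)" by (simp add: D_def)
  have pq: "prob_space q'" unfolding q'_def by (rule D.prob_space_distr[OF XD])
  have sq: "sets q' = UNIV" by (simp add: q'_def)
  interpret q: prob_space q' by (rule pq)
  have "AE x in q'. measure q' {x} \<noteq> 0"
    unfolding q.AE_support_countable[OF sq] by (rule exI[of _ UNIV]) auto
  hence q: "measure_pmf (Abs_pmf q') = q'" using pq sq by (intro Abs_pmf_inverse) simp
  have "Abs_pmf q' = KQ t i"
  proof (rule pmf_eqI_pgf)
    fix x :: real assume x: "0 < x" "x < 1"
    have "measure_pmf.expectation (Abs_pmf q') (\<lambda>n. complex_of_real x ^ n) = (\<integral>n. complex_of_real x ^ n \<partial>q')"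
      by (simp only: q)
    also have "\<dots> = (\<integral>\<omega>. complex_of_real x ^ X t \<omega> \<partial>D)"
      unfolding q'_def by (rule integral_distr[OF XD]) simp
    also have "\<dots> = (\<integral>\<omega>. complex_of_real (tilt t i \<omega>) * complex_of_real x ^ X t \<omega> \<partial>Pr i)"
      unfolding D_def by (subst integral_density) (use tilt_nonneg measurable_compose[OF Xm borel_measurable_count_space] in \<open>auto simp: scaleR_conv_of_real\<close>)
    also have "\<dots> = measure_pmf.expectation (KQ t i) (\<lambda>j. complex_of_real x ^ j)"
      by (rule tilted_generating_function[OF KQ]) (use x t in auto)
    finally show "measure_pmf.expectation (Abs_pmf q') (\<lambda>n. complex_of_real x ^ n) = measure_pmf.expectation (KQ t i) (\<lambda>n. complex_of_real x ^ n)" .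
  qed
  hence "ennreal (pmf (KQ t i) j) = emeasure q' {j}" by (metis emeasure_pmf_single q)
  also have "\<dots> = emeasure D {\<omega> \<in> space (Pr i). X t \<omega> = j}"
    using XD by (simp add: q'_def emeasure_distr vimage_def Int_def conj_commute D_def)
  also have "\<dots> = (\<integral>\<^sup>+\<omega>. ennreal (tilt t i \<omega>) * indicator {\<omega> \<in> space (Pr i). X t \<omega> = j} \<omega> \<partial>Pr i)"
    unfolding D_def by (rule emeasure_density) auto
  finally show "(\<integral>\<^sup>+\<omega>. ennreal (tilt t i \<omega>) * indicator {\<omega> \<in> space (Pr i). X t \<omega> = j} \<omega> \<partial>Pr i) = ennreal (pmf (KQ t i) j)" by simp
qed

lemma area_past: "\<omega> \<in> space (Pr n) \<Longrightarrow> 0 \<le> t \<Longrightarrow> {0..t} \<subseteq> I \<Longrightarrow> area t (pth I X \<omega>) = time_integral X t \<omega>"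
  by (rule area_pth(1)[where X=X, OF cadlag])

lemma area_future: "\<omega> \<in> space (Pr n) \<Longrightarrow> 0 \<le> t \<Longrightarrow> 0 \<le> u \<Longrightarrow> area u (pth {0..} (shiftp t X) \<omega>) = time_integral (shiftp t X) u \<omega>"
  by (rule area_pth(1)[where X="shiftp t X", OF cadlag_shift[OF cadlag]]) auto

text \<open>The density is multiplicative over time: \<open>tilt S\<close> from \<open>n\<close> is \<open>tilt t\<close> from \<open>n\<close> times the density over the
remaining time \<open>S - t\<close> of the path restarted at \<open>X t = x\<close>. So the first visit can be split off by the Markov property.\<close>

lemma tilted_finite_dimensional:
  assumes KQ: "transition_semigroup KQ" "has_transition_rates KQ (bdi_rates (r * a) (r * b) (c / r))"
    and L: "sorted (map fst L)" "\<And>t x. (t, x) \<in> set L \<Longrightarrow> 0 \<le> t \<and> t \<le> S" and S: "0 \<le> S"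
  shows "(\<integral>\<^sup>+\<omega>. ennreal (tilt S n \<omega>) * indicator (visits (Pr n) X L) \<omega> \<partial>Pr n) = ennreal (chain_weight KQ n 0 L)"
  using L S
proof (induction "length L" arbitrary: L n S)
  case 0
  hence "L = []" by simp
  hence "(\<integral>\<^sup>+\<omega>. ennreal (tilt S n \<omega>) * indicator (visits (Pr n) X L) \<omega> \<partial>Pr n) = (\<integral>\<^sup>+\<omega>. ennreal (tilt S n \<omega>) \<partial>Pr n)"
    by (intro nn_integral_cong) (simp add: visits_def)
  thus ?case using tilted_one_time_law(2)[OF KQ 0(4)] \<open>L = []\<close> by simp
next
  case (Suc k L0)
  then obtain a' L where L0: "L0 = a' # L" by (cases L0) auto
  obtain t x where a': "a' = (t, x)" by (cases a')
  have t: "0 \<le> t" "t \<le> S" using Suc.prems(2)[of t x] by (auto simp: L0 a')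
  define L' where "L' = map (\<lambda>(u, y). (u - t, y)) L"
  define S' where "S' = S - t"
  have S': "0 \<le> S'" using t by (simp add: S'_def)
  have tL: "t \<le> u" "u \<le> S" if "(u, y) \<in> set L" for u y
    using Suc.prems(1) Suc.prems(2)[of u y] that by (force simp: L0 a')+
  have L': "0 \<le> u \<and> u \<le> S'" if "(u, y) \<in> set L'" for u y
    using that tL by (auto simp: L'_def S'_def)
  have sL': "sorted (map fst L')"
  proof -
    have "map fst L' = map (\<lambda>u. u - t) (map fst L)" by (auto simp: L'_def)
    moreover have "sorted (map fst L)" using Suc.prems(1) by (simp add: L0)
    moreover have "sorted us \<Longrightarrow> sorted (map (\<lambda>u. u - t) us)" for us by (induction us) auto
    ultimately show ?thesis by (simp del: map_map)
  qed
  have IH: "(\<integral>\<^sup>+\<omega>. ennreal (tilt S' x \<omega>) * indicator (visits (Pr x) X L') \<omega> \<partial>Pr x) = ennreal (chain_weight KQ x 0 L')"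
  proof (rule Suc.hyps(1)[OF _ sL' _ S'])
    show "k = length L'" using Suc.hyps(2) by (simp add: L0 L'_def)
  qed (rule L')
  \<comment> \<open>\<open>F\<close> and \<open>G\<close> are the two factors as functions on path space, for the past up to \<open>t\<close> and the shifted future.\<close>
  define G where "G y = ennreal (exp (E * S' - \<beta> * area S' y) * r ^ y S' / r ^ x) * indicator {y \<in> space (paths {0..}). \<forall>(u, z)\<in>set L'. y u = z} y" for y
  define F where "F y = ennreal (exp (E * t - \<beta> * area t y) * r ^ y t / r ^ n) * indicator {y \<in> space (paths {0..t}). y t = x} y" for y
  have meas_pow: "(\<lambda>y. r ^ y u) \<in> borel_measurable (paths I)" if "u \<in> I" for u I
    using that by (intro measurable_compose[OF paths_coord borel_measurable_count_space])
  have Gm: "G \<in> borel_measurable (paths {0..})"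
  proof -
    have [measurable]: "area S' \<in> borel_measurable (paths {0..})" "(\<lambda>y. r ^ y S') \<in> borel_measurable (paths {0..})"
      using S' by (auto intro!: area_measurable meas_pow)
    have [measurable]: "{y \<in> space (paths {0..}). \<forall>(u, z)\<in>set L'. y u = z} \<in> sets (paths {0..})"
    proof (rule sets.sets_Collect_finite_All)
      fix p assume "p \<in> set L'"
      moreover obtain u z where "p = (u, z)" by (cases p)
      ultimately have p: "p = (u, z)" "0 \<le> u" using L'[of u z] by simp_all
      have "{y \<in> space (paths {0..}). y u = z} \<in> sets (paths {0..})"
        using p(2) by (intro measurable_sets_Collect[OF paths_coord]) auto
      thus "{y \<in> space (paths {0..}). case p of (u, z) \<Rightarrow> y u = z} \<in> sets (paths {0..})" by (simp add: p)
    qed simp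
    show ?thesis unfolding G_def[abs_def] by measurable
  qed
  have Fm: "F \<in> borel_measurable (paths {0..t})"
  proof -
    have [measurable]: "area t \<in> borel_measurable (paths {0..t})" "(\<lambda>y. r ^ y t) \<in> borel_measurable (paths {0..t})"
      using t by (auto intro!: area_measurable meas_pow)
    have [measurable]: "{y \<in> space (paths {0..t}). y t = x} \<in> sets (paths {0..t})"
      using t by (intro measurable_sets_Collect[OF paths_coord]) auto
    show ?thesis unfolding F_def[abs_def] by measurable
  qed
  have pspace: "pth I Y \<omega> \<in> space (paths I)" for I Y and \<omega> :: 'w by (auto simp: pth_def space_PiM)
  have Gpast: "G (pth {0..} X \<omega>) = ennreal (tilt S' x \<omega>) * indicator (visits (Pr m) X L') \<omega>" if "\<omega> \<in> space (Pr m)" for \<omega> m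
  proof -
    have "(pth {0..} X \<omega> \<in> {y \<in> space (paths {0..}). \<forall>(u, z)\<in>set L'. y u = z}) = (\<omega> \<in> visits (Pr m) X L')"
      proof -
      have "(\<forall>(u, z)\<in>set L'. pth {0..} X \<omega> u = z) \<longleftrightarrow> (\<forall>(u, z)\<in>set L'. X u \<omega> = z)"
        by (intro ball_cong refl) (auto simp: pth_def dest: L')
      thus ?thesis using that pspace[of "{0..}" X \<omega>] by (simp add: visits_def)
    qed
    moreover have "pth {0..} X \<omega> S' = X S' \<omega>" using S' by (simp add: pth_def)
    ultimately show ?thesis using area_past[OF that S', of "{0..}"] by (simp add: G_def tilt_def indicator_def)
  qed
  have Fpast: "F (pth {0..t} X \<omega>) = ennreal (tilt t n \<omega>) * indicator {\<omega> \<in> space (Pr n). X t \<omega> = x} \<omega>" if "\<omega> \<in> space (Pr n)" for \<omega>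
  proof -
    have "pth {0..t} X \<omega> t = X t \<omega>" using t by (simp add: pth_def)
    thus ?thesis using that area_past[OF that t(1), of "{0..t}"] pspace[of "{0..t}" X \<omega>] by (simp add: F_def tilt_def indicator_def)
  qed
  have split: "ennreal (tilt S n \<omega>) * indicator (visits (Pr n) X L0) \<omega> = F (pth {0..t} X \<omega>) * G (pth {0..} (shiftp t X) \<omega>)" if w: "\<omega> \<in> space (Pr n)" for \<omega>
  proof (cases "X t \<omega> = x")
    case True
    have evL: "(pth {0..} (shiftp t X) \<omega> \<in> {y \<in> space (paths {0..}). \<forall>(u, z)\<in>set L'. y u = z}) = (\<omega> \<in> visits (Pr n) X L0)"
    proof -
      have "(\<forall>(u, z)\<in>set L'. pth {0..} (shiftp t X) \<omega> u = z) \<longleftrightarrow> (\<forall>(u, z)\<in>set L. X u \<omega> = z)"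
      proof -
        have "pth {0..} (shiftp t X) \<omega> (u - t) = X u \<omega>" if "(u, z) \<in> set L" for u z
          using tL(1)[OF that] by (simp add: pth_def)
        hence "(\<forall>(u, z)\<in>set L. pth {0..} (shiftp t X) \<omega> (u - t) = z) \<longleftrightarrow> (\<forall>(u, z)\<in>set L. X u \<omega> = z)"
          by (intro ball_cong refl) auto
        thus ?thesis by (simp add: L'_def split_def)
      qed
      thus ?thesis using w True pspace[of "{0..}" "shiftp t X" \<omega>] by (auto simp: visits_def L0 a')
    qed
    have "pth {0..} (shiftp t X) \<omega> S' = X S \<omega>" using S' by (simp add: pth_def S'_def)
    moreover have "time_integral X S \<omega> = time_integral X t \<omega> + time_integral (shiftp t X) S' \<omega>"
      unfolding S'_def by (rule time_integral_add[where X=X, OF cadlag[OF w] t])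
    ultimately have "tilt S n \<omega> = tilt t n \<omega> * (exp (E * S' - \<beta> * area S' (pth {0..} (shiftp t X) \<omega>)) * r ^ pth {0..} (shiftp t X) \<omega> S' / r ^ x)"
    proof -
      have "exp (E * S - \<beta> * (A0 + A1)) = exp (E * t - \<beta> * A0) * exp (E * S' - \<beta> * A1)" for A0 A1
        by (simp add: S'_def algebra_simps flip: exp_add)
      thus ?thesis using r_pos True unfolding tilt_def area_future[OF w t(1) S'] \<open>time_integral X S \<omega> = _\<close> \<open>pth {0..} (shiftp t X) \<omega> S' = _\<close>
        by simp
    qed
    hence "ennreal (tilt S n \<omega>) = ennreal (tilt t n \<omega>) * ennreal (exp (E * S' - \<beta> * area S' (pth {0..} (shiftp t X) \<omega>)) * r ^ pth {0..} (shiftp t X) \<omega> S' / r ^ x)"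
      by (simp only: ennreal_mult'[OF tilt_nonneg])
    thus ?thesis unfolding Fpast[OF w] G_def using evL True w by (simp add: indicator_def)
  next
    case False
    hence "\<omega> \<notin> visits (Pr n) X L0" by (auto simp: visits_def L0 a')
    thus ?thesis unfolding Fpast[OF w] using False by simp
  qed
  have Hm: "(\<lambda>(y, y'). F y * G y') \<in> borel_measurable (paths {0..t} \<Otimes>\<^sub>M paths {0..})"
    using Fm Gm by measurable
  have "(\<integral>\<^sup>+\<omega>. ennreal (tilt S n \<omega>) * indicator (visits (Pr n) X L0) \<omega> \<partial>Pr n) =
     (\<integral>\<^sup>+\<omega>. F (pth {0..t} X \<omega>) * G (pth {0..} (shiftp t X) \<omega>) \<partial>Pr n)"
    by (rule nn_integral_cong) (rule split)
  also have "\<dots> = (\<integral>\<^sup>+\<omega>. (\<integral>\<^sup>+\<omega>'. F (pth {0..t} X \<omega>) * G (pth {0..} X \<omega>') \<partial>Pr (X t \<omega>)) \<partial>Pr n)"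
    by (rule markov_fubini(1)[where H="\<lambda>y y'. F y * G y'", OF M M t(1) Hm])
  also have "\<dots> = (\<integral>\<^sup>+\<omega>. (ennreal (tilt t n \<omega>) * indicator {\<omega> \<in> space (Pr n). X t \<omega> = x} \<omega>) * ennreal (chain_weight KQ x 0 L') \<partial>Pr n)"
  proof (rule nn_integral_cong)
    fix \<omega> assume w: "\<omega> \<in> space (Pr n)"
    have pm: "pth {0..} X \<in> measurable (Pr m) (paths {0..})" for m by (rule pth_measurable) (auto intro: X_meas)
    have "(\<integral>\<^sup>+\<omega>'. F (pth {0..t} X \<omega>) * G (pth {0..} X \<omega>') \<partial>Pr (X t \<omega>)) = F (pth {0..t} X \<omega>) * (\<integral>\<^sup>+\<omega>'. G (pth {0..} X \<omega>') \<partial>Pr (X t \<omega>))"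
      by (rule nn_integral_cmult) (rule measurable_compose[OF pm Gm])
    also have "(\<integral>\<^sup>+\<omega>'. G (pth {0..} X \<omega>') \<partial>Pr (X t \<omega>)) = (\<integral>\<^sup>+\<omega>'. ennreal (tilt S' x \<omega>') * indicator (visits (Pr (X t \<omega>)) X L') \<omega>' \<partial>Pr (X t \<omega>))"
      by (rule nn_integral_cong) (rule Gpast)
    finally show "(\<integral>\<^sup>+\<omega>'. F (pth {0..t} X \<omega>) * G (pth {0..} X \<omega>') \<partial>Pr (X t \<omega>)) =
       (ennreal (tilt t n \<omega>) * indicator {\<omega> \<in> space (Pr n). X t \<omega> = x} \<omega>) * ennreal (chain_weight KQ x 0 L')"
      unfolding Fpast[OF w] using w IH by (cases "X t \<omega> = x") auto
  qed
  also have "\<dots> = (\<integral>\<^sup>+\<omega>. ennreal (tilt t n \<omega>) * indicator {\<omega> \<in> space (Pr n). X t \<omega> = x} \<omega> \<partial>Pr n) * ennreal (chain_weight KQ x 0 L')"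
  proof (rule nn_integral_multc)
    note [measurable] = tilt_measurable[OF t(1), of n n] X_meas[OF t(1), of n]
    show "(\<lambda>\<omega>. ennreal (tilt t n \<omega>) * indicator {\<omega> \<in> space (Pr n). X t \<omega> = x} \<omega>) \<in> borel_measurable (Pr n)" by measurable
  qed
  also have "\<dots> = ennreal (pmf (KQ t n) x * chain_weight KQ x 0 L')"
    unfolding tilted_one_time_law(1)[OF KQ t(1)] by (simp add: ennreal_mult'[symmetric])
  also have "pmf (KQ t n) x * chain_weight KQ x 0 L' = chain_weight KQ n 0 L0"
    by (simp add: L0 a' chain_weight_shift[of KQ x t L] L'_def)
  finally show ?case .
qed

theorem tilted_path_law:
  assumes KQ: "transition_semigroup KQ" "has_transition_rates KQ (bdi_rates (r * a) (r * b) (c / r))"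
    and Y: "markov_with N Y KQ n" and S: "0 \<le> S"
  shows "distr (density (Pr n) (\<lambda>\<omega>. ennreal (tilt S n \<omega>))) (paths {0..S}) (pth {0..S} X) = path_law S N Y"
proof -
  interpret N: prob_space N using Y by (simp add: markov_with_def)
  have pX: "pth {0..S} X \<in> measurable (Pr n) (paths {0..S})" by (rule pth_measurable) (auto intro: X_meas)
  have pY: "pth {0..S} Y \<in> measurable N (paths {0..S})" by (rule pth_measurable) (auto intro: measurable_markov[OF Y])
  note tm[measurable] = tilt_measurable[OF S, of n n]
  define D where "D = density (Pr n) (\<lambda>\<omega>. ennreal (tilt S n \<omega>))"
  have pD: "pth {0..S} X \<in> measurable D (paths {0..S})" using pX by (simp add: D_def)
  have law: "path_law S N Y = distr N (paths {0..S}) (pth {0..S} Y)"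
    by (rule path_law_pth)
  have "distr N (paths {0..S}) (pth {0..S} Y) = distr D (paths {0..S}) (pth {0..S} X)"
  proof (rule paths_measure_eqI)
    show "finite_measure (distr N (paths {0..S}) (pth {0..S} Y))" by (rule N.finite_measure_distr[OF pY])
    fix J :: "real set" and p :: "real \<Rightarrow> nat" assume J: "finite J" "J \<subseteq> {0..S}"
    have J0: "J \<subseteq> {0..}" using J by auto
    note cs = cyl_sets[OF J, of p]
    have "emeasure (distr N (paths {0..S}) (pth {0..S} Y)) (cyl {0..S} J p) = emeasure N {\<omega> \<in> space N. \<forall>j\<in>J. Y j \<omega> = p j}"
      using pth_in_cyl[OF J(2), of Y _ p] by (simp add: emeasure_distr[OF pY cs] vimage_def Int_def conj_commute)
    also have "\<dots> = ennreal (chain_weight KQ n 0 (graph_list J p))"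
      unfolding N.emeasure_eq_measure markov_start[OF Y J(1) J0] ..
    also have "\<dots> = (\<integral>\<^sup>+\<omega>. ennreal (tilt S n \<omega>) * indicator (visits (Pr n) X (graph_list J p)) \<omega> \<partial>Pr n)"
      by (rule tilted_finite_dimensional[OF KQ _ _ S, symmetric]) (use J graph_list(1)[OF J(1), of p] graph_list(2)[of J p] in auto)
    also have "visits (Pr n) X (graph_list J p) = pth {0..S} X -` cyl {0..S} J p \<inter> space (Pr n)"
      using pth_in_cyl[OF J(2), of X _ p] graph_list(1)[OF J(1), of p] by (auto simp: visits_def)
    also have "(\<integral>\<^sup>+\<omega>. ennreal (tilt S n \<omega>) * indicator (pth {0..S} X -` cyl {0..S} J p \<inter> space (Pr n)) \<omega> \<partial>Pr n) =
       emeasure D (pth {0..S} X -` cyl {0..S} J p \<inter> space (Pr n))"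
      unfolding D_def by (rule emeasure_density[symmetric]) (use measurable_sets[OF pX cs] in auto)
    also have "\<dots> = emeasure (distr D (paths {0..S}) (pth {0..S} X)) (cyl {0..S} J p)"
      unfolding emeasure_distr[OF pD cs] by (simp add: D_def)
    finally show "emeasure (distr N (paths {0..S}) (pth {0..S} Y)) (cyl {0..S} J p) = emeasure (distr D (paths {0..S}) (pth {0..S} X)) (cyl {0..S} J p)" .
  qed auto
  thus ?thesis by (simp add: law D_def)
qed

text \<open>The conditional probability of \<open>time_integral X T \<le> \<theta> T\<close>, given the path up to time \<open>S\<close>.\<close>

definition tail :: "real \<Rightarrow> real \<Rightarrow> 'w \<Rightarrow> real" where
  "tail S T \<omega> = measure (Pr (X S \<omega>)) {\<omega>' \<in> space (Pr (X S \<omega>)). time_integral X (T - S) \<omega>' \<le> \<theta> * T - time_integral X S \<omega>}"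

lemma tail_bounds: "0 \<le> tail S T \<omega>" "tail S T \<omega> \<le> 1"
  using prob_space.prob_le_1[OF prob_Pr] by (auto simp: tail_def)

lemma conditioned_event:
  assumes S: "0 \<le> S" "S \<le> T" and A: "A \<in> sets (paths {0..S})"
  shows "tail S T \<in> borel_measurable (Pr n)"
    "measure (Pr n) {\<omega> \<in> space (Pr n). pth {0..S} X \<omega> \<in> A \<and> time_integral X T \<omega> \<le> \<theta> * T} =
      (\<integral>\<omega>. indicator A (pth {0..S} X \<omega>) * tail S T \<omega> \<partial>Pr n)"
proof -
  interpret prob_space "Pr n" by (rule prob_Pr)
  have pm: "pth {0..} X \<in> measurable (Pr m) (paths {0..})" for m by (rule pth_measurable) (auto intro: X_meas)
  have pX[measurable]: "pth {0..S} X \<in> measurable (Pr n) (paths {0..S})" by (rule pth_measurable) (auto intro: X_meas)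
  have pS[measurable]: "pth {0..} (shiftp S X) \<in> measurable (Pr n) (paths {0..})" by (rule pth_measurable) (use S in \<open>auto intro: X_meas\<close>)
  have T': "0 \<le> T - S" using S by simp
  have [measurable]: "area S \<in> borel_measurable (paths {0..S})" "area (T - S) \<in> borel_measurable (paths {0..})"
    using S by (auto intro!: area_measurable)
  define H where "H B y y' = (indicator B y * (if area S y + area (T - S) y' \<le> \<theta> * T then 1 else 0) :: ennreal)" for B and y y' :: "real \<Rightarrow> nat"
  have Hm: "case_prod (H B) \<in> borel_measurable (paths {0..S} \<Otimes>\<^sub>M paths {0..})" if [measurable]: "B \<in> sets (paths {0..S})" for B
    unfolding H_def[abs_def] by measurable
  have inner: "(\<integral>\<^sup>+\<omega>'. H B (pth {0..S} X \<omega>) (pth {0..} X \<omega>') \<partial>Pr (X S \<omega>)) = ennreal (indicator B (pth {0..S} X \<omega>) * tail S T \<omega>)"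
    if w: "\<omega> \<in> space (Pr n)" for \<omega> B
  proof -
    interpret P: prob_space "Pr (X S \<omega>)" by (rule prob_Pr)
    have "(\<integral>\<^sup>+\<omega>'. H B (pth {0..S} X \<omega>) (pth {0..} X \<omega>') \<partial>Pr (X S \<omega>)) =
      (\<integral>\<^sup>+\<omega>'. indicator B (pth {0..S} X \<omega>) * indicator {\<omega>' \<in> space (Pr (X S \<omega>)). time_integral X (T - S) \<omega>' \<le> \<theta> * T - time_integral X S \<omega>} \<omega>' \<partial>Pr (X S \<omega>))"
    proof (rule nn_integral_cong)
      fix \<omega>' assume w': "\<omega>' \<in> space (Pr (X S \<omega>))"
      show "H B (pth {0..S} X \<omega>) (pth {0..} X \<omega>') = indicator B (pth {0..S} X \<omega>) *
         indicator {\<omega>' \<in> space (Pr (X S \<omega>)). time_integral X (T - S) \<omega>' \<le> \<theta> * T - time_integral X S \<omega>} \<omega>'"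
        using w' area_past[OF w S(1), of "{0..S}"] area_past[OF w' T', of "{0..}"] by (auto simp: H_def indicator_def)
    qed
    also have "\<dots> = indicator B (pth {0..S} X \<omega>) * emeasure (Pr (X S \<omega>)) {\<omega>' \<in> space (Pr (X S \<omega>)). time_integral X (T - S) \<omega>' \<le> \<theta> * T - time_integral X S \<omega>}"
      by (subst nn_integral_cmult_indicator) auto
    also have "\<dots> = ennreal (indicator B (pth {0..S} X \<omega>) * tail S T \<omega>)"
      by (simp add: tail_def P.emeasure_eq_measure indicator_def)
    finally show ?thesis .
  qed
  have "(\<lambda>\<omega>. \<integral>\<^sup>+\<omega>'. H (space (paths {0..S})) (pth {0..S} X \<omega>) (pth {0..} X \<omega>') \<partial>Pr (X S \<omega>)) \<in> borel_measurable (Pr n)"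
    by (rule markov_fubini(2)[OF M M S(1) Hm]) simp
  hence "(\<lambda>\<omega>. ennreal (indicator (space (paths {0..S})) (pth {0..S} X \<omega>) * tail S T \<omega>)) \<in> borel_measurable (Pr n)"
    by (subst (asm) measurable_cong[OF inner]) auto
  hence "(\<lambda>\<omega>. enn2real (ennreal (indicator (space (paths {0..S})) (pth {0..S} X \<omega>) * tail S T \<omega>))) \<in> borel_measurable (Pr n)"
    by measurable
  moreover have "enn2real (ennreal (indicator (space (paths {0..S})) (pth {0..S} X \<omega>) * tail S T \<omega>)) = tail S T \<omega>" for \<omega>
    using tail_bounds(1)[of S T \<omega>] by (simp add: pth_def space_PiM)
  ultimately show tm[measurable]: "tail S T \<in> borel_measurable (Pr n)" by simp
  note A[measurable]
  have split: "time_integral X T \<omega> = time_integral X S \<omega> + time_integral (shiftp S X) (T - S) \<omega>" if "\<omega> \<in> space (Pr n)" for \<omega>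
    by (rule time_integral_add[where X=X, OF cadlag[OF that] S])
  have "emeasure (Pr n) {\<omega> \<in> space (Pr n). pth {0..S} X \<omega> \<in> A \<and> time_integral X T \<omega> \<le> \<theta> * T} =
    (\<integral>\<^sup>+\<omega>. indicator {\<omega> \<in> space (Pr n). pth {0..S} X \<omega> \<in> A \<and> time_integral X T \<omega> \<le> \<theta> * T} \<omega> \<partial>Pr n)"
    by (rule nn_integral_indicator[symmetric]) measurable
  also have "\<dots> = (\<integral>\<^sup>+\<omega>. H A (pth {0..S} X \<omega>) (pth {0..} (shiftp S X) \<omega>) \<partial>Pr n)"
  proof (rule nn_integral_cong)
    fix \<omega> assume w: "\<omega> \<in> space (Pr n)"
    show "indicator {\<omega> \<in> space (Pr n). pth {0..S} X \<omega> \<in> A \<and> time_integral X T \<omega> \<le> \<theta> * T} \<omega> = H A (pth {0..S} X \<omega>) (pth {0..} (shiftp S X) \<omega>)"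
      using w area_past[OF w S(1), of "{0..S}"] area_future[OF w S(1) T'] split[OF w] by (auto simp: H_def indicator_def)
  qed
  also have "\<dots> = (\<integral>\<^sup>+\<omega>. (\<integral>\<^sup>+\<omega>'. H A (pth {0..S} X \<omega>) (pth {0..} X \<omega>') \<partial>Pr (X S \<omega>)) \<partial>Pr n)"
    by (rule markov_fubini(1)[OF M M S(1) Hm[OF A]])
  also have "\<dots> = (\<integral>\<^sup>+\<omega>. ennreal (indicator A (pth {0..S} X \<omega>) * tail S T \<omega>) \<partial>Pr n)"
    by (rule nn_integral_cong) (rule inner)
  also have "\<dots> = ennreal (\<integral>\<omega>. indicator A (pth {0..S} X \<omega>) * tail S T \<omega> \<partial>Pr n)"
  proof (rule nn_integral_eq_integral)
    show "integrable (Pr n) (\<lambda>\<omega>. indicator A (pth {0..S} X \<omega>) * tail S T \<omega>)"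
      by (rule integrable_const_bound[where B=1]) (use tail_bounds in \<open>auto simp: indicator_def\<close>)
  qed (use tail_bounds in auto)
  finally show "measure (Pr n) {\<omega> \<in> space (Pr n). pth {0..S} X \<omega> \<in> A \<and> time_integral X T \<omega> \<le> \<theta> * T} =
      (\<integral>\<omega>. indicator A (pth {0..S} X \<omega>) * tail S T \<omega> \<partial>Pr n)"
    by (simp add: emeasure_eq_measure integral_nonneg_AE tail_bounds)
qed

definition ptail :: "nat \<Rightarrow> real \<Rightarrow> real" where
  "ptail n T = measure (Pr n) {\<omega> \<in> space (Pr n). time_integral X T \<omega> \<le> \<theta> * T}"

lemma ptail_limit: "((\<lambda>T. sqrt T * exp (bdi_I a b c \<theta> * T) * ptail n T) \<longlongrightarrow> tail_const n / (\<beta> * sqrt (2 * pi * v))) at_top"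
  using lower_tail_limit[of n 0] by (simp add: ptail_def)

lemma ptail_pos: "\<forall>\<^sub>F T in at_top. 0 < ptail n T"
proof -
  have "0 < tail_const n / (\<beta> * sqrt (2 * pi * v))" using tail_const_pos[of n] beta_pos v_pos by simp
  from order_tendstoD(1)[OF ptail_limit this] eventually_gt_at_top[of 0] show ?thesis
  proof eventually_elim
    case (elim T)
    have "0 < sqrt T * exp (bdi_I a b c \<theta> * T)" using elim(2) by simp
    with elim(1) show ?case by (rule zero_less_mult_pos)
  qed
qed

text \<open>Numerator and denominator are both of order \<open>exp (- I T) / sqrt T\<close>. What remains is \<open>exp (I S)\<close> from the
shorter time horizon, \<open>exp (\<beta> (\<theta> S - A))\<close> from the shifted level, where \<open>A\<close> is the area up to \<open>S\<close>, and
\<open>r ^ X S / r ^ n\<close> from the starting points. By \<open>I = E - \<beta> \<theta>\<close> their product is \<open>tilt\<close>.\<close>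

lemma tail_ratio_limit: "((\<lambda>T. tail S T \<omega> / ptail n T) \<longlongrightarrow> tilt S n \<omega>) at_top"
proof -
  define m x where "m = X S \<omega>" and "x = time_integral X S \<omega>"
  define I where "I = bdi_I a b c \<theta>"
  define f where "f T = measure (Pr m) {\<omega>' \<in> space (Pr m). time_integral X T \<omega>' \<le> \<theta> * T + (\<theta> * S - x)}" for T
  define C where "C = \<beta> * sqrt (2 * pi * v)"
  have C: "0 < C" using beta_pos v_pos by (simp add: C_def)
  have "((\<lambda>T. sqrt T * exp (I * T) * f T) \<longlongrightarrow> tail_const m / C * exp (\<beta> * (\<theta> * S - x))) at_top"
    unfolding f_def I_def C_def by (rule lower_tail_limit)
  moreover have "filterlim (\<lambda>T. T - S) at_top at_top" by real_asymp
  ultimately have 1: "((\<lambda>T. sqrt (T - S) * exp (I * (T - S)) * f (T - S)) \<longlongrightarrow> tail_const m / C * exp (\<beta> * (\<theta> * S - x))) at_top"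
    by (rule filterlim_compose)
  have 2: "((\<lambda>T. sqrt T * exp (I * T) * ptail n T) \<longlongrightarrow> tail_const n / C) at_top"
    unfolding I_def C_def by (rule ptail_limit)
  have 3: "((\<lambda>T. sqrt T / sqrt (T - S)) \<longlongrightarrow> 1) at_top" by real_asymp
  have tail_constn: "tail_const n / C \<noteq> 0" using tail_const_pos[of n] C by simp
  have "((\<lambda>T. (sqrt (T - S) * exp (I * (T - S)) * f (T - S)) / (sqrt T * exp (I * T) * ptail n T) * (sqrt T / sqrt (T - S)) * exp (I * S))
     \<longlongrightarrow> (tail_const m / C * exp (\<beta> * (\<theta> * S - x))) / (tail_const n / C) * 1 * exp (I * S)) at_top"
    by (intro tendsto_mult tendsto_divide 1 2 3 tendsto_const tail_constn)
  moreover have "(tail_const m / C * exp (\<beta> * (\<theta> * S - x))) / (tail_const n / C) * 1 * exp (I * S) = tilt S n \<omega>"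
  proof -
    have "((c - b * r\<^sup>2) / (c - b * r)) powr (a / b) \<noteq> 0" using br br2 by simp
    hence "tail_const m / tail_const n = r ^ m / r ^ n" by (simp add: tail_const_def)
    moreover have "exp (\<beta> * (\<theta> * S - x)) * exp (I * S) = exp (E * S - \<beta> * x)"
      unfolding exp_add[symmetric] I_def I_eq by (rule arg_cong[where f=exp]) (simp add: algebra_simps)
    moreover have "(tail_const m / C * exp (\<beta> * (\<theta> * S - x))) / (tail_const n / C) * 1 * exp (I * S) = (tail_const m / tail_const n) * (exp (\<beta> * (\<theta> * S - x)) * exp (I * S))"
      using C by simp
    ultimately show ?thesis by (simp add: tilt_def m_def x_def)
  qed
  moreover have "\<forall>\<^sub>F T in at_top. (sqrt (T - S) * exp (I * (T - S)) * f (T - S)) / (sqrt T * exp (I * T) * ptail n T) * (sqrt T / sqrt (T - S)) * exp (I * S) = tail S T \<omega> / ptail n T"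
    using eventually_gt_at_top[of 0] eventually_gt_at_top[of S]
  proof eventually_elim
    case (elim T)
    have f: "f (T - S) = tail S T \<omega>" by (simp add: f_def tail_def m_def x_def algebra_simps)
    have e: "exp (I * (T - S)) = exp (I * T) / exp (I * S)" by (simp add: right_diff_distrib exp_diff)
    have "sqrt T \<noteq> 0" "sqrt (T - S) \<noteq> 0" using elim by auto
    thus ?case unfolding e f by simp
  qed
  ultimately show ?thesis by (simp add: Lim_transform_eventually)
qed

text \<open>Scheffe's argument. Both laws have densities with respect to the law of the path up to \<open>S\<close>, namely \<open>h = tail / ptail\<close> and
\<open>tilt\<close>, with integral \<open>1\<close>. Hence their total variation distance is at most twice the integral of the
positive part of \<open>tilt - h\<close>, which is dominated by \<open>tilt\<close> and tends to \<open>0\<close> pointwise.\<close>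

theorem conditioned_law_converges:
  assumes KQ: "transition_semigroup KQ" "has_transition_rates KQ (bdi_rates (r * a) (r * b) (c / r))"
    and Y: "markov_with N Y KQ n" and S: "0 \<le> S"
  shows "((\<lambda>T. tv_dist (path_law S (uniform_measure (Pr n) {\<omega>\<in>space (Pr n). time_integral X T \<omega> \<le> \<theta> * T}) X) (path_law S N Y)) \<longlongrightarrow> 0) at_top"
proof -
  interpret prob_space "Pr n" by (rule prob_Pr)
  have pX[measurable]: "pth {0..S} X \<in> measurable (Pr n) (paths {0..S})" by (rule pth_measurable) (auto intro: X_meas)
  note tm[measurable] = tilt_measurable[OF S, of n n]
  note ti = tilt_integrable[OF S, of n n]
  have one: "(\<integral>\<omega>. tilt S n \<omega> \<partial>Pr n) = 1"
  proof -
    have "ennreal (\<integral>\<omega>. tilt S n \<omega> \<partial>Pr n) = 1"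
      using tilted_one_time_law(2)[OF KQ S, of n] nn_integral_eq_integral[OF ti] tilt_nonneg by simp
    thus ?thesis by (simp add: ennreal_eq_1)
  qed
  define deficit where "deficit T \<omega> = (if S \<le> T then max 0 (tilt S n \<omega> - tail S T \<omega> / ptail n T) else 0)" for T \<omega>
  have tmeas: "tail S T \<in> borel_measurable (Pr n)" if "S \<le> T" for T
    by (rule conditioned_event(1)[OF S that sets.top])
  have defm: "deficit T \<in> borel_measurable (Pr n)" for T
  proof (cases "S \<le> T")
    case True
    note [measurable] = tmeas[OF True]
    show ?thesis unfolding deficit_def[abs_def] using True by simp
  qed (simp add: deficit_def[abs_def])
  have defb: "0 \<le> deficit T \<omega>" "deficit T \<omega> \<le> tilt S n \<omega>" for T \<omega>
    using tilt_nonneg[of S n \<omega>] tail_bounds(1)[of S T \<omega>] by (auto simp: deficit_def ptail_def)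
  have "((\<lambda>T. \<integral>\<omega>. deficit T \<omega> \<partial>Pr n) \<longlongrightarrow> (\<integral>\<omega>. 0 \<partial>Pr n)) at_top"
  proof (rule integral_dominated_convergence_at_top[OF _ defm ti])
    have "((\<lambda>T. deficit T \<omega>) \<longlongrightarrow> 0) at_top" for \<omega>
    proof -
      have "((\<lambda>T. max 0 (tilt S n \<omega> - tail S T \<omega> / ptail n T)) \<longlongrightarrow> max 0 (tilt S n \<omega> - tilt S n \<omega>)) at_top"
        by (intro tendsto_intros tail_ratio_limit)
      moreover have "\<forall>\<^sub>F T in at_top. max 0 (tilt S n \<omega> - tail S T \<omega> / ptail n T) = deficit T \<omega>"
        using eventually_ge_at_top[of S] by eventually_elim (simp add: deficit_def)
      ultimately show ?thesis by (simp add: Lim_transform_eventually)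
    qed
    thus "AE \<omega> in Pr n. ((\<lambda>T. deficit T \<omega>) \<longlongrightarrow> 0) at_top" by simp
    show "\<forall>\<^sub>F T in at_top. AE \<omega> in Pr n. norm (deficit T \<omega>) \<le> tilt S n \<omega>" using defb by simp
  qed simp
  hence lim: "((\<lambda>T. 2 * (\<integral>\<omega>. deficit T \<omega> \<partial>Pr n)) \<longlongrightarrow> 0) at_top" by (intro tendsto_mult_right_zero) simp
  have bound: "0 \<le> tv_dist (path_law S (uniform_measure (Pr n) {\<omega>\<in>space (Pr n). time_integral X T \<omega> \<le> \<theta> * T}) X) (path_law S N Y) \<and>
     tv_dist (path_law S (uniform_measure (Pr n) {\<omega>\<in>space (Pr n). time_integral X T \<omega> \<le> \<theta> * T}) X) (path_law S N Y) \<le> 2 * (\<integral>\<omega>. deficit T \<omega> \<partial>Pr n)"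
    if T: "S \<le> T" and p: "0 < ptail n T" for T
  proof -
    define Ev where "Ev = {\<omega>\<in>space (Pr n). time_integral X T \<omega> \<le> \<theta> * T}"
    have Ev[measurable]: "Ev \<in> sets (Pr n)" unfolding Ev_def by measurable
    note [measurable] = tmeas[OF T]
    define h where "h \<omega> = tail S T \<omega> / ptail n T" for \<omega>
    have hm[measurable]: "h \<in> borel_measurable (Pr n)" unfolding h_def by measurable
    have h0: "0 \<le> h \<omega>" for \<omega> using tail_bounds p by (simp add: h_def)
    have hi: "integrable (Pr n) h"
      by (rule integrable_const_bound[where B="1 / ptail n T"]) (use tail_bounds p in \<open>auto simp: h_def divide_right_mono\<close>)
    define P1 P2 where "P1 = path_law S (uniform_measure (Pr n) Ev) X" and "P2 = path_law S N Y"
    have sP1: "sets P1 = sets (paths {0..S})" by (simp add: P1_def path_law_def)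
    have m1: "measure P1 A = (\<integral>\<omega>. indicator A (pth {0..S} X \<omega>) * h \<omega> \<partial>Pr n)" if A: "A \<in> sets (paths {0..S})" for A
    proof -
      have pE: "emeasure (Pr n) Ev \<noteq> 0" using p by (simp add: emeasure_eq_measure ptail_def Ev_def)
      have pU: "pth {0..S} X \<in> measurable (uniform_measure (Pr n) Ev) (paths {0..S})" using pX by simp
      have "measure P1 A = measure (uniform_measure (Pr n) Ev) (pth {0..S} X -` A \<inter> space (Pr n))"
        unfolding P1_def path_law_pth using measure_distr[OF pU A] by simp
      also have "\<dots> = measure (Pr n) (Ev \<inter> (pth {0..S} X -` A \<inter> space (Pr n))) / measure (Pr n) Ev"
        by (rule measure_uniform_measure[OF pE _ measurable_sets[OF pX A]]) simp
      also have "Ev \<inter> (pth {0..S} X -` A \<inter> space (Pr n)) = {\<omega> \<in> space (Pr n). pth {0..S} X \<omega> \<in> A \<and> time_integral X T \<omega> \<le> \<theta> * T}"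
        by (auto simp: Ev_def)
      finally show ?thesis unfolding conditioned_event(2)[OF S T A] by (simp add: h_def Ev_def ptail_def)
    qed
    have m2: "measure P2 A = (\<integral>\<omega>. indicator A (pth {0..S} X \<omega>) * tilt S n \<omega> \<partial>Pr n)" if A[measurable]: "A \<in> sets (paths {0..S})" for A
    proof -
      define D where "D = density (Pr n) (\<lambda>\<omega>. ennreal (tilt S n \<omega>))"
      have pD: "pth {0..S} X \<in> measurable D (paths {0..S})" using pX by (simp add: D_def)
      have "emeasure P2 A = emeasure D (pth {0..S} X -` A \<inter> space (Pr n))"
        unfolding P2_def tilted_path_law[OF KQ Y S, symmetric] D_def[symmetric] by (simp add: emeasure_distr[OF pD A]) (simp add: D_def)
      also have "\<dots> = (\<integral>\<^sup>+\<omega>. ennreal (tilt S n \<omega>) * indicator (pth {0..S} X -` A \<inter> space (Pr n)) \<omega> \<partial>Pr n)"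
        unfolding D_def by (rule emeasure_density) (use measurable_sets[OF pX A] in auto)
      also have "\<dots> = (\<integral>\<^sup>+\<omega>. ennreal (indicator A (pth {0..S} X \<omega>) * tilt S n \<omega>) \<partial>Pr n)"
        by (rule nn_integral_cong) (auto simp: indicator_def)
      also have "\<dots> = ennreal (\<integral>\<omega>. indicator A (pth {0..S} X \<omega>) * tilt S n \<omega> \<partial>Pr n)"
      proof (rule nn_integral_eq_integral)
        show "integrable (Pr n) (\<lambda>\<omega>. indicator A (pth {0..S} X \<omega>) * tilt S n \<omega>)"
          by (rule Bochner_Integration.integrable_bound[OF ti]) (auto simp: indicator_def)
      qed (use tilt_nonneg in auto)
      finally show ?thesis
        unfolding measure_def by (simp add: integral_nonneg_AE tilt_nonneg)
    qed
    have hint: "(\<integral>\<omega>. h \<omega> \<partial>Pr n) = 1"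
    proof -
      have "(\<integral>\<omega>. indicator (space (paths {0..S})) (pth {0..S} X \<omega>) * tail S T \<omega> \<partial>Pr n) = ptail n T"
        unfolding conditioned_event(2)[OF S T sets.top, symmetric] ptail_def
        by (rule arg_cong[where f="measure (Pr n)"]) (auto simp: pth_def space_PiM)
      moreover have "indicator (space (paths {0..S})) (pth {0..S} X \<omega>) = (1::real)" for \<omega> by (simp add: pth_def space_PiM)
      ultimately show ?thesis using p by (simp add: h_def)
    qed
    have "integrable (Pr n) (deficit T)"
      by (rule Bochner_Integration.integrable_bound[OF ti defm]) (use defb tilt_nonneg in auto)
    note defi = this
    have diff: "\<bar>measure P1 A - measure P2 A\<bar> \<le> 2 * (\<integral>\<omega>. deficit T \<omega> \<partial>Pr n)" if A[measurable]: "A \<in> sets (paths {0..S})" for A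
    proof -
      have i1: "integrable (Pr n) (\<lambda>\<omega>. indicator A (pth {0..S} X \<omega>) * h \<omega>)"
        by (rule Bochner_Integration.integrable_bound[OF hi]) (auto simp: indicator_def)
      have i2: "integrable (Pr n) (\<lambda>\<omega>. indicator A (pth {0..S} X \<omega>) * tilt S n \<omega>)"
        by (rule Bochner_Integration.integrable_bound[OF ti]) (auto simp: indicator_def)
      define d where "d \<omega> = indicator A (pth {0..S} X \<omega>) * h \<omega> - indicator A (pth {0..S} X \<omega>) * tilt S n \<omega>" for \<omega>
      have "measure P1 A - measure P2 A = (\<integral>\<omega>. d \<omega> \<partial>Pr n)"
        unfolding m1[OF A] m2[OF A] d_def by (rule Bochner_Integration.integral_diff[OF i1 i2, symmetric])
      hence "\<bar>measure P1 A - measure P2 A\<bar> \<le> (\<integral>\<omega>. norm (d \<omega>) \<partial>Pr n)"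
        using integral_norm_bound[of "Pr n" d] by simp
      also have "\<dots> \<le> (\<integral>\<omega>. (h \<omega> - tilt S n \<omega>) + 2 * deficit T \<omega> \<partial>Pr n)"
      proof (rule integral_mono)
        show "integrable (Pr n) (\<lambda>\<omega>. norm (d \<omega>))"
          unfolding d_def by (intro integrable_norm Bochner_Integration.integrable_diff i1 i2)
        show "integrable (Pr n) (\<lambda>\<omega>. (h \<omega> - tilt S n \<omega>) + 2 * deficit T \<omega>)"
          by (intro Bochner_Integration.integrable_add Bochner_Integration.integrable_diff hi ti integrable_mult_right defi)
        show "norm (d \<omega>) \<le> (h \<omega> - tilt S n \<omega>) + 2 * deficit T \<omega>" for \<omega>
          using T h0[of \<omega>] tilt_nonneg[of S n \<omega>] by (auto simp: d_def deficit_def h_def indicator_def max_def abs_if)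
      qed
      also have "\<dots> = 2 * (\<integral>\<omega>. deficit T \<omega> \<partial>Pr n)"
        using hi ti defi one hint by simp
      finally show ?thesis .
    qed
    have ne: "sets P1 \<noteq> {}" by auto
    have "tv_dist P1 P2 \<le> 2 * (\<integral>\<omega>. deficit T \<omega> \<partial>Pr n)"
      unfolding tv_dist_def by (rule cSUP_least[OF ne]) (use diff sP1 in auto)
    moreover have "0 \<le> tv_dist P1 P2"
    proof -
      have "\<bar>measure P1 {} - measure P2 {}\<bar> \<le> tv_dist P1 P2"
        unfolding tv_dist_def by (rule cSUP_upper) (use diff sP1 in \<open>auto intro!: bdd_aboveI2\<close>)
      thus ?thesis by simp
    qed
    ultimately show ?thesis by (simp add: P1_def P2_def Ev_def)
  qed
  have visits: "\<forall>\<^sub>F T in at_top. 0 \<le> tv_dist (path_law S (uniform_measure (Pr n) {\<omega>\<in>space (Pr n). time_integral X T \<omega> \<le> \<theta> * T}) X) (path_law S N Y) \<and>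
     tv_dist (path_law S (uniform_measure (Pr n) {\<omega>\<in>space (Pr n). time_integral X T \<omega> \<le> \<theta> * T}) X) (path_law S N Y) \<le> 2 * (\<integral>\<omega>. deficit T \<omega> \<partial>Pr n)"
    using eventually_ge_at_top[of S] ptail_pos[of n] by eventually_elim (rule bound)
  show ?thesis
    by (rule tendsto_sandwich[OF _ _ tendsto_const lim]) (use visits in \<open>auto elim: eventually_mono\<close>)
qed

end

section \<open>The invariant law of the tilted chain and the conclusion\<close>

lemma bdi_tilted_rates_eq:
  "bdi_tilted_rates a b c \<theta> = bdi_rates (bdi_r a b c \<theta> * a) (bdi_r a b c \<theta> * b) (c / bdi_r a b c \<theta>)"
  by (simp add: bdi_tilted_rates_def bdi_rates_def algebra_simps)

lemma markov_chain_from_markov_with: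
  assumes "markov_chain_from M X q n"
  obtains K where "transition_semigroup K" "has_transition_rates K q" "markov_with M X K n"
  using assms unfolding markov_chain_from_def markov_with_def by blast

lemma markov_with_cong:
  assumes M: "markov_with M X K n" and eq: "\<And>T i. 0 \<le> T \<Longrightarrow> K T i = K' T i"
  shows "markov_with M X K' n"
  unfolding markov_with_def
proof (intro conjI allI impI)
  fix m and t :: "nat \<Rightarrow> real" and x :: "nat \<Rightarrow> nat"
  assume t: "0 \<le> t 0 \<and> (\<forall>k\<le>m. t k \<le> t (Suc k))"
  hence "0 \<le> t (Suc m) - t m" by simp
  hence "K (t (Suc m) - t m) (x m) = K' (t (Suc m) - t m) (x m)" by (rule eq)
  thus "measure M {\<omega>\<in>space M. \<forall>k\<le>Suc m. X (t k) \<omega> = x k} =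
          measure M {\<omega>\<in>space M. \<forall>k\<le>m. X (t k) \<omega> = x k}
            * pmf (K' (t (Suc m) - t m) (x m)) (x (Suc m))"
    using M t by (simp add: markov_with_def)
qed (use M in \<open>auto simp: markov_with_def\<close>)

context bdi_family begin

text \<open>The tilted rates are those of the same family with parameters \<open>r a, r b, c / r\<close>: the shape is unchanged and
\<open>p = b r\<^sup>2 / c\<close>, so the mean is \<open>a r\<^sup>2 / (c - b r\<^sup>2)\<close>, which is \<open>\<theta>\<close> by the choice of \<open>r\<close>.\<close>

lemma tilted_invariant_law:
  assumes KQ: "transition_semigroup KQ" "has_transition_rates KQ (bdi_rates (r * a) (r * b) (c / r))"
  shows "\<exists>\<mu>. neg_binomial_law (a / b) \<theta> \<mu> \<and> (\<forall>\<nu>. invariant_law KQ \<nu> \<longleftrightarrow> \<nu> = \<mu>)"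
proof (intro exI conjI)
  define p where "p = (r * b) / (c / r)"
  have p: "0 < p" "p < 1" using b c r_pos br2 by (auto simp: p_def field_simps power2_eq_square)
  have s: "(r * a) / (r * b) = a / b" using r_pos by simp
  have "a / b * p / (1 - p) = \<theta>"
  proof -
    have "1 - p = (c - b * r\<^sup>2) / c" using c r_pos by (simp add: p_def field_simps power2_eq_square)
    moreover have "a / b * p = a * r\<^sup>2 / c" using b c r_pos by (simp add: p_def field_simps power2_eq_square)
    ultimately show ?thesis using c theta_eq by simp
  qed
  moreover have "neg_binomial_law (a / b) (a / b * p / (1 - p)) (neg_binomial_pmf (a / b) p)"
    by (rule neg_binomial_pmf_law) (use p a b in auto)
  ultimately show "neg_binomial_law (a / b) \<theta> (neg_binomial_pmf (a / b) p)" by simp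
  show "\<forall>\<nu>. invariant_law KQ \<nu> \<longleftrightarrow> \<nu> = neg_binomial_pmf (a / b) p"
  proof
    fix \<nu>
    have "invariant_law KQ \<nu> \<longleftrightarrow> \<nu> = neg_binomial_pmf ((r * a) / (r * b)) ((r * b) / (c / r))"
      by (rule bdi_invariant_law_iff[OF KQ]) (use a b c r_pos br2 in \<open>auto simp: field_simps power2_eq_square\<close>)
    thus "invariant_law KQ \<nu> \<longleftrightarrow> \<nu> = neg_binomial_pmf (a / b) p" by (simp only: s p_def)
  qed
qed

end

theorem corollary3p4:
  fixes a b c \<theta> :: real
    and Pr :: "nat \<Rightarrow> 'w measure" and X :: "real \<Rightarrow> 'w \<Rightarrow> nat"
  assumes "0 < a" and "0 < b" and "0 < c" and "b < c"
    and "\<And>n. markov_chain_from (Pr n) X (bdi_rates a b c) n"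
    and "0 < \<theta>" and "\<theta> < a / (c - b)"
  shows
    "(\<forall>(n::nat) (z::real).
        (\<lambda>T::real. measure (Pr n) {\<omega>\<in>space (Pr n). time_integral X T \<omega> \<le> \<theta> * T + z})
          \<sim>[at_top]
        (\<lambda>T. bdi_psi a b c (bdi_beta a b c \<theta>) n
               * bdi_inner a b c (bdi_psi a b c (bdi_beta a b c \<theta>)) (\<lambda>_. 1)
               / (bdi_beta a b c \<theta> * sqrt (2 * pi * bdi_v a b c \<theta> * T))
               * exp (- bdi_I a b c \<theta> * T + bdi_beta a b c \<theta> * z)))
     \<and> (\<forall>(n::nat) (S::real) (N :: 'v measure) (Y :: real \<Rightarrow> 'v \<Rightarrow> nat).
          0 \<le> S \<and> markov_chain_from N Y (bdi_tilted_rates a b c \<theta>) n \<longrightarrow>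
          ((\<lambda>T::real. tv_dist
               (path_law S
                  (uniform_measure (Pr n) {\<omega>\<in>space (Pr n). time_integral X T \<omega> \<le> \<theta> * T}) X)
               (path_law S N Y)) \<longlongrightarrow> 0) at_top)
     \<and> (\<forall>K. transition_semigroup K \<and> has_transition_rates K (bdi_tilted_rates a b c \<theta>) \<longrightarrow>
          (\<exists>\<mu>. neg_binomial_law (a / b) \<theta> \<mu> \<and> (\<forall>\<nu>. invariant_law K \<nu> \<longleftrightarrow> \<nu> = \<mu>)))"
proof -
  obtain K where K: "transition_semigroup K" "has_transition_rates K (bdi_rates a b c)"
    using markov_chain_from_markov_with[OF assms(5)[of 0]] by blast
  \<comment> \<open>The hypothesis provides a semigroup for each starting point; uniqueness makes them coincide at nonnegative times.\<close>
  have Mw: "markov_with (Pr n) X K n" for n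
  proof -
    obtain K' where K': "transition_semigroup K'" "has_transition_rates K' (bdi_rates a b c)" "markov_with (Pr n) X K' n"
      using markov_chain_from_markov_with[OF assms(5)[of n]] by blast
    show ?thesis
      by (rule markov_with_cong[OF K'(3)]) (rule bdi_semigroup_unique[OF K'(1,2) K], use assms in auto)
  qed
  interpret bdi_family a b c \<theta> Pr X K
    by unfold_locales (use assms K Mw in auto)
  have rates: "bdi_tilted_rates a b c \<theta> = bdi_rates (r * a) (r * b) (c / r)"
    by (simp add: bdi_tilted_rates_eq r_def)
  show ?thesis
  proof (intro conjI allI impI)
    fix n :: nat and z :: real
    show "(\<lambda>T::real. measure (Pr n) {\<omega>\<in>space (Pr n). time_integral X T \<omega> \<le> \<theta> * T + z})
          \<sim>[at_top]
        (\<lambda>T. bdi_psi a b c (bdi_beta a b c \<theta>) n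
               * bdi_inner a b c (bdi_psi a b c (bdi_beta a b c \<theta>)) (\<lambda>_. 1)
               / (bdi_beta a b c \<theta> * sqrt (2 * pi * bdi_v a b c \<theta> * T))
               * exp (- bdi_I a b c \<theta> * T + bdi_beta a b c \<theta> * z))"
      by (rule lower_tail_asymptotics)
  next
    fix n :: nat and S :: real and N :: "'v measure" and Y :: "real \<Rightarrow> 'v \<Rightarrow> nat"
    assume *: "0 \<le> S \<and> markov_chain_from N Y (bdi_tilted_rates a b c \<theta>) n"
    then obtain KQ where KQ: "transition_semigroup KQ" "has_transition_rates KQ (bdi_rates (r * a) (r * b) (c / r))" "markov_with N Y KQ n"
      using markov_chain_from_markov_with[of N Y "bdi_tilted_rates a b c \<theta>" n] unfolding rates by blast
    show "((\<lambda>T::real. tv_dist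
               (path_law S
                  (uniform_measure (Pr n) {\<omega>\<in>space (Pr n). time_integral X T \<omega> \<le> \<theta> * T}) X)
               (path_law S N Y)) \<longlongrightarrow> 0) at_top"
      by (rule conditioned_law_converges[OF KQ]) (use * in simp)
  next
    fix KQ assume "transition_semigroup KQ \<and> has_transition_rates KQ (bdi_tilted_rates a b c \<theta>)"
    thus "\<exists>\<mu>. neg_binomial_law (a / b) \<theta> \<mu> \<and> (\<forall>\<nu>. invariant_law KQ \<nu> \<longleftrightarrow> \<nu> = \<mu>)"
      unfolding rates by (intro tilted_invariant_law) auto
  qed
qed

end
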